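(* For every $K>1$ and $0<\alpha<1$ there exists a constant $c(K,\alpha)>0$, depending only on $K$ and $\alpha$, such that the following holds for all positive integers $m,n,p$, every non-zero matrix $X\in\mathbb{R}^{m\times p}$ with rank $q$, every $A\in\mathbb{R}^{p\times n}$ and every $\sigma>0$. Let $Y=XA+\sigma E$, where $E$ is an $m\times n$ random matrix with i.i.d. standard Gaussian entries. Let $r_{\max}\in\{1,\ldots,\min(n,q)\}$ satisfy $$r_{\max}\ \le\ \alpha\,\frac{nm-1}{K(\sqrt q+\sqrt n)^2},$$ and set, for $r\in\{1,\ldots,r_{\max}\}$, $$\mathrm{pen}(r)=-\log\left(1-\frac{K\,\mathcal{S}_{q\times n}(r)^2}{nm-1}\right).$$ Let $\hat r$ be a minimizer over $r\in\{1,\ldots,r_{\max}\}$ of $$\mathrm{Crit}(r)=\log\big(\|Y-X\widehat A_r\|^2\big)+\mathrm{pen}(r).$$ Then the estimator $\widehat A=\widehat A_{\hat r}$ satisfies $$\mathbb{E}\big[\|X\widehat A-XA\|^2\big]\ \le\ c(K,\alpha)\,\min_{1\le r\le r_{\max}}\Big\{\mathbb{E}\big[\|X\widehat A_r-XA\|^2\big]+r(\sqrt n+\sqrt q)^2\sigma^2+\sigma^2\Big\}.$$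
   Context: $\|\cdot\|$ denotes the Hilbert–Schmidt (Frobenius) norm. $\sigma_1(M)\ge\sigma_2(M)\ge\cdots$ are the singular values of a matrix $M$, and $\|M\|_{(2,r)}=\big(\sum_{k=1}^r\sigma_k(M)^2\big)^{1/2}$ is its Ky-Fan $(2,r)$-norm. For a $q\times n$ random matrix $G_{q\times n}$ with i.i.d. standard Gaussian entries, $\mathcal{S}_{q\times n}(r)=\mathbb{E}\big[\|G_{q\times n}\|_{(2,r)}\big]$. The matrix $X$ is deterministic. For each $r$, $\widehat A_r$ denotes a minimizer of $B\mapsto\|Y-XB\|$ over the matrices $B\in\mathbb{R}^{p\times n}$ of rank at most $r$ (so $\widehat A_r$ depends on $Y$). *)

theory Defs
  imports
    "HOL-Probability.Probability"
    "HOL-Computational_Algebra.Polynomial"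
    "Jordan_Normal_Form.Char_Poly"
    "Jordan_Normal_Form.DL_Rank"
begin

definition frob_norm :: "real mat \<Rightarrow> real" where
  "frob_norm M = sqrt (\<Sum>i<dim_row M. \<Sum>j<dim_col M. (M $$ (i, j))\<^sup>2)"

definition mat_rank :: "real mat \<Rightarrow> nat" where
  "mat_rank M = vec_space.rank (dim_row M) M"

text \<open>Non-increasing list of the square roots of the eigenvalues of \<open>M\<^sup>T M\<close>, repeated according
  to algebraic multiplicity; its length is \<open>dim_col M\<close>, so zeros may be included.\<close>

definition singular_values :: "real mat \<Rightarrow> real list" where
  "singular_values M =
     rev (sorted_list_of_multiset (image_mset sqrt (proots (char_poly (transpose_mat M * M)))))"

text \<open>Indexed from 1, and 0 beyond the end of the list.\<close>

definition sing_val :: "nat \<Rightarrow> real mat \<Rightarrow> real" where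
  "sing_val k M =
     (if 1 \<le> k \<and> k \<le> length (singular_values M) then singular_values M ! (k - 1) else 0)"

definition ky_fan_2 :: "nat \<Rightarrow> real mat \<Rightarrow> real" where
  "ky_fan_2 r M = sqrt (\<Sum>k=1..r. (sing_val k M)\<^sup>2)"

text \<open>The canonical probability space carrying \<open>m * n\<close> independent standard Gaussian coordinates.
  A point \<open>\<omega>\<close> of it is read as the \<open>m \<times> n\<close> matrix \<open>mat m n \<omega>\<close>.\<close>

definition gauss_space :: "nat \<Rightarrow> nat \<Rightarrow> (nat \<times> nat \<Rightarrow> real) measure" where
  "gauss_space m n = PiM ({..<m} \<times> {..<n}) (\<lambda>_. density lborel (\<lambda>x. ennreal (std_normal_density x)))"

definition gauss_ky_fan :: "nat \<Rightarrow> nat \<Rightarrow> nat \<Rightarrow> real" where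
  "gauss_ky_fan q n r = (\<integral>\<omega>. ky_fan_2 r (mat q n \<omega>) \<partial>gauss_space q n)"

definition observation :: "real mat \<Rightarrow> real mat \<Rightarrow> real \<Rightarrow> real mat \<Rightarrow> real mat" where
  "observation X A \<sigma> E = X * A + \<sigma> \<cdot>\<^sub>m E"

definition rank_restricted_ls :: "real mat \<Rightarrow> real mat \<Rightarrow> nat \<Rightarrow> real mat \<Rightarrow> bool" where
  "rank_restricted_ls X Y r B \<longleftrightarrow>
     is_arg_min (\<lambda>B. frob_norm (Y - X * B))
       (\<lambda>B. B \<in> carrier_mat (dim_col X) (dim_col Y) \<and> mat_rank B \<le> r) B"

definition pen :: "real \<Rightarrow> nat \<Rightarrow> nat \<Rightarrow> nat \<Rightarrow> nat \<Rightarrow> real" where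
  "pen K m n q r = - ln (1 - K * (gauss_ky_fan q n r)\<^sup>2 / (real n * real m - 1))"

text \<open>Since \<open>ln 0 = 0\<close>, this agrees with the usual convention only when the residual is non-zero;
  minimality of the criterion is therefore to be required almost surely.\<close>

definition crit :: "real \<Rightarrow> real mat \<Rightarrow> real mat \<Rightarrow> (nat \<Rightarrow> real mat) \<Rightarrow> nat \<Rightarrow> real" where
  "crit K X Y Ahat r = ln ((frob_norm (Y - X * Ahat r))\<^sup>2)
     + pen K (dim_row Y) (dim_col Y) (mat_rank X) r"

definition loss :: "real mat \<Rightarrow> real mat \<Rightarrow> real mat \<Rightarrow> real" where
  "loss X A B = (frob_norm (X * B - X * A))\<^sup>2"

end

theory Submission
  imports Defs "Jordan_Normal_Form.Spectral_Radius"
begin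

text \<open>Minimality of the criterion turns, at the selected rank, into a bound on the loss in which the noise
  enters only through its suprema over unit-norm matrices \<open>X * B\<close> of bounded rank. In mean these are
  at most \<open>gauss_ky_fan q n r\<close>, and Gaussian concentration bounds their variances by a constant. Since
  \<open>K > 1\<close>, the penalty dominates the squared mean with a factor to spare; the fluctuations over the
  candidate ranks are simply summed, which is affordable because \<open>rmax \<le> (\<surd>n + \<surd>q)\<^sup>2\<close>, and Chevet's
  inequality bounds the penalty itself.\<close>

section \<open>Gaussian suprema\<close>

text \<open>The selected rank depends on the noise, so every noise term at that rank must be
  dominated by quantities indexed by fixed ranks before any integration. One place is delicate. The
  penalty is \<open>K\<close> times a squared mean with \<open>K\<close> possibly close to 1, so the
  cross term between the selected and the comparison estimator may charge the noise at the selected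
  rank only slightly more than once. Hence the difference \<open>X * B - X * B'\<close> is split
  orthogonally into pieces of the two ranks instead of being estimated by the triangle inequality,
  and the slack is spent in four equal factors \<open>t\<close> with \<open>t ^ 4 = K\<close>. Means
  and variances of the suprema come from one interpolation formula, applied to a log-sum-exp
  smoothing over a finite net: moving from one family to another gives the Sudakov-Fernique
  inequality, decoupling a family from itself gives a dimension-free variance bound. The residuals
  must also be shown nonzero almost surely, since only then can the logarithmic criterion be
  exponentiated.\<close>

definition gaussian :: "'i set \<Rightarrow> ('i \<Rightarrow> real) measure" where
  "gaussian I = PiM I (\<lambda>_. std_normal_distribution)"

lemma prob_space_std_normal: "prob_space std_normal_distribution"
  by (rule prob_space_normal_density) simp

lemma sigma_finite_std_normal: "sigma_finite_measure std_normal_distribution"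
  using prob_space_std_normal by (simp add: prob_space_imp_sigma_finite)

lemma prob_space_gaussian: "prob_space (gaussian I)"
  unfolding gaussian_def using prob_space_std_normal by (intro prob_space_PiM) auto

lemma sigma_finite_gaussian: "sigma_finite_measure (gaussian I)"
  by (rule prob_space_imp_sigma_finite[OF prob_space_gaussian])

lemma product_prob_space_std_normal: "product_prob_space (\<lambda>_. std_normal_distribution)"
  by (intro product_prob_spaceI prob_space_std_normal)

lemma product_sigma_finite_std_normal: "product_sigma_finite (\<lambda>_. std_normal_distribution)"
  using sigma_finite_std_normal by (simp add: product_sigma_finite_def)

lemma measurable_gaussian_component [measurable (raw)]:
  "i \<in> I \<Longrightarrow> (\<lambda>\<omega>. \<omega> i) \<in> borel_measurable (gaussian I)"
  unfolding gaussian_def using measurable_component_singleton[of i I "\<lambda>_. std_normal_distribution"]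
  by simp

text \<open>Extends the component rule to composed maps, such as \<open>snd x\<close> evaluated at
  \<open>i\<close> on a product space.\<close>

lemma measurable_gaussian_component' [measurable_dest]:
  "f \<in> measurable N (gaussian I) \<Longrightarrow> g \<in> measurable L N \<Longrightarrow> i \<in> I
    \<Longrightarrow> (\<lambda>x. f (g x) i) \<in> borel_measurable L"
  using measurable_compose[OF measurable_compose[of g L N f "gaussian I"] measurable_gaussian_component] by blast

lemma distr_gaussian_component:
  assumes "i \<in> I"
  shows "distr (gaussian I) std_normal_distribution (\<lambda>\<omega>. \<omega> i) = std_normal_distribution"
  unfolding gaussian_def
  using product_prob_space.PiM_component[OF product_prob_space_std_normal assms] by simp

lemma gaussian_component_integrable:
  fixes g :: "real \<Rightarrow> real"
  assumes "i \<in> I" "integrable std_normal_distribution g"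
  shows "integrable (gaussian I) (\<lambda>\<omega>. g (\<omega> i))"
proof -
  have "(\<lambda>\<omega>. \<omega> i) \<in> measurable (gaussian I) std_normal_distribution"
    using measurable_gaussian_component[OF assms(1)] by simp
  moreover have "integrable (distr (gaussian I) std_normal_distribution (\<lambda>\<omega>. \<omega> i)) g"
    using assms distr_gaussian_component by metis
  ultimately show ?thesis by (rule integrable_distr)
qed

lemma gaussian_component_integral:
  fixes g :: "real \<Rightarrow> real"
  assumes "i \<in> I" and [measurable]: "g \<in> borel_measurable borel"
  shows "(\<integral>\<omega>. g (\<omega> i) \<partial>gaussian I) = (\<integral>x. g x \<partial>std_normal_distribution)"
proof -
  have "(\<lambda>\<omega>. \<omega> i) \<in> measurable (gaussian I) std_normal_distribution"
    using measurable_gaussian_component[OF assms(1)] by simp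
  then have "(\<integral>\<omega>. g (\<omega> i) \<partial>gaussian I)
      = integral\<^sup>L (distr (gaussian I) std_normal_distribution (\<lambda>\<omega>. \<omega> i)) g"
    by (subst integral_distr) auto
  then show ?thesis using assms distr_gaussian_component by metis
qed

lemma gaussian_square_integrable: "i \<in> I \<Longrightarrow> integrable (gaussian I) (\<lambda>\<omega>. (\<omega> i)\<^sup>2)"
  by (rule gaussian_component_integrable[OF _ integrable_std_normal_distribution_moment])

lemma gaussian_square_integral: "i \<in> I \<Longrightarrow> (\<integral>\<omega>. (\<omega> i)\<^sup>2 \<partial>gaussian I) = 1"
  using std_normal_distribution_even_moments(1)[of 1]
  by (subst gaussian_component_integral) auto

section \<open>Gaussian integration by parts\<close>

text \<open>Stein's identity. The density has derivative \<open>- x * \<phi> x\<close>, so the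
  difference of the two integrands is the derivative of \<open>\<phi> * h\<close>, and linear growth
  of \<open>h\<close> kills the boundary terms. The growth bounds also give integrability of both
  sides.\<close>

lemma gaussian_ibp_1d:
  fixes h h' :: "real \<Rightarrow> real"
  assumes h: "\<And>x. (h has_real_derivative h' x) (at x)" and cont: "\<And>x. isCont h' x"
    and bd: "\<And>x. \<bar>h x\<bar> \<le> a + b * \<bar>x\<bar>" and bd': "\<And>x. \<bar>h' x\<bar> \<le> a + b * \<bar>x\<bar>"
  shows "(\<integral>x. x * h x \<partial>std_normal_distribution) = (\<integral>x. h' x \<partial>std_normal_distribution)"
proof -
  define \<phi> where "\<phi> = std_normal_density"
  have \<phi>d: "(\<phi> has_real_derivative - x * \<phi> x) (at x)" for x
  proof -
    have "((\<lambda>x. 1 / sqrt (2 * pi) * exp (- x\<^sup>2 / 2)) has_real_derivative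
        1 / sqrt (2 * pi) * (exp (- x\<^sup>2 / 2) * (- x))) (at x)"
      by (rule DERIV_cmult) (auto intro!: derivative_eq_intros)
    then show ?thesis unfolding \<phi>_def std_normal_density_def[abs_def] by (simp add: algebra_simps)
  qed
  have conth: "isCont h x" for x using h DERIV_isCont by blast
  have cont\<phi>: "isCont \<phi> x" for x using \<phi>d DERIV_isCont by blast
  have hm[measurable]: "h \<in> borel_measurable borel"
    using conth by (intro borel_measurable_continuous_onI) (simp add: continuous_at_imp_continuous_on)
  have hm'[measurable]: "h' \<in> borel_measurable borel"
    using cont by (intro borel_measurable_continuous_onI) (simp add: continuous_at_imp_continuous_on)
  have \<phi>m[measurable]: "\<phi> \<in> borel_measurable borel" unfolding \<phi>_def by simp
  have \<phi>0: "\<phi> x \<ge> 0" for x unfolding \<phi>_def by (simp add: normal_density_nonneg)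
  have ab: "a \<ge> 0" using order_trans[OF abs_ge_zero bd[of 0]] by simp
  note mom = integrable_std_normal_moment_abs[folded \<phi>_def]
  have ib: "integrable lborel (\<lambda>x. \<phi> x * (a + b * \<bar>x\<bar>))"
  proof -
    have "(\<lambda>x. \<phi> x * (a + b * \<bar>x\<bar>)) = (\<lambda>x. a * (\<phi> x * \<bar>x\<bar>^0) + b * (\<phi> x * \<bar>x\<bar>^1))"
      by (simp add: fun_eq_iff algebra_simps)
    then show ?thesis
      by (simp only:) (intro Bochner_Integration.integrable_add integrable_mult_right mom)
  qed
  have ib2: "integrable lborel (\<lambda>x. \<phi> x * (\<bar>x\<bar> * (a + b * \<bar>x\<bar>)))"
  proof -
    have "(\<lambda>x. \<phi> x * (\<bar>x\<bar> * (a + b * \<bar>x\<bar>))) = (\<lambda>x. a * (\<phi> x * \<bar>x\<bar>^1) + b * (\<phi> x * \<bar>x\<bar>^2))"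
      by (rule ext) (simp only: power2_eq_square power_one_right distrib_left mult_ac)
    then show ?thesis
      by (simp only:) (intro Bochner_Integration.integrable_add integrable_mult_right mom)
  qed
  have i1: "integrable lborel (\<lambda>x. \<phi> x * h' x)"
  proof (rule Bochner_Integration.integrable_bound[OF ib], measurable, rule AE_I2)
    fix x
    have "\<bar>h' x\<bar> \<le> \<bar>a + b * \<bar>x\<bar>\<bar>" using bd'[of x] by linarith
    then show "norm (\<phi> x * h' x) \<le> norm (\<phi> x * (a + b * \<bar>x\<bar>))"
      unfolding real_norm_def abs_mult[of "\<phi> x"] by (intro mult_left_mono) auto
  qed
  have i2: "integrable lborel (\<lambda>x. \<phi> x * (x * h x))"
  proof (rule Bochner_Integration.integrable_bound[OF ib2], measurable, rule AE_I2)
    fix x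
    have "\<bar>x\<bar> * \<bar>h x\<bar> \<le> \<bar>x\<bar> * (a + b * \<bar>x\<bar>)" by (intro mult_left_mono bd) auto
    also have "\<dots> \<le> \<bar>\<bar>x\<bar> * (a + b * \<bar>x\<bar>)\<bar>" by simp
    finally show "norm (\<phi> x * (x * h x)) \<le> norm (\<phi> x * (\<bar>x\<bar> * (a + b * \<bar>x\<bar>)))"
      using \<phi>0[of x] by (simp only: real_norm_def abs_mult[of "\<phi> x"] abs_mult[of x])
       (intro mult_left_mono, auto)
  qed
  have l1: "((\<lambda>x. \<phi> x * (a + b * \<bar>x\<bar>)) \<longlongrightarrow> 0) at_top"
    unfolding \<phi>_def std_normal_density_def by real_asymp
  have l2: "((\<lambda>x. \<phi> x * (a + b * \<bar>x\<bar>)) \<longlongrightarrow> 0) at_bot"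
    unfolding \<phi>_def std_normal_density_def by real_asymp
  have dom: "\<bar>\<phi> x * h x\<bar> \<le> \<phi> x * (a + b * \<bar>x\<bar>)" for x
    using bd[of x] \<phi>0[of x] by (simp add: abs_mult mult_left_mono)
  have t1: "((\<lambda>x. \<phi> x * h x) \<longlongrightarrow> 0) at_top"
    by (rule Lim_null_comparison[OF _ l1]) (use dom in auto)
  have t2: "((\<lambda>x. \<phi> x * h x) \<longlongrightarrow> 0) at_bot"
    by (rule Lim_null_comparison[OF _ l2]) (use dom in auto)
  \<comment> \<open>The fundamental theorem on the whole line for \<open>\<phi> * h\<close>; both
    limits are 0 by \<open>t1\<close> and \<open>t2\<close>.\<close>
  have "(LBINT x=-\<infinity>..\<infinity>. \<phi> x * h' x - \<phi> x * (x * h x)) = 0 - 0"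
  proof (rule interval_integral_FTC_integrable[where F="\<lambda>x. \<phi> x * h x"])
    show "((\<lambda>x. \<phi> x * h x) has_vector_derivative \<phi> x * h' x - \<phi> x * (x * h x)) (at x)" for x
      unfolding has_real_derivative_iff_has_vector_derivative[symmetric]
      by (auto intro!: derivative_eq_intros \<phi>d h simp: algebra_simps)
    show "isCont (\<lambda>x. \<phi> x * h' x - \<phi> x * (x * h x)) x" for x
      using cont\<phi> conth cont by (intro continuous_intros) auto
    show "set_integrable lborel (einterval (- \<infinity>) \<infinity>) (\<lambda>x. \<phi> x * h' x - \<phi> x * (x * h x))"
      unfolding set_integrable_def using i1 i2 by simp
    show "(((\<lambda>x. \<phi> x * h x) \<circ> real_of_ereal) \<longlongrightarrow> 0) (at_right (- \<infinity>))"
      "(((\<lambda>x. \<phi> x * h x) \<circ> real_of_ereal) \<longlongrightarrow> 0) (at_left \<infinity>)"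
      using t1 t2 by (simp_all add: ereal_tendsto_simps)
  qed simp
  then have "(\<integral>x. \<phi> x * h' x - \<phi> x * (x * h x) \<partial>lborel) = 0"
    by (simp add: interval_lebesgue_integral_def set_lebesgue_integral_def)
  then have "(\<integral>x. \<phi> x * h' x \<partial>lborel) = (\<integral>x. \<phi> x * (x * h x) \<partial>lborel)"
    using i1 i2 by simp
  then show ?thesis
    by (subst (1 2) integral_density) (auto simp: \<phi>_def[symmetric] \<phi>0)
qed

text \<open>The dominating function of the integrability arguments. The l1 norm splits additively
  when a single coordinate is updated; the summand 1 keeps the function at least 1, so that
  constants are covered and linear bounds imply quadratic ones.\<close>

definition lin_growth :: "'i set \<Rightarrow> ('i \<Rightarrow> real) \<Rightarrow> real" where
  "lin_growth I \<omega> = 1 + (\<Sum>i\<in>I. \<bar>\<omega> i\<bar>)"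

lemma lin_growth_ge_1: "lin_growth I \<omega> \<ge> 1"
  unfolding lin_growth_def by (simp add: sum_nonneg)

lemma lin_growth_ge_component: "finite I \<Longrightarrow> i \<in> I \<Longrightarrow> \<bar>\<omega> i\<bar> \<le> lin_growth I \<omega>"
  unfolding lin_growth_def
  using member_le_sum[of i I "\<lambda>i. \<bar>\<omega> i\<bar>"] by (simp add: add_increasing)

lemma measurable_lin_growth [measurable]: "lin_growth I \<in> borel_measurable (gaussian I)"
  unfolding lin_growth_def[abs_def] by measurable

lemma lin_growth_square_integrable:
  assumes "finite I"
  shows "integrable (gaussian I) (\<lambda>\<omega>. (lin_growth I \<omega>)\<^sup>2)"
proof (rule Bochner_Integration.integrable_bound)
  interpret prob_space "gaussian I" by (rule prob_space_gaussian)
  show "integrable (gaussian I) (\<lambda>\<omega>. 2 + 2 * (real (card I) * (\<Sum>i\<in>I. (\<omega> i)\<^sup>2)))"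
    by (intro Bochner_Integration.integrable_add integrable_mult_right Bochner_Integration.integrable_sum
        gaussian_square_integrable) simp_all
  show "AE \<omega> in gaussian I. norm ((lin_growth I \<omega>)\<^sup>2) \<le> norm (2 + 2 * (real (card I) * (\<Sum>i\<in>I. (\<omega> i)\<^sup>2)))"
  proof (rule AE_I2)
    fix \<omega> :: "'a \<Rightarrow> real"
    have "(\<Sum>i\<in>I. \<bar>\<omega> i\<bar>)\<^sup>2 \<le> real (card I) * (\<Sum>i\<in>I. (\<omega> i)\<^sup>2)"
      using Cauchy_Schwarz_ineq_sum[of "\<lambda>_. 1" "\<lambda>i. \<bar>\<omega> i\<bar>" I] by simp
    moreover have "(lin_growth I \<omega>)\<^sup>2 \<le> 2 + 2 * (\<Sum>i\<in>I. \<bar>\<omega> i\<bar>)\<^sup>2"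
      unfolding lin_growth_def using sum_squares_bound[of 1 "\<Sum>i\<in>I. \<bar>\<omega> i\<bar>"]
      by (simp add: power2_sum)
    ultimately show "norm ((lin_growth I \<omega>)\<^sup>2) \<le> norm (2 + 2 * (real (card I) * (\<Sum>i\<in>I. (\<omega> i)\<^sup>2)))"
      by simp
  qed
qed simp

lemma gaussian_integrable_quadratic:
  fixes h :: "_ \<Rightarrow> real"
  assumes "finite I" and [measurable]: "h \<in> borel_measurable (gaussian I)"
    and bd: "\<And>\<omega>. \<bar>h \<omega>\<bar> \<le> C * (lin_growth I \<omega>)\<^sup>2"
  shows "integrable (gaussian I) h"
proof (rule Bochner_Integration.integrable_bound[OF integrable_mult_right[OF lin_growth_square_integrable[OF assms(1)], of C]])
  show "AE \<omega> in gaussian I. norm (h \<omega>) \<le> norm (C * (lin_growth I \<omega>)\<^sup>2)"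
  proof (rule AE_I2)
    fix \<omega> show "norm (h \<omega>) \<le> norm (C * (lin_growth I \<omega>)\<^sup>2)"
      using bd[of \<omega>] unfolding real_norm_def by linarith
  qed
qed simp

lemma gaussian_integrable_linear:
  fixes h :: "_ \<Rightarrow> real"
  assumes "finite I" and [measurable]: "h \<in> borel_measurable (gaussian I)"
    and bd: "\<And>\<omega>. \<bar>h \<omega>\<bar> \<le> C * lin_growth I \<omega>"
  shows "integrable (gaussian I) h"
proof (rule gaussian_integrable_quadratic[OF assms(1,2)])
  fix \<omega>
  have C: "C \<ge> 0" using order_trans[OF abs_ge_zero bd[of \<omega>]] lin_growth_ge_1[of I \<omega>]
    by (simp add: zero_le_mult_iff)
  show "\<bar>h \<omega>\<bar> \<le> C * (lin_growth I \<omega>)\<^sup>2"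
    using bd[of \<omega>] lin_growth_ge_1[of I \<omega>] C
    by (intro order_trans[OF bd] mult_left_mono) (auto simp: power2_eq_square mult_ge1_I)
qed

lemma gaussian_ibp:
  fixes h h' :: "('i \<Rightarrow> real) \<Rightarrow> real"
  assumes I: "finite I" "i \<in> I"
    and [measurable]: "h \<in> borel_measurable (gaussian I)" "h' \<in> borel_measurable (gaussian I)"
    and d: "\<And>\<omega> y. ((\<lambda>y. h (fun_upd \<omega> i y)) has_real_derivative h' (fun_upd \<omega> i y)) (at y)"
    and c: "\<And>\<omega> y. isCont (\<lambda>y. h' (fun_upd \<omega> i y)) y"
    and bd: "\<And>\<omega>. \<bar>h \<omega>\<bar> \<le> C * lin_growth I \<omega>" and bd': "\<And>\<omega>. \<bar>h' \<omega>\<bar> \<le> C * lin_growth I \<omega>"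
  shows "(\<integral>\<omega>. \<omega> i * h \<omega> \<partial>gaussian I) = (\<integral>\<omega>. h' \<omega> \<partial>gaussian I)"
proof -
  interpret product_sigma_finite "\<lambda>_. std_normal_distribution"
    by (rule product_sigma_finite_std_normal)
  define J where "J = I - {i}"
  have J: "I = insert i J" "finite J" "i \<notin> J" using I J_def by auto
  have i1: "integrable (gaussian I) (\<lambda>\<omega>. \<omega> i * h \<omega>)"
  proof (rule gaussian_integrable_quadratic[OF I(1)])
    show "(\<lambda>\<omega>. \<omega> i * h \<omega>) \<in> borel_measurable (gaussian I)" using I by measurable
    fix \<omega>
    have "\<bar>\<omega> i * h \<omega>\<bar> \<le> lin_growth I \<omega> * (C * lin_growth I \<omega>)"
      unfolding abs_mult using lin_growth_ge_1[of I \<omega>]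
      by (intro mult_mono lin_growth_ge_component I bd) auto
    then show "\<bar>\<omega> i * h \<omega>\<bar> \<le> C * (lin_growth I \<omega>)\<^sup>2" by (simp add: power2_eq_square algebra_simps)
  qed
  have i2: "integrable (gaussian I) h'"
    by (rule gaussian_integrable_linear[OF I(1) _ bd']) measurable
  have split: "lin_growth I (fun_upd \<omega> i y) = lin_growth J \<omega> + \<bar>y\<bar>" for \<omega> y
  proof -
    have "(\<Sum>j\<in>J. \<bar>fun_upd \<omega> i y j\<bar>) = (\<Sum>j\<in>J. \<bar>\<omega> j\<bar>)"
      by (intro sum.cong) (use J in auto)
    then show ?thesis unfolding lin_growth_def using J by simp
  qed
  have "(\<integral>y. y * h (fun_upd \<omega> i y) \<partial>std_normal_distribution)
      = (\<integral>y. h' (fun_upd \<omega> i y) \<partial>std_normal_distribution)" for \<omega>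
  proof (rule gaussian_ibp_1d[OF d c])
    fix y show "\<bar>h (fun_upd \<omega> i y)\<bar> \<le> C * lin_growth J \<omega> + C * \<bar>y\<bar>"
      "\<bar>h' (fun_upd \<omega> i y)\<bar> \<le> C * lin_growth J \<omega> + C * \<bar>y\<bar>"
      using bd[of "fun_upd \<omega> i y"] bd'[of "fun_upd \<omega> i y"] unfolding split by (simp_all add: algebra_simps)
  qed
  then show ?thesis
    using product_integral_insert[OF J(2,3) i1[unfolded J(1) gaussian_def]]
      product_integral_insert[OF J(2,3) i2[unfolded J(1) gaussian_def]]
    unfolding J(1) gaussian_def by simp
qed

section \<open>Interpolation between Gaussian processes\<close>

text \<open>The mean of \<open>\<Phi>\<close> along the Gaussian vector with coefficients
  \<open>c k i t\<close> is followed in \<open>t\<close>. Integration by parts trades the factors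
  \<open>\<omega> i\<close> in its time derivative for second derivatives of \<open>\<Phi>\<close>,
  weighted by the covariances of velocity and position; a lower bound on that double sum integrates
  to one on the increment of the mean. The derivatives \<open>\<Delta>\<close> and
  \<open>\<Gamma>\<close> are specified along curves only, which avoids Frechet derivatives, and the
  \<open>loc\<close> hypotheses mediate between total functions and the extensional ones in the
  space of \<open>PiM\<close>.\<close>

lemma gaussian_interpolation:
  fixes c c' :: "'k \<Rightarrow> 'i \<Rightarrow> real \<Rightarrow> real" and \<Phi> :: "('k \<Rightarrow> real) \<Rightarrow> real"
  assumes I: "finite I" and T: "finite T" and ab: "a \<le> b"
    and c: "\<And>k i t. (c k i has_real_derivative c' k i t) (at t)"
    and c': "\<And>k i t. isCont (c' k i) t"
    and cM: "\<And>k i t. \<bar>c k i t\<bar> \<le> M" "\<And>k i t. \<bar>c' k i t\<bar> \<le> M"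
    and d\<Phi>: "\<And>u u' t. (\<And>k. k \<in> T \<Longrightarrow> ((\<lambda>s. u s k) has_real_derivative u' k) (at t)) \<Longrightarrow>
      ((\<lambda>s. \<Phi> (u s)) has_real_derivative (\<Sum>k\<in>T. \<Delta> k (u t) * u' k)) (at t)"
    and d\<Delta>: "\<And>k u u' t. k \<in> T \<Longrightarrow> (\<And>l. l \<in> T \<Longrightarrow> ((\<lambda>s. u s l) has_real_derivative u' l) (at t)) \<Longrightarrow>
      ((\<lambda>s. \<Delta> k (u s)) has_real_derivative (\<Sum>l\<in>T. \<Gamma> k l (u t) * u' l)) (at t)"
    and c\<Gamma>: "\<And>k l u (t::real). k \<in> T \<Longrightarrow> l \<in> T \<Longrightarrow> (\<And>j. j \<in> T \<Longrightarrow> isCont (\<lambda>s. u s j) t) \<Longrightarrow>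
      isCont (\<lambda>s. \<Gamma> k l (u s)) t"
    and m\<Phi>: "(\<lambda>u. \<Phi> u) \<in> borel_measurable (PiM T (\<lambda>_. borel))"
    and m\<Delta>: "\<And>k. k \<in> T \<Longrightarrow> \<Delta> k \<in> borel_measurable (PiM T (\<lambda>_. borel))"
    and m\<Gamma>: "\<And>k l. k \<in> T \<Longrightarrow> l \<in> T \<Longrightarrow> \<Gamma> k l \<in> borel_measurable (PiM T (\<lambda>_. borel))"
    and loc: "\<And>u. \<Phi> (restrict u T) = \<Phi> u" "\<And>k u. k \<in> T \<Longrightarrow> \<Delta> k (restrict u T) = \<Delta> k u"
      "\<And>k l u. k \<in> T \<Longrightarrow> l \<in> T \<Longrightarrow> \<Gamma> k l (restrict u T) = \<Gamma> k l u"
    and g\<Phi>: "\<And>u. \<bar>\<Phi> u\<bar> \<le> C * (lin_growth T u)\<^sup>2"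
    and g\<Delta>: "\<And>k u. k \<in> T \<Longrightarrow> \<bar>\<Delta> k u\<bar> \<le> C * lin_growth T u"
    and g\<Gamma>: "\<And>k l u. k \<in> T \<Longrightarrow> l \<in> T \<Longrightarrow> \<bar>\<Gamma> k l u\<bar> \<le> C * lin_growth T u"
    and lower: "\<And>t u. a \<le> t \<Longrightarrow> t \<le> b \<Longrightarrow>
      (\<Sum>k\<in>T. \<Sum>l\<in>T. (\<Sum>i\<in>I. c' k i t * c l i t) * \<Gamma> k l u) \<ge> - B"
  shows "(\<integral>\<omega>. \<Phi> (\<lambda>k. \<Sum>i\<in>I. c k i b * \<omega> i) \<partial>gaussian I)
       - (\<integral>\<omega>. \<Phi> (\<lambda>k. \<Sum>i\<in>I. c k i a * \<omega> i) \<partial>gaussian I) \<ge> - B * (b - a)"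
proof -
  interpret G: prob_space "gaussian I" by (rule prob_space_gaussian)
  interpret P: pair_sigma_finite lborel "gaussian I"
    unfolding pair_sigma_finite_def
    using sigma_finite_gaussian[of I] lborel.sigma_finite_measure_axioms by blast
  define L where "L t \<omega> k = (\<Sum>i\<in>I. c k i t * \<omega> i)" for t and \<omega> :: "'i \<Rightarrow> real" and k
  define L' where "L' t \<omega> k = (\<Sum>i\<in>I. c' k i t * \<omega> i)" for t and \<omega> :: "'i \<Rightarrow> real" and k
  \<comment> \<open>The time derivative of \<open>\<Phi> (L t \<omega>)\<close> for fixed
    \<open>\<omega>\<close>.\<close>
  define \<Psi> where "\<Psi> t \<omega> = (\<Sum>k\<in>T. \<Delta> k (L t \<omega>) * L' t \<omega> k)" for t \<omega>
  define D where "D = 1 + real (card T) * M"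
  have M0: "M \<ge> 0" using order_trans[OF abs_ge_zero cM(1)] .
  have D1: "D \<ge> 1" using M0 by (simp add: D_def)
  have C0: "C \<ge> 0"
    using order_trans[OF abs_ge_zero g\<Phi>[of "\<lambda>_. 0"]] by (simp add: lin_growth_def)
  have absL: "\<bar>L t \<omega> k\<bar> \<le> M * lin_growth I \<omega>" for t \<omega> k
  proof -
    have "\<bar>L t \<omega> k\<bar> \<le> (\<Sum>i\<in>I. \<bar>c k i t * \<omega> i\<bar>)" unfolding L_def by (rule sum_abs)
    also have "\<dots> \<le> (\<Sum>i\<in>I. M * \<bar>\<omega> i\<bar>)" by (intro sum_mono) (simp add: abs_mult mult_right_mono cM)
    also have "\<dots> \<le> M * lin_growth I \<omega>"
      using M0 by (simp add: lin_growth_def sum_distrib_left algebra_simps)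
    finally show ?thesis .
  qed
  have absL': "\<bar>L' t \<omega> k\<bar> \<le> M * lin_growth I \<omega>" for t \<omega> k
  proof -
    have "\<bar>L' t \<omega> k\<bar> \<le> (\<Sum>i\<in>I. \<bar>c' k i t * \<omega> i\<bar>)" unfolding L'_def by (rule sum_abs)
    also have "\<dots> \<le> (\<Sum>i\<in>I. M * \<bar>\<omega> i\<bar>)" by (intro sum_mono) (simp add: abs_mult mult_right_mono cM)
    also have "\<dots> \<le> M * lin_growth I \<omega>"
      using M0 by (simp add: lin_growth_def sum_distrib_left algebra_simps)
    finally show ?thesis .
  qed
  have gL: "lin_growth T (L t \<omega>) \<le> D * lin_growth I \<omega>" for t \<omega>
  proof -
    have "(\<Sum>k\<in>T. \<bar>L t \<omega> k\<bar>) \<le> real (card T) * (M * lin_growth I \<omega>)"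
      using sum_mono[of T "\<lambda>k. \<bar>L t \<omega> k\<bar>" "\<lambda>_. M * lin_growth I \<omega>"] absL by simp
    then show ?thesis
      using lin_growth_ge_1[of I \<omega>] by (simp add: lin_growth_def[of T] D_def algebra_simps)
  qed
  have gL0: "0 \<le> lin_growth T (L t \<omega>)" for t \<omega> using lin_growth_ge_1[of T "L t \<omega>"] by simp
  have gI0: "0 \<le> lin_growth I \<omega>" for \<omega> :: "'i \<Rightarrow> real" using lin_growth_ge_1[of I \<omega>] by simp
  have bd\<Phi>: "\<bar>\<Phi> (L t \<omega>)\<bar> \<le> (C * D\<^sup>2) * (lin_growth I \<omega>)\<^sup>2" for t \<omega>
  proof -
    have "\<bar>\<Phi> (L t \<omega>)\<bar> \<le> C * (D * lin_growth I \<omega>)\<^sup>2"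
      by (rule order_trans[OF g\<Phi>]) (intro mult_left_mono power_mono gL gL0 C0)
    then show ?thesis by (simp add: power_mult_distrib)
  qed
  have bd\<Delta>: "\<bar>\<Delta> k (L t \<omega>)\<bar> \<le> (C * D) * lin_growth I \<omega>" if "k \<in> T" for k t \<omega>
  proof -
    have "\<bar>\<Delta> k (L t \<omega>)\<bar> \<le> C * (D * lin_growth I \<omega>)"
      by (rule order_trans[OF g\<Delta>[OF that]]) (intro mult_left_mono gL C0)
    then show ?thesis by simp
  qed
  have bd\<Gamma>: "\<bar>\<Gamma> k l (L t \<omega>)\<bar> \<le> (C * D) * lin_growth I \<omega>" if "k \<in> T" "l \<in> T" for k l t \<omega>
  proof -
    have "\<bar>\<Gamma> k l (L t \<omega>)\<bar> \<le> C * (D * lin_growth I \<omega>)"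
      by (rule order_trans[OF g\<Gamma>[OF that]]) (intro mult_left_mono gL C0)
    then show ?thesis by simp
  qed
  have bd\<Psi>: "\<bar>\<Psi> t \<omega>\<bar> \<le> (real (card T) * (C * D * M)) * (lin_growth I \<omega>)\<^sup>2" for t \<omega>
  proof -
    have "\<bar>\<Psi> t \<omega>\<bar> \<le> (\<Sum>k\<in>T. \<bar>\<Delta> k (L t \<omega>)\<bar> * \<bar>L' t \<omega> k\<bar>)"
      unfolding \<Psi>_def abs_mult[symmetric] by (rule sum_abs)
    also have "\<dots> \<le> (\<Sum>k\<in>T. ((C * D) * lin_growth I \<omega>) * (M * lin_growth I \<omega>))"
      using C0 D1 gI0 by (intro sum_mono mult_mono bd\<Delta> absL') auto
    finally show ?thesis by (simp add: power2_eq_square algebra_simps)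
  qed
  have [measurable]: "c k i \<in> borel_measurable borel" "c' k i \<in> borel_measurable borel" for k i
    using c c' by (auto intro!: borel_measurable_continuous_onI continuous_at_imp_continuous_on
        dest: DERIV_isCont)
  have mL2 [measurable]: "(\<lambda>x. L (fst x) (snd x) k) \<in> borel_measurable (lborel \<Otimes>\<^sub>M gaussian I)"
    "(\<lambda>x. L' (fst x) (snd x) k) \<in> borel_measurable (lborel \<Otimes>\<^sub>M gaussian I)" for k
    unfolding L_def L'_def by measurable
  have mL1 [measurable]: "(\<lambda>\<omega>. L t \<omega> k) \<in> borel_measurable (gaussian I)"
    "(\<lambda>\<omega>. L' t \<omega> k) \<in> borel_measurable (gaussian I)" for k t
    unfolding L_def L'_def by measurable
  \<comment> \<open>Measurability is assumed on extensional functions; by locality, restricting to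
    \<open>T\<close> changes no value.\<close>
  have lift: "(\<lambda>x. f (g x)) \<in> borel_measurable N"
    if "f \<in> borel_measurable (PiM T (\<lambda>_. borel))" "\<And>u. f (restrict u T) = f u"
      "\<And>k. (\<lambda>x. g x k) \<in> borel_measurable N" for f :: "_ \<Rightarrow> real" and g N
  proof -
    have "(\<lambda>x. restrict (g x) T) \<in> measurable N (PiM T (\<lambda>_. borel))"
      by (rule measurable_restrict) (use that in auto)
    from measurable_compose[OF this that(1)] show ?thesis by (simp add: that(2))
  qed
  have [measurable]: "(\<lambda>\<omega>. \<Phi> (L t \<omega>)) \<in> borel_measurable (gaussian I)" for t
    by (rule lift[OF m\<Phi> loc(1)]) measurable
  have m1 [measurable]: "(\<lambda>\<omega>. \<Delta> k (L t \<omega>)) \<in> borel_measurable (gaussian I)" if "k \<in> T" for t k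
    by (rule lift[OF m\<Delta>[OF that] loc(2)[OF that]]) measurable
  have m2 [measurable]: "(\<lambda>\<omega>. \<Gamma> k l (L t \<omega>)) \<in> borel_measurable (gaussian I)" if "k \<in> T" "l \<in> T" for t k l
    by (rule lift[OF m\<Gamma>[OF that] loc(3)[OF that]]) measurable
  have m3 [measurable]: "(\<lambda>x. \<Delta> k (L (fst x) (snd x))) \<in> borel_measurable (lborel \<Otimes>\<^sub>M gaussian I)" if "k \<in> T" for k
  proof -
    have "(\<lambda>x. restrict (L (fst x) (snd x)) T) \<in> measurable (lborel \<Otimes>\<^sub>M gaussian I) (PiM T (\<lambda>_. borel))"
      by (rule measurable_restrict) measurable
    from measurable_compose[OF this m\<Delta>[OF that]] show ?thesis by (simp add: loc(2)[OF that])
  qed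
  have m\<Psi>: "(\<lambda>x. \<Psi> (fst x) (snd x)) \<in> borel_measurable (lborel \<Otimes>\<^sub>M gaussian I)"
    unfolding \<Psi>_def by measurable
  have dL: "((\<lambda>t. L t \<omega> k) has_real_derivative L' t \<omega> k) (at t)" for t \<omega> k
    unfolding L_def L'_def by (intro DERIV_sum DERIV_cmult_right c)
  have contL: "isCont (\<lambda>t. L t \<omega> k) t" for t \<omega> k using dL DERIV_isCont by blast
  have contL': "isCont (\<lambda>t. L' t \<omega> k) t" for t \<omega> k
    unfolding L'_def by (intro continuous_intros c')
  \<comment> \<open>The fundamental theorem is used pathwise, so nothing is differentiated under the
    expectation; the expectation is exchanged with the time integral instead.\<close>
  have ftc: "(\<integral>t. indicator {a..b} t *\<^sub>R \<Psi> t \<omega> \<partial>lborel) = \<Phi> (L b \<omega>) - \<Phi> (L a \<omega>)" for \<omega>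
  proof (rule integral_FTC_atLeastAtMost[OF ab])
    fix t
    have "((\<lambda>t. \<Phi> (L t \<omega>)) has_real_derivative \<Psi> t \<omega>) (at t)"
      unfolding \<Psi>_def by (rule d\<Phi>) (rule dL)
    then show "((\<lambda>t. \<Phi> (L t \<omega>)) has_vector_derivative \<Psi> t \<omega>) (at t within {a..b})"
      by (simp add: has_real_derivative_iff_has_vector_derivative has_vector_derivative_at_within)
  next
    have "isCont (\<lambda>t. \<Delta> k (L t \<omega>)) t" if "k \<in> T" for k t
      using d\<Delta>[OF that, of "\<lambda>t. L t \<omega>", OF dL] DERIV_isCont by blast
    then show "continuous_on {a..b} (\<lambda>t. \<Psi> t \<omega>)"
      unfolding \<Psi>_def by (intro continuous_at_imp_continuous_on ballI continuous_intros contL') auto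
  qed
  \<comment> \<open>The hypothesis of Fubini: on the compact time interval the integrand is
    dominated, uniformly in time, by a multiple of the squared
    \<open>lin_growth I \<omega>\<close>.\<close>
  have intg: "integrable (lborel \<Otimes>\<^sub>M gaussian I) (\<lambda>(t, \<omega>). indicator {a..b} t *\<^sub>R \<Psi> t \<omega>)"
  proof (rule Bochner_Integration.integrable_bound)
    let ?K = "real (card T) * (C * D * M)"
    show "integrable (lborel \<Otimes>\<^sub>M gaussian I) (\<lambda>(t, \<omega>). indicator {a..b} t * (?K * (lin_growth I \<omega>)\<^sup>2))"
    proof (rule P.Fubini_integrable)
      have "(\<integral>\<omega>. norm (indicator {a..b} t * (?K * (lin_growth I \<omega>)\<^sup>2)) \<partial>gaussian I)
          = indicator {a..b} t * (\<integral>\<omega>. \<bar>?K\<bar> * (lin_growth I \<omega>)\<^sup>2 \<partial>gaussian I)" for t :: real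
        by (simp add: abs_mult indicator_def)
      then show "integrable lborel (\<lambda>t. \<integral>\<omega>. norm (case (t, \<omega>) of (t, \<omega>) \<Rightarrow>
          indicator {a..b} t * (?K * (lin_growth I \<omega>)\<^sup>2)) \<partial>gaussian I)"
        using ab by (simp only: prod.case) (intro integrable_mult_left integrable_real_indicator, auto)
      show "AE t in lborel. integrable (gaussian I) (\<lambda>\<omega>. case (t, \<omega>) of (t, \<omega>) \<Rightarrow>
          indicator {a..b} t * (?K * (lin_growth I \<omega>)\<^sup>2))"
        by (intro AE_I2) (simp only: prod.case, intro integrable_mult_right lin_growth_square_integrable I)
    qed simp
    show "(\<lambda>(t, \<omega>). indicator {a..b} t *\<^sub>R \<Psi> t \<omega>) \<in> borel_measurable (lborel \<Otimes>\<^sub>M gaussian I)"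
      using m\<Psi> by (simp add: split_beta)
    show "AE x in lborel \<Otimes>\<^sub>M gaussian I. norm (case x of (t, \<omega>) \<Rightarrow> indicator {a..b} t *\<^sub>R \<Psi> t \<omega>)
        \<le> norm (case x of (t, \<omega>) \<Rightarrow> indicator {a..b} t * (?K * (lin_growth I \<omega>)\<^sup>2))"
      using order_trans[OF bd\<Psi> abs_ge_self] by (intro AE_I2) (auto simp: split_beta abs_mult indicator_def)
  qed
  have E\<Psi>: "(\<integral>\<omega>. \<Psi> t \<omega> \<partial>gaussian I) \<ge> - B" if "a \<le> t" "t \<le> b" for t
  proof -
    have ibp: "(\<integral>\<omega>. \<omega> i * \<Delta> k (L t \<omega>) \<partial>gaussian I)
        = (\<integral>\<omega>. (\<Sum>l\<in>T. \<Gamma> k l (L t \<omega>) * c l i t) \<partial>gaussian I)" if "i \<in> I" "k \<in> T" for i k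
    proof (rule gaussian_ibp[OF I that(1)])
      have dupd: "((\<lambda>y. L t (fun_upd \<omega> i y) l) has_real_derivative c l i t) (at y)" for \<omega> l y
      proof -
        have "L t (fun_upd \<omega> i y) l = (\<Sum>j\<in>I - {i}. c l j t * \<omega> j) + c l i t * y" for y
          unfolding L_def using that I by (subst sum.remove[of I i]) (auto intro!: sum.cong)
        then show ?thesis by (auto intro!: derivative_eq_intros)
      qed
      show "((\<lambda>y. \<Delta> k (L t (fun_upd \<omega> i y))) has_real_derivative
          (\<Sum>l\<in>T. \<Gamma> k l (L t (fun_upd \<omega> i y)) * c l i t)) (at y)" for \<omega> y
        by (rule d\<Delta>[OF that(2)]) (rule dupd)
      show "isCont (\<lambda>y. \<Sum>l\<in>T. \<Gamma> k l (L t (fun_upd \<omega> i y)) * c l i t) y" for \<omega> y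
      proof -
        have "isCont (\<lambda>y. \<Gamma> k l (L t (fun_upd \<omega> i y))) y" if "l \<in> T" for l
          by (rule c\<Gamma>[where u = "\<lambda>y. L t (fun_upd \<omega> i y)", OF \<open>k \<in> T\<close> that]) (rule DERIV_isCont[OF dupd])
        then show ?thesis by (intro continuous_intros) auto
      qed
      \<comment> \<open>\<open>gaussian_ibp\<close> takes one constant for a function and its
        derivative; this one covers both \<open>\<Delta>\<close> and the sum over
        \<open>\<Gamma>\<close>.\<close>
      have K: "C * D \<le> (1 + real (card T) * M) * (C * D)"
        using C0 D1 M0 by (simp add: mult_le_cancel_right1 algebra_simps)
      show "\<bar>\<Delta> k (L t \<omega>)\<bar> \<le> ((1 + real (card T) * M) * (C * D)) * lin_growth I \<omega>" for \<omega>
        by (rule order_trans[OF bd\<Delta>[OF that(2)]]) (rule mult_right_mono[OF K gI0])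
      show "\<bar>\<Sum>l\<in>T. \<Gamma> k l (L t \<omega>) * c l i t\<bar> \<le> ((1 + real (card T) * M) * (C * D)) * lin_growth I \<omega>" for \<omega>
      proof -
        have "\<bar>\<Sum>l\<in>T. \<Gamma> k l (L t \<omega>) * c l i t\<bar> \<le> (\<Sum>l\<in>T. \<bar>\<Gamma> k l (L t \<omega>)\<bar> * \<bar>c l i t\<bar>)"
          unfolding abs_mult[symmetric] by (rule sum_abs)
        also have "\<dots> \<le> (\<Sum>l\<in>T. (C * D * lin_growth I \<omega>) * M)"
          using C0 D1 gI0 that by (intro sum_mono mult_mono bd\<Gamma> cM) auto
        also have "\<dots> = (real (card T) * M) * (C * D) * lin_growth I \<omega>" by simp
        also have "\<dots> \<le> (1 + real (card T) * M) * (C * D) * lin_growth I \<omega>"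
          using C0 D1 gI0 by (intro mult_right_mono) auto
        finally show ?thesis .
      qed
    qed (use that in measurable)
    have i1: "integrable (gaussian I) (\<lambda>\<omega>. \<omega> i * \<Delta> k (L t \<omega>))" if "i \<in> I" "k \<in> T" for i k
    proof (rule gaussian_integrable_quadratic[OF I])
      show "(\<lambda>\<omega>. \<omega> i * \<Delta> k (L t \<omega>)) \<in> borel_measurable (gaussian I)" using that by measurable
      fix \<omega>
      have "\<bar>\<omega> i * \<Delta> k (L t \<omega>)\<bar> \<le> lin_growth I \<omega> * (C * D * lin_growth I \<omega>)"
        unfolding abs_mult using gI0 by (intro mult_mono lin_growth_ge_component I that bd\<Delta>) auto
      then show "\<bar>\<omega> i * \<Delta> k (L t \<omega>)\<bar> \<le> (C * D) * (lin_growth I \<omega>)\<^sup>2"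
        by (simp add: power2_eq_square algebra_simps)
    qed
    have i2: "integrable (gaussian I) (\<lambda>\<omega>. \<Gamma> k l (L t \<omega>))" if "k \<in> T" "l \<in> T" for k l
      by (rule gaussian_integrable_linear[OF I _ bd\<Gamma>[OF that]]) (use that in measurable)
    have "(\<integral>\<omega>. \<Psi> t \<omega> \<partial>gaussian I)
        = (\<integral>\<omega>. (\<Sum>k\<in>T. \<Sum>i\<in>I. c' k i t * (\<omega> i * \<Delta> k (L t \<omega>))) \<partial>gaussian I)"
      unfolding \<Psi>_def L'_def by (simp add: sum_distrib_left algebra_simps)
    also have "\<dots> = (\<Sum>k\<in>T. \<Sum>i\<in>I. c' k i t * (\<integral>\<omega>. \<omega> i * \<Delta> k (L t \<omega>) \<partial>gaussian I))"
      using i1 by (simp add: Bochner_Integration.integral_sum)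
    also have "\<dots> = (\<Sum>k\<in>T. \<Sum>i\<in>I. c' k i t * (\<integral>\<omega>. (\<Sum>l\<in>T. \<Gamma> k l (L t \<omega>) * c l i t) \<partial>gaussian I))"
      using ibp by (intro sum.cong refl) simp
    also have "\<dots> = (\<integral>\<omega>. (\<Sum>k\<in>T. \<Sum>i\<in>I. c' k i t * (\<Sum>l\<in>T. \<Gamma> k l (L t \<omega>) * c l i t)) \<partial>gaussian I)"
      using i2 by (simp add: Bochner_Integration.integral_sum)
    also have "\<dots> = (\<integral>\<omega>. (\<Sum>k\<in>T. \<Sum>l\<in>T. (\<Sum>i\<in>I. c' k i t * c l i t) * \<Gamma> k l (L t \<omega>)) \<partial>gaussian I)"
    proof (intro Bochner_Integration.integral_cong refl sum.cong)
      fix \<omega> k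
      show "(\<Sum>i\<in>I. c' k i t * (\<Sum>l\<in>T. \<Gamma> k l (L t \<omega>) * c l i t))
          = (\<Sum>l\<in>T. (\<Sum>i\<in>I. c' k i t * c l i t) * \<Gamma> k l (L t \<omega>))"
        unfolding sum_distrib_left sum_distrib_right
        by (subst sum.swap) (intro sum.cong refl, simp)
    qed
    also have "\<dots> \<ge> (\<integral>\<omega>. - B \<partial>gaussian I)"
      by (intro integral_mono lower that Bochner_Integration.integrable_sum integrable_mult_right i2) auto
    finally show ?thesis by (simp add: G.prob_space)
  qed
  have "- B * (b - a) = (\<integral>t. indicator {a..b} t * (- B) \<partial>lborel)"
    using ab by simp
  also have "\<dots> \<le> (\<integral>t. (\<integral>\<omega>. indicator {a..b} t *\<^sub>R \<Psi> t \<omega> \<partial>gaussian I) \<partial>lborel)"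
  proof (rule integral_mono)
    show "integrable lborel (\<lambda>t. indicator {a..b} t * (- B))"
      using ab by (intro integrable_mult_left integrable_real_indicator) auto
    show "integrable lborel (\<lambda>t. \<integral>\<omega>. indicator {a..b} t *\<^sub>R \<Psi> t \<omega> \<partial>gaussian I)"
      using P.integrable_fst'[OF intg] by simp
    show "indicator {a..b} t * (- B) \<le> (\<integral>\<omega>. indicator {a..b} t *\<^sub>R \<Psi> t \<omega> \<partial>gaussian I)" for t
      using E\<Psi>[of t] by (auto simp: indicator_def)
  qed
  also have "\<dots> = (\<integral>\<omega>. (\<integral>t. indicator {a..b} t *\<^sub>R \<Psi> t \<omega> \<partial>lborel) \<partial>gaussian I)"
    using P.Fubini_integral[of "\<lambda>t \<omega>. indicator {a..b} t *\<^sub>R \<Psi> t \<omega>"] intg by simp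
  also have "\<dots> = (\<integral>\<omega>. \<Phi> (L b \<omega>) - \<Phi> (L a \<omega>) \<partial>gaussian I)" by (simp only: ftc)
  also have "\<dots> = (\<integral>\<omega>. \<Phi> (L b \<omega>) \<partial>gaussian I) - (\<integral>\<omega>. \<Phi> (L a \<omega>) \<partial>gaussian I)"
    by (intro Bochner_Integration.integral_diff gaussian_integrable_quadratic[OF I _ bd\<Phi>]) measurable
  finally show ?thesis unfolding L_def .
qed

text \<open>Distinct coordinates of a larger space are again independent standard Gaussians. The
  lemma reads off single blocks of \<open>I <+> J\<close>.\<close>

lemma gaussian_reindex:
  fixes F :: "('i \<Rightarrow> real) \<Rightarrow> real"
  assumes "inj_on \<phi> I" "\<phi> ` I \<subseteq> K" and [measurable]: "F \<in> borel_measurable (gaussian I)"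
  shows "(\<integral>\<omega>. F (\<lambda>i\<in>I. \<omega> (\<phi> i)) \<partial>gaussian K) = (\<integral>\<omega>. F \<omega> \<partial>gaussian I)"
proof -
  have d: "distr (gaussian K) (gaussian I) (\<lambda>\<omega>. \<lambda>i\<in>I. \<omega> (\<phi> i)) = gaussian I"
    unfolding gaussian_def
    using distr_PiM_reindex[of K "\<lambda>_. std_normal_distribution" \<phi> I] prob_space_std_normal assms by auto
  have m: "(\<lambda>\<omega>. \<lambda>i\<in>I. \<omega> (\<phi> i)) \<in> measurable (gaussian K) (gaussian I)"
    unfolding gaussian_def using assms(2) by (intro measurable_restrict measurable_component_singleton) auto
  show ?thesis using integral_distr[OF m assms(3)] d by simp
qed

lemma measurable_gaussian_reindex [measurable]:
  "\<phi> \<in> I \<rightarrow> K \<Longrightarrow> (\<lambda>\<omega>. \<lambda>i\<in>I. \<omega> (\<phi> i)) \<in> measurable (gaussian K) (gaussian I)"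
  unfolding gaussian_def by (intro measurable_restrict measurable_component_singleton) auto

text \<open>Fubini over the \<open>Inl\<close> and the \<open>Inr\<close> coordinates, after which
  each block is identified with its own space.\<close>

lemma gaussian_independent:
  fixes F :: "('i \<Rightarrow> real) \<Rightarrow> real" and G :: "('j \<Rightarrow> real) \<Rightarrow> real"
  assumes I: "finite I" and J: "finite J"
    and [measurable]: "F \<in> borel_measurable (gaussian I)" "G \<in> borel_measurable (gaussian J)"
    and int: "integrable (gaussian (I <+> J)) (\<lambda>\<omega>. F (\<lambda>i\<in>I. \<omega> (Inl i)) * G (\<lambda>j\<in>J. \<omega> (Inr j)))"
  shows "(\<integral>\<omega>. F (\<lambda>i\<in>I. \<omega> (Inl i)) * G (\<lambda>j\<in>J. \<omega> (Inr j)) \<partial>gaussian (I <+> J))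
    = (\<integral>\<omega>. F \<omega> \<partial>gaussian I) * (\<integral>\<omega>. G \<omega> \<partial>gaussian J)"
proof -
  interpret product_sigma_finite "\<lambda>_. std_normal_distribution"
    by (rule product_sigma_finite_std_normal)
  let ?I = "Inl ` I :: ('i + 'j) set" and ?J = "Inr ` J :: ('i + 'j) set"
  have IJ: "I <+> J = ?I \<union> ?J" "?I \<inter> ?J = {}" "finite ?I" "finite ?J"
    using I J by auto
  have "(\<integral>\<omega>. F (\<lambda>i\<in>I. \<omega> (Inl i)) * G (\<lambda>j\<in>J. \<omega> (Inr j)) \<partial>gaussian (I <+> J))
      = (\<integral>x. (\<integral>y. F (\<lambda>i\<in>I. merge ?I ?J (x, y) (Inl i)) * G (\<lambda>j\<in>J. merge ?I ?J (x, y) (Inr j))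
          \<partial>gaussian ?J) \<partial>gaussian ?I)"
    using product_integral_fold[OF IJ(2-4)] int unfolding gaussian_def IJ(1) by blast
  also have "\<dots> = (\<integral>x. (\<integral>y. F (\<lambda>i\<in>I. x (Inl i)) * G (\<lambda>j\<in>J. y (Inr j)) \<partial>gaussian ?J) \<partial>gaussian ?I)"
  proof -
    have "(\<lambda>i\<in>I. merge ?I ?J (x, y) (Inl i)) = (\<lambda>i\<in>I. x (Inl i))" for x y :: "'i + 'j \<Rightarrow> real"
      by (rule restrict_ext) (simp add: merge_def)
    moreover have "(\<lambda>j\<in>J. merge ?I ?J (x, y) (Inr j)) = (\<lambda>j\<in>J. y (Inr j))" for x y :: "'i + 'j \<Rightarrow> real"
      by (rule restrict_ext) (auto simp: merge_def)
    ultimately show ?thesis by simp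
  qed
  also have "\<dots> = (\<integral>x. F (\<lambda>i\<in>I. x (Inl i)) \<partial>gaussian ?I) * (\<integral>y. G (\<lambda>j\<in>J. y (Inr j)) \<partial>gaussian ?J)"
    by simp
  also have "\<dots> = (\<integral>\<omega>. F \<omega> \<partial>gaussian I) * (\<integral>\<omega>. G \<omega> \<partial>gaussian J)"
    by (subst (1 2) gaussian_reindex) auto
  finally show ?thesis .
qed

section \<open>Smoothed maxima and their comparison\<close>

text \<open>Log-sum-exp at inverse temperature \<open>\<beta>\<close>. It lies above the maximum of
  \<open>u\<close> over \<open>T\<close> by at most \<open>ln (card T) / \<beta>\<close> and is
  smooth; its gradient consists of the Gibbs weights defined next.\<close>

definition softmax :: "real \<Rightarrow> 'k set \<Rightarrow> ('k \<Rightarrow> real) \<Rightarrow> real" where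
  "softmax \<beta> T u = ln (\<Sum>k\<in>T. exp (\<beta> * u k)) / \<beta>"

definition softmax_weight :: "real \<Rightarrow> 'k set \<Rightarrow> ('k \<Rightarrow> real) \<Rightarrow> 'k \<Rightarrow> real" where
  "softmax_weight \<beta> T u k = exp (\<beta> * u k) / (\<Sum>l\<in>T. exp (\<beta> * u l))"

lemma sum_exp_pos: "finite T \<Longrightarrow> T \<noteq> {} \<Longrightarrow> (\<Sum>k\<in>T. exp (g k :: real)) > 0"
  by (intro sum_pos) auto

lemma softmax_weight_nonneg: "softmax_weight \<beta> T u k \<ge> 0"
  unfolding softmax_weight_def by (intro divide_nonneg_nonneg sum_nonneg) auto

lemma softmax_weight_sum: "finite T \<Longrightarrow> T \<noteq> {} \<Longrightarrow> (\<Sum>k\<in>T. softmax_weight \<beta> T u k) = 1"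
  unfolding softmax_weight_def sum_divide_distrib[symmetric] using sum_exp_pos[of T "\<lambda>k. \<beta> * u k"] by simp

lemma softmax_weight_le_1:
  assumes "finite T" "k \<in> T" shows "softmax_weight \<beta> T u k \<le> 1"
  using member_le_sum[of k T "softmax_weight \<beta> T u"] softmax_weight_sum[of T \<beta> u] softmax_weight_nonneg assms
  by (metis empty_iff)

lemma softmax_ge:
  assumes "finite T" "k \<in> T" "\<beta> > 0" shows "u k \<le> softmax \<beta> T u"
proof -
  have "exp (\<beta> * u k) \<le> (\<Sum>k\<in>T. exp (\<beta> * u k))" using assms by (intro member_le_sum) auto
  then have "\<beta> * u k \<le> ln (\<Sum>k\<in>T. exp (\<beta> * u k))"
    using sum_exp_pos[of T "\<lambda>k. \<beta> * u k"] assms by (subst ln_ge_iff) auto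
  then show ?thesis unfolding softmax_def using assms by (simp add: field_simps)
qed

lemma softmax_le:
  assumes "finite T" "T \<noteq> {}" "\<beta> > 0" "\<And>k. k \<in> T \<Longrightarrow> u k \<le> m"
  shows "softmax \<beta> T u \<le> m + ln (real (card T)) / \<beta>"
proof -
  have c: "real (card T) > 0" using assms by (simp add: card_gt_0_iff)
  have "(\<Sum>k\<in>T. exp (\<beta> * u k)) \<le> (\<Sum>k\<in>T. exp (\<beta> * m))" using assms by (intro sum_mono) auto
  also have "\<dots> = exp (ln (real (card T)) + \<beta> * m)" using c by (simp add: exp_add)
  finally have "ln (\<Sum>k\<in>T. exp (\<beta> * u k)) \<le> ln (real (card T)) + \<beta> * m"
    using sum_exp_pos[of T "\<lambda>k. \<beta> * u k"] assms by (metis exp_gt_zero ln_exp ln_le_cancel_iff)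
  then show ?thesis unfolding softmax_def using assms by (simp add: field_simps)
qed

lemma softmax_abs_le:
  assumes T: "finite T" "T \<noteq> {}" and \<beta>: "\<beta> > 0"
  shows "\<bar>softmax \<beta> T u\<bar> \<le> (1 + ln (real (card T)) / \<beta>) * lin_growth T u"
proof -
  have c: "real (card T) \<ge> 1" using T by (metis card_0_eq less_one not_le of_nat_1 of_nat_le_iff)
  have l: "ln (real (card T)) / \<beta> \<ge> 0" using c \<beta> by simp
  obtain k where k: "k \<in> T" using T by auto
  have "u k \<le> softmax \<beta> T u" by (rule softmax_ge) (use T k \<beta> in auto)
  then have "- softmax \<beta> T u \<le> lin_growth T u" using lin_growth_ge_component[OF T(1) k, of u] by linarith
  also have "\<dots> \<le> (1 + ln (real (card T)) / \<beta>) * lin_growth T u"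
    using mult_nonneg_nonneg[OF l, of "lin_growth T u"] lin_growth_ge_1[of T u] by (simp add: distrib_right)
  finally have 1: "- softmax \<beta> T u \<le> (1 + ln (real (card T)) / \<beta>) * lin_growth T u" .
  have "softmax \<beta> T u \<le> lin_growth T u + ln (real (card T)) / \<beta>"
    using lin_growth_ge_component[OF T(1)] by (intro softmax_le T \<beta>) (meson abs_le_D1)
  also have "\<dots> \<le> (1 + ln (real (card T)) / \<beta>) * lin_growth T u"
    using mult_left_mono[OF lin_growth_ge_1[of T u] l] by (simp add: distrib_right)
  finally show ?thesis using 1 by linarith
qed

lemma softmax_deriv:
  assumes T: "finite T" "T \<noteq> {}" and \<beta>: "\<beta> > 0"
    and u: "\<And>k. k \<in> T \<Longrightarrow> ((\<lambda>s. u s k) has_real_derivative u' k) (at t)"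
  shows "((\<lambda>s. softmax \<beta> T (u s)) has_real_derivative (\<Sum>k\<in>T. softmax_weight \<beta> T (u t) k * u' k)) (at t)"
proof -
  have S: "((\<lambda>s. \<Sum>k\<in>T. exp (\<beta> * u s k)) has_real_derivative (\<Sum>k\<in>T. exp (\<beta> * u t k) * (\<beta> * u' k))) (at t)"
    by (intro DERIV_sum) (use u in \<open>auto intro!: derivative_eq_intros\<close>)
  let ?S = "\<Sum>l\<in>T. exp (\<beta> * u t l)"
  have pos: "?S > 0" by (rule sum_exp_pos[OF T])
  have "((\<lambda>s. softmax \<beta> T (u s)) has_real_derivative
      1 / ?S * (\<Sum>k\<in>T. exp (\<beta> * u t k) * (\<beta> * u' k)) / \<beta>) (at t)"
    unfolding softmax_def by (intro DERIV_cdivide DERIV_chain'[OF S, of ln] DERIV_ln_divide pos)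
  also have "1 / ?S * (\<Sum>k\<in>T. exp (\<beta> * u t k) * (\<beta> * u' k)) / \<beta>
      = (\<Sum>k\<in>T. softmax_weight \<beta> T (u t) k * u' k)"
    unfolding softmax_weight_def sum_distrib_left sum_divide_distrib using \<beta> by (intro sum.cong) auto
  finally show ?thesis .
qed

text \<open>The coefficients are the Hessian of log-sum-exp: \<open>\<beta>\<close> times the
  covariance matrix of the Gibbs distribution. The form along curves is the one the interpolation
  asks for.\<close>

lemma softmax_weight_deriv:
  assumes T: "finite T" "k \<in> T"
    and u: "\<And>l. l \<in> T \<Longrightarrow> ((\<lambda>s. u s l) has_real_derivative u' l) (at t)"
  shows "((\<lambda>s. softmax_weight \<beta> T (u s) k) has_real_derivative
    (\<Sum>l\<in>T. \<beta> * softmax_weight \<beta> T (u t) k * ((if k = l then 1 else 0) - softmax_weight \<beta> T (u t) l) * u' l)) (at t)"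
proof -
  have T': "T \<noteq> {}" using T by auto
  have S: "((\<lambda>s. \<Sum>k\<in>T. exp (\<beta> * u s k)) has_real_derivative (\<Sum>k\<in>T. exp (\<beta> * u t k) * (\<beta> * u' k))) (at t)"
    by (intro DERIV_sum) (use u in \<open>auto intro!: derivative_eq_intros\<close>)
  let ?S = "\<Sum>l\<in>T. exp (\<beta> * u t l)"
  have pos: "?S > 0" by (rule sum_exp_pos[OF T(1) T'])
  have "((\<lambda>s. softmax_weight \<beta> T (u s) k) has_real_derivative
     (exp (\<beta> * u t k) * (\<beta> * u' k) * ?S - exp (\<beta> * u t k) * (\<Sum>k\<in>T. exp (\<beta> * u t k) * (\<beta> * u' k))) / (?S * ?S)) (at t)"
    unfolding softmax_weight_def
    by (rule DERIV_divide[OF _ S]) (use u[OF T(2)] pos in \<open>auto intro!: derivative_eq_intros\<close>)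
  moreover have "(exp (\<beta> * u t k) * (\<beta> * u' k) * ?S - exp (\<beta> * u t k) * (\<Sum>k\<in>T. exp (\<beta> * u t k) * (\<beta> * u' k))) / (?S * ?S)
     = (\<Sum>l\<in>T. \<beta> * softmax_weight \<beta> T (u t) k * ((if k = l then 1 else 0) - softmax_weight \<beta> T (u t) l) * u' l)"
  proof -
    have "(\<Sum>l\<in>T. \<beta> * softmax_weight \<beta> T (u t) k * ((if k = l then 1 else 0) - softmax_weight \<beta> T (u t) l) * u' l)
      = (\<Sum>l\<in>T. (if k = l then \<beta> * softmax_weight \<beta> T (u t) k * u' l else 0)) -
        \<beta> * softmax_weight \<beta> T (u t) k * (\<Sum>l\<in>T. softmax_weight \<beta> T (u t) l * u' l)"
      unfolding sum_distrib_left sum_subtractf[symmetric] by (intro sum.cong) (auto simp: algebra_simps)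
    also have "\<dots> = \<beta> * softmax_weight \<beta> T (u t) k * (u' k - (\<Sum>l\<in>T. softmax_weight \<beta> T (u t) l * u' l))"
      using T by (simp add: algebra_simps)
    also have "(\<Sum>l\<in>T. softmax_weight \<beta> T (u t) l * u' l) = (\<Sum>l\<in>T. exp (\<beta> * u t l) * u' l) / ?S"
      by (simp add: softmax_weight_def sum_divide_distrib)
    also have "\<beta> * softmax_weight \<beta> T (u t) k * (u' k - \<dots>)
       = (exp (\<beta> * u t k) * (\<beta> * u' k) * ?S - exp (\<beta> * u t k) * (\<beta> * (\<Sum>k\<in>T. exp (\<beta> * u t k) * u' k))) / (?S * ?S)"
      unfolding softmax_weight_def using pos by (simp add: field_simps)
    finally show ?thesis by (simp add: sum_distrib_left mult.left_commute)
  qed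
  ultimately show ?thesis by simp
qed

lemma softmax_weight_isCont:
  assumes T: "finite T" "k \<in> T" and u: "\<And>l. l \<in> T \<Longrightarrow> isCont (\<lambda>s. u s l) t"
  shows "isCont (\<lambda>s. softmax_weight \<beta> T (u s) k) t"
proof -
  have "T \<noteq> {}" using T by auto
  then show ?thesis unfolding softmax_weight_def
    using sum_exp_pos[OF T(1), of "\<lambda>l. \<beta> * u t l"] T u by (intro continuous_intros) auto
qed

lemma softmax_isCont:
  assumes T: "finite T" "T \<noteq> {}" "\<beta> > 0" and u: "\<And>l. l \<in> T \<Longrightarrow> isCont (\<lambda>s. u s l) t"
  shows "isCont (\<lambda>s. softmax \<beta> T (u s)) t"
  unfolding softmax_def
  using sum_exp_pos[OF T(1,2), of "\<lambda>l. \<beta> * u t l"] T u by (intro continuous_intros) auto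

lemma softmax_restrict [simp]: "softmax \<beta> T (restrict u T) = softmax \<beta> T u"
  unfolding softmax_def by simp

lemma softmax_weight_restrict: "k \<in> T \<Longrightarrow> softmax_weight \<beta> T (restrict u T) k = softmax_weight \<beta> T u k"
  unfolding softmax_weight_def by simp

lemma measurable_softmax [measurable (raw)]:
  assumes "\<And>k. k \<in> T \<Longrightarrow> (\<lambda>x. u x k) \<in> borel_measurable N"
  shows "(\<lambda>x. softmax \<beta> T (u x)) \<in> borel_measurable N"
  unfolding softmax_def using assms by measurable

lemma measurable_softmax_weight [measurable (raw)]:
  assumes "\<And>k. k \<in> T \<Longrightarrow> (\<lambda>x. u x k) \<in> borel_measurable N" "k \<in> T"
  shows "(\<lambda>x. softmax_weight \<beta> T (u x) k) \<in> borel_measurable N"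
  unfolding softmax_weight_def using assms by measurable

text \<open>The family is rotated from \<open>a\<close> to \<open>b\<close>. By \<open>orth\<close>
  the two use disjoint coordinates, so the covariance of velocity and position is
  \<open>sin t * cos t\<close> times the difference of the covariances of \<open>b\<close> and
  \<open>a\<close>. Paired with the Gibbs Hessian it becomes a weighted sum of differences of
  squared increments, which \<open>incr\<close> makes nonnegative.\<close>

lemma softmax_comparison:
  fixes a :: "'k \<Rightarrow> 'i \<Rightarrow> real" and b :: "'k \<Rightarrow> 'i \<Rightarrow> real"
  assumes I: "finite I" and T: "finite T" "T \<noteq> {}" and \<beta>: "\<beta> > 0"
    and orth: "\<And>k l i. a k i * b l i = 0"
    and bda: "\<And>k i. \<bar>a k i\<bar> \<le> M" and bdb: "\<And>k i. \<bar>b k i\<bar> \<le> M"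
    and incr: "\<And>k l. k \<in> T \<Longrightarrow> l \<in> T \<Longrightarrow>
      (\<Sum>i\<in>I. (a k i - a l i)\<^sup>2) \<le> (\<Sum>i\<in>I. (b k i - b l i)\<^sup>2)"
  shows "(\<integral>\<omega>. softmax \<beta> T (\<lambda>k. \<Sum>i\<in>I. a k i * \<omega> i) \<partial>gaussian I)
    \<le> (\<integral>\<omega>. softmax \<beta> T (\<lambda>k. \<Sum>i\<in>I. b k i * \<omega> i) \<partial>gaussian I)"
proof -
  \<comment> \<open>One constant for the growth of the smoothed maximum, its gradient and its
    Hessian.\<close>
  define C where "C = 1 + \<bar>ln (real (card T))\<bar> / \<beta> + 2 * \<beta>"
  have C1: "C \<ge> 1" "C \<ge> 1 + ln (real (card T)) / \<beta>" "C \<ge> 2 * \<beta>"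
    using \<beta> unfolding C_def by (auto simp: divide_right_mono add_increasing2)
  let ?c = "\<lambda>k i t. cos t * a k i + sin t * b k i"
  let ?c' = "\<lambda>k i t. - sin t * a k i + cos t * b k i"
  let ?w = "\<lambda>k u. softmax_weight \<beta> T u k"
  let ?w2 = "\<lambda>k l u. \<beta> * softmax_weight \<beta> T u k * ((if k = l then 1 else 0) - softmax_weight \<beta> T u l)"
  have M0: "M \<ge> 0" using order_trans[OF abs_ge_zero bda] .
  have lg: "lin_growth T u \<ge> 1" for u by (rule lin_growth_ge_1)
  have "(\<integral>\<omega>. softmax \<beta> T (\<lambda>k. \<Sum>i\<in>I. ?c k i (pi/2) * \<omega> i) \<partial>gaussian I)
      - (\<integral>\<omega>. softmax \<beta> T (\<lambda>k. \<Sum>i\<in>I. ?c k i 0 * \<omega> i) \<partial>gaussian I) \<ge> - 0 * (pi/2 - 0)"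
  proof (rule gaussian_interpolation[OF I T(1), where c' = ?c' and \<Delta> = ?w and \<Gamma> = ?w2 and C = C and M = "2 * M"])
    show "((\<lambda>t. ?c k i t) has_real_derivative ?c' k i t) (at t)" for k i t
      by (auto intro!: derivative_eq_intros)
    show "isCont (\<lambda>t. ?c' k i t) t" for k i t by (intro continuous_intros)
    show "\<bar>cos t * a k i + sin t * b k i\<bar> \<le> 2 * M" for k i t
    proof -
      have "\<bar>cos t * a k i\<bar> \<le> 1 * M" "\<bar>sin t * b k i\<bar> \<le> 1 * M"
        unfolding abs_mult by (intro mult_mono; simp add: bda bdb)+
      then show ?thesis by linarith
    qed
    show "\<bar>- sin t * a k i + cos t * b k i\<bar> \<le> 2 * M" for k i t
    proof -
      have "\<bar>sin t * a k i\<bar> \<le> 1 * M" "\<bar>cos t * b k i\<bar> \<le> 1 * M"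
        unfolding abs_mult by (intro mult_mono; simp add: bda bdb)+
      then show ?thesis by linarith
    qed
    show "((\<lambda>s. softmax \<beta> T (u s)) has_real_derivative (\<Sum>k\<in>T. ?w k (u t) * u' k)) (at t)"
      if "\<And>k. k \<in> T \<Longrightarrow> ((\<lambda>s. u s k) has_real_derivative u' k) (at t)" for u u' t
      by (rule softmax_deriv[OF T \<beta> that])
    show "((\<lambda>s. ?w k (u s)) has_real_derivative (\<Sum>l\<in>T. ?w2 k l (u t) * u' l)) (at t)"
      if "k \<in> T" "\<And>k. k \<in> T \<Longrightarrow> ((\<lambda>s. u s k) has_real_derivative u' k) (at t)" for k u u' t
      by (rule softmax_weight_deriv[OF T(1) that])
    show "isCont (\<lambda>s. ?w2 k l (u s)) t"
      if "k \<in> T" "l \<in> T" "\<And>j. j \<in> T \<Longrightarrow> isCont (\<lambda>s. u s j) t" for k l u and t :: real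
      by (intro continuous_intros softmax_weight_isCont T that)
    show "\<bar>softmax \<beta> T u\<bar> \<le> C * (lin_growth T u)\<^sup>2" for u
    proof -
      have "(1 + ln (real (card T)) / \<beta>) * lin_growth T u \<le> C * (lin_growth T u * lin_growth T u)"
        using C1 lg[of u] by (intro mult_mono) (auto simp: mult_ge1_I)
      then show ?thesis using softmax_abs_le[OF T \<beta>, of u] by (simp add: power2_eq_square)
    qed
    show "\<bar>?w k u\<bar> \<le> C * lin_growth T u" if "k \<in> T" for k u
      using softmax_weight_le_1[OF T(1) that, of \<beta> u] softmax_weight_nonneg[of \<beta> T u k]
        mult_mono[OF C1(1) lg[of u]] C1 by simp
    show "\<bar>?w2 k l u\<bar> \<le> C * lin_growth T u" if "k \<in> T" "l \<in> T" for k l u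
    proof -
      have "\<bar>(if k = l then 1 else 0) - softmax_weight \<beta> T u l\<bar> \<le> 2"
        using softmax_weight_le_1[OF T(1) that(2), of \<beta> u] softmax_weight_nonneg[of \<beta> T u l] by auto
      then have "\<bar>?w2 k l u\<bar> \<le> \<beta> * 1 * 2" unfolding abs_mult
        using softmax_weight_le_1[OF T(1) that(1), of \<beta> u] softmax_weight_nonneg[of \<beta> T u k] \<beta>
        by (intro mult_mono) auto
      also have "\<dots> \<le> C * lin_growth T u"
        using mult_mono[OF C1(3) lg[of u]] C1 \<beta> by simp
      finally show ?thesis .
    qed
    show "- 0 \<le> (\<Sum>k\<in>T. \<Sum>l\<in>T. (\<Sum>i\<in>I. ?c' k i t * ?c l i t) * ?w2 k l u)"
      if t: "0 \<le> t" "t \<le> pi/2" for t u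
    proof -
      define A where "A k l = (\<Sum>i\<in>I. a k i * a l i)" for k l
      define B where "B k l = (\<Sum>i\<in>I. b k i * b l i)" for k l
      define g where "g k l = B k l - A k l" for k l
      define w where "w = softmax_weight \<beta> T u"
      have gsym: "g k l = g l k" for k l unfolding g_def A_def B_def by (simp add: mult.commute)
      have cov: "(\<Sum>i\<in>I. ?c' k i t * ?c l i t) = sin t * cos t * g k l" for k l
      proof -
        have "?c' k i t * ?c l i t = sin t * cos t * (b k i * b l i - a k i * a l i)" for i
        proof -
          have "?c' k i t * ?c l i t = sin t * cos t * (b k i * b l i - a k i * a l i)
              - (sin t)\<^sup>2 * (a k i * b l i) + (cos t)\<^sup>2 * (a l i * b k i)"
            by (simp add: power2_eq_square algebra_simps)
          then show ?thesis by (simp add: orth)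
        qed
        then show ?thesis
          unfolding g_def A_def B_def sum_subtractf[symmetric] by (simp add: sum_distrib_left)
      qed
      have gd: "0 \<le> g k k + g l l - 2 * g k l" if "k \<in> T" "l \<in> T" for k l
      proof -
        have "g k k + g l l - 2 * g k l = (\<Sum>i\<in>I. (b k i - b l i)\<^sup>2) - (\<Sum>i\<in>I. (a k i - a l i)\<^sup>2)"
          unfolding g_def A_def B_def
          by (simp add: power2_eq_square algebra_simps sum.distrib sum_subtractf sum_distrib_left)
        then show ?thesis using incr[OF that] by simp
      qed
      have w1: "(\<Sum>k\<in>T. w k) = 1" unfolding w_def by (rule softmax_weight_sum[OF T])
      have w0: "w k \<ge> 0" for k unfolding w_def by (rule softmax_weight_nonneg)
      have s1: "(\<Sum>k\<in>T. \<Sum>l\<in>T. w k * w l * g k k) = (\<Sum>k\<in>T. w k * g k k)"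
      proof (intro sum.cong refl)
        fix k show "(\<Sum>l\<in>T. w k * w l * g k k) = w k * g k k"
          using w1 by (simp add: sum_distrib_right[symmetric] sum_distrib_left[symmetric])
      qed
      have s2: "(\<Sum>k\<in>T. \<Sum>l\<in>T. w k * w l * g l l) = (\<Sum>k\<in>T. w k * g k k)"
        by (subst sum.swap) (simp add: s1[symmetric] mult.commute)
      have "(\<Sum>k\<in>T. \<Sum>l\<in>T. (\<Sum>i\<in>I. ?c' k i t * ?c l i t) * ?w2 k l u)
         = sin t * cos t * \<beta> * (\<Sum>k\<in>T. \<Sum>l\<in>T. g k l * (w k * ((if k = l then 1 else 0) - w l)))"
        unfolding cov w_def sum_distrib_left by (intro sum.cong refl) (simp add: algebra_simps)
      also have "(\<Sum>k\<in>T. \<Sum>l\<in>T. g k l * (w k * ((if k = l then 1 else 0) - w l)))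
         = (\<Sum>k\<in>T. w k * g k k) - (\<Sum>k\<in>T. \<Sum>l\<in>T. w k * w l * g k l)"
      proof -
        have "(\<Sum>l\<in>T. g k l * (w k * ((if k = l then 1 else 0) - w l)))
          = w k * g k k - (\<Sum>l\<in>T. w k * w l * g k l)" if "k \<in> T" for k
        proof -
          have "(\<Sum>l\<in>T. g k l * (w k * ((if k = l then 1 else 0) - w l)))
            = (\<Sum>l\<in>T. (if k = l then w k * g k l else 0)) - (\<Sum>l\<in>T. w k * w l * g k l)"
            unfolding sum_subtractf[symmetric] by (intro sum.cong) (auto simp: algebra_simps)
          then show ?thesis using that T by simp
        qed
        then show ?thesis by (simp add: sum_subtractf)
      qed
      \<comment> \<open>Symmetrisation: since the weights sum to 1, the diagonal term is a double
        sum in either index.\<close>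
      also have "\<dots> = (\<Sum>k\<in>T. \<Sum>l\<in>T. w k * w l * (g k k + g l l - 2 * g k l)) / 2"
      proof -
        have "(\<Sum>k\<in>T. \<Sum>l\<in>T. w k * w l * (g k k + g l l - 2 * g k l)) =
          (\<Sum>k\<in>T. \<Sum>l\<in>T. w k * w l * g k k) + (\<Sum>k\<in>T. \<Sum>l\<in>T. w k * w l * g l l)
          - 2 * (\<Sum>k\<in>T. \<Sum>l\<in>T. w k * w l * g k l)"
          by (simp add: algebra_simps sum.distrib sum_subtractf sum_distrib_left)
        then show ?thesis unfolding s1 s2 by simp
      qed
      finally have eq: "(\<Sum>k\<in>T. \<Sum>l\<in>T. (\<Sum>i\<in>I. ?c' k i t * ?c l i t) * ?w2 k l u)
        = sin t * cos t * \<beta> * ((\<Sum>k\<in>T. \<Sum>l\<in>T. w k * w l * (g k k + g l l - 2 * g k l)) / 2)" .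
      have "sin t \<ge> 0" "cos t \<ge> 0" using t by (auto intro!: sin_ge_zero cos_ge_zero)
      moreover have "(\<Sum>k\<in>T. \<Sum>l\<in>T. w k * w l * (g k k + g l l - 2 * g k l)) \<ge> 0"
        by (intro sum_nonneg mult_nonneg_nonneg w0 gd)
      ultimately show ?thesis unfolding eq using \<beta> by simp
    qed
    show "softmax \<beta> T (restrict u T) = softmax \<beta> T u" for u by (rule softmax_restrict)
    show "?w k (restrict u T) = ?w k u" if "k \<in> T" for k u by (rule softmax_weight_restrict[OF that])
    show "?w2 k l (restrict u T) = ?w2 k l u" if "k \<in> T" "l \<in> T" for k l u
      by (simp only: softmax_weight_restrict[OF that(1)] softmax_weight_restrict[OF that(2)])
  qed simp_all
  then show ?thesis by simp
qed

text \<open>A Gaussian Poincare inequality by decoupling. The mean product of \<open>f\<close> at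
  two copies of the noise is followed while the second copy rotates from the first to an independent
  one; the endpoints are the second moment and the squared mean. The derivative is the mean of
  \<open>- sin t\<close> times an inner product of two convex combinations of vectors of norm at
  most 1, hence at least -1, over a time \<open>pi / 2\<close>.\<close>

lemma softmax_variance:
  fixes a :: "'k \<Rightarrow> 'i \<Rightarrow> real"
  assumes I: "finite I" and T: "finite T" "T \<noteq> {}" and \<beta>: "\<beta> > 0"
    and bd: "\<And>k i. \<bar>a k i\<bar> \<le> M"
    and norm: "\<And>k. k \<in> T \<Longrightarrow> (\<Sum>i\<in>I. (a k i)\<^sup>2) \<le> 1"
  defines "f \<equiv> \<lambda>\<omega>. softmax \<beta> T (\<lambda>k. \<Sum>i\<in>I. a k i * \<omega> i)"
  shows "(\<integral>\<omega>. (f \<omega>)\<^sup>2 \<partial>gaussian I) - (\<integral>\<omega>. f \<omega> \<partial>gaussian I)\<^sup>2 \<le> pi / 2"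
proof -
  define K where "K = 1 + \<bar>ln (real (card T))\<bar> / \<beta>"
  define C where "C = K\<^sup>2 + K + 1 + 2 * \<beta> * K"
  have K1: "K \<ge> 1" using \<beta> unfolding K_def by auto
  have K1': "K \<ge> 1 + ln (real (card T)) / \<beta>"
    using \<beta> unfolding K_def by (auto simp: divide_right_mono)
  have C1: "C \<ge> K\<^sup>2" "C \<ge> K" "C \<ge> 1" "C \<ge> 2 * \<beta> * K"
    using \<beta> K1 unfolding C_def by auto
  let ?sm = "softmax \<beta> T" and ?w = "softmax_weight \<beta> T"
  let ?T = "T \<times> (UNIV :: bool set)"
  \<comment> \<open>The index \<open>(k, False)\<close> belongs to the copy resting on the
    \<open>Inl\<close> block, \<open>(k, True)\<close> to the copy rotating towards the
    \<open>Inr\<close> block.\<close>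
  define c :: "'k \<times> bool \<Rightarrow> 'i + 'i \<Rightarrow> real \<Rightarrow> real" where
    "c = (\<lambda>(k, s) x t. if s then (case x of Inl i \<Rightarrow> cos t * a k i | Inr i \<Rightarrow> sin t * a k i)
       else (case x of Inl i \<Rightarrow> a k i | Inr i \<Rightarrow> 0))"
  define c' :: "'k \<times> bool \<Rightarrow> 'i + 'i \<Rightarrow> real \<Rightarrow> real" where
    "c' = (\<lambda>(k, s) x t. if s then (case x of Inl i \<Rightarrow> - sin t * a k i | Inr i \<Rightarrow> cos t * a k i) else 0)"
  define sl :: "('k \<times> bool \<Rightarrow> real) \<Rightarrow> bool \<Rightarrow> 'k \<Rightarrow> real" where "sl = (\<lambda>u s k. u (k, s))"
  define \<Phi> where "\<Phi> u = ?sm (sl u False) * ?sm (sl u True)" for u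
  define \<Delta> where "\<Delta> x u = ?w (sl u (snd x)) (fst x) * ?sm (sl u (\<not> snd x))" for x u
  define \<Gamma> where "\<Gamma> x y u = (if snd x = snd y
      then \<beta> * ?w (sl u (snd x)) (fst x) * ((if fst x = fst y then 1 else 0) - ?w (sl u (snd x)) (fst y)) * ?sm (sl u (\<not> snd x))
      else ?w (sl u (snd x)) (fst x) * ?w (sl u (snd y)) (fst y))" for x y u
  have M0: "M \<ge> 0" using order_trans[OF abs_ge_zero bd] .
  have lg: "lin_growth ?T u \<ge> 1" for u by (rule lin_growth_ge_1)
  have sm_bd: "\<bar>?sm (sl u s)\<bar> \<le> K * lin_growth ?T u" for u s
  proof -
    have "(\<Sum>k\<in>T. \<bar>sl u s k\<bar>) = (\<Sum>x\<in>T \<times> {s}. \<bar>u x\<bar>)"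
      unfolding sl_def by (rule sum.reindex_bij_witness[of _ fst "\<lambda>k. (k, s)"]) auto
    also have "\<dots> \<le> (\<Sum>x\<in>?T. \<bar>u x\<bar>)" using T by (intro sum_mono2) auto
    finally have "lin_growth T (sl u s) \<le> lin_growth ?T u" unfolding lin_growth_def by simp
    then have "(1 + ln (real (card T)) / \<beta>) * lin_growth T (sl u s) \<le> K * lin_growth ?T u"
      using K1 K1' lin_growth_ge_1[of T "sl u s"] by (intro mult_mono) auto
    then show ?thesis using softmax_abs_le[OF T \<beta>, of "sl u s"] by simp
  qed
  have w0: "?w v k \<ge> 0" for v k by (rule softmax_weight_nonneg)
  have w1: "?w v k \<le> 1" if "k \<in> T" for v k by (rule softmax_weight_le_1[OF T(1) that])
  have sumT: "(\<Sum>x\<in>?T. g x) = (\<Sum>k\<in>T. g (k, False)) + (\<Sum>k\<in>T. g (k, True))" for g :: "_ \<Rightarrow> real"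
    by (simp add: sum.cartesian_product[symmetric, of "\<lambda>k s. g (k, s)", simplified] UNIV_bool sum.distrib add.commute)
  have loc: "sl (restrict u ?T) s k = sl u s k" if "k \<in> T" for u s k using that by (simp add: sl_def)
  have locsm: "?sm (sl (restrict u ?T) s) = ?sm (sl u s)" for u s
    unfolding softmax_def using loc by (simp cong: sum.cong)
  have locw: "?w (sl (restrict u ?T) s) k = ?w (sl u s) k" if "k \<in> T" for u s k
    unfolding softmax_weight_def using loc that by (simp cong: sum.cong)
  have [measurable]: "(\<lambda>u. sl u s k) \<in> borel_measurable (PiM ?T (\<lambda>_. borel))" if "k \<in> T" for s k
    unfolding sl_def by (rule measurable_component_singleton) (use that in simp)
  have dsl: "((\<lambda>s. sl (u s) r k) has_real_derivative u' (k, r)) (at t)"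
    if "k \<in> T" "\<And>x. x \<in> ?T \<Longrightarrow> ((\<lambda>s. u s x) has_real_derivative u' x) (at t)" for u u' t k r
    unfolding sl_def using that by auto
  let ?L = "\<lambda>t \<omega> x. \<Sum>i\<in>I <+> I. c x i t * \<omega> i"
  have "(\<integral>\<omega>. \<Phi> (?L (pi/2) \<omega>) \<partial>gaussian (I <+> I)) - (\<integral>\<omega>. \<Phi> (?L 0 \<omega>) \<partial>gaussian (I <+> I)) \<ge> - 1 * (pi/2 - 0)"
  proof (rule gaussian_interpolation[where T = ?T and c' = c' and \<Delta> = \<Delta> and \<Gamma> = \<Gamma> and C = C and M = M])
    show "finite (I <+> I)" "finite ?T" using I T by auto
    show "(c x i has_real_derivative c' x i t) (at t)" for x i t
      unfolding c_def c'_def by (cases x; cases i; cases "snd x") (auto intro!: derivative_eq_intros)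
    show "isCont (c' x i) t" for x i t
      unfolding c'_def by (cases x; cases i; cases "snd x") (auto intro!: continuous_intros)
    have sc: "\<bar>sin t * a k i\<bar> \<le> M" "\<bar>cos t * a k i\<bar> \<le> M" for t k i
      using mult_mono[of "\<bar>sin t\<bar>" 1 "\<bar>a k i\<bar>" M] mult_mono[of "\<bar>cos t\<bar>" 1 "\<bar>a k i\<bar>" M] bd
      by (simp_all add: abs_mult)
    show "\<bar>c x i t\<bar> \<le> M" for x i t
      unfolding c_def using sc bd M0 by (cases x; cases i; cases "snd x") auto
    show "\<bar>c' x i t\<bar> \<le> M" for x i t
      unfolding c'_def using sc bd M0 by (cases x; cases i; cases "snd x") auto
    show "((\<lambda>s. \<Phi> (u s)) has_real_derivative (\<Sum>x\<in>?T. \<Delta> x (u t) * u' x)) (at t)"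
      if "\<And>x. x \<in> ?T \<Longrightarrow> ((\<lambda>s. u s x) has_real_derivative u' x) (at t)" for u u' t
    proof -
      have d: "((\<lambda>s. ?sm (sl (u s) r)) has_real_derivative (\<Sum>k\<in>T. ?w (sl (u t) r) k * u' (k, r))) (at t)" for r
        by (rule softmax_deriv[OF T \<beta>]) (rule dsl[OF _ that])
      show ?thesis unfolding \<Phi>_def
        by (rule DERIV_cong[OF DERIV_mult[OF d d]])
          (simp add: sumT \<Delta>_def sum_distrib_left sum_distrib_right algebra_simps)
    qed
    show "((\<lambda>s. \<Delta> x (u s)) has_real_derivative (\<Sum>y\<in>?T. \<Gamma> x y (u t) * u' y)) (at t)"
      if x: "x \<in> ?T" and u: "\<And>x. x \<in> ?T \<Longrightarrow> ((\<lambda>s. u s x) has_real_derivative u' x) (at t)" for x u u' t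
    proof -
      obtain k r where xk: "x = (k, r)" "k \<in> T" using x by auto
      have d: "((\<lambda>s. ?sm (sl (u s) r)) has_real_derivative (\<Sum>k\<in>T. ?w (sl (u t) r) k * u' (k, r))) (at t)" for r
        by (rule softmax_deriv[OF T \<beta>]) (rule dsl[OF _ u])
      have d2: "((\<lambda>s. ?w (sl (u s) r) k) has_real_derivative
          (\<Sum>l\<in>T. \<beta> * ?w (sl (u t) r) k * ((if k = l then 1 else 0) - ?w (sl (u t) r) l) * u' (l, r))) (at t)"
        by (rule softmax_weight_deriv[OF T(1) xk(2)]) (rule dsl[OF _ u])
      show ?thesis unfolding \<Delta>_def xk fst_conv snd_conv
        by (rule DERIV_cong[OF DERIV_mult[OF d2 d]], cases r)
          (simp_all add: sumT \<Gamma>_def sum_distrib_left sum_distrib_right mult_ac)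
    qed
    show "isCont (\<lambda>s. \<Gamma> x y (u s)) t"
      if "x \<in> ?T" "y \<in> ?T" and u: "\<And>j. j \<in> ?T \<Longrightarrow> isCont (\<lambda>s. u s j) t" for x y u and t :: real
    proof -
      have u': "isCont (\<lambda>s. sl (u s) r l) t" if "l \<in> T" for r l unfolding sl_def using u that by auto
      have cw: "isCont (\<lambda>s. ?w (sl (u s) r) l) t" if "l \<in> T" for r l
        by (rule softmax_weight_isCont[OF T(1) that u'])
      have cs: "isCont (\<lambda>s. ?sm (sl (u s) r)) t" for r
        by (rule softmax_isCont[OF T \<beta> u'])
      have "fst x \<in> T" "fst y \<in> T" using that by auto
      then show ?thesis unfolding \<Gamma>_def
        by (cases "snd x = snd y") (auto intro!: continuous_intros cw cs)
    qed
    show "\<Phi> \<in> borel_measurable (PiM ?T (\<lambda>_. borel))" unfolding \<Phi>_def by measurable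
    show "\<Delta> x \<in> borel_measurable (PiM ?T (\<lambda>_. borel))" if "x \<in> ?T" for x
    proof -
      have "fst x \<in> T" using that by auto
      then show ?thesis unfolding \<Delta>_def by measurable
    qed
    show "\<Gamma> x y \<in> borel_measurable (PiM ?T (\<lambda>_. borel))" if "x \<in> ?T" "y \<in> ?T" for x y
    proof -
      have "fst x \<in> T" "fst y \<in> T" using that by auto
      then show ?thesis unfolding \<Gamma>_def by (cases "snd x = snd y") simp_all
    qed
    show "\<Phi> (restrict u ?T) = \<Phi> u" for u unfolding \<Phi>_def locsm ..
    show "\<Delta> x (restrict u ?T) = \<Delta> x u" if "x \<in> ?T" for x u
      using that unfolding \<Delta>_def locsm by (auto simp: locw)
    show "\<Gamma> x y (restrict u ?T) = \<Gamma> x y u" if "x \<in> ?T" "y \<in> ?T" for x y u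
      using that unfolding \<Gamma>_def locsm by (auto simp: locw)
    show "\<bar>\<Phi> u\<bar> \<le> C * (lin_growth ?T u)\<^sup>2" for u
    proof -
      have "\<bar>\<Phi> u\<bar> \<le> (K * lin_growth ?T u) * (K * lin_growth ?T u)"
        unfolding \<Phi>_def abs_mult using K1 lg[of u] by (intro mult_mono sm_bd) auto
      also have "\<dots> = K\<^sup>2 * (lin_growth ?T u)\<^sup>2" by (simp add: power2_eq_square)
      also have "\<dots> \<le> C * (lin_growth ?T u)\<^sup>2" using C1 by (intro mult_right_mono) auto
      finally show ?thesis .
    qed
    show "\<bar>\<Delta> x u\<bar> \<le> C * lin_growth ?T u" if "x \<in> ?T" for x u
    proof -
      have "\<bar>\<Delta> x u\<bar> \<le> 1 * (K * lin_growth ?T u)"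
        unfolding \<Delta>_def abs_mult using that w0 w1 by (intro mult_mono sm_bd) auto
      also have "\<dots> \<le> C * lin_growth ?T u" using C1 lg[of u] by (simp add: mult_right_mono)
      finally show ?thesis .
    qed
    show "\<bar>\<Gamma> x y u\<bar> \<le> C * lin_growth ?T u" if "x \<in> ?T" "y \<in> ?T" for x y u
    proof (cases "snd x = snd y")
      case True
      have "\<bar>(if fst x = fst y then 1 else 0) - ?w (sl u (snd x)) (fst y)\<bar> \<le> 2"
        using w0[of "sl u (snd x)" "fst y"] w1[of "fst y" "sl u (snd x)"] that by auto
      moreover have "\<bar>\<beta> * ?w (sl u (snd x)) (fst x)\<bar> \<le> \<beta> * 1"
        using that w0 w1 \<beta> by (auto simp: abs_mult)
      ultimately have "\<bar>\<Gamma> x y u\<bar> \<le> (\<beta> * 1 * 2) * (K * lin_growth ?T u)"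
        unfolding \<Gamma>_def if_P[OF True] abs_mult[of _ "?sm _"] abs_mult[of "\<beta> * _" "_ - _"] using \<beta>
        by (intro mult_mono sm_bd) auto
      also have "\<dots> = (2 * \<beta> * K) * lin_growth ?T u" by simp
      also have "\<dots> \<le> C * lin_growth ?T u" using C1 lg[of u] by (intro mult_right_mono) auto
      finally show ?thesis .
    next
      case False
      have "\<bar>\<Gamma> x y u\<bar> \<le> 1 * 1"
        unfolding \<Gamma>_def if_not_P[OF False] abs_mult using that w0 w1 by (intro mult_mono) auto
      also have "\<dots> \<le> C * lin_growth ?T u" using C1(3) lg[of u] by (intro mult_mono) auto
      finally show ?thesis .
    qed
    show "- 1 \<le> (\<Sum>x\<in>?T. \<Sum>y\<in>?T. (\<Sum>i\<in>I <+> I. c' x i t * c y i t) * \<Gamma> x y u)"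
      if t: "0 \<le> t" "t \<le> pi/2" for t u
    proof -
      define p where "p = ?w (sl u True)"
      define q where "q = ?w (sl u False)"
      \<comment> \<open>The resting copy has no velocity and the rotating copy keeps its covariance,
        so only the pairing of the rotating velocity with the resting copy survives.\<close>
      have c1: "(\<Sum>i\<in>I <+> I. c' (k, False) i t * c y i t) = 0" for k y
        by (simp add: c'_def)
      have c2: "(\<Sum>i\<in>I <+> I. c' (k, True) i t * c (l, True) i t) = 0" for k l
        using I by (simp add: c'_def c_def sum.Plus sum.distrib[symmetric] algebra_simps)
      have c3: "(\<Sum>i\<in>I <+> I. c' (k, True) i t * c (l, False) i t) = - sin t * (\<Sum>i\<in>I. a k i * a l i)" for k l
        using I by (simp add: c'_def c_def sum.Plus sum_distrib_left mult.assoc sum_negf)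
      have "(\<Sum>x\<in>?T. \<Sum>y\<in>?T. (\<Sum>i\<in>I <+> I. c' x i t * c y i t) * \<Gamma> x y u)
        = - sin t * (\<Sum>k\<in>T. \<Sum>l\<in>T. (\<Sum>i\<in>I. a k i * a l i) * (p k * q l))"
        unfolding sumT c1 c2 c3 by (simp add: \<Gamma>_def p_def q_def sum_distrib_left sum_negf mult_ac)
      also have "(\<Sum>k\<in>T. \<Sum>l\<in>T. (\<Sum>i\<in>I. a k i * a l i) * (p k * q l))
        = (\<Sum>i\<in>I. (\<Sum>k\<in>T. p k * a k i) * (\<Sum>l\<in>T. q l * a l i))"
      proof -
        have "(\<Sum>i\<in>I. (\<Sum>k\<in>T. p k * a k i) * (\<Sum>l\<in>T. q l * a l i))
          = (\<Sum>i\<in>I. \<Sum>k\<in>T. \<Sum>l\<in>T. (a k i * a l i) * (p k * q l))"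
          by (simp add: sum_product mult_ac)
        also have "\<dots> = (\<Sum>k\<in>T. \<Sum>l\<in>T. \<Sum>i\<in>I. (a k i * a l i) * (p k * q l))"
          by (subst sum.swap) (intro sum.cong refl sum.swap)
        finally show ?thesis by (simp add: sum_distrib_right)
      qed
      finally have eq: "(\<Sum>x\<in>?T. \<Sum>y\<in>?T. (\<Sum>i\<in>I <+> I. c' x i t * c y i t) * \<Gamma> x y u)
        = - sin t * (\<Sum>i\<in>I. (\<Sum>k\<in>T. p k * a k i) * (\<Sum>l\<in>T. q l * a l i))" .
      \<comment> \<open>Averages of vectors of norm at most 1 obey the same bound, by Cauchy-Schwarz
        with weights \<open>sqrt (v k)\<close>.\<close>
      have conv: "(\<Sum>i\<in>I. (\<Sum>k\<in>T. v k * a k i)\<^sup>2) \<le> 1"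
        if v: "\<And>k. v k \<ge> 0" "(\<Sum>k\<in>T. v k) = 1" for v
      proof -
        have "(\<Sum>k\<in>T. v k * a k i)\<^sup>2 \<le> (\<Sum>k\<in>T. v k * (a k i)\<^sup>2)" for i
        proof -
          have "(\<Sum>k\<in>T. sqrt (v k) * (sqrt (v k) * a k i))\<^sup>2
              \<le> (\<Sum>k\<in>T. (sqrt (v k))\<^sup>2) * (\<Sum>k\<in>T. (sqrt (v k) * a k i)\<^sup>2)"
            by (rule Cauchy_Schwarz_ineq_sum)
          then show ?thesis using v by (simp add: power_mult_distrib mult.assoc[symmetric])
        qed
        then have "(\<Sum>i\<in>I. (\<Sum>k\<in>T. v k * a k i)\<^sup>2) \<le> (\<Sum>i\<in>I. \<Sum>k\<in>T. v k * (a k i)\<^sup>2)"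
          by (intro sum_mono) auto
        also have "\<dots> = (\<Sum>k\<in>T. v k * (\<Sum>i\<in>I. (a k i)\<^sup>2))"
          by (subst sum.swap) (simp add: sum_distrib_left)
        also have "\<dots> \<le> (\<Sum>k\<in>T. v k * 1)" using v norm by (intro sum_mono mult_left_mono) auto
        finally show ?thesis using v by simp
      qed
      have cs: "(\<Sum>i\<in>I. (\<Sum>k\<in>T. p k * a k i) * (\<Sum>l\<in>T. q l * a l i))\<^sup>2 \<le> 1 * 1"
        by (rule order_trans[OF Cauchy_Schwarz_ineq_sum], rule mult_mono)
          (auto intro!: conv sum_nonneg w0 simp: p_def q_def softmax_weight_sum T)
      have s: "(\<Sum>i\<in>I. (\<Sum>k\<in>T. p k * a k i) * (\<Sum>l\<in>T. q l * a l i)) \<le> 1"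
        by (rule power2_le_imp_le) (use cs in simp_all)
      have "sin t \<ge> 0" using t by (auto intro!: sin_ge_zero)
      then have "sin t * (\<Sum>i\<in>I. (\<Sum>k\<in>T. p k * a k i) * (\<Sum>l\<in>T. q l * a l i)) \<le> 1 * 1"
        using mult_left_mono[OF s, of "sin t"] sin_le_one[of t] by linarith
      then show ?thesis unfolding eq by simp
    qed
  qed simp
  \<comment> \<open>At time 0 the copies coincide; at time \<open>pi / 2\<close> they use disjoint
    blocks.\<close>
  moreover have "\<Phi> (?L 0 \<omega>) = (f (\<lambda>i\<in>I. \<omega> (Inl i)))\<^sup>2" for \<omega>
    using I unfolding \<Phi>_def f_def sl_def c_def by (simp add: sum.Plus power2_eq_square cong: sum.cong)
  moreover have "\<Phi> (?L (pi/2) \<omega>) = f (\<lambda>i\<in>I. \<omega> (Inl i)) * f (\<lambda>i\<in>I. \<omega> (Inr i))" for \<omega>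
    using I unfolding \<Phi>_def f_def sl_def c_def by (simp add: sum.Plus cong: sum.cong)
  ultimately have *: "(\<integral>\<omega>. (f (\<lambda>i\<in>I. \<omega> (Inl i)))\<^sup>2 \<partial>gaussian (I <+> I))
      - (\<integral>\<omega>. f (\<lambda>i\<in>I. \<omega> (Inl i)) * f (\<lambda>i\<in>I. \<omega> (Inr i)) \<partial>gaussian (I <+> I)) \<le> pi/2"
    by simp
  have mf[measurable]: "f \<in> borel_measurable (gaussian I)" unfolding f_def by measurable
  have bdf: "\<bar>f (\<lambda>i\<in>I. \<omega> (\<phi> i))\<bar> \<le> (K * (1 + real (card T) * M)) * lin_growth (I <+> I) \<omega>"
    if "\<phi> = Inl \<or> \<phi> = Inr" for \<omega> \<phi>
  proof -
    have "(\<Sum>i\<in>I. \<bar>\<omega> (\<phi> i)\<bar>) \<le> (\<Sum>i\<in>I <+> I. \<bar>\<omega> i\<bar>)"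
      using that I by (auto simp: sum.Plus sum_nonneg)
    then have S: "(\<Sum>i\<in>I. \<bar>\<omega> (\<phi> i)\<bar>) \<le> lin_growth (I <+> I) \<omega>" unfolding lin_growth_def by simp
    have "\<bar>\<Sum>i\<in>I. a k i * \<omega> (\<phi> i)\<bar> \<le> M * lin_growth (I <+> I) \<omega>" for k
    proof -
      have "\<bar>\<Sum>i\<in>I. a k i * \<omega> (\<phi> i)\<bar> \<le> (\<Sum>i\<in>I. \<bar>a k i * \<omega> (\<phi> i)\<bar>)" by (rule sum_abs)
      also have "\<dots> \<le> (\<Sum>i\<in>I. M * \<bar>\<omega> (\<phi> i)\<bar>)" by (intro sum_mono) (simp add: abs_mult mult_right_mono bd)
      also have "\<dots> \<le> M * lin_growth (I <+> I) \<omega>"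
        using S M0 by (simp add: sum_distrib_left[symmetric] mult_left_mono)
      finally show ?thesis .
    qed
    then have "(\<Sum>k\<in>T. \<bar>\<Sum>i\<in>I. a k i * \<omega> (\<phi> i)\<bar>) \<le> real (card T) * (M * lin_growth (I <+> I) \<omega>)"
      by (intro sum_bounded_above) auto
    then have "lin_growth T (\<lambda>k. \<Sum>i\<in>I. a k i * \<omega> (\<phi> i)) \<le> (1 + real (card T) * M) * lin_growth (I <+> I) \<omega>"
      using lin_growth_ge_1[of "I <+> I" \<omega>] unfolding lin_growth_def[of T] by (simp add: algebra_simps)
    then have "K * lin_growth T (\<lambda>k. \<Sum>i\<in>I. a k i * \<omega> (\<phi> i)) \<le> K * (1 + real (card T) * M) * lin_growth (I <+> I) \<omega>"
      using K1 by (simp add: mult_left_mono)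
    moreover have "\<bar>f (\<lambda>i\<in>I. \<omega> (\<phi> i))\<bar> \<le> K * lin_growth T (\<lambda>k. \<Sum>i\<in>I. a k i * \<omega> (\<phi> i))"
    proof -
      have "f (\<lambda>i\<in>I. \<omega> (\<phi> i)) = ?sm (\<lambda>k. \<Sum>i\<in>I. a k i * \<omega> (\<phi> i))" unfolding f_def by (simp cong: sum.cong)
      then show ?thesis
        using softmax_abs_le[OF T \<beta>, of "\<lambda>k. \<Sum>i\<in>I. a k i * \<omega> (\<phi> i)"] K1'
        mult_right_mono[OF K1', of "lin_growth T (\<lambda>k. \<Sum>i\<in>I. a k i * \<omega> (\<phi> i))"]
        lin_growth_ge_1[of T "\<lambda>k. \<Sum>i\<in>I. a k i * \<omega> (\<phi> i)"] by linarith
    qed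
    ultimately show ?thesis by linarith
  qed
  have "integrable (gaussian (I <+> I)) (\<lambda>\<omega>. f (\<lambda>i\<in>I. \<omega> (Inl i)) * f (\<lambda>i\<in>I. \<omega> (Inr i)))"
  proof (rule gaussian_integrable_quadratic)
    let ?B = "K * (1 + real (card T) * M)"
    show "(\<lambda>\<omega>. f (\<lambda>i\<in>I. \<omega> (Inl i)) * f (\<lambda>i\<in>I. \<omega> (Inr i))) \<in> borel_measurable (gaussian (I <+> I))"
      by (intro borel_measurable_times measurable_compose[OF measurable_gaussian_reindex mf]) auto
    fix \<omega>
    have "\<bar>f (\<lambda>i\<in>I. \<omega> (Inl i)) * f (\<lambda>i\<in>I. \<omega> (Inr i))\<bar> \<le> (?B * lin_growth (I <+> I) \<omega>) * (?B * lin_growth (I <+> I) \<omega>)"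
      unfolding abs_mult using K1 M0 lin_growth_ge_1[of "I <+> I" \<omega>] by (intro mult_mono bdf) auto
    then show "\<bar>f (\<lambda>i\<in>I. \<omega> (Inl i)) * f (\<lambda>i\<in>I. \<omega> (Inr i))\<bar> \<le> ?B\<^sup>2 * (lin_growth (I <+> I) \<omega>)\<^sup>2"
      by (simp add: power2_eq_square mult_ac)
  qed (use I in auto)
  from gaussian_independent[OF I I mf mf this, folded power2_eq_square]
  have "(\<integral>\<omega>. f (\<lambda>i\<in>I. \<omega> (Inl i)) * f (\<lambda>i\<in>I. \<omega> (Inr i)) \<partial>gaussian (I <+> I)) = (\<integral>\<omega>. f \<omega> \<partial>gaussian I)\<^sup>2" .
  moreover have "(\<integral>\<omega>. (f (\<lambda>i\<in>I. \<omega> (Inl i)))\<^sup>2 \<partial>gaussian (I <+> I)) = (\<integral>\<omega>. (f \<omega>)\<^sup>2 \<partial>gaussian I)"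
    by (rule gaussian_reindex[where F = "\<lambda>\<omega>. (f \<omega>)\<^sup>2"]) auto
  ultimately show ?thesis using * by simp
qed

section \<open>Suprema of Gaussian linear forms\<close>

text \<open>The index set may be uncountable, and a real \<open>SUP\<close> is meaningful only for
  bounded nonempty families; hence the uniform bound \<open>R\<close> on the coefficients in the
  lemmas below.\<close>

definition lin_sup :: "'i set \<Rightarrow> ('k \<Rightarrow> 'i \<Rightarrow> real) \<Rightarrow> 'k set \<Rightarrow> ('i \<Rightarrow> real) \<Rightarrow> real" where
  "lin_sup I a T \<omega> = (SUP k\<in>T. \<Sum>i\<in>I. a k i * \<omega> i)"

lemma lin_form_abs_le:
  assumes "finite I" "\<And>i. i \<in> I \<Longrightarrow> \<bar>v i\<bar> \<le> R" "R \<ge> 0"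
  shows "\<bar>\<Sum>i\<in>I. v i * \<omega> i\<bar> \<le> R * lin_growth I \<omega>"
proof -
  have "\<bar>\<Sum>i\<in>I. v i * \<omega> i\<bar> \<le> (\<Sum>i\<in>I. \<bar>v i * \<omega> i\<bar>)" by (rule sum_abs)
  also have "\<dots> \<le> (\<Sum>i\<in>I. R * \<bar>\<omega> i\<bar>)" by (intro sum_mono) (simp add: abs_mult mult_right_mono assms)
  also have "\<dots> \<le> R * lin_growth I \<omega>"
    using assms by (simp add: lin_growth_def sum_distrib_left algebra_simps)
  finally show ?thesis .
qed

lemma lin_sup_bdd:
  fixes \<omega> :: "'i \<Rightarrow> real"
  assumes "finite I" "\<forall>k\<in>T. \<forall>i\<in>I. \<bar>a k i\<bar> \<le> R" "R \<ge> 0"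
  shows "bdd_above ((\<lambda>k. \<Sum>i\<in>I. a k i * \<omega> i) ` T)"
proof (rule bdd_aboveI[of _ "R * lin_growth I \<omega>"], clarify)
  fix k assume "k \<in> T"
  then have "\<bar>\<Sum>i\<in>I. a k i * \<omega> i\<bar> \<le> R * lin_growth I \<omega>"
    by (intro lin_form_abs_le) (use assms in auto)
  then show "(\<Sum>i\<in>I. a k i * \<omega> i) \<le> R * lin_growth I \<omega>" by linarith
qed

lemma lin_sup_upper:
  assumes "finite I" "\<forall>k\<in>T. \<forall>i\<in>I. \<bar>a k i\<bar> \<le> R" "R \<ge> 0" "k \<in> T"
  shows "(\<Sum>i\<in>I. a k i * \<omega> i) \<le> lin_sup I a T \<omega>"
  unfolding lin_sup_def by (rule cSUP_upper[OF assms(4) lin_sup_bdd[OF assms(1-3)]])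

lemma lin_sup_least:
  assumes "T \<noteq> {}" "\<And>k. k \<in> T \<Longrightarrow> (\<Sum>i\<in>I. a k i * \<omega> i) \<le> m"
  shows "lin_sup I a T \<omega> \<le> m"
  unfolding lin_sup_def by (rule cSUP_least) (use assms in auto)

lemma lin_sup_abs_le:
  assumes "finite I" "\<forall>k\<in>T. \<forall>i\<in>I. \<bar>a k i\<bar> \<le> R" "R \<ge> 0" "T \<noteq> {}"
  shows "\<bar>lin_sup I a T \<omega>\<bar> \<le> R * lin_growth I \<omega>"
proof -
  have b: "\<bar>\<Sum>i\<in>I. a k i * \<omega> i\<bar> \<le> R * lin_growth I \<omega>" if "k \<in> T" for k
    by (rule lin_form_abs_le) (use assms that in auto)
  obtain k where k: "k \<in> T" using assms by auto
  have "lin_sup I a T \<omega> \<le> R * lin_growth I \<omega>"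
    by (rule lin_sup_least) (use assms b in \<open>auto intro: abs_le_D1\<close>)
  moreover have "- (R * lin_growth I \<omega>) \<le> lin_sup I a T \<omega>"
    using lin_sup_upper[of I T a R k \<omega>, OF assms(1-3) k] b[OF k] by linarith
  ultimately show ?thesis by linarith
qed

text \<open>Rounding the coefficients down to multiples of \<open>\<epsilon>\<close> sends
  \<open>T\<close> into a finite grid; one representative per occupied cell is enough.\<close>

lemma finite_net:
  fixes a :: "'k \<Rightarrow> 'i \<Rightarrow> real"
  assumes I: "finite I" and bd: "\<forall>k\<in>T. \<forall>i\<in>I. \<bar>a k i\<bar> \<le> R" and e: "\<epsilon> > 0"
  shows "\<exists>T'\<subseteq>T. finite T' \<and> (\<forall>k\<in>T. \<exists>k'\<in>T'. \<forall>i\<in>I. \<bar>a k i - a k' i\<bar> \<le> \<epsilon>)"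
proof -
  let ?g = "\<lambda>k. \<lambda>i\<in>I. \<lfloor>a k i / \<epsilon>\<rfloor>"
  have "?g ` T \<subseteq> PiE I (\<lambda>_. {\<lfloor>- R / \<epsilon>\<rfloor>..\<lfloor>R / \<epsilon>\<rfloor>})"
  proof (clarsimp simp: PiE_iff)
    fix k i assume "k \<in> T" "i \<in> I"
    then have "\<bar>a k i\<bar> \<le> R" using bd by auto
    then have "- R \<le> a k i" "a k i \<le> R" by auto
    then show "\<lfloor>- (R / \<epsilon>)\<rfloor> \<le> \<lfloor>a k i / \<epsilon>\<rfloor> \<and> \<lfloor>a k i / \<epsilon>\<rfloor> \<le> \<lfloor>R / \<epsilon>\<rfloor>"
      using e by (intro conjI floor_mono) (simp_all add: divide_right_mono field_simps)
  qed
  then have "finite (?g ` T)" by (rule finite_subset) (intro finite_PiE I finite_atLeastAtMost_int)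
  from finite_subset_image[OF this order_refl]
  obtain T' where T': "T' \<subseteq> T" "finite T'" "?g ` T = ?g ` T'" by auto
  show ?thesis
  proof (intro exI[of _ T'] conjI T'(1,2) ballI)
    fix k assume "k \<in> T"
    then obtain k' where k': "k' \<in> T'" "?g k = ?g k'" using T'(3) by (metis (no_types, lifting) image_iff)
    have "\<bar>a k i - a k' i\<bar> \<le> \<epsilon>" if "i \<in> I" for i
    proof -
      have "\<lfloor>a k i / \<epsilon>\<rfloor> = \<lfloor>a k' i / \<epsilon>\<rfloor>" using fun_cong[OF k'(2), of i] that by simp
      then have "\<bar>a k i / \<epsilon> - a k' i / \<epsilon>\<bar> \<le> 1" by linarith
      then have "\<bar>a k i - a k' i\<bar> / \<epsilon> \<le> 1" using e by (simp add: diff_divide_distrib[symmetric])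
      then show ?thesis using e by simp
    qed
    then show "\<exists>k'\<in>T'. \<forall>i\<in>I. \<bar>a k i - a k' i\<bar> \<le> \<epsilon>" using k'(1) by auto
  qed
qed

text \<open>Two approximations at once: passing to a finite net costs \<open>\<epsilon>\<close>
  times the l1 size of the noise, and a large \<open>\<beta>\<close> makes the smoothing error at
  most \<open>\<epsilon>\<close>.\<close>

lemma lin_sup_softmax:
  fixes a :: "'k \<Rightarrow> 'i \<Rightarrow> real"
  assumes I: "finite I" and bd: "\<forall>k\<in>T. \<forall>i\<in>I. \<bar>a k i\<bar> \<le> R" and R: "R \<ge> 0" and T: "T \<noteq> {}"
    and e: "\<epsilon> > 0"
  obtains T' \<beta> where "finite T'" "T' \<noteq> {}" "T' \<subseteq> T" "\<beta> > 0" "ln (real (card T')) / \<beta> \<le> \<epsilon>"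
    "\<And>\<omega>. \<bar>softmax \<beta> T' (\<lambda>k. \<Sum>i\<in>I. a k i * \<omega> i) - lin_sup I a T \<omega>\<bar> \<le> \<epsilon> * lin_growth I \<omega>"
proof -
  obtain T' where T': "finite T'" "T' \<subseteq> T"
    "\<And>k. k \<in> T \<Longrightarrow> \<exists>k'\<in>T'. \<forall>i\<in>I. \<bar>a k i - a k' i\<bar> \<le> \<epsilon>"
    using finite_net[of I T a R \<epsilon>] I bd e by blast
  have ne: "T' \<noteq> {}" using T T'(3) by blast
  \<comment> \<open>The summand 1 keeps \<open>\<beta>\<close> positive when the net is a single
    point.\<close>
  define \<beta> where "\<beta> = \<bar>ln (real (card T'))\<bar> / \<epsilon> + 1"
  have \<beta>: "\<beta> > 0" unfolding \<beta>_def using e by (simp add: add_nonneg_pos)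
  have l: "ln (real (card T')) / \<beta> \<le> \<epsilon>"
  proof -
    have "ln (real (card T')) \<le> \<bar>ln (real (card T'))\<bar> + \<epsilon>" using e by linarith
    also have "\<dots> = \<epsilon> * \<beta>" using e unfolding \<beta>_def by (simp add: field_simps)
    finally show ?thesis using \<beta> by (simp add: divide_le_eq)
  qed
  show ?thesis
  proof (rule that[OF T'(1) ne T'(2) \<beta> l])
    fix \<omega> :: "'i \<Rightarrow> real"
    have lg: "lin_growth I \<omega> \<ge> 1" by (rule lin_growth_ge_1)
    have "softmax \<beta> T' (\<lambda>k. \<Sum>i\<in>I. a k i * \<omega> i) \<le> lin_sup I a T \<omega> + ln (real (card T')) / \<beta>"
      using T'(2) by (intro softmax_le T' ne \<beta> lin_sup_upper[OF I bd R]) auto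
    moreover have "\<epsilon> * 1 \<le> \<epsilon> * lin_growth I \<omega>" using e lg by (intro mult_left_mono) auto
    moreover have "lin_sup I a T \<omega> \<le> softmax \<beta> T' (\<lambda>k. \<Sum>i\<in>I. a k i * \<omega> i) + \<epsilon> * lin_growth I \<omega>"
    proof (rule lin_sup_least[OF T])
      fix k assume "k \<in> T"
      then obtain k' where k': "k' \<in> T'" "\<And>i. i \<in> I \<Longrightarrow> \<bar>a k i - a k' i\<bar> \<le> \<epsilon>" using T'(3) by blast
      have "\<bar>\<Sum>i\<in>I. (a k i - a k' i) * \<omega> i\<bar> \<le> \<epsilon> * lin_growth I \<omega>"
        by (rule lin_form_abs_le) (use I k' e in auto)
      moreover have "(\<Sum>i\<in>I. a k' i * \<omega> i) \<le> softmax \<beta> T' (\<lambda>k. \<Sum>i\<in>I. a k i * \<omega> i)"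
        by (rule softmax_ge[OF T'(1) k'(1) \<beta>])
      ultimately show "(\<Sum>i\<in>I. a k i * \<omega> i) \<le> softmax \<beta> T' (\<lambda>k. \<Sum>i\<in>I. a k i * \<omega> i) + \<epsilon> * lin_growth I \<omega>"
        by (simp add: algebra_simps sum_subtractf)
    qed
    ultimately show "\<bar>softmax \<beta> T' (\<lambda>k. \<Sum>i\<in>I. a k i * \<omega> i) - lin_sup I a T \<omega>\<bar> \<le> \<epsilon> * lin_growth I \<omega>"
      using l by linarith
  qed
qed

text \<open>Measurability of a supremum over an uncountable set is not automatic; here it is the
  pointwise limit of smoothed maxima over finite nets.\<close>

lemma measurable_lin_sup:
  fixes a :: "'k \<Rightarrow> 'i \<Rightarrow> real"
  assumes I: "finite I" and bd: "\<forall>k\<in>T. \<forall>i\<in>I. \<bar>a k i\<bar> \<le> R" and R: "R \<ge> 0" and T: "T \<noteq> {}"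
  shows "lin_sup I a T \<in> borel_measurable (gaussian I)"
proof -
  have "\<exists>h \<in> borel_measurable (gaussian I). \<forall>\<omega>. \<bar>h \<omega> - lin_sup I a T \<omega>\<bar> \<le> inverse (real (Suc n)) * lin_growth I \<omega>" for n
  proof -
    have "inverse (real (Suc n)) > 0" by simp
    then obtain T' \<beta> where
      "\<And>\<omega>. \<bar>softmax \<beta> T' (\<lambda>k. \<Sum>i\<in>I. a k i * \<omega> i) - lin_sup I a T \<omega>\<bar> \<le> inverse (real (Suc n)) * lin_growth I \<omega>"
      by (rule lin_sup_softmax[of I T a R "inverse (real (Suc n))", OF I bd R T]) (rule that)
    moreover have "(\<lambda>\<omega>. softmax \<beta> T' (\<lambda>k. \<Sum>i\<in>I. a k i * \<omega> i)) \<in> borel_measurable (gaussian I)" by measurable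
    ultimately show ?thesis by (intro bexI[where x = "\<lambda>\<omega>. softmax \<beta> T' (\<lambda>k. \<Sum>i\<in>I. a k i * \<omega> i)"]) auto
  qed
  then have "\<forall>n. \<exists>h. h \<in> borel_measurable (gaussian I) \<and>
      (\<forall>\<omega>. \<bar>h \<omega> - lin_sup I a T \<omega>\<bar> \<le> inverse (real (Suc n)) * lin_growth I \<omega>)" by blast
  from choice[OF this] obtain h where h: "\<And>n. h n \<in> borel_measurable (gaussian I)"
    "\<And>n \<omega>. \<bar>h n \<omega> - lin_sup I a T \<omega>\<bar> \<le> inverse (real (Suc n)) * lin_growth I \<omega>" by blast
  show ?thesis
  proof (rule borel_measurable_LIMSEQ_real[OF _ h(1)])
    fix \<omega>
    have l: "(\<lambda>n. inverse (real (Suc n)) * lin_growth I \<omega>) \<longlonglongrightarrow> 0"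
      by (rule tendsto_mult_left_zero[OF LIMSEQ_inverse_real_of_nat])
    have "(\<lambda>n. h n \<omega> - lin_sup I a T \<omega>) \<longlonglongrightarrow> 0"
      by (rule Lim_null_comparison[OF always_eventually l]) (simp only: real_norm_def h(2) simp_thms)
    then show "(\<lambda>n. h n \<omega>) \<longlonglongrightarrow> lin_sup I a T \<omega>" by (simp add: LIM_zero_iff)
  qed
qed

lemma lin_sup_square_integrable:
  fixes a :: "'k \<Rightarrow> 'i \<Rightarrow> real"
  assumes I: "finite I" and bd: "\<forall>k\<in>T. \<forall>i\<in>I. \<bar>a k i\<bar> \<le> R" and R: "R \<ge> 0" and T: "T \<noteq> {}"
  shows "integrable (gaussian I) (\<lambda>\<omega>. (lin_sup I a T \<omega>)\<^sup>2)"
proof (rule gaussian_integrable_quadratic[OF I])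
  show "(\<lambda>\<omega>. (lin_sup I a T \<omega>)\<^sup>2) \<in> borel_measurable (gaussian I)"
    by (intro borel_measurable_power measurable_lin_sup[OF assms])
  show "\<bar>(lin_sup I a T \<omega>)\<^sup>2\<bar> \<le> R\<^sup>2 * (lin_growth I \<omega>)\<^sup>2" for \<omega>
    using power_mono[OF lin_sup_abs_le[of I T a R \<omega>, OF assms], of 2] by (simp add: power_mult_distrib)
qed

lemma lin_sup_integrable:
  fixes a :: "'k \<Rightarrow> 'i \<Rightarrow> real"
  assumes I: "finite I" and bd: "\<forall>k\<in>T. \<forall>i\<in>I. \<bar>a k i\<bar> \<le> R" and R: "R \<ge> 0" and T: "T \<noteq> {}"
  shows "integrable (gaussian I) (lin_sup I a T)"
  by (rule gaussian_integrable_linear[OF I measurable_lin_sup[OF assms] lin_sup_abs_le[OF assms]])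

lemma softmax_square_integrable:
  assumes I: "finite I" and T: "finite T" "T \<noteq> {}" and \<beta>: "\<beta> > 0"
  shows "integrable (gaussian I) (\<lambda>\<omega>. (softmax \<beta> T (\<lambda>k. \<Sum>i\<in>I. a k i * \<omega> i))\<^sup>2)" (is ?A)
    and "integrable (gaussian I) (\<lambda>\<omega>. softmax \<beta> T (\<lambda>k. \<Sum>i\<in>I. a k i * \<omega> i))" (is ?B)
proof -
  define M where "M = (\<Sum>k\<in>T. \<Sum>i\<in>I. \<bar>a k i\<bar>)"
  have M: "\<bar>a k i\<bar> \<le> M" if "k \<in> T" "i \<in> I" for k i
  proof -
    have "\<bar>a k i\<bar> \<le> (\<Sum>i\<in>I. \<bar>a k i\<bar>)" by (rule member_le_sum[OF that(2)]) (use I in auto)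
    also have "\<dots> \<le> M" unfolding M_def by (rule member_le_sum[OF that(1)]) (use T in \<open>auto intro: sum_nonneg\<close>)
    finally show ?thesis .
  qed
  have M0: "M \<ge> 0" unfolding M_def by (intro sum_nonneg) auto
  define K where "K = 1 + ln (real (card T)) / \<beta>"
  have "real (card T) \<ge> 1" using T by (metis card_0_eq less_one not_le of_nat_1 of_nat_le_iff)
  then have K: "K \<ge> 0" using \<beta> by (simp add: K_def)
  define D where "D = K * (1 + real (card T) * M)"
  have bd: "\<bar>softmax \<beta> T (\<lambda>k. \<Sum>i\<in>I. a k i * \<omega> i)\<bar> \<le> D * lin_growth I \<omega>" for \<omega>
  proof -
    have "(\<Sum>k\<in>T. \<bar>\<Sum>i\<in>I. a k i * \<omega> i\<bar>) \<le> real (card T) * (M * lin_growth I \<omega>)"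
      by (intro sum_bounded_above lin_form_abs_le I M M0)
    then have "lin_growth T (\<lambda>k. \<Sum>i\<in>I. a k i * \<omega> i) \<le> (1 + real (card T) * M) * lin_growth I \<omega>"
      using lin_growth_ge_1[of I \<omega>] unfolding lin_growth_def[of T] by (simp add: algebra_simps)
    then have "K * lin_growth T (\<lambda>k. \<Sum>i\<in>I. a k i * \<omega> i) \<le> D * lin_growth I \<omega>"
      using K unfolding D_def by (simp add: mult_left_mono mult.assoc)
    then show ?thesis using softmax_abs_le[OF T \<beta>, folded K_def] order_trans by blast
  qed
  show ?B by (rule gaussian_integrable_linear[OF I _ bd]) measurable
  have "\<bar>(softmax \<beta> T (\<lambda>k. \<Sum>i\<in>I. a k i * \<omega> i))\<^sup>2\<bar> \<le> D\<^sup>2 * (lin_growth I \<omega>)\<^sup>2" for \<omega>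
    using power_mono[OF bd[of \<omega>], of 2] by (simp add: power_mult_distrib)
  then show ?A by (intro gaussian_integrable_quadratic[OF I]) measurable
qed

lemma softmax_cong: "(\<And>k. k \<in> T \<Longrightarrow> u k = v k) \<Longrightarrow> softmax \<beta> T u = softmax \<beta> T v"
  by (simp add: softmax_def)

text \<open>Both families are put on one Gaussian space, on disjoint blocks of coordinates, so that the
  rotation from one to the other interpolates the covariances linearly.\<close>

lemma softmax_comparison_sum:
  fixes a :: "'k \<Rightarrow> 'i \<Rightarrow> real" and b :: "'k \<Rightarrow> 'j \<Rightarrow> real"
  assumes I: "finite I" and J: "finite J" and T: "finite T" "T \<noteq> {}" and \<beta>: "\<beta> > 0"
    and incr: "\<And>k l. k \<in> T \<Longrightarrow> l \<in> T \<Longrightarrow>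
      (\<Sum>i\<in>I. (a k i - a l i)\<^sup>2) \<le> (\<Sum>j\<in>J. (b k j - b l j)\<^sup>2)"
  shows "(\<integral>\<omega>. softmax \<beta> T (\<lambda>k. \<Sum>i\<in>I. a k i * \<omega> i) \<partial>gaussian I)
    \<le> (\<integral>\<omega>. softmax \<beta> T (\<lambda>k. \<Sum>j\<in>J. b k j * \<omega> j) \<partial>gaussian J)"
proof -
  \<comment> \<open>Setting coefficients to 0 outside \<open>T\<close> and the index blocks provides
    the bound over all indices that the comparison lemma requires.\<close>
  define A :: "'k \<Rightarrow> 'i + 'j \<Rightarrow> real"
    where "A k x = (case x of Inl i \<Rightarrow> if k \<in> T \<and> i \<in> I then a k i else 0 | Inr j \<Rightarrow> 0)" for k x
  define B :: "'k \<Rightarrow> 'i + 'j \<Rightarrow> real"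
    where "B k x = (case x of Inl i \<Rightarrow> 0 | Inr j \<Rightarrow> if k \<in> T \<and> j \<in> J then b k j else 0)" for k x
  define M where "M = (\<Sum>k\<in>T. \<Sum>i\<in>I. \<bar>a k i\<bar>) + (\<Sum>k\<in>T. \<Sum>j\<in>J. \<bar>b k j\<bar>)"
  have M0: "(\<Sum>k\<in>T. \<Sum>i\<in>I. \<bar>a k i\<bar>) \<ge> 0" "(\<Sum>k\<in>T. \<Sum>j\<in>J. \<bar>b k j\<bar>) \<ge> 0"
    by (auto intro!: sum_nonneg)
  have Ma: "\<bar>a k i\<bar> \<le> (\<Sum>k\<in>T. \<Sum>i\<in>I. \<bar>a k i\<bar>)" if "k \<in> T" "i \<in> I" for k i
  proof -
    have "\<bar>a k i\<bar> \<le> (\<Sum>i\<in>I. \<bar>a k i\<bar>)" by (rule member_le_sum[OF that(2)]) (use I in auto)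
    also have "\<dots> \<le> (\<Sum>k\<in>T. \<Sum>i\<in>I. \<bar>a k i\<bar>)"
      by (rule member_le_sum[OF that(1)]) (use T in \<open>auto intro: sum_nonneg\<close>)
    finally show ?thesis .
  qed
  have Mb: "\<bar>b k i\<bar> \<le> (\<Sum>k\<in>T. \<Sum>i\<in>J. \<bar>b k i\<bar>)" if "k \<in> T" "i \<in> J" for k i
  proof -
    have "\<bar>b k i\<bar> \<le> (\<Sum>i\<in>J. \<bar>b k i\<bar>)" by (rule member_le_sum[OF that(2)]) (use J in auto)
    also have "\<dots> \<le> (\<Sum>k\<in>T. \<Sum>i\<in>J. \<bar>b k i\<bar>)"
      by (rule member_le_sum[OF that(1)]) (use T in \<open>auto intro: sum_nonneg\<close>)
    finally show ?thesis .
  qed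
  have mA: "(\<lambda>\<omega>. softmax \<beta> T (\<lambda>k. \<Sum>i\<in>I. a k i * \<omega> i)) \<in> borel_measurable (gaussian I)" by measurable
  have mB: "(\<lambda>\<omega>. softmax \<beta> T (\<lambda>k. \<Sum>j\<in>J. b k j * \<omega> j)) \<in> borel_measurable (gaussian J)" by measurable
  have "(\<integral>\<omega>. softmax \<beta> T (\<lambda>k. \<Sum>x\<in>I <+> J. A k x * \<omega> x) \<partial>gaussian (I <+> J))
      \<le> (\<integral>\<omega>. softmax \<beta> T (\<lambda>k. \<Sum>x\<in>I <+> J. B k x * \<omega> x) \<partial>gaussian (I <+> J))"
  proof (rule softmax_comparison[OF _ T \<beta>, where M = M])
    show "finite (I <+> J)" using I J by auto
    show "A k x * B l x = 0" for k l x unfolding A_def B_def by (cases x) auto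
    show "\<bar>A k x\<bar> \<le> M" for k x
    proof (cases "\<exists>i. x = Inl i \<and> k \<in> T \<and> i \<in> I")
      case True
      then obtain i where "x = Inl i" "k \<in> T" "i \<in> I" by auto
      then show ?thesis using Ma[of k i] M0 by (simp add: A_def M_def)
    next
      case False
      then have "A k x = 0" by (cases x) (auto simp: A_def)
      then show ?thesis using M0 by (simp add: M_def)
    qed
    show "\<bar>B k x\<bar> \<le> M" for k x
    proof (cases "\<exists>j. x = Inr j \<and> k \<in> T \<and> j \<in> J")
      case True
      then obtain j where "x = Inr j" "k \<in> T" "j \<in> J" by auto
      then show ?thesis using Mb[of k j] M0 by (simp add: B_def M_def)
    next
      case False
      then have "B k x = 0" by (cases x) (auto simp: B_def)
      then show ?thesis using M0 by (simp add: M_def)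
    qed
    show "(\<Sum>x\<in>I <+> J. (A k x - A l x)\<^sup>2) \<le> (\<Sum>x\<in>I <+> J. (B k x - B l x)\<^sup>2)" if "k \<in> T" "l \<in> T" for k l
      using incr[OF that] I J that by (simp add: A_def B_def sum.Plus cong: sum.cong)
  qed
  moreover have "(\<integral>\<omega>. softmax \<beta> T (\<lambda>k. \<Sum>x\<in>I <+> J. A k x * \<omega> x) \<partial>gaussian (I <+> J))
      = (\<integral>\<omega>. softmax \<beta> T (\<lambda>k. \<Sum>i\<in>I. a k i * \<omega> i) \<partial>gaussian I)"
  proof -
    have "(\<Sum>x\<in>I <+> J. A k x * \<omega> x) = (\<Sum>i\<in>I. a k i * (\<lambda>i\<in>I. \<omega> (Inl i)) i)" if "k \<in> T" for k \<omega>
      using I J that by (simp add: A_def sum.Plus)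
    then have "(\<integral>\<omega>. softmax \<beta> T (\<lambda>k. \<Sum>x\<in>I <+> J. A k x * \<omega> x) \<partial>gaussian (I <+> J))
      = (\<integral>\<omega>. softmax \<beta> T (\<lambda>k. \<Sum>i\<in>I. a k i * (\<lambda>i\<in>I. \<omega> (Inl i)) i) \<partial>gaussian (I <+> J))"
      by (intro Bochner_Integration.integral_cong refl softmax_cong)
    also have "\<dots> = (\<integral>\<omega>. softmax \<beta> T (\<lambda>k. \<Sum>i\<in>I. a k i * \<omega> i) \<partial>gaussian I)"
      by (rule gaussian_reindex[where \<phi> = Inl and K = "I <+> J", OF _ _ mA]) auto
    finally show ?thesis .
  qed
  moreover have "(\<integral>\<omega>. softmax \<beta> T (\<lambda>k. \<Sum>x\<in>I <+> J. B k x * \<omega> x) \<partial>gaussian (I <+> J))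
      = (\<integral>\<omega>. softmax \<beta> T (\<lambda>k. \<Sum>j\<in>J. b k j * \<omega> j) \<partial>gaussian J)"
  proof -
    have "(\<Sum>x\<in>I <+> J. B k x * \<omega> x) = (\<Sum>j\<in>J. b k j * (\<lambda>j\<in>J. \<omega> (Inr j)) j)" if "k \<in> T" for k \<omega>
      using I J that by (simp add: B_def sum.Plus)
    then have "(\<integral>\<omega>. softmax \<beta> T (\<lambda>k. \<Sum>x\<in>I <+> J. B k x * \<omega> x) \<partial>gaussian (I <+> J))
      = (\<integral>\<omega>. softmax \<beta> T (\<lambda>k. \<Sum>j\<in>J. b k j * (\<lambda>j\<in>J. \<omega> (Inr j)) j) \<partial>gaussian (I <+> J))"
      by (intro Bochner_Integration.integral_cong refl softmax_cong)
    also have "\<dots> = (\<integral>\<omega>. softmax \<beta> T (\<lambda>k. \<Sum>j\<in>J. b k j * \<omega> j) \<partial>gaussian J)"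
      by (rule gaussian_reindex[where \<phi> = Inr and K = "I <+> J", OF _ _ mB]) auto
    finally show ?thesis .
  qed
  ultimately show ?thesis by linarith
qed

text \<open>The comparison of smoothed maxima is applied on a single net \<open>T'\<close>, chosen
  for \<open>a\<close>. The other side needs no approximation: restricting to \<open>T'\<close> only
  lowers the supremum of \<open>b\<close>, and smoothing raises it by at most
  \<open>\<epsilon>\<close>.\<close>

theorem sudakov_fernique:
  fixes a :: "'k \<Rightarrow> 'i \<Rightarrow> real" and b :: "'k \<Rightarrow> 'j \<Rightarrow> real"
  assumes I: "finite I" and J: "finite J" and T: "T \<noteq> {}" and R: "R \<ge> 0"
    and bda: "\<forall>k\<in>T. \<forall>i\<in>I. \<bar>a k i\<bar> \<le> R"
    and bdb: "\<forall>k\<in>T. \<forall>j\<in>J. \<bar>b k j\<bar> \<le> R"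
    and incr: "\<And>k l. k \<in> T \<Longrightarrow> l \<in> T \<Longrightarrow>
      (\<Sum>i\<in>I. (a k i - a l i)\<^sup>2) \<le> (\<Sum>j\<in>J. (b k j - b l j)\<^sup>2)"
  shows "(\<integral>\<omega>. lin_sup I a T \<omega> \<partial>gaussian I) \<le> (\<integral>\<omega>. lin_sup J b T \<omega> \<partial>gaussian J)"
proof (rule field_le_epsilon)
  fix e :: real assume e: "e > 0"
  interpret GJ: prob_space "gaussian J" by (rule prob_space_gaussian)
  have lg0: "0 \<le> lin_growth I \<omega>" for \<omega> :: "'i \<Rightarrow> real"
    by (rule order_trans[OF zero_le_one lin_growth_ge_1])
  have ilg: "integrable (gaussian I) (lin_growth I)"
    by (rule gaussian_integrable_linear[OF I, where C = 1]) (use lg0 in auto)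
  define E where "E = (\<integral>\<omega>. lin_growth I \<omega> \<partial>gaussian I)"
  have E0: "E \<ge> 0" unfolding E_def by (intro Bochner_Integration.integral_nonneg lg0)
  \<comment> \<open>The total error is \<open>\<epsilon> * E\<close> on the side of \<open>a\<close>
    plus \<open>\<epsilon>\<close> on the side of \<open>b\<close>.\<close>
  define \<epsilon> where "\<epsilon> = e / (1 + E)"
  have "\<epsilon> * (1 + E) = e" using E0 by (simp add: \<epsilon>_def)
  then have "\<epsilon> * E + \<epsilon> = e" by (simp only: distrib_left mult_1_right add.commute)
  moreover have "\<epsilon> > 0" using e E0 by (simp add: \<epsilon>_def)
  ultimately have \<epsilon>: "\<epsilon> > 0" "\<epsilon> * E + \<epsilon> = e" by auto
  obtain T' \<beta> where T': "finite T'" "T' \<noteq> {}" "T' \<subseteq> T" "\<beta> > 0" "ln (real (card T')) / \<beta> \<le> \<epsilon>"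
    and ap: "\<And>\<omega>. \<bar>softmax \<beta> T' (\<lambda>k. \<Sum>i\<in>I. a k i * \<omega> i) - lin_sup I a T \<omega>\<bar> \<le> \<epsilon> * lin_growth I \<omega>"
    by (rule lin_sup_softmax[of I T a R \<epsilon>, OF I bda R T \<epsilon>(1)]) (rule that)
  have ia: "integrable (gaussian I) (lin_sup I a T)" by (rule lin_sup_integrable[OF I bda R T])
  have ib: "integrable (gaussian J) (lin_sup J b T)" by (rule lin_sup_integrable[OF J bdb R T])
  have "(\<integral>\<omega>. lin_sup I a T \<omega> \<partial>gaussian I)
      \<le> (\<integral>\<omega>. softmax \<beta> T' (\<lambda>k. \<Sum>i\<in>I. a k i * \<omega> i) + \<epsilon> * lin_growth I \<omega> \<partial>gaussian I)"
  proof (intro integral_mono ia Bochner_Integration.integrable_add softmax_square_integrable(2)[OF I T'(1,2,4)] integrable_mult_right ilg)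
    show "lin_sup I a T \<omega> \<le> softmax \<beta> T' (\<lambda>k. \<Sum>i\<in>I. a k i * \<omega> i) + \<epsilon> * lin_growth I \<omega>" for \<omega>
      using ap[of \<omega>] by linarith
  qed
  also have "\<dots> = (\<integral>\<omega>. softmax \<beta> T' (\<lambda>k. \<Sum>i\<in>I. a k i * \<omega> i) \<partial>gaussian I) + \<epsilon> * E"
    using softmax_square_integrable(2)[OF I T'(1,2,4)] ilg by (simp add: E_def)
  also have "(\<integral>\<omega>. softmax \<beta> T' (\<lambda>k. \<Sum>i\<in>I. a k i * \<omega> i) \<partial>gaussian I)
      \<le> (\<integral>\<omega>. softmax \<beta> T' (\<lambda>k. \<Sum>j\<in>J. b k j * \<omega> j) \<partial>gaussian J)"
    using T'(3) by (intro softmax_comparison_sum[OF I J T'(1,2,4)] incr) auto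
  also have "\<dots> \<le> (\<integral>\<omega>. lin_sup J b T \<omega> + \<epsilon> \<partial>gaussian J)"
  proof (intro integral_mono softmax_square_integrable(2)[OF J T'(1,2,4)] Bochner_Integration.integrable_add ib)
    fix \<omega>
    have "softmax \<beta> T' (\<lambda>k. \<Sum>j\<in>J. b k j * \<omega> j) \<le> lin_sup J b T \<omega> + ln (real (card T')) / \<beta>"
      using T'(3) by (intro softmax_le T' lin_sup_upper[OF J bdb R]) auto
    then show "softmax \<beta> T' (\<lambda>k. \<Sum>j\<in>J. b k j * \<omega> j) \<le> lin_sup J b T \<omega> + \<epsilon>" using T'(5) by linarith
  qed simp
  also have "\<dots> = (\<integral>\<omega>. lin_sup J b T \<omega> \<partial>gaussian J) + \<epsilon>" using ib by (simp add: GJ.prob_space)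
  finally show "(\<integral>\<omega>. lin_sup I a T \<omega> \<partial>gaussian I) \<le> (\<integral>\<omega>. lin_sup J b T \<omega> \<partial>gaussian J) + e"
    using \<epsilon>(2) by linarith
qed

text \<open>The bound \<open>pi / 2\<close> for smoothed maxima survives the approximation up to a
  factor 2 and an error of at most 2, and 6 exceeds \<open>pi + 2\<close>. What matters later is
  that the constant depends neither on the dimension nor on the size of \<open>T\<close>.\<close>

theorem lin_sup_variance:
  fixes a :: "'k \<Rightarrow> 'i \<Rightarrow> real"
  assumes I: "finite I" and T: "T \<noteq> {}" and norm: "\<And>k. k \<in> T \<Longrightarrow> (\<Sum>i\<in>I. (a k i)\<^sup>2) \<le> 1"
  defines "\<mu> \<equiv> (\<integral>\<omega>. lin_sup I a T \<omega> \<partial>gaussian I)"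
  shows "(\<integral>\<omega>. (lin_sup I a T \<omega> - \<mu>)\<^sup>2 \<partial>gaussian I) \<le> 6"
proof -
  interpret G: prob_space "gaussian I" by (rule prob_space_gaussian)
  have bd: "\<forall>k\<in>T. \<forall>i\<in>I. \<bar>a k i\<bar> \<le> 1"
  proof (intro ballI)
    fix k i assume that: "k \<in> T" "i \<in> I"
    have "(a k i)\<^sup>2 \<le> (\<Sum>i\<in>I. (a k i)\<^sup>2)" by (rule member_le_sum[OF that(2)]) (use I in auto)
    then have "(a k i)\<^sup>2 \<le> 1" using norm[OF that(1)] by (rule order_trans)
    then show "\<bar>a k i\<bar> \<le> 1" by (simp add: abs_square_le_1)
  qed
  define V where "V = (\<integral>\<omega>. (lin_growth I \<omega>)\<^sup>2 \<partial>gaussian I)"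
  have ilg: "integrable (gaussian I) (\<lambda>\<omega>. (lin_growth I \<omega>)\<^sup>2)" by (rule lin_growth_square_integrable[OF I])
  have V1: "V \<ge> 1"
  proof -
    have "(\<integral>\<omega>. 1 \<partial>gaussian I) \<le> V" unfolding V_def
      using lin_growth_ge_1[of I] by (intro integral_mono ilg) auto
    then show ?thesis by (simp add: G.prob_space)
  qed
  \<comment> \<open>With accuracy \<open>1 / V\<close> the squared approximation error has mean at
    most \<open>1 / V\<close>, hence at most 1.\<close>
  have ep: "1 / V > 0" using V1 by simp
  obtain T' \<beta> where T': "finite T'" "T' \<noteq> {}" "T' \<subseteq> T" "\<beta> > 0"
    and ap: "\<And>\<omega>. \<bar>softmax \<beta> T' (\<lambda>k. \<Sum>i\<in>I. a k i * \<omega> i) - lin_sup I a T \<omega>\<bar> \<le> (1 / V) * lin_growth I \<omega>"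
    by (rule lin_sup_softmax[of I T a 1 "1 / V", OF I bd zero_le_one T ep]) (rule that)
  define h where "h \<omega> = softmax \<beta> T' (\<lambda>k. \<Sum>i\<in>I. a k i * \<omega> i)" for \<omega>
  define s where "s = lin_sup I a T"
  define \<nu> where "\<nu> = (\<integral>\<omega>. h \<omega> \<partial>gaussian I)"
  have ih: "integrable (gaussian I) h" "integrable (gaussian I) (\<lambda>\<omega>. (h \<omega>)\<^sup>2)"
    unfolding h_def[abs_def] by (rule softmax_square_integrable[OF I T'(1,2,4)])+
  have si: "integrable (gaussian I) s" "integrable (gaussian I) (\<lambda>\<omega>. (s \<omega>)\<^sup>2)"
    unfolding s_def using lin_sup_integrable[OF I bd zero_le_one T] lin_sup_square_integrable[OF I bd zero_le_one T] by auto
  have varh: "(\<integral>\<omega>. (h \<omega>)\<^sup>2 \<partial>gaussian I) - \<nu>\<^sup>2 \<le> pi / 2"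
  proof -
    \<comment> \<open>\<open>softmax_variance\<close> takes a coefficient bound over all indices, so
      the coefficients are cut off outside \<open>T\<close> and \<open>I\<close>.\<close>
    define a' where "a' k i = (if k \<in> T \<and> i \<in> I then a k i else 0)" for k i
    have h': "h \<omega> = softmax \<beta> T' (\<lambda>k. \<Sum>i\<in>I. a' k i * \<omega> i)" for \<omega>
      unfolding h_def softmax_def a'_def using T'(3) by (simp cong: sum.cong add: subset_iff)
    show ?thesis unfolding \<nu>_def h'
      by (rule softmax_variance[OF I T'(1,2,4), where M = 1])
        (use bd norm T'(3) in \<open>auto simp: a'_def subset_iff\<close>)
  qed
  have ih2: "integrable (gaussian I) (\<lambda>\<omega>. (h \<omega> - \<nu>)\<^sup>2)"
    using ih by (simp add: power2_diff)
  have si2: "integrable (gaussian I) (\<lambda>\<omega>. (s \<omega> - c)\<^sup>2)" for c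
    using si by (simp add: power2_diff)
  have Es: "(\<integral>\<omega>. (s \<omega> - c)\<^sup>2 \<partial>gaussian I) = (\<integral>\<omega>. (s \<omega>)\<^sup>2 \<partial>gaussian I) - 2 * \<mu> * c + c\<^sup>2" for c
    using si by (simp add: power2_diff G.prob_space \<mu>_def s_def algebra_simps)
  \<comment> \<open>The mean minimises the mean squared deviation, so \<open>\<mu>\<close> may be
    replaced by the mean \<open>\<nu>\<close> of the approximation.\<close>
  have "(\<integral>\<omega>. (s \<omega> - \<mu>)\<^sup>2 \<partial>gaussian I) \<le> (\<integral>\<omega>. (s \<omega> - \<nu>)\<^sup>2 \<partial>gaussian I)"
    unfolding Es using sum_squares_bound[of \<mu> \<nu>] by (simp add: power2_eq_square)
  also have "\<dots> \<le> (\<integral>\<omega>. 2 * (h \<omega> - \<nu>)\<^sup>2 + 2 * (1 / V)\<^sup>2 * (lin_growth I \<omega>)\<^sup>2 \<partial>gaussian I)"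
  proof (intro integral_mono si2 Bochner_Integration.integrable_add integrable_mult_right ih2 ilg)
    fix \<omega>
    have "(s \<omega> - \<nu>)\<^sup>2 = ((h \<omega> - \<nu>) + (s \<omega> - h \<omega>))\<^sup>2" by simp
    also have "\<dots> \<le> 2 * (h \<omega> - \<nu>)\<^sup>2 + 2 * (s \<omega> - h \<omega>)\<^sup>2"
      using sum_squares_bound[of "h \<omega> - \<nu>" "s \<omega> - h \<omega>"] unfolding power2_sum by linarith
    also have "(s \<omega> - h \<omega>)\<^sup>2 \<le> ((1 / V) * lin_growth I \<omega>)\<^sup>2"
      using power_mono[OF ap[of \<omega>] abs_ge_zero, of 2] unfolding h_def s_def
      by (simp only: power2_abs power2_commute)
    finally show "(s \<omega> - \<nu>)\<^sup>2 \<le> 2 * (h \<omega> - \<nu>)\<^sup>2 + 2 * (1 / V)\<^sup>2 * (lin_growth I \<omega>)\<^sup>2"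
      by (simp only: power_mult_distrib mult.assoc mult_left_mono add_left_mono)
  qed
  also have "\<dots> = 2 * (\<integral>\<omega>. (h \<omega> - \<nu>)\<^sup>2 \<partial>gaussian I) + 2 * (1 / V)\<^sup>2 * V"
    using ih2 ilg by (simp add: V_def)
  also have "(\<integral>\<omega>. (h \<omega> - \<nu>)\<^sup>2 \<partial>gaussian I) = (\<integral>\<omega>. (h \<omega>)\<^sup>2 \<partial>gaussian I) - \<nu>\<^sup>2"
    using ih by (simp add: power2_diff G.prob_space \<nu>_def[symmetric]) (simp add: power2_eq_square)
  also have "2 * (1 / V)\<^sup>2 * V = 2 / V" using V1 by (simp add: power2_eq_square)
  finally have "(\<integral>\<omega>. (s \<omega> - \<mu>)\<^sup>2 \<partial>gaussian I) \<le> 2 * ((\<integral>\<omega>. (h \<omega>)\<^sup>2 \<partial>gaussian I) - \<nu>\<^sup>2) + 2 / V" .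
  moreover have "2 / V \<le> 2" using V1 by (simp add: divide_le_eq)
  moreover have "2 * ((\<integral>\<omega>. (h \<omega>)\<^sup>2 \<partial>gaussian I) - \<nu>\<^sup>2) \<le> pi" using varh by simp
  ultimately have "(\<integral>\<omega>. (s \<omega> - \<mu>)\<^sup>2 \<partial>gaussian I) \<le> pi + 2" by (meson add_mono order_trans)
  then show ?thesis using pi_less_4 unfolding s_def by simp
qed

section \<open>Rank and Ky Fan norms\<close>

lemma mat_mult_entry:
  fixes A B :: "real mat"
  assumes "A \<in> carrier_mat m k" "B \<in> carrier_mat k n" "i < m" "j < n"
  shows "(A * B) $$ (i, j) = (\<Sum>l<k. A $$ (i, l) * B $$ (l, j))"
  using assms by (auto simp: scalar_prod_def lessThan_atLeast0 intro!: sum.cong)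

section \<open>Rank through factorisations\<close>

text \<open>\<open>P\<close> collects a maximal independent set of columns of \<open>W\<close>, and
  \<open>Q\<close> holds the coordinates of all columns with respect to it. Rank bounds for products
  are then read off from inner dimensions.\<close>

lemma rank_factorization:
  assumes W: "W \<in> carrier_mat m n"
  obtains P Q where "P \<in> carrier_mat m (mat_rank W)" "Q \<in> carrier_mat (mat_rank W) n" "W = P * Q"
proof -
  interpret vec_space "TYPE(real)" m .
  have cW: "set (cols W) \<subseteq> carrier_vec m" using W cols_dim by blast
  obtain U where U: "finite U" "maximal U (\<lambda>T. T \<subseteq> set (cols W) \<and> lin_indpt T)"
    using maximal_exists_superset[of "set (cols W)" "\<lambda>T. T \<subseteq> set (cols W) \<and> lin_indpt T" "{}"]
    by (auto simp: finite_lin_indpt2)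
  have U': "U \<subseteq> set (cols W)" "lin_indpt U" using U(2) unfolding maximal_def by auto
  have Uc: "U \<subseteq> carrier_vec m" using U' cW by auto
  obtain us where us: "set us = U" "distinct us" using finite_distinct_list[OF U(1)] by blast
  have len: "length us = mat_rank W"
    using rank_card_indpt[OF W U(2)] us distinct_card[of us] W by (simp add: mat_rank_def)
  define P where "P = mat_of_cols m us"
  have P: "P \<in> carrier_mat m (mat_rank W)" using len by (metis P_def mat_of_cols_carrier(1))
  have cP: "cols P = us" unfolding P_def using us Uc by (intro cols_mat_of_cols) auto
  have "\<exists>a. lincomb a U = col W j" if "j < n" for j
  proof -
    have cj: "col W j \<in> set (cols W)" using that W by (auto simp: cols_def)
    have "col W j \<in> span U"
    proof (cases "col W j \<in> U")
      case True then show ?thesis using in_own_span[OF Uc] by auto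
    next
      case False
      have "\<not> lin_indpt (U \<union> {col W j})"
      proof
        assume "lin_indpt (U \<union> {col W j})"
        then have "U = U \<union> {col W j}" using U(2) U' cj unfolding maximal_def by auto
        then show False using False by auto
      qed
      then show ?thesis using lin_dep_iff_in_span[OF Uc U'(2) _ False] cj cW by auto
    qed
    then show ?thesis using finite_in_span[OF U(1) Uc] by auto
  qed
  then obtain a where a: "\<And>j. j < n \<Longrightarrow> lincomb (a j) U = col W j" by metis
  define Q where "Q = mat (mat_rank W) n (\<lambda>(i, j). a j (col P i))"
  have Q: "Q \<in> carrier_mat (mat_rank W) n" unfolding Q_def by simp
  have "W = P * Q"
  proof (rule mat_col_eqI)
    fix j assume "j < dim_col (P * Q)"
    then have j: "j < n" using Q by simp
    have "col (P * Q) j = P *\<^sub>v col Q j" by (rule col_mult2[OF P Q j])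
    also have "col Q j = vec (mat_rank W) (\<lambda>i. a j (col P i))"
      using j unfolding Q_def by (intro eq_vecI) auto
    also have "P *\<^sub>v \<dots> = lincomb (a j) (set (cols P))"
      by (rule mat_mult_eq_lincomb[OF P]) (simp add: cP us)
    finally show "col W j = col (P * Q) j" using a[OF j] cP us by simp
  qed (use W P Q in auto)
  then show ?thesis using that P Q by blast
qed

text \<open>Padding \<open>Q\<close> with zero rows to a square matrix makes the determinant vanish,
  because the transpose kills a unit vector.\<close>

lemma wide_mat_kernel:
  fixes Q :: "real mat"
  assumes Q: "Q \<in> carrier_mat s r" and "s < r"
  obtains v where "v \<in> carrier_vec r" "v \<noteq> 0\<^sub>v r" "Q *\<^sub>v v = 0\<^sub>v s"
proof -
  define R where "R = mat r r (\<lambda>(i, j). if i < s then Q $$ (i, j) else 0)"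
  have R: "R \<in> carrier_mat r r" unfolding R_def by simp
  have "transpose_mat R *\<^sub>v unit_vec r s = 0\<^sub>v r"
    using \<open>s < r\<close> unfolding R_def by (intro eq_vecI) (auto simp: scalar_prod_right_unit)
  then have "det (transpose_mat R) = 0"
    using det_0_iff_vec_prod_zero_field[of "transpose_mat R" r] R \<open>s < r\<close> unit_vec_nonzero[OF \<open>s < r\<close>]
    by (metis transpose_carrier_mat unit_vec_carrier)
  then have "det R = 0" using det_transpose[OF R] by simp
  then obtain v where v: "v \<in> carrier_vec r" "v \<noteq> 0\<^sub>v r" "R *\<^sub>v v = 0\<^sub>v r"
    using det_0_iff_vec_prod_zero_field[OF R] by blast
  have "Q *\<^sub>v v = 0\<^sub>v s"
  proof (rule eq_vecI)
    fix i assume "i < dim_vec (0\<^sub>v s)"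
    then have i: "i < s" by simp
    then have "row Q i = row R i" using Q \<open>s < r\<close> unfolding R_def by (intro eq_vecI) auto
    moreover have "(R *\<^sub>v v) $ i = 0" using v(3) i \<open>s < r\<close> by simp
    ultimately show "(Q *\<^sub>v v) $ i = 0\<^sub>v s $ i" using Q R i \<open>s < r\<close> by simp
  qed (use Q in auto)
  then show ?thesis using that v by blast
qed

text \<open>Otherwise more than \<open>s\<close> independent columns of \<open>P * Q\<close> would
  have coordinates in \<open>s\<close> dimensions, and a kernel vector of that wide coordinate
  matrix would be a linear dependence among them.\<close>

lemma mat_rank_mult_inner:
  fixes P Q :: "real mat"
  assumes P: "P \<in> carrier_mat m s" and Q: "Q \<in> carrier_mat s n"
  shows "mat_rank (P * Q) \<le> s"
proof (rule ccontr)
  assume "\<not> mat_rank (P * Q) \<le> s"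
  then have gt: "s < mat_rank (P * Q)" by simp
  interpret vec_space "TYPE(real)" m .
  have W: "P * Q \<in> carrier_mat m n" using P Q by simp
  have cW: "set (cols (P * Q)) \<subseteq> carrier_vec m" using W cols_dim by blast
  obtain U where U: "finite U" "maximal U (\<lambda>T. T \<subseteq> set (cols (P * Q)) \<and> lin_indpt T)"
    using maximal_exists_superset[of "set (cols (P * Q))" "\<lambda>T. T \<subseteq> set (cols (P * Q)) \<and> lin_indpt T" "{}"]
    by (auto simp: finite_lin_indpt2)
  have U': "U \<subseteq> set (cols (P * Q))" "lin_indpt U" using U(2) unfolding maximal_def by auto
  obtain us where us: "set us = U" "distinct us" using finite_distinct_list[OF U(1)] by blast
  define r where "r = length us"
  have r: "r = mat_rank (P * Q)"
    using rank_card_indpt[OF W U(2)] us distinct_card[of us] P by (simp add: r_def mat_rank_def)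
  have Uc: "set us \<subseteq> carrier_vec m" using us U' cW by auto
  define A where "A = mat_of_cols m us"
  have A: "A \<in> carrier_mat m r" by (metis A_def r_def mat_of_cols_carrier(1))
  have cA: "cols A = us" unfolding A_def using Uc by (intro cols_mat_of_cols) auto
  have "\<exists>j<n. us ! i = col (P * Q) j" if "i < r" for i
  proof -
    have "us ! i \<in> set (cols (P * Q))" using that us U' unfolding r_def by (metis nth_mem subsetD)
    then show ?thesis using W Q by (auto simp: cols_def)
  qed
  then obtain f where f: "\<And>i. i < r \<Longrightarrow> f i < n \<and> us ! i = col (P * Q) (f i)" by metis
  define R where "R = mat s r (\<lambda>(i, j). Q $$ (i, f j))"
  have R: "R \<in> carrier_mat s r" unfolding R_def by simp
  have AR: "A = P * R"
  proof (rule mat_col_eqI)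
    fix j assume "j < dim_col (P * R)"
    then have j: "j < r" using R by simp
    have "col R j = col Q (f j)" using j f[OF j] Q unfolding R_def by (intro eq_vecI) auto
    moreover have "col A j = us ! j" using j A Uc unfolding A_def r_def by (intro col_mat_of_cols) auto
    ultimately show "col A j = col (P * R) j"
      using f[OF j] col_mult2[OF P R j] col_mult2[OF P Q, of "f j"] by simp
  qed (use A P R in auto)
  obtain v where v: "v \<in> carrier_vec r" "v \<noteq> 0\<^sub>v r" "R *\<^sub>v v = 0\<^sub>v s"
    using wide_mat_kernel[OF R] gt r by blast
  have "A *\<^sub>v v = P *\<^sub>v (R *\<^sub>v v)" unfolding AR using P R v by (intro assoc_mult_mat_vec) auto
  also have "\<dots> = 0\<^sub>v m" using v P by (intro eq_vecI) auto
  finally have "A *\<^sub>v v = 0\<^sub>v m" .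
  from lin_depI[OF A v(1,2) this] have "lin_dep (set (cols A))" using cA us by simp
  then show False using cA us U' by simp
qed

lemma mat_rank_mult_left:
  assumes A: "A \<in> carrier_mat m k" and B: "B \<in> carrier_mat k n"
  shows "mat_rank (A * B) \<le> mat_rank B"
proof -
  obtain P Q where PQ: "P \<in> carrier_mat k (mat_rank B)" "Q \<in> carrier_mat (mat_rank B) n" "B = P * Q"
    by (rule rank_factorization[OF B])
  have eq: "A * B = (A * P) * Q" by (subst PQ(3)) (rule assoc_mult_mat[OF A PQ(1,2), symmetric])
  show ?thesis unfolding eq by (rule mat_rank_mult_inner[OF mult_carrier_mat[OF A PQ(1)] PQ(2)])
qed

lemma mat_rank_mult_right:
  assumes A: "A \<in> carrier_mat m k" and B: "B \<in> carrier_mat k n"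
  shows "mat_rank (A * B) \<le> mat_rank A"
proof -
  obtain P Q where PQ: "P \<in> carrier_mat m (mat_rank A)" "Q \<in> carrier_mat (mat_rank A) k" "A = P * Q"
    by (rule rank_factorization[OF A])
  have eq: "A * B = P * (Q * B)" by (subst PQ(3)) (rule assoc_mult_mat[OF PQ(1,2) B])
  show ?thesis unfolding eq by (rule mat_rank_mult_inner[OF PQ(1) mult_carrier_mat[OF PQ(2) B]])
qed

text \<open>Scaling is left multiplication by a scalar matrix. It is only an inequality because
  \<open>c\<close> may be 0.\<close>

lemma mat_rank_smult:
  assumes "A \<in> carrier_mat m k"
  shows "mat_rank (c \<cdot>\<^sub>m A) \<le> mat_rank A"
proof -
  have "(c \<cdot>\<^sub>m 1\<^sub>m m) * A = c \<cdot>\<^sub>m A"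
    using mult_smult_assoc_mat[OF one_carrier_mat assms, of c] left_mult_one_mat[OF assms] by simp
  then show ?thesis
    using mat_rank_mult_left[of "c \<cdot>\<^sub>m 1\<^sub>m m" m m A k] assms by simp
qed

section \<open>The Frobenius inner product\<close>

definition mat_inner :: "real mat \<Rightarrow> real mat \<Rightarrow> real" where
  "mat_inner A B = (\<Sum>i<dim_row A. \<Sum>j<dim_col A. A $$ (i, j) * B $$ (i, j))"

lemma mat_inner_eq:
  "A \<in> carrier_mat m n \<Longrightarrow> mat_inner A B = (\<Sum>x\<in>{..<m} \<times> {..<n}. A $$ x * B $$ x)"
  unfolding mat_inner_def sum.cartesian_product by (intro sum.cong) auto

lemma frob_norm_power2: "(frob_norm A)\<^sup>2 = mat_inner A A"
proof -
  have "(frob_norm A)\<^sup>2 = (\<Sum>i<dim_row A. \<Sum>j<dim_col A. (A $$ (i, j))\<^sup>2)"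
    unfolding frob_norm_def by (intro real_sqrt_pow2 sum_nonneg) auto
  then show ?thesis unfolding mat_inner_def power2_eq_square[of "_ $$ _"] .
qed

lemma frob_norm_nonneg [simp]: "frob_norm A \<ge> 0"
  unfolding frob_norm_def by (intro real_sqrt_ge_zero sum_nonneg) auto

lemma mat_inner_commute:
  assumes "A \<in> carrier_mat m n" "B \<in> carrier_mat m n"
  shows "mat_inner A B = mat_inner B A"
  unfolding mat_inner_eq[OF assms(1)] mat_inner_eq[OF assms(2)] by (simp add: mult.commute)

lemma mat_inner_add_left:
  assumes "A \<in> carrier_mat m n" "B \<in> carrier_mat m n"
  shows "mat_inner (A + B) C = mat_inner A C + mat_inner B C"
proof -
  have c: "A + B \<in> carrier_mat m n" using assms by (auto simp: minus_carrier_mat)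
  show ?thesis
    unfolding mat_inner_eq[OF c] mat_inner_eq[OF assms(1)] mat_inner_eq[OF assms(2)] sum.distrib[symmetric]
    using assms by (intro sum.cong) (auto simp: algebra_simps)
qed

lemma mat_inner_diff_left:
  assumes "A \<in> carrier_mat m n" "B \<in> carrier_mat m n"
  shows "mat_inner (A - B) C = mat_inner A C - mat_inner B C"
proof -
  have c: "A - B \<in> carrier_mat m n" using assms by (auto simp: minus_carrier_mat)
  show ?thesis
    unfolding mat_inner_eq[OF c] mat_inner_eq[OF assms(1)] mat_inner_eq[OF assms(2)] sum_subtractf[symmetric]
    using assms by (intro sum.cong) (auto simp: algebra_simps)
qed

lemma mat_inner_smult_left:
  assumes "A \<in> carrier_mat m n"
  shows "mat_inner (c \<cdot>\<^sub>m A) C = c * mat_inner A C"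
proof -
  have c: "c \<cdot>\<^sub>m A \<in> carrier_mat m n" using assms by (auto simp: minus_carrier_mat)
  show ?thesis
    unfolding mat_inner_eq[OF c] mat_inner_eq[OF assms(1)] sum_distrib_left
    using assms by (intro sum.cong) (auto simp: algebra_simps)
qed

lemma mat_inner_add_right:
  assumes "A \<in> carrier_mat m n" "B \<in> carrier_mat m n" "C \<in> carrier_mat m n"
  shows "mat_inner A (B + C) = mat_inner A B + mat_inner A C"
proof -
  have c: "B + C \<in> carrier_mat m n" using assms by (auto simp: minus_carrier_mat)
  show ?thesis
    unfolding mat_inner_eq[OF c] mat_inner_eq[OF assms(1)] sum.distrib[symmetric]
    using assms by (intro sum.cong) (auto simp: algebra_simps)
qed

lemma mat_inner_diff_right:
  assumes "A \<in> carrier_mat m n" "B \<in> carrier_mat m n" "C \<in> carrier_mat m n"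
  shows "mat_inner A (B - C) = mat_inner A B - mat_inner A C"
proof -
  have c: "B - C \<in> carrier_mat m n" using assms by (auto simp: minus_carrier_mat)
  show ?thesis
    unfolding mat_inner_eq[OF c] mat_inner_eq[OF assms(1)] sum_subtractf[symmetric]
    using assms by (intro sum.cong) (auto simp: algebra_simps)
qed

lemma mat_inner_smult_right:
  assumes "A \<in> carrier_mat m n" "B \<in> carrier_mat m n"
  shows "mat_inner A (c \<cdot>\<^sub>m B) = c * mat_inner A B"
proof -
  have c: "c \<cdot>\<^sub>m B \<in> carrier_mat m n" using assms by (auto simp: minus_carrier_mat)
  show ?thesis
    unfolding mat_inner_eq[OF c] mat_inner_eq[OF assms(1)] sum_distrib_left
    using assms by (intro sum.cong) (auto simp: algebra_simps)
qed

lemma mat_inner_abs_le: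
  assumes "A \<in> carrier_mat m n" "B \<in> carrier_mat m n"
  shows "\<bar>mat_inner A B\<bar> \<le> frob_norm A * frob_norm B"
proof -
  have "(mat_inner A B)\<^sup>2 \<le> mat_inner A A * mat_inner B B"
    using Cauchy_Schwarz_ineq_sum[of "\<lambda>x. A $$ x" "\<lambda>x. B $$ x" "{..<m} \<times> {..<n}"]
    unfolding mat_inner_eq[OF assms(1)] mat_inner_eq[OF assms(2)] power2_eq_square[of "_ $$ _"] .
  also have "\<dots> = (frob_norm A * frob_norm B)\<^sup>2" by (simp add: power_mult_distrib frob_norm_power2)
  finally show ?thesis
    using abs_le_square_iff[of "mat_inner A B" "frob_norm A * frob_norm B"] by simp
qed

lemma mat_inner_mult_left:
  assumes A: "A \<in> carrier_mat m k" and B: "B \<in> carrier_mat k n" and C: "C \<in> carrier_mat m n"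
  shows "mat_inner (A * B) C = mat_inner B (transpose_mat A * C)"
proof -
  have "mat_inner (A * B) C = (\<Sum>i<m. \<Sum>j<n. \<Sum>l<k. A $$ (i, l) * B $$ (l, j) * C $$ (i, j))"
    unfolding mat_inner_def using A B by (auto simp: mat_mult_entry[OF A B] sum_distrib_right simp del: index_mult_mat(1) intro!: sum.cong)
  also have "\<dots> = (\<Sum>i<m. \<Sum>l<k. \<Sum>j<n. A $$ (i, l) * B $$ (l, j) * C $$ (i, j))"
    by (intro sum.cong refl sum.swap)
  also have "\<dots> = (\<Sum>l<k. \<Sum>i<m. \<Sum>j<n. A $$ (i, l) * B $$ (l, j) * C $$ (i, j))" by (rule sum.swap)
  also have "\<dots> = (\<Sum>l<k. \<Sum>j<n. \<Sum>i<m. A $$ (i, l) * B $$ (l, j) * C $$ (i, j))"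
    by (intro sum.cong refl sum.swap)
  also have "\<dots> = mat_inner B (transpose_mat A * C)"
    unfolding mat_inner_def using A B C
    by (auto simp: mat_mult_entry[of "transpose_mat A" k m C n] sum_distrib_left simp del: index_mult_mat(1) intro!: sum.cong)
  finally show ?thesis .
qed

lemma mat_inner_mult_right:
  assumes A: "A \<in> carrier_mat m k" and B: "B \<in> carrier_mat k n" and C: "C \<in> carrier_mat m n"
  shows "mat_inner (A * B) C = mat_inner A (C * transpose_mat B)"
proof -
  have "mat_inner (A * B) C = (\<Sum>i<m. \<Sum>j<n. \<Sum>l<k. A $$ (i, l) * B $$ (l, j) * C $$ (i, j))"
    unfolding mat_inner_def using A B by (auto simp: mat_mult_entry[OF A B] sum_distrib_right simp del: index_mult_mat(1) intro!: sum.cong)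
  also have "\<dots> = (\<Sum>i<m. \<Sum>l<k. \<Sum>j<n. A $$ (i, l) * B $$ (l, j) * C $$ (i, j))"
    by (intro sum.cong refl sum.swap)
  also have "\<dots> = mat_inner A (C * transpose_mat B)"
    unfolding mat_inner_def using A B C
    by (auto simp: mat_mult_entry[of C m n "transpose_mat B" k] sum_distrib_left simp del: index_mult_mat(1) intro!: sum.cong)
  finally show ?thesis .
qed

unbundle no inner_syntax

section \<open>Spectral theorem and singular values\<close>

definition diag_matrix :: "nat \<Rightarrow> (nat \<Rightarrow> real) \<Rightarrow> real mat" where
  "diag_matrix n d = mat n n (\<lambda>(i, j). if i = j then d i else 0)"

lemma diag_matrix_carrier [simp]: "diag_matrix n d \<in> carrier_mat n n"
  "dim_row (diag_matrix n d) = n" "dim_col (diag_matrix n d) = n"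
  by (simp_all add: diag_matrix_def)

lemma symmetric_mat_scalar_prod:
  fixes A :: "real mat"
  assumes A: "A \<in> carrier_mat n n" "transpose_mat A = A" and v: "v \<in> carrier_vec n" "w \<in> carrier_vec n"
  shows "(A *\<^sub>v v) \<bullet> w = v \<bullet> (A *\<^sub>v w)"
  using transpose_vec_mult_scalar[OF A(1) v(2,1)] A comm_scalar_prod[of w n "A *\<^sub>v v"] v
    comm_scalar_prod[of "A *\<^sub>v w" n v]
  by simp

lemma scalar_prod_self_nonneg: "(w :: real vec) \<bullet> w \<ge> 0"
  by (auto simp: scalar_prod_def intro!: sum_nonneg)

lemma scalar_prod_self_pos:
  fixes w :: "real vec"
  assumes w: "w \<in> carrier_vec n" "w \<noteq> 0\<^sub>v n"
  shows "w \<bullet> w > 0"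
proof -
  obtain i where i: "i < n" "w $ i \<noteq> 0" using w by (metis carrier_vecD eq_vecI index_zero_vec)
  have "w $ i * w $ i \<le> (\<Sum>i\<in>{0..<n}. w $ i * w $ i)"
    by (rule member_le_sum[where f = "\<lambda>i. w $ i * w $ i"]) (use i in auto)
  then show ?thesis using i w by (metis carrier_vecD not_square_less_zero order_less_le_trans scalar_prod_def linorder_neqE_linordered_idom mult_eq_0_iff)
qed

text \<open>Over the complex numbers an eigenvector \<open>z\<close> exists. Testing symmetry on its
  real part \<open>x\<close> and imaginary part \<open>y\<close> gives
  \<open>Im l * (x \<bullet> x + y \<bullet> y) = 0\<close>, so the eigenvalue is real and whichever
  of \<open>x\<close>, \<open>y\<close> is nonzero is a real eigenvector.\<close>

lemma symmetric_mat_has_eigenvector: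
  fixes A :: "real mat"
  assumes A: "A \<in> carrier_mat n n" "transpose_mat A = A" and n: "n > 0"
  obtains a v where "v \<in> carrier_vec n" "v \<bullet> v = 1" "A *\<^sub>v v = a \<cdot>\<^sub>v v"
proof -
  let ?A = "map_mat complex_of_real A"
  have cA: "?A \<in> carrier_mat n n" using A by simp
  obtain l where "eigenvalue ?A l" using spectrum_non_empty[OF cA n] unfolding spectrum_def by auto
  then obtain z where z: "z \<in> carrier_vec n" "z \<noteq> 0\<^sub>v n" "?A *\<^sub>v z = l \<cdot>\<^sub>v z"
    using cA unfolding eigenvalue_def eigenvector_def by auto
  define x where "x = map_vec Re z"
  define y where "y = map_vec Im z"
  have xy: "x \<in> carrier_vec n" "y \<in> carrier_vec n" using z by (auto simp: x_def y_def)
  have ent: "(?A *\<^sub>v z) $ i = l * z $ i" if "i < n" for i using z that by simp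
  have re: "Re ((?A *\<^sub>v z) $ i) = (A *\<^sub>v x) $ i" if "i < n" for i
    using that A(1) z(1) by (auto simp: scalar_prod_def x_def)
  have im: "Im ((?A *\<^sub>v z) $ i) = (A *\<^sub>v y) $ i" if "i < n" for i
    using that A(1) z(1) by (auto simp: scalar_prod_def y_def)
  have Ax: "A *\<^sub>v x = Re l \<cdot>\<^sub>v x - Im l \<cdot>\<^sub>v y"
  proof (rule eq_vecI)
    fix i assume "i < dim_vec (Re l \<cdot>\<^sub>v x - Im l \<cdot>\<^sub>v y)"
    then have i: "i < n" using xy by simp
    show "(A *\<^sub>v x) $ i = (Re l \<cdot>\<^sub>v x - Im l \<cdot>\<^sub>v y) $ i"
      using re[OF i] ent[OF i] i xy z by (simp add: x_def y_def)
  qed (use A xy in auto)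
  have Ay: "A *\<^sub>v y = Re l \<cdot>\<^sub>v y + Im l \<cdot>\<^sub>v x"
  proof (rule eq_vecI)
    fix i assume "i < dim_vec (Re l \<cdot>\<^sub>v y + Im l \<cdot>\<^sub>v x)"
    then have i: "i < n" using xy by simp
    show "(A *\<^sub>v y) $ i = (Re l \<cdot>\<^sub>v y + Im l \<cdot>\<^sub>v x) $ i"
      using im[OF i] ent[OF i] i xy z by (simp add: x_def y_def)
  qed (use A xy in auto)
  have "(A *\<^sub>v x) \<bullet> y = x \<bullet> (A *\<^sub>v y)" by (rule symmetric_mat_scalar_prod[OF A xy])
  then have "Re l * (x \<bullet> y) - Im l * (y \<bullet> y) = Re l * (x \<bullet> y) + Im l * (x \<bullet> x)"
    unfolding Ax Ay using xy
    by (simp add: minus_scalar_prod_distrib[of _ n] scalar_prod_add_distrib[of _ n])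
  then have b: "Im l * (x \<bullet> x + y \<bullet> y) = 0" by (simp add: algebra_simps)
  have nz: "x \<noteq> 0\<^sub>v n \<or> y \<noteq> 0\<^sub>v n"
  proof (rule ccontr)
    assume "\<not> (x \<noteq> 0\<^sub>v n \<or> y \<noteq> 0\<^sub>v n)"
    then have eq: "x = 0\<^sub>v n" "y = 0\<^sub>v n" by auto
    have "z = 0\<^sub>v n"
    proof (rule eq_vecI)
      fix i assume "i < dim_vec (0\<^sub>v n :: complex vec)"
      then have i: "i < n" by simp
      have "x $ i = 0" "y $ i = 0" using eq i by auto
      then show "z $ i = 0\<^sub>v n $ i" using i z by (simp add: x_def y_def complex_eq_iff)
    qed (use z in auto)
    then show False using z by simp
  qed
  note sp = scalar_prod_self_pos
  have l0: "Im l = 0"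
  proof -
    have "x \<bullet> x + y \<bullet> y > 0" using nz sp[OF xy(1)] sp[OF xy(2)] scalar_prod_self_nonneg[of x] scalar_prod_self_nonneg[of y]
      by (metis add_pos_nonneg add_nonneg_pos)
    then show ?thesis using b by simp
  qed
  obtain w where w: "w \<in> carrier_vec n" "w \<noteq> 0\<^sub>v n" "A *\<^sub>v w = Re l \<cdot>\<^sub>v w"
  proof (cases "x = 0\<^sub>v n")
    case False
    have "A *\<^sub>v x = Re l \<cdot>\<^sub>v x" unfolding Ax l0 using xy by (intro eq_vecI) auto
    then show ?thesis using that xy False by blast
  next
    case True
    have "A *\<^sub>v y = Re l \<cdot>\<^sub>v y" unfolding Ay l0 using xy by (intro eq_vecI) auto
    then show ?thesis using that xy True nz by blast
  qed
  let ?c = "1 / sqrt (w \<bullet> w)"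
  show ?thesis
  proof (rule that[of "?c \<cdot>\<^sub>v w" "Re l"])
    show "?c \<cdot>\<^sub>v w \<in> carrier_vec n" using w by simp
    have "(?c \<cdot>\<^sub>v w) \<bullet> (?c \<cdot>\<^sub>v w) = ?c * ?c * (w \<bullet> w)" using w by simp
    also have "\<dots> = 1" using sp[OF w(1,2)] by simp
    finally show "(?c \<cdot>\<^sub>v w) \<bullet> (?c \<cdot>\<^sub>v w) = 1" .
    show "A *\<^sub>v (?c \<cdot>\<^sub>v w) = Re l \<cdot>\<^sub>v (?c \<cdot>\<^sub>v w)"
      using mult_mat_vec[OF A(1) w(1), of ?c] w(3) by (simp add: smult_smult_assoc mult.commute)
  qed
qed

text \<open>The Householder reflection exchanging \<open>v\<close> and the first unit vector.\<close>

lemma orthogonal_mat_first_col: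
  fixes v :: "real vec"
  assumes v: "v \<in> carrier_vec n" "v \<bullet> v = 1" and n: "n > 0"
  obtains H where "H \<in> carrier_mat n n" "transpose_mat H = H" "H * H = 1\<^sub>m n" "H *\<^sub>v unit_vec n 0 = v"
proof (cases "v = unit_vec n 0")
  case True
  show ?thesis by (rule that[of "1\<^sub>m n"]) (use True v in auto)
next
  case False
  define w where "w i = v $ i - (if i = 0 then 1 else 0)" for i
  define S where "S = (\<Sum>i<n. (w i)\<^sup>2)"
  have vv: "(\<Sum>i<n. (v $ i)\<^sup>2) = 1"
    using v by (simp add: scalar_prod_def lessThan_atLeast0 power2_eq_square)
  \<comment> \<open>\<open>S\<close> is the squared distance of two unit vectors, \<open>v\<close>
    and the first coordinate vector.\<close>
  have S: "S = 2 - 2 * v $ 0"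
  proof -
    have "(w i)\<^sup>2 = (v $ i)\<^sup>2 + (if i = 0 then 1 - 2 * v $ 0 else 0)" for i
      unfolding w_def by (auto simp: power2_diff)
    then show ?thesis unfolding S_def using vv n by (simp add: sum.distrib)
  qed
  have S0: "S \<noteq> 0"
  proof
    assume "S = 0"
    then have "w i = 0" if "i < n" for i using that unfolding S_def by (simp add: sum_nonneg_eq_0_iff)
    then have "v = unit_vec n 0" using v unfolding w_def by (intro eq_vecI) (auto simp: unit_vec_def)
    then show False using False by simp
  qed
  define H where "H = mat n n (\<lambda>(i, j). (if i = j then 1 else 0) - 2 / S * w i * w j)"
  have H: "H \<in> carrier_mat n n" unfolding H_def by simp
  show ?thesis
  proof (rule that[of H])
    show "H \<in> carrier_mat n n" by fact
    show "transpose_mat H = H" unfolding H_def by (intro eq_matI) auto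
    show "H * H = 1\<^sub>m n"
    proof (rule eq_matI)
      fix i j assume "i < dim_row (1\<^sub>m n :: real mat)" "j < dim_col (1\<^sub>m n :: real mat)"
      then have ij: "i < n" "j < n" by auto
      let ?\<delta> = "\<lambda>i j. if i = j then 1 else (0::real)"
      have "(H * H) $$ (i, j) = (\<Sum>l<n. (?\<delta> i l - 2 / S * w i * w l) * (?\<delta> l j - 2 / S * w l * w j))"
        using ij unfolding H_def by (auto simp: scalar_prod_def lessThan_atLeast0 intro!: sum.cong)
      also have "\<dots> = (\<Sum>l<n. (if i = l then ?\<delta> l j else 0) - (if i = l then 2 / S * w l * w j else 0)
          - (if l = j then 2 / S * w i * w l else 0) + (2 / S)\<^sup>2 * w i * w j * (w l)\<^sup>2)"
        by (intro sum.cong) (auto simp: algebra_simps power2_eq_square)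
      also have "\<dots> = ?\<delta> i j - 2 / S * w i * w j - 2 / S * w i * w j + (2 / S)\<^sup>2 * w i * w j * S"
        using ij by (simp add: sum.distrib sum_subtractf S_def sum_distrib_left)
      also have "\<dots> = ?\<delta> i j" using S0 by (simp add: power2_eq_square)
      finally show "(H * H) $$ (i, j) = 1\<^sub>m n $$ (i, j)" using ij by simp
    qed (use H in auto)
    show "H *\<^sub>v unit_vec n 0 = v"
    proof (rule eq_vecI)
      fix i assume "i < dim_vec v"
      then have i: "i < n" using v by simp
      \<comment> \<open>\<open>w 0\<close> is \<open>v $ 0 - 1\<close>, which equals
        \<open>- S / 2\<close>.\<close>
      have "2 / S * w 0 = - 1" using S0 S unfolding w_def by (simp add: field_simps)
      then have "2 / S * w i * w 0 = - w i" by (metis mult.commute mult.left_commute mult_minus1)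
      then have "(if i = 0 then 1 else 0) - 2 / S * w i * w 0 = v $ i" by (simp add: w_def)
      then show "(H *\<^sub>v unit_vec n 0) $ i = v $ i"
        using i n by (simp add: H_def)
    qed (use H v in auto)
  qed
qed

lemma orthogonal_mat_right_inverse:
  fixes H :: "real mat"
  assumes "H \<in> carrier_mat n n" "transpose_mat H * H = 1\<^sub>m n"
  shows "H * transpose_mat H = 1\<^sub>m n"
  using mat_mult_left_right_inverse[of "transpose_mat H" n H] assms by simp

text \<open>Induction on the size: a reflection moves a unit eigenvector to the first axis, symmetry
  clears the first row together with the first column, and the remaining block falls to the
  induction hypothesis.\<close>

theorem symmetric_mat_spectral:
  fixes A :: "real mat"
  assumes "A \<in> carrier_mat n n" "transpose_mat A = A"
  shows "\<exists>H d. H \<in> carrier_mat n n \<and> transpose_mat H * H = 1\<^sub>m n \<and> transpose_mat H * A * H = diag_matrix n d"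
  using assms
proof (induction n arbitrary: A)
  case 0
  then show ?case
    by (intro exI[of _ "1\<^sub>m 0"] exI[of _ "\<lambda>_. 0"]) (auto intro!: eq_matI)
next
  case (Suc n A)
  note A = Suc.prems
  obtain a v where v: "v \<in> carrier_vec (Suc n)" "v \<bullet> v = 1" "A *\<^sub>v v = a \<cdot>\<^sub>v v"
    by (rule symmetric_mat_has_eigenvector[OF A]) auto
  obtain H where H: "H \<in> carrier_mat (Suc n) (Suc n)" "transpose_mat H = H" "H * H = 1\<^sub>m (Suc n)"
      "H *\<^sub>v unit_vec (Suc n) 0 = v"
    by (rule orthogonal_mat_first_col[OF v(1,2)]) auto
  define B where "B = H * A * H"
  have B: "B \<in> carrier_mat (Suc n) (Suc n)" using H A by (simp add: B_def)
  have Bt: "transpose_mat B = B"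
    unfolding B_def using H(1,2) A by (simp add: transpose_mult[of _ "Suc n" "Suc n" _ "Suc n"] assoc_mult_mat[of _ "Suc n" "Suc n" _ "Suc n" _ "Suc n"])
  have "B *\<^sub>v unit_vec (Suc n) 0 = H *\<^sub>v (A *\<^sub>v (H *\<^sub>v unit_vec (Suc n) 0))"
    unfolding B_def using H A by (simp add: assoc_mult_mat_vec[of _ "Suc n" "Suc n" _ "Suc n"])
  also have "\<dots> = a \<cdot>\<^sub>v (H *\<^sub>v (H *\<^sub>v unit_vec (Suc n) 0))"
    unfolding H(4) v(3) using mult_mat_vec[OF H(1) v(1), of a] by simp
  also have "H *\<^sub>v (H *\<^sub>v unit_vec (Suc n) 0) = (H * H) *\<^sub>v unit_vec (Suc n) 0"
    using assoc_mult_mat_vec[OF H(1) H(1), of "unit_vec (Suc n) 0"] by simp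
  also have "\<dots> = unit_vec (Suc n) 0" unfolding H(3) by simp
  finally have Be: "B *\<^sub>v unit_vec (Suc n) 0 = a \<cdot>\<^sub>v unit_vec (Suc n) 0" .
  have B0: "B $$ (i, 0) = (if i = 0 then a else 0)" if "i < Suc n" for i
  proof -
    have "(B *\<^sub>v unit_vec (Suc n) 0) $ i = B $$ (i, 0)" using B that by simp
    then show ?thesis unfolding Be using that by (cases "i = 0") auto
  qed
  have B0': "B $$ (0, j) = (if j = 0 then a else 0)" if "j < Suc n" for j
  proof -
    have "transpose_mat B $$ (0, j) = B $$ (j, 0)" using B that by simp
    then show ?thesis using B0[OF that] Bt by simp
  qed
  define C where "C = mat n n (\<lambda>(i, j). B $$ (Suc i, Suc j))"
  have C: "C \<in> carrier_mat n n" unfolding C_def by simp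
  have Ct: "transpose_mat C = C"
  proof (rule eq_matI)
    fix i j assume "i < dim_row C" "j < dim_col C"
    then have ij: "i < n" "j < n" using C by auto
    have "transpose_mat B $$ (Suc i, Suc j) = B $$ (Suc j, Suc i)" using B ij by simp
    then show "transpose_mat C $$ (i, j) = C $$ (i, j)" using ij Bt unfolding C_def by simp
  qed (use C in auto)
  define a1 where "a1 = mat 1 1 (\<lambda>_. a)"
  have a1: "a1 \<in> carrier_mat 1 1" unfolding a1_def by simp
  have Bblock: "B = four_block_mat a1 (0\<^sub>m 1 n) (0\<^sub>m n 1) C"
  proof (rule eq_matI)
    fix i j assume "i < dim_row (four_block_mat a1 (0\<^sub>m 1 n) (0\<^sub>m n 1) C)"
      "j < dim_col (four_block_mat a1 (0\<^sub>m 1 n) (0\<^sub>m n 1) C)"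
    then have ij: "i < Suc n" "j < Suc n" using a1 C by auto
    show "B $$ (i, j) = four_block_mat a1 (0\<^sub>m 1 n) (0\<^sub>m n 1) C $$ (i, j)"
      using ij B0[of i] B0'[of j] a1 C by (cases i; cases j) (auto simp: C_def a1_def)
  qed (use B a1 C in auto)
  obtain G d where G: "G \<in> carrier_mat n n" "transpose_mat G * G = 1\<^sub>m n" "transpose_mat G * C * G = diag_matrix n d"
    using Suc.IH[OF C Ct] by blast
  \<comment> \<open>The orthogonal matrix of the lower block, extended by the identity in the first
    coordinate.\<close>
  define F where "F = four_block_mat (1\<^sub>m 1) (0\<^sub>m 1 n) (0\<^sub>m n 1) G"
  have F: "F \<in> carrier_mat (Suc n) (Suc n)"
    using G(1) four_block_carrier_mat[of "1\<^sub>m 1" 1 1 G n n] unfolding F_def by simp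
  have Ft: "transpose_mat F = four_block_mat (1\<^sub>m 1) (0\<^sub>m 1 n) (0\<^sub>m n 1) (transpose_mat G)"
    unfolding F_def using G(1) by (subst transpose_four_block_mat[of _ 1 1 _ n _ n]) auto
  have FF: "transpose_mat F * F = 1\<^sub>m (Suc n)"
  proof -
    have "transpose_mat F * F = four_block_mat (1\<^sub>m 1) (0\<^sub>m 1 n) (0\<^sub>m n 1) (transpose_mat G * G)"
      unfolding Ft unfolding F_def using G(1) by (subst mult_four_block_mat[of _ 1 1 _ n _ n _ _ 1 _ n]) auto
    then show ?thesis unfolding G(2) using four_block_one_mat[of 1 n] by simp
  qed
  have FBF: "transpose_mat F * B * F = diag_matrix (Suc n) (\<lambda>i. case i of 0 \<Rightarrow> a | Suc k \<Rightarrow> d k)"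
  proof -
    have "transpose_mat F * B = four_block_mat a1 (0\<^sub>m 1 n) (0\<^sub>m n 1) (transpose_mat G * C)"
      unfolding Ft Bblock using G(1) a1 C by (subst mult_four_block_mat[of _ 1 1 _ n _ n _ _ 1 _ n]) auto
    then have "transpose_mat F * B * F = four_block_mat a1 (0\<^sub>m 1 n) (0\<^sub>m n 1) (transpose_mat G * C * G)"
      using G(1) a1 C unfolding F_def by (simp, subst mult_four_block_mat[of _ 1 1 _ n _ n _ _ 1 _ n]) auto
    also have "\<dots> = diag_matrix (Suc n) (\<lambda>i. case i of 0 \<Rightarrow> a | Suc k \<Rightarrow> d k)"
      unfolding G(3) using a1 by (intro eq_matI) (auto simp: diag_matrix_def a1_def split: nat.splits)
    finally show ?thesis .
  qed
  have dist: "transpose_mat (H * F) = transpose_mat F * H" using transpose_mult[OF H(1) F] H(2) by simp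
  have Fc: "transpose_mat F \<in> carrier_mat (Suc n) (Suc n)" using F by simp
  note asc = assoc_mult_mat[of _ "Suc n" "Suc n" _ "Suc n" _ "Suc n"]
  have HHF: "H * (H * F) = F" using asc[of H H F] H F by simp
  have 1: "transpose_mat (H * F) * (H * F) = 1\<^sub>m (Suc n)"
    unfolding dist using asc[of "transpose_mat F" H "H * F"] HHF FF Fc H F by simp
  have 2: "transpose_mat (H * F) * A * (H * F) = transpose_mat F * B * F"
    unfolding dist B_def using H(1) F Fc A(1) by (simp add: asc)
  show ?case
    by (intro exI[of _ "H * F"] exI[of _ "\<lambda>i. case i of 0 \<Rightarrow> a | Suc k \<Rightarrow> d k"] conjI)
      (use 1 2 FBF H F in auto)
qed

lemma proots_prod_linear: "proots (\<Prod>a\<leftarrow>xs. [:- a, 1:]) = mset (xs :: real list)"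
proof (induction xs)
  case (Cons a xs)
  have "(\<Prod>a\<leftarrow>xs. [:- a, 1:]) \<noteq> 0" by (auto simp: prod_list_zero_iff)
  then have "proots ([:- a, 1:] * (\<Prod>a\<leftarrow>xs. [:- a, 1:])) = proots [:- a, 1:] + proots (\<Prod>a\<leftarrow>xs. [:- a, 1:])"
    by (intro proots_mult) auto
  then show ?case using Cons by simp
qed simp

text \<open>A one-sided singular value decomposition: the columns of \<open>W * H\<close> are
  orthogonal and \<open>d\<close> lists their squared lengths, so \<open>d\<close> is nonnegative.
  Sorting permutes the columns of \<open>H\<close>.\<close>

lemma gram_spectral_sorted:
  fixes W :: "real mat"
  assumes W: "W \<in> carrier_mat m n"
  obtains H d where "H \<in> carrier_mat n n" "transpose_mat H * H = 1\<^sub>m n"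
    "transpose_mat (W * H) * (W * H) = diag_matrix n d"
    "\<And>i j. i \<le> j \<Longrightarrow> j < n \<Longrightarrow> d j \<le> d i" "\<And>i. i < n \<Longrightarrow> d i \<ge> 0"
proof -
  have G: "transpose_mat W * W \<in> carrier_mat n n" using W by simp
  have Gt: "transpose_mat (transpose_mat W * W) = transpose_mat W * W"
    using transpose_mult[of "transpose_mat W" n m W n] W by simp
  obtain H d where H: "H \<in> carrier_mat n n" "transpose_mat H * H = 1\<^sub>m n"
      "transpose_mat H * (transpose_mat W * W) * H = diag_matrix n d"
    using symmetric_mat_spectral[OF G Gt] by blast
  have WH: "W * H \<in> carrier_mat m n" using W H by simp
  have N: "transpose_mat (W * H) * (W * H) = diag_matrix n d"
  proof -
    have Ht: "transpose_mat H \<in> carrier_mat n n" and Wt: "transpose_mat W \<in> carrier_mat n m" using H W by auto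
    have "transpose_mat (W * H) * (W * H) = transpose_mat H * transpose_mat W * (W * H)"
      using transpose_mult[OF W H(1)] by simp
    also have "\<dots> = transpose_mat H * (transpose_mat W * (W * H))" by (rule assoc_mult_mat[OF Ht Wt WH])
    also have "transpose_mat W * (W * H) = transpose_mat W * W * H" by (rule assoc_mult_mat[OF Wt W H(1), symmetric])
    also have "transpose_mat H * (transpose_mat W * W * H) = transpose_mat H * (transpose_mat W * W) * H"
      by (rule assoc_mult_mat[OF Ht G H(1), symmetric])
    finally show ?thesis using H(3) by simp
  qed
  \<comment> \<open>The negated key puts \<open>d\<close> in decreasing order.\<close>
  define xs where "xs = sort_key (\<lambda>i. - d i) [0..<n]"
  define f where "f i = xs ! i" for i
  have xs: "length xs = n" "distinct xs" "set xs = {0..<n}" by (simp_all add: xs_def)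
  have fn: "f i < n" if "i < n" for i
  proof -
    have "xs ! i \<in> set xs" using that xs by (intro nth_mem) simp
    then show ?thesis using xs(3) by (simp add: f_def)
  qed
  have finj: "f i = f j \<longleftrightarrow> i = j" if "i < n" "j < n" for i j
    using that xs by (simp add: f_def nth_eq_iff_index_eq)
  have fsort: "d (f j) \<le> d (f i)" if "i \<le> j" "j < n" for i j
  proof -
    have "sorted (map (\<lambda>i. - d i) xs)" by (simp add: xs_def)
    then have "map (\<lambda>i. - d i) xs ! i \<le> map (\<lambda>i. - d i) xs ! j"
      using that xs by (intro sorted_nth_mono) auto
    then show ?thesis using that xs by (simp add: f_def)
  qed
  define K where "K = mat n n (\<lambda>(i, j). H $$ (i, f j))"
  have K: "K \<in> carrier_mat n n" unfolding K_def by simp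
  \<comment> \<open>Used with the identity for orthogonality and with \<open>W\<close> for the Gram
    matrix.\<close>
  have perm: "(transpose_mat (A * K) * (A * K)) $$ (i, j) = (transpose_mat (A * H) * (A * H)) $$ (f i, f j)"
    if A: "A \<in> carrier_mat k n" and ij: "i < n" "j < n" for A k i j
  proof -
    have AK: "(A * K) $$ (l, j) = (A * H) $$ (l, f j)" if "l < k" "j < n" for l j
    proof -
      have "col K j = col H (f j)" using H fn[of j] that unfolding K_def by (intro eq_vecI) auto
      then show ?thesis using A K H fn[of j] that by simp
    qed
    have c: "A * K \<in> carrier_mat k n" "A * H \<in> carrier_mat k n" using A K H by auto
    have t: "transpose_mat (A * K) \<in> carrier_mat n k" "transpose_mat (A * H) \<in> carrier_mat n k" using c by auto
    have e1: "transpose_mat (A * K) $$ (i, l) = (A * K) $$ (l, i)" if "l < k" for l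
      using c(1) that ij by (intro index_transpose_mat(1)) auto
    have e2: "transpose_mat (A * H) $$ (f i, l) = (A * H) $$ (l, f i)" if "l < k" for l
      using c(2) that fn[OF ij(1)] by (intro index_transpose_mat(1)) auto
    show ?thesis unfolding mat_mult_entry[OF t(1) c(1) ij] mat_mult_entry[OF t(2) c(2) fn[OF ij(1)] fn[OF ij(2)]]
      using AK e1 e2 ij by (intro sum.cong refl) auto
  qed
  have KK: "transpose_mat K * K = 1\<^sub>m n"
  proof (rule eq_matI)
    fix i j assume "i < dim_row (1\<^sub>m n :: real mat)" "j < dim_col (1\<^sub>m n :: real mat)"
    then have ij: "i < n" "j < n" by auto
    have "(transpose_mat (1\<^sub>m n * K) * (1\<^sub>m n * K)) $$ (i, j) = (transpose_mat (1\<^sub>m n * H) * (1\<^sub>m n * H)) $$ (f i, f j)"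
      by (rule perm[OF one_carrier_mat ij])
    then show "(transpose_mat K * K) $$ (i, j) = 1\<^sub>m n $$ (i, j)"
      unfolding left_mult_one_mat[OF K] left_mult_one_mat[OF H(1)] H(2) using ij fn finj by simp
  qed (use K in auto)
  have NK: "transpose_mat (W * K) * (W * K) = diag_matrix n (\<lambda>i. d (f i))"
  proof (rule eq_matI)
    fix i j assume "i < dim_row (diag_matrix n (\<lambda>i. d (f i)))" "j < dim_col (diag_matrix n (\<lambda>i. d (f i)))"
    then have ij: "i < n" "j < n" by auto
    show "(transpose_mat (W * K) * (W * K)) $$ (i, j) = diag_matrix n (\<lambda>i. d (f i)) $$ (i, j)"
      unfolding perm[OF W ij] N using ij fn finj by (simp add: diag_matrix_def)
  qed (use K in auto)
  have nonneg: "d (f i) \<ge> 0" if "i < n" for i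
  proof -
    have c: "W * K \<in> carrier_mat m n" using W K by simp
    have "d (f i) = (transpose_mat (W * K) * (W * K)) $$ (i, i)" unfolding NK using that by (simp add: diag_matrix_def)
    also have "\<dots> = (\<Sum>l<m. transpose_mat (W * K) $$ (i, l) * (W * K) $$ (l, i))"
      by (rule mat_mult_entry[OF _ c that that]) (use c in auto)
    also have "\<dots> = (\<Sum>l<m. (W * K) $$ (l, i) * (W * K) $$ (l, i))"
    proof (intro sum.cong refl)
      fix l assume "l \<in> {..<m}"
      then have "transpose_mat (W * K) $$ (i, l) = (W * K) $$ (l, i)"
        using c that by (intro index_transpose_mat(1)) auto
      then show "transpose_mat (W * K) $$ (i, l) * (W * K) $$ (l, i) = (W * K) $$ (l, i) * (W * K) $$ (l, i)" by simp
    qed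
    finally show ?thesis by (simp add: sum_nonneg)
  qed
  show ?thesis by (rule that[OF K KK NK fsort nonneg])
qed

lemma gram_entry:
  fixes N :: "real mat"
  assumes N: "N \<in> carrier_mat m n" and ij: "i < n" "j < n"
  shows "(transpose_mat N * N) $$ (i, j) = (\<Sum>l<m. N $$ (l, i) * N $$ (l, j))"
proof -
  have "(transpose_mat N * N) $$ (i, j) = (\<Sum>l<m. transpose_mat N $$ (i, l) * N $$ (l, j))"
    by (rule mat_mult_entry[OF _ N ij]) (use N in auto)
  also have "\<dots> = (\<Sum>l<m. N $$ (l, i) * N $$ (l, j))"
  proof (intro sum.cong refl)
    fix l assume "l \<in> {..<m}"
    then have "transpose_mat N $$ (i, l) = N $$ (l, i)" using N ij by (intro index_transpose_mat(1)) auto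
    then show "transpose_mat N $$ (i, l) * N $$ (l, j) = N $$ (l, i) * N $$ (l, j)" by simp
  qed
  finally show ?thesis .
qed

text \<open>The Gram matrix of \<open>W\<close> is similar to the diagonal matrix, so its
  characteristic polynomial splits with roots \<open>d\<close>, counted with multiplicity. It serves
  to turn any sorted diagonalisation into the list of the definition.\<close>

lemma singular_values_gram_spectral:
  fixes W :: "real mat"
  assumes W: "W \<in> carrier_mat m n" and H: "H \<in> carrier_mat n n" "transpose_mat H * H = 1\<^sub>m n"
    and N: "transpose_mat (W * H) * (W * H) = diag_matrix n d"
    and sorted: "\<And>i j. i \<le> j \<Longrightarrow> j < n \<Longrightarrow> d j \<le> d i"
  shows "singular_values W = map (\<lambda>i. sqrt (d i)) [0..<n]"
proof -
  have HH: "H * transpose_mat H = 1\<^sub>m n" by (rule orthogonal_mat_right_inverse[OF H])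
  have Ht: "transpose_mat H \<in> carrier_mat n n" and Wt: "transpose_mat W \<in> carrier_mat n m"
    and G: "transpose_mat W * W \<in> carrier_mat n n" and WH: "W * H \<in> carrier_mat m n" using H W by auto
  have "diag_matrix n d = transpose_mat H * transpose_mat W * (W * H)"
    using transpose_mult[OF W H(1)] N by simp
  also have "\<dots> = transpose_mat H * (transpose_mat W * (W * H))" by (rule assoc_mult_mat[OF Ht Wt WH])
  also have "transpose_mat W * (W * H) = transpose_mat W * W * H" by (rule assoc_mult_mat[OF Wt W H(1), symmetric])
  also have "transpose_mat H * (transpose_mat W * W * H) = transpose_mat H * (transpose_mat W * W) * H"
    by (rule assoc_mult_mat[OF Ht G H(1), symmetric])
  finally have D: "diag_matrix n d = transpose_mat H * (transpose_mat W * W) * H" .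
  have "similar_mat (diag_matrix n d) (transpose_mat W * W)"
    unfolding similar_mat_def
    by (intro exI[of _ "transpose_mat H"] exI[of _ H] similar_mat_witI[of _ _ n]) (use D H HH G Ht in auto)
  then have "char_poly (transpose_mat W * W) = char_poly (diag_matrix n d)" by (simp add: char_poly_similar)
  also have "\<dots> = (\<Prod>a\<leftarrow>diag_mat (diag_matrix n d). [:- a, 1:])"
    by (rule char_poly_upper_triangular[of _ n]) (auto simp: diag_matrix_def upper_triangular_def)
  also have "diag_mat (diag_matrix n d) = map d [0..<n]"
    by (auto simp: diag_mat_def diag_matrix_def intro!: map_cong)
  finally have "proots (char_poly (transpose_mat W * W)) = mset (map d [0..<n])"
    using proots_prod_linear[of "map d [0..<n]"] by simp
  then have "singular_values W = rev (sort (map (\<lambda>i. sqrt (d i)) [0..<n]))"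
    unfolding singular_values_def by (simp add: sorted_list_of_multiset_mset[symmetric] image_mset.compositionality comp_def)
  moreover have "sort (map (\<lambda>i. sqrt (d i)) [0..<n]) = rev (map (\<lambda>i. sqrt (d i)) [0..<n])"
  proof (rule properties_for_sort)
    show "sorted (rev (map (\<lambda>i. sqrt (d i)) [0..<n]))"
      unfolding sorted_rev_iff_nth_mono using sorted by auto
  qed simp
  ultimately show ?thesis by simp
qed

text \<open>The minimum arises because \<open>sing_val\<close> is 0 past the end of the list; the
  index shift comes from counting singular values from 1.\<close>

lemma ky_fan_2_gram_spectral:
  assumes "singular_values W = map (\<lambda>i. sqrt (d i)) [0..<n]" and "\<And>i. i < n \<Longrightarrow> d i \<ge> 0"
  shows "ky_fan_2 r W = sqrt (\<Sum>k<min r n. d k)"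
proof -
  have "(\<Sum>k=1..r. (sing_val k W)\<^sup>2) = (\<Sum>k<r. (sing_val (Suc k) W)\<^sup>2)"
    by (rule sum.reindex_bij_witness[of _ Suc "\<lambda>k. k - 1"]) auto
  also have "\<dots> = (\<Sum>k<r. if k < n then d k else 0)"
    using assms by (intro sum.cong) (auto simp: sing_val_def)
  also have "\<dots> = (\<Sum>k<min r n. d k)"
    by (rule sum.mono_neutral_cong_right) auto
  finally show ?thesis by (simp add: ky_fan_2_def)
qed

text \<open>If \<open>d i > 0\<close>, the first \<open>i + 1\<close> columns of
  \<open>W * H\<close> are orthogonal and nonzero, yet they factor through
  \<open>mat_rank W \<le> i\<close> dimensions. A kernel vector \<open>v\<close> of the factor is
  mapped to 0, while the squared length of its image is a positive combination of the squares of its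
  entries.\<close>

lemma gram_spectral_rank:
  fixes W :: "real mat"
  assumes W: "W \<in> carrier_mat m n" and H: "H \<in> carrier_mat n n"
    and N: "transpose_mat (W * H) * (W * H) = diag_matrix n d"
    and sorted: "\<And>i j. i \<le> j \<Longrightarrow> j < n \<Longrightarrow> d j \<le> d i" and nonneg: "\<And>i. i < n \<Longrightarrow> d i \<ge> 0"
    and i: "i < n" "mat_rank W \<le> i"
  shows "d i = 0"
proof (rule ccontr)
  assume "d i \<noteq> 0"
  then have di: "d i > 0" using nonneg[OF i(1)] by simp
  define \<rho> where "\<rho> = mat_rank W"
  obtain P Q where P: "P \<in> carrier_mat m \<rho>" and Q: "Q \<in> carrier_mat \<rho> n" and PQ: "W = P * Q"
    unfolding \<rho>_def by (rule rank_factorization[OF W])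
  have R: "Q * H \<in> carrier_mat \<rho> n" and WH: "W * H \<in> carrier_mat m n" using Q H W by auto
  have WH': "W * H = P * (Q * H)" unfolding PQ by (rule assoc_mult_mat[OF P Q H])
  define S where "S = mat \<rho> (Suc i) (\<lambda>(l, j). (Q * H) $$ (l, j))"
  have S: "S \<in> carrier_mat \<rho> (Suc i)" unfolding S_def by simp
  obtain v where v: "v \<in> carrier_vec (Suc i)" "v \<noteq> 0\<^sub>v (Suc i)" "S *\<^sub>v v = 0\<^sub>v \<rho>"
    using wide_mat_kernel[OF S] i(2) unfolding \<rho>_def by auto
  have Sv: "(\<Sum>j<Suc i. (Q * H) $$ (l, j) * v $ j) = 0" if "l < \<rho>" for l
  proof -
    have "(S *\<^sub>v v) $ l = (\<Sum>j<Suc i. (Q * H) $$ (l, j) * v $ j)"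
      using that S v(1) by (auto simp: scalar_prod_def lessThan_atLeast0 S_def intro!: sum.cong simp del: sum.lessThan_Suc sum.op_ivl_Suc)
    then show ?thesis using v(3) that by simp
  qed
  have Nv: "(\<Sum>j<Suc i. (W * H) $$ (k, j) * v $ j) = 0" if k: "k < m" for k
  proof -
    have "(\<Sum>j<Suc i. (W * H) $$ (k, j) * v $ j) = (\<Sum>j<Suc i. \<Sum>l<\<rho>. P $$ (k, l) * (Q * H) $$ (l, j) * v $ j)"
      unfolding WH' using k i(1) by (intro sum.cong refl) (simp add: mat_mult_entry[OF P R] sum_distrib_right del: index_mult_mat(1))
    also have "\<dots> = (\<Sum>l<\<rho>. P $$ (k, l) * (\<Sum>j<Suc i. (Q * H) $$ (l, j) * v $ j))"
      by (subst sum.swap) (simp only: sum_distrib_left mult.assoc)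
    also have "\<dots> = 0" by (intro sum.neutral ballI) (simp only: Sv lessThan_iff mult_zero_right)
    finally show ?thesis .
  qed
  \<comment> \<open>The squared length of the zero vector is expanded; the off-diagonal terms drop
    out by orthogonality.\<close>
  have "0 = (\<Sum>k<m. (\<Sum>j<Suc i. (W * H) $$ (k, j) * v $ j) * (\<Sum>j<Suc i. (W * H) $$ (k, j) * v $ j))"
    by (intro sum.neutral[symmetric] ballI) (simp only: Nv lessThan_iff mult_zero_right)
  also have "\<dots> = (\<Sum>k<m. \<Sum>j<Suc i. \<Sum>l<Suc i. (W * H) $$ (k, j) * v $ j * ((W * H) $$ (k, l) * v $ l))"
    unfolding sum_product ..
  also have "\<dots> = (\<Sum>j<Suc i. \<Sum>l<Suc i. \<Sum>k<m. (W * H) $$ (k, j) * v $ j * ((W * H) $$ (k, l) * v $ l))"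
    by (subst sum.swap) (intro sum.cong refl sum.swap)
  also have "\<dots> = (\<Sum>j<Suc i. \<Sum>l<Suc i. v $ j * v $ l * (if j = l then d j else 0))"
  proof (intro sum.cong refl)
    fix j l assume "j \<in> {..<Suc i}" "l \<in> {..<Suc i}"
    then have jl: "j < n" "l < n" using i by auto
    have "(\<Sum>k<m. (W * H) $$ (k, j) * v $ j * ((W * H) $$ (k, l) * v $ l))
        = v $ j * v $ l * (\<Sum>k<m. (W * H) $$ (k, j) * (W * H) $$ (k, l))"
      unfolding sum_distrib_left by (intro sum.cong refl) (simp only: mult_ac)
    also have "(\<Sum>k<m. (W * H) $$ (k, j) * (W * H) $$ (k, l)) = (if j = l then d j else 0)"
      unfolding gram_entry[OF WH jl, symmetric] N using jl by (simp add: diag_matrix_def)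
    finally show "(\<Sum>k<m. (W * H) $$ (k, j) * v $ j * ((W * H) $$ (k, l) * v $ l))
        = v $ j * v $ l * (if j = l then d j else 0)" .
  qed
  also have "\<dots> = (\<Sum>j<Suc i. v $ j * v $ j * d j)"
    by (intro sum.cong refl) (simp add: if_distrib sum.delta cong: if_cong del: sum.lessThan_Suc)
  finally have z: "(\<Sum>j<Suc i. v $ j * v $ j * d j) = 0" by simp
  have dj: "d j > 0" if "j < Suc i" for j using sorted[of j i] di that i by auto
  have vz: "v $ j * v $ j * d j = 0" if "j < Suc i" for j
  proof -
    have "\<forall>j\<in>{..<Suc i}. v $ j * v $ j * d j = 0"
      using z dj by (subst (asm) sum_nonneg_eq_0_iff) (auto simp: less_imp_le simp del: sum.lessThan_Suc)
    then show ?thesis using that by blast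
  qed
  have "v $ j = 0" if "j < Suc i" for j using dj[OF that] vz[OF that] by auto
  then have "v = 0\<^sub>v (Suc i)" using v(1) by (intro eq_vecI) auto
  then show False using v(2) by simp
qed

text \<open>\<open>V\<close> consists of the right singular vectors that can carry a nonzero
  singular value. The remaining columns of \<open>M * H\<close> vanish, so projecting the rows onto
  the span of \<open>V\<close> loses nothing of \<open>M\<close>.\<close>

lemma row_space_projection:
  fixes M :: "real mat"
  assumes M: "M \<in> carrier_mat m n"
  obtains V s where "V \<in> carrier_mat n s" "s \<le> mat_rank M" "transpose_mat V * V = 1\<^sub>m s"
    "M * (V * transpose_mat V) = M"
proof -
  obtain H d where H: "H \<in> carrier_mat n n" "transpose_mat H * H = 1\<^sub>m n"
      and N: "transpose_mat (M * H) * (M * H) = diag_matrix n d"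
      and d: "\<And>i j. i \<le> j \<Longrightarrow> j < n \<Longrightarrow> d j \<le> d i" "\<And>i. i < n \<Longrightarrow> d i \<ge> 0"
    by (rule gram_spectral_sorted[OF M]) (rule that)
  have HH: "H * transpose_mat H = 1\<^sub>m n" by (rule orthogonal_mat_right_inverse[OF H])
  \<comment> \<open>The minimum keeps the selected columns inside \<open>H\<close> without a
    separate bound of the rank by \<open>n\<close>.\<close>
  define s where "s = min (mat_rank M) n"
  define V where "V = mat n s (\<lambda>(i, j). H $$ (i, j))"
  have V: "V \<in> carrier_mat n s" unfolding V_def by simp
  have Vt: "transpose_mat V \<in> carrier_mat s n" and Ht: "transpose_mat H \<in> carrier_mat n n" using V H by auto
  have MH: "M * H \<in> carrier_mat m n" and MV: "M * V \<in> carrier_mat m s" using M H V by auto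
  have VV: "transpose_mat V * V = 1\<^sub>m s"
  proof (rule eq_matI)
    fix i j assume "i < dim_row (1\<^sub>m s :: real mat)" "j < dim_col (1\<^sub>m s :: real mat)"
    then have ij: "i < s" "j < s" "i < n" "j < n" by (auto simp: s_def)
    have "(transpose_mat V * V) $$ (i, j) = (\<Sum>l<n. V $$ (l, i) * V $$ (l, j))" by (rule gram_entry[OF V ij(1,2)])
    also have "\<dots> = (\<Sum>l<n. H $$ (l, i) * H $$ (l, j))" using ij by (intro sum.cong) (auto simp: V_def)
    also have "\<dots> = (transpose_mat H * H) $$ (i, j)" by (rule gram_entry[OF H(1) ij(3,4), symmetric])
    finally show "(transpose_mat V * V) $$ (i, j) = 1\<^sub>m s $$ (i, j)" unfolding H(2) using ij by simp
  qed (use V in auto)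
  have zero: "(M * H) $$ (i, k) = 0" if "i < m" "k < n" "s \<le> k" for i k
  proof -
    have "d k = 0" by (rule gram_spectral_rank[OF M H(1) N d]) (use that s_def in auto)
    then have "(\<Sum>l<m. (M * H) $$ (l, k) * (M * H) $$ (l, k)) = 0"
      unfolding gram_entry[OF MH that(2) that(2), symmetric] N using that by (simp add: diag_matrix_def)
    then show ?thesis using that(1) by (subst (asm) sum_nonneg_eq_0_iff) auto
  qed
  have MVe: "(M * V) $$ (i, k) = (M * H) $$ (i, k)" if "i < m" "k < s" for i k
  proof -
    have "k < n" using that by (simp add: s_def)
    then have "col V k = col H k" using that V H by (intro eq_vecI) (auto simp: V_def)
    then show ?thesis using M V H that \<open>k < n\<close> by simp
  qed
  have "M * V * transpose_mat V = M * H * transpose_mat H"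
  proof (rule eq_matI)
    fix i j assume "i < dim_row (M * H * transpose_mat H)" "j < dim_col (M * H * transpose_mat H)"
    then have ij: "i < m" "j < n" using M H by auto
    have "(M * V * transpose_mat V) $$ (i, j) = (\<Sum>k<s. (M * V) $$ (i, k) * transpose_mat V $$ (k, j))"
      by (rule mat_mult_entry[OF MV Vt ij])
    also have "\<dots> = (\<Sum>k<s. (M * H) $$ (i, k) * H $$ (j, k))"
      using ij MVe V by (intro sum.cong refl) (auto simp: V_def)
    also have "\<dots> = (\<Sum>k<n. (M * H) $$ (i, k) * H $$ (j, k))"
      using zero[OF ij(1)] by (intro sum.mono_neutral_left) (auto simp: s_def)
    also have "\<dots> = (\<Sum>k<n. (M * H) $$ (i, k) * transpose_mat H $$ (k, j))"
      using ij H by (intro sum.cong refl) auto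
    also have "\<dots> = (M * H * transpose_mat H) $$ (i, j)"
      by (rule mat_mult_entry[OF MH Ht ij, symmetric])
    finally show "(M * V * transpose_mat V) $$ (i, j) = (M * H * transpose_mat H) $$ (i, j)" .
  qed (use M V H in auto)
  also have "\<dots> = M" using assoc_mult_mat[OF M H(1) Ht] HH M by simp
  finally have "M * (V * transpose_mat V) = M" using assoc_mult_mat[OF M V Vt] by simp
  then show ?thesis using that[OF V _ VV] by (simp add: s_def)
qed

text \<open>\<open>C\<close> is the diagonal of singular values, cut to \<open>mat_rank X\<close>
  rows, times the transpose of \<open>H\<close>. Since \<open>C * B\<close> and \<open>X * B\<close>
  have equal norms, \<open>C\<close> realises the image of \<open>X\<close> isometrically in a space
  whose dimension is the rank; this is how the number of noise rows drops from \<open>m\<close> to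
  \<open>q\<close>.\<close>

lemma gram_factorization:
  fixes X :: "real mat"
  assumes X: "X \<in> carrier_mat m p"
  obtains C where "C \<in> carrier_mat (mat_rank X) p" "transpose_mat C * C = transpose_mat X * X"
proof -
  obtain H d where H: "H \<in> carrier_mat p p" "transpose_mat H * H = 1\<^sub>m p"
      and N: "transpose_mat (X * H) * (X * H) = diag_matrix p d"
      and d: "\<And>i j. i \<le> j \<Longrightarrow> j < p \<Longrightarrow> d j \<le> d i" "\<And>i. i < p \<Longrightarrow> d i \<ge> 0"
    by (rule gram_spectral_sorted[OF X]) (rule that)
  have HH: "H * transpose_mat H = 1\<^sub>m p" by (rule orthogonal_mat_right_inverse[OF H])
  define q where "q = mat_rank X"
  define S where "S = mat q p (\<lambda>(i, j). if i = j then sqrt (d i) else 0)"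
  have S: "S \<in> carrier_mat q p" unfolding S_def by simp
  have SS: "transpose_mat S * S = diag_matrix p d"
  proof (rule eq_matI)
    fix i j assume "i < dim_row (diag_matrix p d)" "j < dim_col (diag_matrix p d)"
    then have ij: "i < p" "j < p" by auto
    have "(transpose_mat S * S) $$ (i, j) = (\<Sum>l<q. S $$ (l, i) * S $$ (l, j))" by (rule gram_entry[OF S ij])
    also have "\<dots> = (\<Sum>l<q. if l = i then (if i = j then d i else 0) else 0)"
      using ij d(2) by (intro sum.cong) (auto simp: S_def)
    also have "\<dots> = (if i = j then d i else 0)"
    \<comment> \<open>Rows from \<open>q\<close> on were cut off; there \<open>d i\<close> is 0 by
      the rank bound.\<close>
    proof (cases "i < q")
      case False
      then have "d i = 0" by (intro gram_spectral_rank[OF X H(1) N d ij(1)]) (simp_all add: q_def)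
      then show ?thesis by auto
    qed simp
    finally show "(transpose_mat S * S) $$ (i, j) = diag_matrix p d $$ (i, j)" using ij by (simp add: diag_matrix_def)
  qed (use S in auto)
  have Ht: "transpose_mat H \<in> carrier_mat p p" and XH: "X * H \<in> carrier_mat m p" using H X by auto
  have fact: "transpose_mat (A * transpose_mat H) * (A * transpose_mat H) = H * (transpose_mat A * A) * transpose_mat H"
    if A: "A \<in> carrier_mat k p" for A k
  proof -
    have At: "transpose_mat A \<in> carrier_mat p k" and AH: "A * transpose_mat H \<in> carrier_mat k p"
      and AA: "transpose_mat A * A \<in> carrier_mat p p" using A H by auto
    have "transpose_mat (A * transpose_mat H) * (A * transpose_mat H) = H * transpose_mat A * (A * transpose_mat H)"
      using transpose_mult[OF A Ht] by simp
    also have "\<dots> = H * (transpose_mat A * (A * transpose_mat H))" by (rule assoc_mult_mat[OF H(1) At AH])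
    also have "transpose_mat A * (A * transpose_mat H) = transpose_mat A * A * transpose_mat H"
      by (rule assoc_mult_mat[OF At A Ht, symmetric])
    also have "H * (transpose_mat A * A * transpose_mat H) = H * (transpose_mat A * A) * transpose_mat H"
      by (rule assoc_mult_mat[OF H(1) AA Ht, symmetric])
    finally show ?thesis .
  qed
  have XHH: "X * H * transpose_mat H = X" using assoc_mult_mat[OF X H(1) Ht] HH X by simp
  have "transpose_mat (S * transpose_mat H) * (S * transpose_mat H) = transpose_mat X * X"
    using fact[OF S] fact[OF XH] SS N XHH by simp
  then show ?thesis using that[of "S * transpose_mat H"] S Ht by (simp add: q_def)
qed

section \<open>Variational principle for the Ky Fan norm\<close>

text \<open>Subtract the threshold \<open>d r\<close>: then indices below \<open>r\<close> are best
  served by weight 1 and the others by weight 0. What was subtracted is paid back by the bound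
  \<open>r\<close> on the total weight.\<close>

lemma weighted_sum_le_top:
  fixes c d :: "nat \<Rightarrow> real"
  assumes c: "\<And>k. k < n \<Longrightarrow> 0 \<le> c k" "\<And>k. k < n \<Longrightarrow> c k \<le> 1" "(\<Sum>k<n. c k) \<le> real r"
    and d: "\<And>i j. i \<le> j \<Longrightarrow> j < n \<Longrightarrow> d j \<le> d i" "\<And>i. i < n \<Longrightarrow> d i \<ge> 0"
  shows "(\<Sum>k<n. d k * c k) \<le> (\<Sum>k<min r n. d k)"
proof (cases "r < n")
  case False
  have "(\<Sum>k<n. d k * c k) \<le> (\<Sum>k<n. d k)"
    using c d by (intro sum_mono mult_left_le) auto
  then show ?thesis using False by (simp add: min_absorb2)
next
  case True
  have "(\<Sum>k<n. (d k - d r) * c k) \<le> (\<Sum>k<n. if k < r then d k - d r else 0)"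
  proof (rule sum_mono)
    fix k assume "k \<in> {..<n}"
    then have k: "k < n" by simp
    show "(d k - d r) * c k \<le> (if k < r then d k - d r else 0)"
      using d(1)[of k r] d(1)[of r k] c(1,2)[OF k] k True
      by (cases "k < r") (auto intro!: mult_left_le simp: mult_le_0_iff)
  qed
  also have "\<dots> = (\<Sum>k<r. d k - d r)"
    using True by (intro sum.mono_neutral_cong_right) auto
  finally have "(\<Sum>k<n. d k * c k) - d r * (\<Sum>k<n. c k) \<le> (\<Sum>k<r. d k) - d r * real r"
    by (simp add: left_diff_distrib sum_subtractf sum_distrib_left mult.commute[of "real r"])
  moreover have "d r * (\<Sum>k<n. c k) \<le> d r * real r"
    by (rule mult_left_mono[OF c(3) d(2)[OF True]])
  ultimately show ?thesis using True by (simp add: min_absorb1)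
qed

text \<open>\<open>N\<close> enters only through its Gram matrix. The result is a sum of the entries
  of \<open>d\<close> with the squared row lengths of \<open>Z\<close> as weights, ready for the
  rearrangement bound.\<close>

lemma frob_norm_mult_gram:
  fixes N Z :: "real mat"
  assumes N: "N \<in> carrier_mat m n" "transpose_mat N * N = diag_matrix n d" and Z: "Z \<in> carrier_mat n s"
  shows "mat_inner (N * Z) (N * Z) = (\<Sum>k<n. d k * (\<Sum>j<s. (Z $$ (k, j))\<^sup>2))"
proof -
  have Nt: "transpose_mat N \<in> carrier_mat n m" and NZ: "N * Z \<in> carrier_mat m s" using N Z by auto
  have "mat_inner (N * Z) (N * Z) = mat_inner Z (transpose_mat N * (N * Z))"
    by (rule mat_inner_mult_left[OF N(1) Z NZ])
  also have "transpose_mat N * (N * Z) = diag_matrix n d * Z"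
    using assoc_mult_mat[OF Nt N(1) Z] N(2) by simp
  also have "mat_inner Z (diag_matrix n d * Z) = (\<Sum>k<n. \<Sum>j<s. Z $$ (k, j) * (diag_matrix n d * Z) $$ (k, j))"
    unfolding mat_inner_def using Z by simp
  also have "\<dots> = (\<Sum>k<n. \<Sum>j<s. d k * (Z $$ (k, j))\<^sup>2)"
  proof (intro sum.cong refl)
    fix k j assume "k \<in> {..<n}" "j \<in> {..<s}"
    then have kj: "k < n" "j < s" by auto
    have "(diag_matrix n d * Z) $$ (k, j) = (\<Sum>l<n. diag_matrix n d $$ (k, l) * Z $$ (l, j))"
      by (rule mat_mult_entry[OF diag_matrix_carrier(1) Z kj])
    also have "\<dots> = (\<Sum>l<n. if k = l then d k * Z $$ (l, j) else 0)"
      using kj by (intro sum.cong) (auto simp: diag_matrix_def)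
    also have "\<dots> = d k * Z $$ (k, j)" using kj by simp
    finally show "Z $$ (k, j) * (diag_matrix n d * Z) $$ (k, j) = d k * (Z $$ (k, j))\<^sup>2"
      by (simp add: power2_eq_square)
  qed
  finally show ?thesis by (simp add: sum_distrib_left)
qed

text \<open>Ky Fan's maximum principle: by duality, the norm is attained at a matrix of rank at most
  \<open>r\<close>, and on such a matrix only the projection of \<open>W\<close> to its row space matters.\<close>

theorem mat_inner_le_ky_fan_2:
  fixes M W :: "real mat"
  assumes M: "M \<in> carrier_mat m n" "mat_rank M \<le> r" and W: "W \<in> carrier_mat m n"
  shows "mat_inner M W \<le> frob_norm M * ky_fan_2 r W"
proof -
  obtain H d where H: "H \<in> carrier_mat n n" "transpose_mat H * H = 1\<^sub>m n"
      and N: "transpose_mat (W * H) * (W * H) = diag_matrix n d"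
      and d: "\<And>i j. i \<le> j \<Longrightarrow> j < n \<Longrightarrow> d j \<le> d i" "\<And>i. i < n \<Longrightarrow> d i \<ge> 0"
    by (rule gram_spectral_sorted[OF W]) (rule that)
  have ky: "ky_fan_2 r W = sqrt (\<Sum>k<min r n. d k)"
    by (rule ky_fan_2_gram_spectral[OF singular_values_gram_spectral[OF W H N d(1)] d(2)])
  have HH: "H * transpose_mat H = 1\<^sub>m n" by (rule orthogonal_mat_right_inverse[OF H])
  obtain V s where V: "V \<in> carrier_mat n s" "s \<le> mat_rank M" "transpose_mat V * V = 1\<^sub>m s"
      "M * (V * transpose_mat V) = M"
    by (rule row_space_projection[OF M(1)])
  have Vt: "transpose_mat V \<in> carrier_mat s n" and Ht: "transpose_mat H \<in> carrier_mat n n"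
    and WH: "W * H \<in> carrier_mat m n" and WV: "W * V \<in> carrier_mat m s" using V H W by auto
  \<comment> \<open>The basis \<open>V\<close> of the row space expressed in the right singular
    basis of \<open>W\<close>.\<close>
  define Z where "Z = transpose_mat H * V"
  have Z: "Z \<in> carrier_mat n s" and Zt: "transpose_mat Z \<in> carrier_mat s n" using Ht V by (auto simp: Z_def)
  have HZ: "H * Z = V" unfolding Z_def using assoc_mult_mat[OF H(1) Ht V(1)] HH V(1) by simp
  have WHZ: "W * H * Z = W * V" using assoc_mult_mat[OF W H(1) Z] HZ by simp
  have ZZ: "transpose_mat Z * Z = 1\<^sub>m s"
  proof -
    have "transpose_mat Z * Z = transpose_mat V * H * Z" unfolding Z_def using transpose_mult[OF Ht V(1)] by simp
    also have "\<dots> = transpose_mat V * (H * Z)" by (rule assoc_mult_mat[OF Vt H(1) Z])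
    finally show ?thesis using HZ V(3) by simp
  qed
  define c where "c k = (\<Sum>j<s. (Z $$ (k, j))\<^sup>2)" for k
  \<comment> \<open>\<open>c k\<close> is a diagonal entry of the orthogonal projection
    \<open>P\<close>; such an entry dominates its own square.\<close>
  have c1: "c k \<le> 1" if k: "k < n" for k
  proof -
    define P where "P = Z * transpose_mat Z"
    have P: "P \<in> carrier_mat n n" using Z by (simp add: P_def)
    have Pt: "transpose_mat P = P" unfolding P_def using transpose_mult[OF Z Zt] by simp
    have "transpose_mat P * P = P"
    proof -
      have "P * P = Z * (transpose_mat Z * (Z * transpose_mat Z))"
        unfolding P_def by (rule assoc_mult_mat[OF Z Zt]) (use Z in auto)
      also have "transpose_mat Z * (Z * transpose_mat Z) = transpose_mat Z * Z * transpose_mat Z"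
        by (rule assoc_mult_mat[OF Zt Z Zt, symmetric])
      finally show ?thesis unfolding Pt ZZ using Zt by (simp add: P_def)
    qed
    then have "P $$ (k, k) = (\<Sum>l<n. P $$ (l, k) * P $$ (l, k))" using gram_entry[OF P k k] by simp
    also have "\<dots> \<ge> P $$ (k, k) * P $$ (k, k)"
      by (rule member_le_sum[where f = "\<lambda>l. P $$ (l, k) * P $$ (l, k)"]) (use k in auto)
    finally have "P $$ (k, k) * P $$ (k, k) \<le> P $$ (k, k)" .
    have "P $$ (k, k) \<le> 1"
    proof (rule ccontr)
      assume "\<not> P $$ (k, k) \<le> 1"
      then have "P $$ (k, k) * 1 < P $$ (k, k) * P $$ (k, k)" by (intro mult_strict_left_mono) auto
      then show False using \<open>P $$ (k, k) * P $$ (k, k) \<le> P $$ (k, k)\<close> by simp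
    qed
    moreover have "P $$ (k, k) = c k"
      using gram_entry[OF Zt k k] unfolding P_def c_def using Z k by (simp add: power2_eq_square)
    ultimately show ?thesis by simp
  qed
  \<comment> \<open>The trace of the projection, computed from the unit columns of
    \<open>Z\<close>.\<close>
  have csum: "(\<Sum>k<n. c k) = real s"
  proof -
    have "(\<Sum>k<n. c k) = (\<Sum>j<s. \<Sum>k<n. Z $$ (k, j) * Z $$ (k, j))"
      unfolding c_def power2_eq_square by (rule sum.swap)
    also have "\<dots> = (\<Sum>j<s. 1)"
    proof (intro sum.cong refl)
      fix j assume "j \<in> {..<s}"
      then show "(\<Sum>k<n. Z $$ (k, j) * Z $$ (k, j)) = 1" using gram_entry[OF Z, of j j] ZZ by simp
    qed
    finally show ?thesis by simp
  qed
  have "mat_inner (W * V) (W * V) = (\<Sum>k<n. d k * c k)"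
    using frob_norm_mult_gram[OF WH N Z] unfolding WHZ c_def .
  also have "\<dots> \<le> (\<Sum>k<min r n. d k)"
    using c1 csum V(2) M(2) by (intro weighted_sum_le_top d) (auto simp: c_def intro: sum_nonneg)
  finally have WVk: "frob_norm (W * V) \<le> ky_fan_2 r W"
    unfolding ky frob_norm_power2[symmetric] by (rule real_le_rsqrt)
  have VVt: "V * transpose_mat V \<in> carrier_mat n n" using V by simp
  have VVtt: "transpose_mat (V * transpose_mat V) = V * transpose_mat V" using transpose_mult[OF V(1) Vt] by simp
  have WVV: "W * (V * transpose_mat V) = W * V * transpose_mat V" by (rule assoc_mult_mat[OF W V(1) Vt, symmetric])
  have "mat_inner M W = mat_inner (M * (V * transpose_mat V)) W" using V(4) by simp
  also have "\<dots> = mat_inner M (W * V * transpose_mat V)"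
    unfolding mat_inner_mult_right[OF M(1) VVt W] VVtt WVV ..
  also have "\<dots> \<le> frob_norm M * frob_norm (W * V * transpose_mat V)"
    using mat_inner_abs_le[OF M(1), of "W * V * transpose_mat V"] WV Vt by simp
  also have "frob_norm (W * V * transpose_mat V) = frob_norm (W * V)"
  proof -
    have WVVc: "W * V * transpose_mat V \<in> carrier_mat m n" using WV Vt by simp
    have "mat_inner (W * V * transpose_mat V) (W * V * transpose_mat V)
        = mat_inner (W * V) (W * V * transpose_mat V * V)"
      using mat_inner_mult_right[OF WV Vt WVVc] by simp
    also have "W * V * transpose_mat V * V = W * V * (transpose_mat V * V)" by (rule assoc_mult_mat[OF WV Vt V(1)])
    also have "\<dots> = W * V" unfolding V(3) by (rule right_mult_one_mat[OF WV])
    finally have "(frob_norm (W * V * transpose_mat V))\<^sup>2 = (frob_norm (W * V))\<^sup>2" unfolding frob_norm_power2 .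
    then show ?thesis by (rule power2_eq_imp_eq) auto
  qed
  finally show ?thesis using WVk mult_left_mono[OF WVk, of "frob_norm M"] by simp
qed

text \<open>The maximiser is the truncation of \<open>W\<close> to its top \<open>r\<close> right
  singular vectors, divided by its norm \<open>\<kappa>\<close>. If \<open>\<kappa>\<close> is 0,
  division by zero turns it into the zero matrix, which still attains the value.\<close>

theorem ky_fan_2_attained:
  fixes W :: "real mat"
  assumes W: "W \<in> carrier_mat m n"
  obtains M where "M \<in> carrier_mat m n" "mat_rank M \<le> r" "frob_norm M \<le> 1" "mat_inner M W = ky_fan_2 r W"
proof -
  obtain H d where H: "H \<in> carrier_mat n n" "transpose_mat H * H = 1\<^sub>m n"
      and N: "transpose_mat (W * H) * (W * H) = diag_matrix n d"
      and d: "\<And>i j. i \<le> j \<Longrightarrow> j < n \<Longrightarrow> d j \<le> d i" "\<And>i. i < n \<Longrightarrow> d i \<ge> 0"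
    by (rule gram_spectral_sorted[OF W]) (rule that)
  have ky: "ky_fan_2 r W = sqrt (\<Sum>k<min r n. d k)"
    by (rule ky_fan_2_gram_spectral[OF singular_values_gram_spectral[OF W H N d(1)] d(2)])
  have HH: "H * transpose_mat H = 1\<^sub>m n" by (rule orthogonal_mat_right_inverse[OF H])
  define s where "s = min r n"
  define Z :: "real mat" where "Z = mat n s (\<lambda>(i, j). if i = j then 1 else 0)"
  have Z: "Z \<in> carrier_mat n s" by (simp add: Z_def)
  define V where "V = H * Z"
  have V: "V \<in> carrier_mat n s" using H Z by (simp add: V_def)
  have Vt: "transpose_mat V \<in> carrier_mat s n" and WH: "W * H \<in> carrier_mat m n" and WV: "W * V \<in> carrier_mat m s"
    using V H W by auto
  have WHZ: "W * H * Z = W * V" unfolding V_def by (rule assoc_mult_mat[OF W H(1) Z])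
  have Zt: "transpose_mat Z \<in> carrier_mat s n" and Ht: "transpose_mat H \<in> carrier_mat n n" using Z H by auto
  have VV: "transpose_mat V * V = 1\<^sub>m s"
  proof -
    have "transpose_mat V * V = transpose_mat Z * transpose_mat H * V"
      unfolding V_def using transpose_mult[OF H(1) Z] by simp
    also have "\<dots> = transpose_mat Z * (transpose_mat H * V)" by (rule assoc_mult_mat[OF Zt Ht V])
    also have "transpose_mat H * V = transpose_mat H * H * Z"
      unfolding V_def by (rule assoc_mult_mat[OF Ht H(1) Z, symmetric])
    also have "transpose_mat Z * (transpose_mat H * H * Z) = transpose_mat Z * Z" unfolding H(2) using Z by simp
    also have "\<dots> = 1\<^sub>m s"
    proof (rule eq_matI)
      fix i j assume "i < dim_row (1\<^sub>m s :: real mat)" "j < dim_col (1\<^sub>m s :: real mat)"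
      then have ij: "i < s" "j < s" by auto
      have "(transpose_mat Z * Z) $$ (i, j) = (\<Sum>l<n. Z $$ (l, i) * Z $$ (l, j))" by (rule gram_entry[OF Z ij])
      also have "\<dots> = (\<Sum>l<n. if l = i then (if i = j then 1 else 0) else 0)"
        using ij by (intro sum.cong) (auto simp: Z_def)
      also have "\<dots> = (if i = j then 1 else 0)" using ij by (simp add: s_def)
      finally show "(transpose_mat Z * Z) $$ (i, j) = 1\<^sub>m s $$ (i, j)" using ij by simp
    qed (use Z in auto)
    finally show ?thesis .
  qed
  have WVd: "mat_inner (W * V) (W * V) = (\<Sum>k<s. d k)"
  proof -
    have "mat_inner (W * V) (W * V) = (\<Sum>k<n. d k * (\<Sum>j<s. (Z $$ (k, j))\<^sup>2))"
      using frob_norm_mult_gram[OF WH N Z] unfolding WHZ .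
    also have "\<dots> = (\<Sum>k<n. if k < s then d k else 0)"
    proof (intro sum.cong refl)
      fix k assume "k \<in> {..<n}"
      then have "(\<Sum>j<s. (Z $$ (k, j))\<^sup>2) = (\<Sum>j<s. if k = j then 1 else 0)"
        by (intro sum.cong) (auto simp: Z_def)
      then show "d k * (\<Sum>j<s. (Z $$ (k, j))\<^sup>2) = (if k < s then d k else 0)" by simp
    qed
    also have "\<dots> = (\<Sum>k<s. d k)" by (rule sum.mono_neutral_cong_right) (auto simp: s_def)
    finally show ?thesis .
  qed
  define M where "M = W * V * transpose_mat V"
  have M: "M \<in> carrier_mat m n" using WV Vt by (simp add: M_def)
  have Mr: "mat_rank M \<le> r"
    using mat_rank_mult_inner[OF WV Vt] unfolding M_def s_def by simp
  have MW: "mat_inner M W = (\<Sum>k<s. d k)"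
    unfolding M_def mat_inner_mult_right[OF WV Vt W] using WVd by simp
  have MM: "mat_inner M M = (\<Sum>k<s. d k)"
  proof -
    have "mat_inner M M = mat_inner (W * V) (M * V)"
      using mat_inner_mult_right[OF WV Vt M] by (simp add: M_def)
    also have "M * V = W * V * (transpose_mat V * V)" unfolding M_def by (rule assoc_mult_mat[OF WV Vt V])
    also have "\<dots> = W * V" unfolding VV by (rule right_mult_one_mat[OF WV])
    finally show ?thesis using WVd by simp
  qed
  define \<kappa> where "\<kappa> = ky_fan_2 r W"
  have d0: "(\<Sum>k<s. d k) \<ge> 0" using d(2) by (intro sum_nonneg) (auto simp: s_def)
  have \<kappa>2: "\<kappa>\<^sup>2 = (\<Sum>k<s. d k)" and \<kappa>0: "\<kappa> \<ge> 0" unfolding \<kappa>_def ky using d0 by (auto simp: s_def)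
  have Mn: "frob_norm M = \<kappa>"
    by (rule power2_eq_imp_eq) (use \<kappa>2 MM \<kappa>0 in \<open>auto simp: frob_norm_power2\<close>)
  show ?thesis
  proof (rule that[of "(1 / \<kappa>) \<cdot>\<^sub>m M"])
    show "(1 / \<kappa>) \<cdot>\<^sub>m M \<in> carrier_mat m n" using M by simp
    show "mat_rank ((1 / \<kappa>) \<cdot>\<^sub>m M) \<le> r" using mat_rank_smult[OF M, of "1 / \<kappa>"] Mr by simp
    have "(frob_norm ((1 / \<kappa>) \<cdot>\<^sub>m M))\<^sup>2 = (1 / \<kappa>) * ((1 / \<kappa>) * \<kappa>\<^sup>2)"
      unfolding frob_norm_power2 using M MM \<kappa>2
      by (simp add: mat_inner_smult_left[of _ m n] mat_inner_smult_right[of _ m n])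
    also have "\<dots> \<le> 1\<^sup>2" by (simp add: power2_eq_square)
    finally show "frob_norm ((1 / \<kappa>) \<cdot>\<^sub>m M) \<le> 1" by (rule power2_le_imp_le) simp
    have "mat_inner ((1 / \<kappa>) \<cdot>\<^sub>m M) W = (1 / \<kappa>) * \<kappa>\<^sup>2"
      using mat_inner_smult_left[OF M] MW \<kappa>2 by simp
    then show "mat_inner ((1 / \<kappa>) \<cdot>\<^sub>m M) W = ky_fan_2 r W" by (simp add: \<kappa>_def power2_eq_square)
  qed
qed

text \<open>Each of the top \<open>r\<close> squared singular values is at most the largest, and the
  largest singular value is the bilinear form at the leading singular pair. The lemma reduces the Ky
  Fan norm to a process indexed by two unit vectors.\<close>

lemma ky_fan_2_top_pair:
  fixes W :: "real mat"
  assumes W: "W \<in> carrier_mat m n" and "m \<ge> 1" "n \<ge> 1"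
  obtains u v where "(\<Sum>i<m. (u i)\<^sup>2) = 1" "(\<Sum>j<n. (v j)\<^sup>2) = 1"
    "ky_fan_2 r W \<le> sqrt (real r) * (\<Sum>i<m. \<Sum>j<n. u i * v j * W $$ (i, j))"
proof -
  obtain H d where H: "H \<in> carrier_mat n n" "transpose_mat H * H = 1\<^sub>m n"
      and N: "transpose_mat (W * H) * (W * H) = diag_matrix n d"
      and d: "\<And>i j. i \<le> j \<Longrightarrow> j < n \<Longrightarrow> d j \<le> d i" "\<And>i. i < n \<Longrightarrow> d i \<ge> 0"
    by (rule gram_spectral_sorted[OF W]) (rule that)
  have ky: "ky_fan_2 r W = sqrt (\<Sum>k<min r n. d k)"
    by (rule ky_fan_2_gram_spectral[OF singular_values_gram_spectral[OF W H N d(1)] d(2)])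
  have n0: "0 < n" using assms by simp
  have WH: "W * H \<in> carrier_mat m n" using W H by simp
  have d00: "d 0 \<ge> 0" using d(2) n0 by simp
  have "(\<Sum>k<min r n. d k) \<le> (\<Sum>k<min r n. d 0)" using d by (intro sum_mono) auto
  also have "\<dots> \<le> real r * d 0" using d00 by (simp add: mult_right_mono)
  finally have kr: "ky_fan_2 r W \<le> sqrt (real r) * sqrt (d 0)"
    unfolding ky real_sqrt_mult[symmetric] by (rule real_sqrt_le_mono)
  define v where "v j = H $$ (j, 0)" for j
  have v: "(\<Sum>j<n. (v j)\<^sup>2) = 1"
    using gram_entry[OF H(1) n0 n0] H(2) n0 by (simp add: v_def power2_eq_square)
  have Wv: "(\<Sum>j<n. v j * W $$ (i, j)) = (W * H) $$ (i, 0)" if "i < m" for i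
    using mat_mult_entry[OF W H(1) that n0] by (simp add: v_def mult.commute)
  have g: "(\<Sum>i<m. (W * H) $$ (i, 0) * (W * H) $$ (i, 0)) = d 0"
    using gram_entry[OF WH n0 n0] N n0 by (simp add: diag_matrix_def)
  have val: "(\<Sum>i<m. \<Sum>j<n. u i * v j * W $$ (i, j)) = (\<Sum>i<m. u i * (W * H) $$ (i, 0))" for u
  proof (intro sum.cong refl)
    fix i assume "i \<in> {..<m}"
    then have "u i * (W * H) $$ (i, 0) = u i * (\<Sum>j<n. v j * W $$ (i, j))" using Wv by simp
    then show "(\<Sum>j<n. u i * v j * W $$ (i, j)) = u i * (W * H) $$ (i, 0)"
      by (simp add: sum_distrib_left mult.assoc)
  qed
  show ?thesis
  proof (cases "d 0 = 0")
    case True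
    \<comment> \<open>With largest singular value 0 the form vanishes for every \<open>u\<close>, so
      a coordinate vector will do.\<close>
    have "(\<Sum>i<m. (if i = 0 then 1 else 0 :: real)\<^sup>2) = (\<Sum>i<m. if i = 0 then 1 else 0)" by (intro sum.cong) auto
    then have u: "(\<Sum>i<m. (if i = 0 then 1 else 0 :: real)\<^sup>2) = 1" using assms by simp
    have "(\<Sum>i<m. (W * H) $$ (i, 0) * (W * H) $$ (i, 0)) = 0" using g True by simp
    then have "(W * H) $$ (i, 0) = 0" if "i < m" for i
      using that by (subst (asm) sum_nonneg_eq_0_iff) auto
    then show ?thesis using that[OF u v] kr True unfolding val by simp
  next
    case False
    then have dp: "d 0 > 0" using d00 by simp
    define u where "u i = (W * H) $$ (i, 0) / sqrt (d 0)" for i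
    have u: "(\<Sum>i<m. (u i)\<^sup>2) = 1"
      using g dp by (simp add: u_def power_divide sum_divide_distrib[symmetric]) (simp add: power2_eq_square)
    have "(\<Sum>i<m. u i * (W * H) $$ (i, 0)) = d 0 / sqrt (d 0)"
      unfolding g[symmetric] sum_divide_distrib by (intro sum.cong) (auto simp: u_def g)
    also have "\<dots> = sqrt (d 0)" using dp by (simp add: real_div_sqrt)
    finally show ?thesis using that[OF u v] kr unfolding val by simp
  qed
qed

section \<open>Gaussian matrices restricted to the image of the design\<close>

lemma gauss_space_eq: "gauss_space m n = gaussian ({..<m} \<times> {..<n})"
  unfolding gauss_space_def gaussian_def ..

lemma mat_inner_mat:
  fixes \<omega> :: "nat \<times> nat \<Rightarrow> real"
  assumes "M \<in> carrier_mat m n"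
  shows "mat_inner M (mat m n \<omega>) = (\<Sum>x\<in>{..<m} \<times> {..<n}. M $$ x * \<omega> x)"
  unfolding mat_inner_eq[OF assms] by (intro sum.cong) auto

lemma mat_entry_le_frob_norm:
  assumes M: "M \<in> carrier_mat m n" and x: "x \<in> {..<m} \<times> {..<n}"
  shows "\<bar>M $$ x\<bar> \<le> frob_norm M"
proof -
  have "M $$ x * M $$ x \<le> (\<Sum>x\<in>{..<m} \<times> {..<n}. M $$ x * M $$ x)"
    by (rule member_le_sum[OF x]) auto
  then have "(M $$ x)\<^sup>2 \<le> (frob_norm M)\<^sup>2"
    unfolding frob_norm_power2 mat_inner_eq[OF M] power2_eq_square[of "M $$ x"] .
  then show ?thesis using abs_le_square_iff[of "M $$ x" "frob_norm M"] by simp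
qed

lemma frob_norm_smult:
  assumes M: "M \<in> carrier_mat m n"
  shows "frob_norm (c \<cdot>\<^sub>m M) = \<bar>c\<bar> * frob_norm M"
proof (rule power2_eq_imp_eq)
  show "(frob_norm (c \<cdot>\<^sub>m M))\<^sup>2 = (\<bar>c\<bar> * frob_norm M)\<^sup>2"
    unfolding power_mult_distrib frob_norm_power2 mat_inner_smult_left[OF M] mat_inner_smult_right[OF M M]
    by (simp add: power2_eq_square)
qed auto

text \<open>The supremum of the inner product with a matrix over this set is its Ky Fan norm; the
  set is not convex, which does no harm.\<close>

definition rank_ball :: "nat \<Rightarrow> nat \<Rightarrow> nat \<Rightarrow> real mat set" where
  "rank_ball q n r = {M \<in> carrier_mat q n. mat_rank M \<le> r \<and> frob_norm M \<le> 1}"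

lemma rank_ball_nonempty: "rank_ball q n r \<noteq> {}"
proof -
  obtain M where "M \<in> carrier_mat q n" "mat_rank M \<le> r" "frob_norm M \<le> 1"
    by (rule ky_fan_2_attained[of "0\<^sub>m q n" q n r]) auto
  then show ?thesis unfolding rank_ball_def by auto
qed

lemma rank_ball_bounded: "\<forall>M\<in>rank_ball q n r. \<forall>x\<in>{..<q} \<times> {..<n}. \<bar>M $$ x\<bar> \<le> 1"
proof (intro ballI)
  fix M :: "real mat" and x assume "M \<in> rank_ball q n r" "x \<in> {..<q} \<times> {..<n}"
  then show "\<bar>M $$ x\<bar> \<le> 1"
    using mat_entry_le_frob_norm[of M q n x] unfolding rank_ball_def by (auto intro: order_trans)
qed

text \<open>Duality, from the maximum principle and its attainment. It makes
  \<open>gauss_ky_fan\<close> the mean of a supremum of linear forms, and so opens it to the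
  comparison theorem.\<close>

lemma ky_fan_2_eq_lin_sup:
  fixes \<omega> :: "nat \<times> nat \<Rightarrow> real"
  shows "ky_fan_2 r (mat q n \<omega>) = lin_sup ({..<q} \<times> {..<n}) (\<lambda>M x. M $$ x) (rank_ball q n r) \<omega>"
proof (rule antisym)
  obtain M where M: "M \<in> carrier_mat q n" "mat_rank M \<le> r" "frob_norm M \<le> 1" "mat_inner M (mat q n \<omega>) = ky_fan_2 r (mat q n \<omega>)"
    by (rule ky_fan_2_attained[of "mat q n \<omega>" q n r]) auto
  then have "M \<in> rank_ball q n r" by (simp add: rank_ball_def)
  then show "ky_fan_2 r (mat q n \<omega>) \<le> lin_sup ({..<q} \<times> {..<n}) (\<lambda>M x. M $$ x) (rank_ball q n r) \<omega>"
    using lin_sup_upper[of "{..<q} \<times> {..<n}" "rank_ball q n r" "\<lambda>M x. M $$ x" 1 M \<omega>] rank_ball_bounded M(4)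
      mat_inner_mat[OF M(1), of \<omega>] by simp
next
  have ky0: "ky_fan_2 r (mat q n \<omega>) \<ge> 0" unfolding ky_fan_2_def by (intro real_sqrt_ge_zero sum_nonneg) auto
  show "lin_sup ({..<q} \<times> {..<n}) (\<lambda>M x. M $$ x) (rank_ball q n r) \<omega> \<le> ky_fan_2 r (mat q n \<omega>)"
  proof (rule lin_sup_least[OF rank_ball_nonempty])
    fix M :: "real mat" assume "M \<in> rank_ball q n r"
    then have M: "M \<in> carrier_mat q n" "mat_rank M \<le> r" "frob_norm M \<le> 1" by (auto simp: rank_ball_def)
    have "mat_inner M (mat q n \<omega>) \<le> frob_norm M * ky_fan_2 r (mat q n \<omega>)"
      by (rule mat_inner_le_ky_fan_2[OF M(1,2)]) simp
    also have "\<dots> \<le> 1 * ky_fan_2 r (mat q n \<omega>)" by (rule mult_right_mono[OF M(3) ky0])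
    finally show "(\<Sum>x\<in>{..<q} \<times> {..<n}. M $$ x * \<omega> x) \<le> ky_fan_2 r (mat q n \<omega>)"
      unfolding mat_inner_mat[OF M(1)] by simp
  qed
qed

lemma gauss_ky_fan_eq:
  "gauss_ky_fan q n r = (\<integral>\<omega>. lin_sup ({..<q} \<times> {..<n}) (\<lambda>M x. M $$ x) (rank_ball q n r) \<omega> \<partial>gaussian ({..<q} \<times> {..<n}))"
  unfolding gauss_ky_fan_def gauss_space_eq ky_fan_2_eq_lin_sup ..

lemma gauss_ky_fan_nonneg: "gauss_ky_fan q n r \<ge> 0"
  unfolding gauss_ky_fan_def ky_fan_2_def
  by (intro Bochner_Integration.integral_nonneg real_sqrt_ge_zero sum_nonneg) auto

text \<open>Jensen's inequality for the square root, through its tangent at the mean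
  \<open>c\<close> of the sum; the tangent also supplies the integrable majorant. The injection
  \<open>f\<close> places the vector on one block of a larger coordinate space.\<close>

lemma expectation_sqrt_sum_squares:
  fixes f :: "'j \<Rightarrow> 'i"
  assumes K: "finite K" "inj_on f J" "f ` J \<subseteq> K" and J: "finite J" "J \<noteq> {}"
  shows "integrable (gaussian K) (\<lambda>\<omega>. sqrt (\<Sum>j\<in>J. (\<omega> (f j))\<^sup>2))"
    and "(\<integral>\<omega>. sqrt (\<Sum>j\<in>J. (\<omega> (f j))\<^sup>2) \<partial>gaussian K) \<le> sqrt (card J)"
proof -
  interpret prob_space "gaussian K" by (rule prob_space_gaussian)
  define c where "c = real (card J)"
  have c: "c > 0" using J by (simp add: c_def card_gt_0_iff)
  have fj: "f j \<in> K" if "j \<in> J" for j using K that by auto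
  have iS: "integrable (gaussian K) (\<lambda>\<omega>. \<Sum>j\<in>J. (\<omega> (f j))\<^sup>2)"
    by (intro Bochner_Integration.integrable_sum gaussian_square_integrable fj)
  have bd: "sqrt S \<le> (S / sqrt c + sqrt c) / 2" if "S \<ge> 0" for S
  proof -
    have "0 \<le> (sqrt S - sqrt c)\<^sup>2" by simp
    then have "2 * sqrt S * sqrt c \<le> S + c" using that c by (simp add: power2_diff)
    then have "2 * sqrt S \<le> (S + c) / sqrt c" using c by (simp add: pos_le_divide_eq)
    also have "\<dots> = S / sqrt c + sqrt c" using c by (simp add: add_divide_distrib real_div_sqrt)
    finally show ?thesis by simp
  qed
  have S0: "(\<Sum>j\<in>J. (\<omega> (f j))\<^sup>2) \<ge> 0" for \<omega> :: "'i \<Rightarrow> real" by (intro sum_nonneg) auto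
  have ib: "integrable (gaussian K) (\<lambda>\<omega>. ((\<Sum>j\<in>J. (\<omega> (f j))\<^sup>2) / sqrt c + sqrt c) / 2)"
    using iS by (intro integrable_divide Bochner_Integration.integrable_add) auto
  show i: "integrable (gaussian K) (\<lambda>\<omega>. sqrt (\<Sum>j\<in>J. (\<omega> (f j))\<^sup>2))"
  proof (rule Bochner_Integration.integrable_bound[OF ib])
    show "(\<lambda>\<omega>. sqrt (\<Sum>j\<in>J. (\<omega> (f j))\<^sup>2)) \<in> borel_measurable (gaussian K)"
      using borel_measurable_integrable[OF iS] by measurable
    show "AE \<omega> in gaussian K. norm (sqrt (\<Sum>j\<in>J. (\<omega> (f j))\<^sup>2)) \<le> norm (((\<Sum>j\<in>J. (\<omega> (f j))\<^sup>2) / sqrt c + sqrt c) / 2)"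
    proof (rule AE_I2)
      fix \<omega> :: "'i \<Rightarrow> real"
      show "norm (sqrt (\<Sum>j\<in>J. (\<omega> (f j))\<^sup>2)) \<le> norm (((\<Sum>j\<in>J. (\<omega> (f j))\<^sup>2) / sqrt c + sqrt c) / 2)"
        unfolding real_norm_def using bd[OF S0, of \<omega>] real_sqrt_ge_zero[OF S0, of \<omega>] by linarith
    qed
  qed
  have "(\<integral>\<omega>. sqrt (\<Sum>j\<in>J. (\<omega> (f j))\<^sup>2) \<partial>gaussian K)
      \<le> (\<integral>\<omega>. ((\<Sum>j\<in>J. (\<omega> (f j))\<^sup>2) / sqrt c + sqrt c) / 2 \<partial>gaussian K)"
    by (intro integral_mono i ib bd S0)
  also have "\<dots> = ((\<integral>\<omega>. (\<Sum>j\<in>J. (\<omega> (f j))\<^sup>2) \<partial>gaussian K) / sqrt c + sqrt c) / 2"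
    using iS by (simp add: prob_space)
  also have "(\<integral>\<omega>. (\<Sum>j\<in>J. (\<omega> (f j))\<^sup>2) \<partial>gaussian K) = c"
  proof -
    have "(\<integral>\<omega>. (\<Sum>j\<in>J. (\<omega> (f j))\<^sup>2) \<partial>gaussian K) = (\<Sum>j\<in>J. \<integral>\<omega>. (\<omega> (f j))\<^sup>2 \<partial>gaussian K)"
      by (rule Bochner_Integration.integral_sum) (intro gaussian_square_integrable fj)
    also have "\<dots> = (\<Sum>j\<in>J. 1)" by (intro sum.cong refl gaussian_square_integral fj)
    finally show ?thesis by (simp add: c_def)
  qed
  also have "(c / sqrt c + sqrt c) / 2 = sqrt c" using c by (simp add: real_div_sqrt)
  finally show "(\<integral>\<omega>. sqrt (\<Sum>j\<in>J. (\<omega> (f j))\<^sup>2) \<partial>gaussian K) \<le> sqrt (card J)" by (simp add: c_def)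
qed

text \<open>Chevet's inequality, obtained by comparing the process \<open>u\<^sup>T G v\<close> with \<open>u \<bullet> g + v \<bullet> h\<close>.\<close>

theorem gauss_ky_fan_le:
  assumes q: "q \<ge> 1" and n: "n \<ge> 1"
  shows "gauss_ky_fan q n r \<le> sqrt (real r) * (sqrt (real q) + sqrt (real n))"
proof -
  \<comment> \<open>Only the first \<open>q\<close> and the first \<open>n\<close> values are
    constrained, as the forms read no others.\<close>
  define T where "T = {(u :: nat \<Rightarrow> real, v :: nat \<Rightarrow> real). (\<Sum>i<q. (u i)\<^sup>2) = 1 \<and> (\<Sum>j<n. (v j)\<^sup>2) = 1}"
  let ?I = "{..<q} \<times> {..<n}" and ?J = "{..<q} <+> {..<n}"
  define a where "a = (\<lambda>(u :: nat \<Rightarrow> real, v :: nat \<Rightarrow> real) (i, j). u i * v j)"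
  define b :: "(nat \<Rightarrow> real) \<times> (nat \<Rightarrow> real) \<Rightarrow> nat + nat \<Rightarrow> real"
    where "b = (\<lambda>(u, v) x. case x of Inl i \<Rightarrow> u i | Inr j \<Rightarrow> v j)"
  have coord: "\<bar>u i\<bar> \<le> 1" if "(\<Sum>i<k. (u i)\<^sup>2) = 1" "i < k" for u :: "nat \<Rightarrow> real" and i k
  proof -
    have "(u i)\<^sup>2 \<le> (\<Sum>i<k. (u i)\<^sup>2)" by (rule member_le_sum) (use that in auto)
    then show ?thesis using that by (simp add: abs_square_le_1)
  qed
  have bda: "\<forall>k\<in>T. \<forall>x\<in>?I. \<bar>a k x\<bar> \<le> 1"
  proof (intro ballI)
    fix k x assume k: "k \<in> T" "x \<in> ?I"
    obtain u v i j where e: "k = (u, v)" "x = (i, j)" by (cases k; cases x) auto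
    have "\<bar>u i\<bar> * \<bar>v j\<bar> \<le> 1 * 1" using k e coord[where u = u and k = q] coord[where u = v and k = n] by (intro mult_mono) (auto simp: T_def)
    then show "\<bar>a k x\<bar> \<le> 1" by (simp add: a_def e abs_mult)
  qed
  have bdb: "\<forall>k\<in>T. \<forall>x\<in>?J. \<bar>b k x\<bar> \<le> 1"
  proof (intro ballI)
    fix k x assume k: "k \<in> T" "x \<in> ?J"
    obtain u v where e: "k = (u, v)" by (cases k)
    show "\<bar>b k x\<bar> \<le> 1" unfolding e using k e coord[where u = u and k = q] coord[where u = v and k = n] by (cases x) (auto simp: T_def b_def)
  qed
  have pair: "\<exists>k\<in>T. ky_fan_2 r (mat q n \<omega>) \<le> sqrt (real r) * (\<Sum>x\<in>?I. a k x * \<omega> x)" for \<omega> :: "nat \<times> nat \<Rightarrow> real"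
  proof -
    obtain u v where uv: "(\<Sum>i<q. (u i)\<^sup>2) = 1" "(\<Sum>j<n. (v j)\<^sup>2) = 1"
      "ky_fan_2 r (mat q n \<omega>) \<le> sqrt (real r) * (\<Sum>i<q. \<Sum>j<n. u i * v j * mat q n \<omega> $$ (i, j))"
      by (rule ky_fan_2_top_pair[of "mat q n \<omega>" q n r]) (use q n in auto)
    have "(\<Sum>i<q. \<Sum>j<n. u i * v j * mat q n \<omega> $$ (i, j)) = (\<Sum>x\<in>?I. a (u, v) x * \<omega> x)"
      unfolding sum.cartesian_product by (intro sum.cong) (auto simp: a_def)
    then show ?thesis using uv by (intro bexI[of _ "(u, v)"]) (auto simp: T_def)
  qed
  then have T: "T \<noteq> {}" by blast
  have fI: "finite ?I" and fJ: "finite ?J" by auto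
  have ia: "integrable (gaussian ?I) (lin_sup ?I a T)" by (rule lin_sup_integrable[OF fI bda _ T]) simp
  have ik: "integrable (gaussian ?I) (\<lambda>\<omega>. ky_fan_2 r (mat q n \<omega>))"
    unfolding ky_fan_2_eq_lin_sup
    using lin_sup_integrable[OF fI rank_ball_bounded _ rank_ball_nonempty] by simp
  have "gauss_ky_fan q n r \<le> (\<integral>\<omega>. sqrt (real r) * lin_sup ?I a T \<omega> \<partial>gaussian ?I)"
    unfolding gauss_ky_fan_def gauss_space_eq
  proof (intro integral_mono ik integrable_mult_right ia)
    fix \<omega> :: "nat \<times> nat \<Rightarrow> real"
    obtain k where k: "k \<in> T" "ky_fan_2 r (mat q n \<omega>) \<le> sqrt (real r) * (\<Sum>x\<in>?I. a k x * \<omega> x)" using pair by blast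
    have "(\<Sum>x\<in>?I. a k x * \<omega> x) \<le> lin_sup ?I a T \<omega>" by (rule lin_sup_upper[OF fI bda _ k(1)]) simp
    then show "ky_fan_2 r (mat q n \<omega>) \<le> sqrt (real r) * lin_sup ?I a T \<omega>"
      using k(2) mult_left_mono[of _ "lin_sup ?I a T \<omega>" "sqrt (real r)"] by (meson order_trans real_sqrt_ge_zero of_nat_0_le_iff)
  qed
  also have "\<dots> = sqrt (real r) * (\<integral>\<omega>. lin_sup ?I a T \<omega> \<partial>gaussian ?I)" by simp
  also have "\<dots> \<le> sqrt (real r) * (sqrt (real q) + sqrt (real n))"
  proof (rule mult_left_mono)
    have "(\<integral>\<omega>. lin_sup ?I a T \<omega> \<partial>gaussian ?I) \<le> (\<integral>\<omega>. lin_sup ?J b T \<omega> \<partial>gaussian ?J)"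
    proof (rule sudakov_fernique[OF fI fJ T _ bda bdb])
      fix k l assume kl: "k \<in> T" "l \<in> T"
      obtain u v u' v' where e: "k = (u, v)" "l = (u', v')" by (cases k; cases l) auto
      have s: "(\<Sum>i<q. (u i)\<^sup>2) = 1" "(\<Sum>j<n. (v j)\<^sup>2) = 1" "(\<Sum>i<q. (u' i)\<^sup>2) = 1" "(\<Sum>j<n. (v' j)\<^sup>2) = 1"
        using kl e by (auto simp: T_def)
      define A where "A = (\<Sum>i<q. u i * u' i)"
      define B where "B = (\<Sum>j<n. v j * v' j)"
      have sq: "(\<Sum>i<k. (u i - u' i)\<^sup>2) = (\<Sum>i<k. (u i)\<^sup>2) + (\<Sum>i<k. (u' i)\<^sup>2) - 2 * (\<Sum>i<k. u i * u' i)"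
        for u u' :: "nat \<Rightarrow> real" and k
        by (simp add: power2_diff sum.distrib sum_subtractf sum_distrib_left mult.assoc)
      have du: "(\<Sum>i<q. (u i - u' i)\<^sup>2) = 2 - 2 * A" and dv: "(\<Sum>j<n. (v j - v' j)\<^sup>2) = 2 - 2 * B"
        unfolding sq A_def B_def s by simp_all
      have "(\<Sum>i<q. (u i - u' i)\<^sup>2) \<ge> 0" "(\<Sum>j<n. (v j - v' j)\<^sup>2) \<ge> 0" by (auto intro: sum_nonneg)
      then have AB: "A \<le> 1" "B \<le> 1" unfolding du dv by auto
      have "(\<Sum>x\<in>?I. (a k x - a l x)\<^sup>2) = (\<Sum>i<q. \<Sum>j<n. (u i * v j - u' i * v' j)\<^sup>2)"
        unfolding sum.cartesian_product by (intro sum.cong) (auto simp: a_def e)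
      also have "\<dots> = (\<Sum>i<q. \<Sum>j<n. (u i)\<^sup>2 * (v j)\<^sup>2 + (u' i)\<^sup>2 * (v' j)\<^sup>2 - 2 * ((u i * u' i) * (v j * v' j)))"
        by (intro sum.cong refl) (simp add: power2_eq_square algebra_simps)
      \<comment> \<open>The increment of the bilinear process is at most that of the sum process
        because \<open>(1 - A) * (1 - B)\<close> is nonnegative.\<close>
      also have "\<dots> = 1 * 1 + 1 * 1 - 2 * (A * B)"
        by (simp add: sum.distrib sum_subtractf sum_distrib_left[symmetric] sum_distrib_right[symmetric] s A_def B_def)
      also have "\<dots> \<le> (2 - 2 * A) + (2 - 2 * B)"
        using mult_nonneg_nonneg[of "1 - A" "1 - B"] AB by (simp add: algebra_simps)
      also have "\<dots> = (\<Sum>x\<in>?J. (b k x - b l x)\<^sup>2)"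
        unfolding du[symmetric] dv[symmetric] by (simp add: sum.Plus b_def e)
      finally show "(\<Sum>x\<in>?I. (a k x - a l x)\<^sup>2) \<le> (\<Sum>x\<in>?J. (b k x - b l x)\<^sup>2)" .
    qed simp
    also have "\<dots> \<le> (\<integral>\<omega>. sqrt (\<Sum>i<q. (\<omega> (Inl i))\<^sup>2) + sqrt (\<Sum>j<n. (\<omega> (Inr j))\<^sup>2) \<partial>gaussian ?J)"
    proof (intro integral_mono Bochner_Integration.integrable_add)
      show "integrable (gaussian ?J) (lin_sup ?J b T)" by (rule lin_sup_integrable[OF fJ bdb _ T]) simp
      show "integrable (gaussian ?J) (\<lambda>\<omega>. sqrt (\<Sum>i<q. (\<omega> (Inl i))\<^sup>2))"
        by (rule expectation_sqrt_sum_squares(1)) (use q in \<open>auto intro: inj_onI simp: lessThan_empty_iff\<close>)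
      show "integrable (gaussian ?J) (\<lambda>\<omega>. sqrt (\<Sum>j<n. (\<omega> (Inr j))\<^sup>2))"
        by (rule expectation_sqrt_sum_squares(1)) (use n in \<open>auto intro: inj_onI simp: lessThan_empty_iff\<close>)
      fix \<omega> :: "nat + nat \<Rightarrow> real"
      show "lin_sup ?J b T \<omega> \<le> sqrt (\<Sum>i<q. (\<omega> (Inl i))\<^sup>2) + sqrt (\<Sum>j<n. (\<omega> (Inr j))\<^sup>2)"
      proof (rule lin_sup_least[OF T])
        fix k assume k: "k \<in> T"
        obtain u v where e: "k = (u, v)" by (cases k)
        have cs: "(\<Sum>i<p. u i * w i) \<le> sqrt (\<Sum>i<p. (w i)\<^sup>2)" if "(\<Sum>i<p. (u i)\<^sup>2) = 1" for u w :: "nat \<Rightarrow> real" and p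
          using Cauchy_Schwarz_ineq_sum[of u w "{..<p}"] that by (intro real_le_rsqrt) simp
        have "(\<Sum>x\<in>?J. b k x * \<omega> x) = (\<Sum>i<q. u i * \<omega> (Inl i)) + (\<Sum>j<n. v j * \<omega> (Inr j))"
          by (simp add: sum.Plus b_def e)
        also have "\<dots> \<le> sqrt (\<Sum>i<q. (\<omega> (Inl i))\<^sup>2) + sqrt (\<Sum>j<n. (\<omega> (Inr j))\<^sup>2)"
          using k by (intro add_mono cs) (auto simp: T_def e)
        finally show "(\<Sum>x\<in>?J. b k x * \<omega> x) \<le> sqrt (\<Sum>i<q. (\<omega> (Inl i))\<^sup>2) + sqrt (\<Sum>j<n. (\<omega> (Inr j))\<^sup>2)" .
      qed
    qed
    also have "\<dots> = (\<integral>\<omega>. sqrt (\<Sum>i<q. (\<omega> (Inl i))\<^sup>2) \<partial>gaussian ?J) + (\<integral>\<omega>. sqrt (\<Sum>j<n. (\<omega> (Inr j))\<^sup>2) \<partial>gaussian ?J)"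
      by (intro Bochner_Integration.integral_add expectation_sqrt_sum_squares(1)) (use q n in \<open>auto intro: inj_onI simp: lessThan_empty_iff\<close>)
    also have "\<dots> \<le> sqrt (card {..<q}) + sqrt (card {..<n})"
      by (intro add_mono expectation_sqrt_sum_squares(2)) (use q n in \<open>auto intro: inj_onI simp: lessThan_empty_iff\<close>)
    finally show "(\<integral>\<omega>. lin_sup ?I a T \<omega> \<partial>gaussian ?I) \<le> sqrt (real q) + sqrt (real n)" by simp
  qed simp
  finally show ?thesis .
qed

section \<open>Noise suprema over the image of the design\<close>

text \<open>The rank constraint is on the coefficient matrix, the norm constraint on its image.
  \<open>B\<close> itself may be unbounded, which is harmless because the linear forms involve only
  the entries of \<open>X * B\<close>.\<close>

definition image_ball :: "real mat \<Rightarrow> nat \<Rightarrow> nat \<Rightarrow> real mat set" where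
  "image_ball X n r = {B \<in> carrier_mat (dim_col X) n. mat_rank B \<le> r \<and> frob_norm (X * B) \<le> 1}"

definition image_sup :: "real mat \<Rightarrow> nat \<Rightarrow> nat \<Rightarrow> (nat \<times> nat \<Rightarrow> real) \<Rightarrow> real" where
  "image_sup X n r = lin_sup ({..<dim_row X} \<times> {..<n}) (\<lambda>B x. (X * B) $$ x) (image_ball X n r)"

lemma zero_in_image_ball: "0\<^sub>m (dim_col X) n \<in> image_ball X n r"
proof -
  have "mat_rank (0\<^sub>m (dim_col X) n) = 0"
    using vec_space.rank_0I[of "dim_col X" n, where ?'a = real] by (simp add: mat_rank_def)
  then show ?thesis by (auto simp: image_ball_def frob_norm_def)
qed

lemma image_ball_bounded: "\<forall>B\<in>image_ball X n r. \<forall>x\<in>{..<dim_row X} \<times> {..<n}. \<bar>(X * B) $$ x\<bar> \<le> 1"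
proof (intro ballI)
  fix B :: "real mat" and x assume B: "B \<in> image_ball X n r" "x \<in> {..<dim_row X} \<times> {..<n}"
  then have "X * B \<in> carrier_mat (dim_row X) n" by (auto simp: image_ball_def)
  then show "\<bar>(X * B) $$ x\<bar> \<le> 1"
    using mat_entry_le_frob_norm[of "X * B" "dim_row X" n x] B unfolding image_ball_def by auto
qed

lemma image_sup_integrable: "integrable (gaussian ({..<dim_row X} \<times> {..<n})) (image_sup X n r)"
  unfolding image_sup_def
  by (rule lin_sup_integrable[OF _ image_ball_bounded]) (use zero_in_image_ball in auto)

lemma image_sup_square_integrable:
  "integrable (gaussian ({..<dim_row X} \<times> {..<n})) (\<lambda>\<omega>. (image_sup X n r \<omega>)\<^sup>2)"
  unfolding image_sup_def
  by (rule lin_sup_square_integrable[OF _ image_ball_bounded]) (use zero_in_image_ball in auto)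

text \<open>The coefficient vectors lie in the Euclidean unit ball, so the fluctuation bound depends
  on no dimension and not on the rank.\<close>

lemma image_sup_variance:
  "(\<integral>\<omega>. (image_sup X n r \<omega> - (\<integral>\<omega>. image_sup X n r \<omega> \<partial>gaussian ({..<dim_row X} \<times> {..<n})))\<^sup>2
      \<partial>gaussian ({..<dim_row X} \<times> {..<n})) \<le> 6"
  unfolding image_sup_def
proof (rule lin_sup_variance)
  show "image_ball X n r \<noteq> {}" using zero_in_image_ball by blast
  fix B assume B: "B \<in> image_ball X n r"
  then have c: "X * B \<in> carrier_mat (dim_row X) n" by (auto simp: image_ball_def)
  have "(\<Sum>x\<in>{..<dim_row X} \<times> {..<n}. ((X * B) $$ x)\<^sup>2) = (frob_norm (X * B))\<^sup>2"
    unfolding frob_norm_power2 mat_inner_eq[OF c] by (simp add: power2_eq_square)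
  also have "\<dots> \<le> 1" using B by (auto simp: image_ball_def power_le_one)
  finally show "(\<Sum>x\<in>{..<dim_row X} \<times> {..<n}. ((X * B) $$ x)\<^sup>2) \<le> 1" .
qed simp

lemma image_sup_nonneg: "image_sup X n r \<omega> \<ge> 0"
proof -
  have "(\<Sum>x\<in>{..<dim_row X} \<times> {..<n}. (X * 0\<^sub>m (dim_col X) n) $$ x * \<omega> x) \<le> image_sup X n r \<omega>"
    unfolding image_sup_def by (rule lin_sup_upper[OF _ image_ball_bounded _ zero_in_image_ball]) auto
  moreover have "(\<Sum>x\<in>{..<dim_row X} \<times> {..<n}. (X * 0\<^sub>m (dim_col X) n) $$ x * \<omega> x) = 0"
    by (intro sum.neutral) auto
  ultimately show ?thesis by simp
qed

text \<open>By homogeneity, after scaling \<open>B\<close> to unit image norm. When the image norm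
  is 0 the inner product vanishes as well.\<close>

lemma mat_inner_le_image_sup:
  fixes \<omega> :: "nat \<times> nat \<Rightarrow> real"
  assumes X: "X \<in> carrier_mat m p" and B: "B \<in> carrier_mat p n" "mat_rank B \<le> r"
  shows "mat_inner (X * B) (mat m n \<omega>) \<le> frob_norm (X * B) * image_sup X n r \<omega>"
proof (cases "frob_norm (X * B) = 0")
  case True
  have "\<bar>mat_inner (X * B) (mat m n \<omega>)\<bar> \<le> frob_norm (X * B) * frob_norm (mat m n \<omega>)"
    by (rule mat_inner_abs_le[of _ m n]) (use X B in auto)
  then show ?thesis using True by simp
next
  case False
  define t where "t = frob_norm (X * B)"
  have t: "t > 0" using False frob_norm_nonneg[of "X * B"] unfolding t_def by linarith
  have XB: "X * B \<in> carrier_mat m n" using X B by simp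
  define B' where "B' = (1 / t) \<cdot>\<^sub>m B"
  have B': "B' \<in> carrier_mat p n" using B by (simp add: B'_def)
  have XB': "X * B' = (1 / t) \<cdot>\<^sub>m (X * B)" unfolding B'_def by (rule mult_smult_distrib[OF X B(1)])
  have "frob_norm (X * B') = 1" unfolding XB' frob_norm_smult[OF XB] using t by (simp add: t_def)
  moreover have "mat_rank B' \<le> r" unfolding B'_def using mat_rank_smult[OF B(1), of "1 / t"] B(2) by simp
  ultimately have "B' \<in> image_ball X n r" using B' X by (auto simp: image_ball_def)
  then have "(\<Sum>x\<in>{..<dim_row X} \<times> {..<n}. (X * B') $$ x * \<omega> x) \<le> image_sup X n r \<omega>"
    unfolding image_sup_def by (intro lin_sup_upper[OF _ image_ball_bounded]) auto
  then have "mat_inner (X * B') (mat m n \<omega>) \<le> image_sup X n r \<omega>"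
    using mat_inner_mat[of "X * B'" m n \<omega>] X B' by simp
  then have "1 / t * mat_inner (X * B) (mat m n \<omega>) \<le> image_sup X n r \<omega>"
    unfolding XB' mat_inner_smult_left[OF XB] .
  then show ?thesis using t unfolding t_def[symmetric] by (simp add: field_simps)
qed

text \<open>The noise has \<open>m\<close> rows, but the image of \<open>X\<close> has only the
  dimension of its rank. A factor \<open>C\<close> with the Gram matrix of \<open>X\<close> gives
  processes over \<open>X * B\<close> and \<open>C * B\<close> with equal increments, so
  Sudakov-Fernique stands in for rotation invariance of the noise; on the smaller space
  \<open>C * B\<close> lies in the rank ball.\<close>

lemma expectation_image_sup_le:
  assumes X: "X \<in> carrier_mat m p"
  shows "(\<integral>\<omega>. image_sup X n r \<omega> \<partial>gaussian ({..<m} \<times> {..<n})) \<le> gauss_ky_fan (mat_rank X) n r"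
proof -
  let ?q = "mat_rank X"
  let ?I = "{..<m} \<times> {..<n}" and ?J = "{..<?q} \<times> {..<n}" and ?T = "image_ball X n r"
  obtain C where C: "C \<in> carrier_mat ?q p" "transpose_mat C * C = transpose_mat X * X"
    by (rule gram_factorization[OF X])
  \<comment> \<open>Both sides are the quadratic form of the shared Gram matrix.\<close>
  have iso: "mat_inner (C * B) (C * B) = mat_inner (X * B) (X * B)" if B: "B \<in> carrier_mat p n" for B
  proof -
    have Xt: "transpose_mat X \<in> carrier_mat p m" and Ct: "transpose_mat C \<in> carrier_mat p ?q" using X C by auto
    have "mat_inner (C * B) (C * B) = mat_inner B (transpose_mat C * (C * B))"
      by (rule mat_inner_mult_left[OF C(1) B]) (use C B in auto)
    also have "transpose_mat C * (C * B) = transpose_mat C * C * B" by (rule assoc_mult_mat[OF Ct C(1) B, symmetric])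
    also have "\<dots> = transpose_mat X * (X * B)" unfolding C(2) by (rule assoc_mult_mat[OF Xt X B])
    also have "mat_inner B (transpose_mat X * (X * B)) = mat_inner (X * B) (X * B)"
      by (rule mat_inner_mult_left[OF X B, symmetric]) (use X B in auto)
    finally show ?thesis .
  qed
  have T: "B \<in> carrier_mat p n" "mat_rank B \<le> r" "frob_norm (X * B) \<le> 1" if "B \<in> ?T" for B
    using that X by (auto simp: image_ball_def)
  have CB: "C * B \<in> rank_ball ?q n r" if "B \<in> ?T" for B
  proof -
    have "frob_norm (C * B) = frob_norm (X * B)"
      by (rule power2_eq_imp_eq) (simp_all only: frob_norm_power2 iso[OF T(1)[OF that]] frob_norm_nonneg)
    moreover have "mat_rank (C * B) \<le> r" using mat_rank_mult_left[OF C(1) T(1)[OF that]] T(2)[OF that] by simp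
    ultimately show ?thesis using T[OF that] C by (simp add: rank_ball_def)
  qed
  have T0: "?T \<noteq> {}" using zero_in_image_ball by blast
  have fI: "finite ?I" and fJ: "finite ?J" by auto
  have bdb: "\<forall>B\<in>?T. \<forall>x\<in>?J. \<bar>(C * B) $$ x\<bar> \<le> 1" using CB rank_ball_bounded by blast
  have bda: "\<forall>B\<in>?T. \<forall>x\<in>?I. \<bar>(X * B) $$ x\<bar> \<le> 1" using image_ball_bounded[of X n r] X by auto
  have "(\<integral>\<omega>. image_sup X n r \<omega> \<partial>gaussian ?I) = (\<integral>\<omega>. lin_sup ?I (\<lambda>B x. (X * B) $$ x) ?T \<omega> \<partial>gaussian ?I)"
    unfolding image_sup_def using X by simp
  also have "\<dots> \<le> (\<integral>\<omega>. lin_sup ?J (\<lambda>B x. (C * B) $$ x) ?T \<omega> \<partial>gaussian ?J)"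
  proof (rule sudakov_fernique[OF fI fJ T0 _ bda bdb])
    fix B B' assume BB: "B \<in> ?T" "B' \<in> ?T"
    have c: "B - B' \<in> carrier_mat p n" using T(1)[OF BB(2)] by (rule minus_carrier_mat)
    have incr: "(\<Sum>x\<in>{..<k} \<times> {..<n}. ((Y * B) $$ x - (Y * B') $$ x)\<^sup>2) = mat_inner (Y * (B - B')) (Y * (B - B'))"
      if Y: "Y \<in> carrier_mat k p" for Y k
    proof -
      have e: "Y * (B - B') = Y * B - Y * B'" by (rule mult_minus_distrib_mat[OF Y T(1)[OF BB(1)] T(1)[OF BB(2)]])
      have c': "Y * B - Y * B' \<in> carrier_mat k n" using Y T(1)[OF BB(2)] by (intro minus_carrier_mat) auto
      show ?thesis unfolding e mat_inner_eq[OF c'] using Y T(1)[OF BB(1)] T(1)[OF BB(2)]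
        by (intro sum.cong refl) (auto simp: power2_eq_square simp del: index_mult_mat(1))
    qed
    show "(\<Sum>x\<in>?I. ((X * B) $$ x - (X * B') $$ x)\<^sup>2) \<le> (\<Sum>x\<in>?J. ((C * B) $$ x - (C * B') $$ x)\<^sup>2)"
      unfolding incr[OF X] incr[OF C(1)] iso[OF c] by simp
  qed simp
  also have "\<dots> \<le> (\<integral>\<omega>. lin_sup ?J (\<lambda>M x. M $$ x) (rank_ball ?q n r) \<omega> \<partial>gaussian ?J)"
  proof (rule integral_mono)
    show "integrable (gaussian ?J) (lin_sup ?J (\<lambda>B x. (C * B) $$ x) ?T)"
      by (rule lin_sup_integrable[OF fJ bdb _ T0]) simp
    show "integrable (gaussian ?J) (lin_sup ?J (\<lambda>M x. M $$ x) (rank_ball ?q n r))"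
      by (rule lin_sup_integrable[OF fJ rank_ball_bounded _ rank_ball_nonempty]) simp
    fix \<omega> :: "nat \<times> nat \<Rightarrow> real"
    show "lin_sup ?J (\<lambda>B x. (C * B) $$ x) ?T \<omega> \<le> lin_sup ?J (\<lambda>M x. M $$ x) (rank_ball ?q n r) \<omega>"
    proof (rule lin_sup_least[OF T0])
      fix B assume "B \<in> ?T"
      then show "(\<Sum>x\<in>?J. (C * B) $$ x * \<omega> x) \<le> lin_sup ?J (\<lambda>M x. M $$ x) (rank_ball ?q n r) \<omega>"
        using lin_sup_upper[OF fJ rank_ball_bounded _ CB, of B \<omega>] by simp
    qed
  qed
  finally show ?thesis unfolding gauss_ky_fan_eq .
qed

text \<open>Let \<open>P\<close> project onto the row space of \<open>B'\<close>. The part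
  \<open>(B - B') * P\<close> has rank at most \<open>r'\<close>; the complement is
  \<open>B * (1 - P)\<close>, since \<open>B' * (1 - P)\<close> vanishes, and has rank at most
  \<open>r\<close>. The images of the two parts are orthogonal, so Pythagoras and Cauchy-Schwarz
  give the root of the sum of squares with no constant lost.\<close>

lemma mat_inner_diff_le_image_sup:
  fixes \<omega> :: "nat \<times> nat \<Rightarrow> real"
  assumes X: "X \<in> carrier_mat m p" and B: "B \<in> carrier_mat p n" "mat_rank B \<le> r"
    and B': "B' \<in> carrier_mat p n" "mat_rank B' \<le> r'"
  shows "mat_inner (X * B - X * B') (mat m n \<omega>)
    \<le> frob_norm (X * B - X * B') * sqrt ((image_sup X n r \<omega>)\<^sup>2 + (image_sup X n r' \<omega>)\<^sup>2)"
proof -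
  obtain V s where V: "V \<in> carrier_mat n s" "s \<le> mat_rank B'" "transpose_mat V * V = 1\<^sub>m s"
      "B' * (V * transpose_mat V) = B'"
    by (rule row_space_projection[OF B'(1)])
  have Vt: "transpose_mat V \<in> carrier_mat s n" using V by simp
  define P where "P = V * transpose_mat V"
  have P: "P \<in> carrier_mat n n" using V by (simp add: P_def)
  have Pt: "transpose_mat P = P" unfolding P_def using transpose_mult[OF V(1) Vt] by simp
  have PP: "P * P = P"
  proof -
    have "P * P = V * (transpose_mat V * (V * transpose_mat V))"
      unfolding P_def by (rule assoc_mult_mat[OF V(1) Vt]) (use V in auto)
    also have "transpose_mat V * (V * transpose_mat V) = transpose_mat V * V * transpose_mat V"
      by (rule assoc_mult_mat[OF Vt V(1) Vt, symmetric])
    also have "\<dots> = transpose_mat V" unfolding V(3) by (rule left_mult_one_mat[OF Vt])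
    finally show ?thesis by (simp add: P_def)
  qed
  define D where "D = B - B'"
  have D: "D \<in> carrier_mat p n" unfolding D_def by (rule minus_carrier_mat[OF B'(1)])
  define M where "M = X * D"
  have M: "M \<in> carrier_mat m n" using X D by (simp add: M_def)
  have Me: "X * B - X * B' = M" unfolding M_def D_def by (rule mult_minus_distrib_mat[OF X B(1) B'(1), symmetric])
  define M1 where "M1 = M * P"
  have M1: "M1 \<in> carrier_mat m n" using M P by (simp add: M1_def)
  define M2 where "M2 = M - M1"
  have M2: "M2 \<in> carrier_mat m n" unfolding M2_def by (rule minus_carrier_mat[OF M1])
  have sum: "M = M1 + M2" using M M1 M2 by (intro eq_matI) (auto simp: M2_def)
  have DP: "D * P \<in> carrier_mat p n" using D P by simp
  have M1e: "M1 = X * (D * P)" unfolding M1_def M_def by (rule assoc_mult_mat[OF X D P])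
  have r1: "mat_rank (D * P) \<le> r'"
  proof -
    have "D * P = D * V * transpose_mat V" unfolding P_def by (rule assoc_mult_mat[OF D V(1) Vt, symmetric])
    then show ?thesis using mat_rank_mult_inner[of "D * V" p s "transpose_mat V" n] D V Vt B'(2) by simp
  qed
  define R where "R = B * (1\<^sub>m n - P)"
  have IP: "1\<^sub>m n - P \<in> carrier_mat n n" by (rule minus_carrier_mat[OF P])
  have R: "R \<in> carrier_mat p n" using B IP by (simp add: R_def)
  have M2e: "M2 = X * R"
  proof -
    have "D - D * P = R"
    proof -
      have "D * P = B * P - B'" unfolding D_def
        using minus_mult_distrib_mat[OF B(1) B'(1) P] V(4) by (simp add: P_def)
      moreover have "R = B - B * P"
        unfolding R_def using mult_minus_distrib_mat[OF B(1) one_carrier_mat P] right_mult_one_mat[OF B(1)] by simp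
      ultimately show ?thesis using B B' P unfolding D_def by (intro eq_matI) (auto simp del: index_mult_mat(1))
    qed
    then show ?thesis unfolding M2_def M1e unfolding M_def
      using mult_minus_distrib_mat[OF X D DP] by simp
  qed
  have r2: "mat_rank R \<le> r" unfolding R_def using mat_rank_mult_right[OF B(1) IP] B(2) by simp
  have MP: "mat_inner M1 M1 = mat_inner M M1"
  proof -
    have "mat_inner M1 M1 = mat_inner M (M1 * P)"
      using mat_inner_mult_right[OF M P M1] Pt by (simp add: M1_def)
    also have "M1 * P = M1" unfolding M1_def using assoc_mult_mat[OF M P P] PP by simp
    finally show ?thesis .
  qed
  have orth: "mat_inner M1 M2 = 0"
    unfolding M2_def mat_inner_diff_right[OF M1 M M1] MP using mat_inner_commute[OF M M1] by simp
  have pyth: "(frob_norm M)\<^sup>2 = (frob_norm M1)\<^sup>2 + (frob_norm M2)\<^sup>2"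
  proof -
    have c: "M1 + M2 \<in> carrier_mat m n" using M1 M2 by simp
    have "mat_inner (M1 + M2) (M1 + M2) = mat_inner M1 M1 + mat_inner M1 M2 + (mat_inner M2 M1 + mat_inner M2 M2)"
      unfolding mat_inner_add_left[OF M1 M2] mat_inner_add_right[OF M1 M1 M2] mat_inner_add_right[OF M2 M1 M2] ..
    then show ?thesis unfolding frob_norm_power2 sum using orth mat_inner_commute[OF M2 M1] by simp
  qed
  let ?k = "image_sup X n r \<omega>" and ?k' = "image_sup X n r' \<omega>"
  have "mat_inner M (mat m n \<omega>) = mat_inner M1 (mat m n \<omega>) + mat_inner M2 (mat m n \<omega>)"
    using mat_inner_add_left[OF M1 M2] sum by simp
  also have "\<dots> \<le> frob_norm M1 * ?k' + frob_norm M2 * ?k"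
    using mat_inner_le_image_sup[OF X DP r1, of \<omega>] mat_inner_le_image_sup[OF X R r2, of \<omega>] unfolding M1e M2e by simp
  also have "\<dots> \<le> frob_norm M * sqrt (?k\<^sup>2 + ?k'\<^sup>2)"
  proof (rule power2_le_imp_le)
    have "0 \<le> (frob_norm M1 * ?k - frob_norm M2 * ?k')\<^sup>2" by simp
    then have "(frob_norm M1 * ?k' + frob_norm M2 * ?k)\<^sup>2
        \<le> ((frob_norm M1)\<^sup>2 + (frob_norm M2)\<^sup>2) * (?k\<^sup>2 + ?k'\<^sup>2)"
      by (simp add: power2_eq_square algebra_simps)
    then show "(frob_norm M1 * ?k' + frob_norm M2 * ?k)\<^sup>2 \<le> (frob_norm M * sqrt (?k\<^sup>2 + ?k'\<^sup>2))\<^sup>2"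
      by (simp add: power_mult_distrib pyth)
  qed simp
  finally show ?thesis unfolding Me .
qed

section \<open>Almost surely nonzero residuals\<close>

text \<open>With the other coordinates fixed and the slope nonzero, the affine function of
  coordinate \<open>i\<close> vanishes at a single point, a null set; Fubini does the rest.\<close>

lemma AE_gaussian_affine_nonzero:
  fixes a b :: "('i \<Rightarrow> real) \<Rightarrow> real"
  assumes I: "finite I" "i \<in> I"
    and m [measurable]: "a \<in> borel_measurable (gaussian I)" "b \<in> borel_measurable (gaussian I)"
    and a: "\<And>\<omega> y. a (fun_upd \<omega> i y) = a \<omega>" and b: "\<And>\<omega> y. b (fun_upd \<omega> i y) = b \<omega>"
  shows "AE \<omega> in gaussian I. b \<omega> \<noteq> 0 \<longrightarrow> a \<omega> + b \<omega> * \<omega> i \<noteq> 0"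
proof -
  interpret product_sigma_finite "\<lambda>_. std_normal_distribution"
    by (rule product_sigma_finite_std_normal)
  interpret G: prob_space "gaussian I" by (rule prob_space_gaussian)
  define J where "J = I - {i}"
  have J: "I = insert i J" "finite J" "i \<notin> J" using I J_def by auto
  define Z where "Z = {\<omega> \<in> space (gaussian I). b \<omega> \<noteq> 0 \<and> a \<omega> + b \<omega> * \<omega> i = 0}"
  have Z [measurable]: "Z \<in> sets (gaussian I)" unfolding Z_def using I by measurable
  \<comment> \<open>The indicator of the bad event, so that the Fubini rule for real integrals over
    one split-off coordinate applies.\<close>
  define f where "f \<omega> = (if b \<omega> \<noteq> 0 \<and> a \<omega> + b \<omega> * \<omega> i = 0 then 1 else (0::real))" for \<omega>
  have fm: "f \<in> borel_measurable (gaussian I)" unfolding f_def using I by measurable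
  have fi: "integrable (gaussian I) f"
    by (rule G.integrable_const_bound[of _ 1]) (use fm in \<open>auto simp: f_def\<close>)
  have inner: "(\<integral>y. f (fun_upd \<omega> i y) \<partial>std_normal_distribution) = 0" for \<omega>
  proof (cases "b \<omega> = 0")
    case True
    then show ?thesis by (simp add: f_def b)
  next
    case False
    have "AE y in std_normal_distribution. y \<noteq> - a \<omega> / b \<omega>"
    proof (subst AE_density)
      show "AE y in lborel. 0 < ennreal (std_normal_density y) \<longrightarrow> y \<noteq> - a \<omega> / b \<omega>"
        using AE_lborel_singleton[of "- a \<omega> / b \<omega>"] by eventually_elim simp
    qed simp
    then have "AE y in std_normal_distribution. f (fun_upd \<omega> i y) = 0"
    proof eventually_elim
      case (elim y)
      then have "a \<omega> + b \<omega> * y \<noteq> 0" using False by (auto simp: field_simps add_eq_0_iff)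
      then show ?case by (simp add: f_def a b)
    qed
    then show ?thesis by (rule integral_eq_zero_AE)
  qed
  have "(\<integral>\<omega>. f \<omega> \<partial>gaussian I) = (\<integral>\<omega>. (\<integral>y. f (fun_upd \<omega> i y) \<partial>std_normal_distribution) \<partial>gaussian J)"
    using product_integral_insert[OF J(2,3) fi[unfolded J(1) gaussian_def]] unfolding J(1) gaussian_def .
  also have "\<dots> = 0" by (simp add: inner)
  finally have z: "(\<integral>\<omega>. f \<omega> \<partial>gaussian I) = 0" .
  have "AE \<omega> in gaussian I. 0 \<le> f \<omega>" by (simp add: f_def)
  from integral_nonneg_eq_0_iff_AE[OF fi this] z have "AE \<omega> in gaussian I. f \<omega> = 0" by blast
  then show ?thesis by eventually_elim (auto simp: f_def split: if_splits)
qed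

text \<open>Laplace expansion along the last row is affine in the noise of the corner entry, with
  slope \<open>\<sigma>\<close> times the next smaller leading minor, which is almost surely nonzero
  by induction.\<close>

lemma AE_gaussian_minor_nonzero:
  fixes c :: "nat \<times> nat \<Rightarrow> real"
  assumes "\<sigma> \<noteq> 0" "k \<le> m" "k \<le> n"
  shows "AE \<omega> in gaussian ({..<m} \<times> {..<n}). det (mat k k (\<lambda>x. c x + \<sigma> * \<omega> x)) \<noteq> 0"
  using assms(2,3)
proof (induction k)
  case 0
  then show ?case by (simp add: det_dim_zero[of "mat 0 0 _"])
next
  case (Suc k)
  let ?I = "{..<m} \<times> {..<n}"
  define A where "A \<omega> = mat (Suc k) (Suc k) (\<lambda>x. c x + \<sigma> * \<omega> x)" for \<omega> :: "nat \<times> nat \<Rightarrow> real"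
  define B where "B \<omega> = mat k k (\<lambda>x. c x + \<sigma> * \<omega> x)" for \<omega> :: "nat \<times> nat \<Rightarrow> real"
  have A: "A \<omega> \<in> carrier_mat (Suc k) (Suc k)" for \<omega> by (simp add: A_def)
  define b where "b \<omega> = \<sigma> * det (B \<omega>)" for \<omega>
  define a where "a \<omega> = c (k, k) * det (B \<omega>) + (\<Sum>j<k. (c (k, j) + \<sigma> * \<omega> (k, j)) * cofactor (A \<omega>) k j)" for \<omega>
  have exp: "det (A \<omega>) = a \<omega> + b \<omega> * \<omega> (k, k)" for \<omega>
  proof -
    have "mat_delete (A \<omega>) k k = B \<omega>"
      by (intro eq_matI) (auto simp: mat_delete_def A_def B_def)
    then have ck: "cofactor (A \<omega>) k k = det (B \<omega>)" by (simp add: cofactor_def)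
    have "det (A \<omega>) = (\<Sum>j<Suc k. A \<omega> $$ (k, j) * cofactor (A \<omega>) k j)"
      by (rule laplace_expansion_row[OF A, symmetric, THEN sym]) simp
    also have "\<dots> = (\<Sum>j<k. A \<omega> $$ (k, j) * cofactor (A \<omega>) k j) + A \<omega> $$ (k, k) * det (B \<omega>)"
      using ck by simp
    also have "(\<Sum>j<k. A \<omega> $$ (k, j) * cofactor (A \<omega>) k j) = (\<Sum>j<k. (c (k, j) + \<sigma> * \<omega> (k, j)) * cofactor (A \<omega>) k j)"
      by (intro sum.cong refl) (simp add: A_def)
    finally show ?thesis by (simp add: a_def b_def A_def algebra_simps)
  qed
  \<comment> \<open>By the Leibniz formula the determinant is a polynomial in the entries.\<close>
  have det_meas: "(\<lambda>\<omega>. det (mat l l (\<lambda>x. g x \<omega>))) \<in> borel_measurable (gaussian ?I)"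
    if "\<And>x. x \<in> {..<l} \<times> {..<l} \<Longrightarrow> g x \<in> borel_measurable (gaussian ?I)"
    for l and g :: "nat \<times> nat \<Rightarrow> (nat \<times> nat \<Rightarrow> real) \<Rightarrow> real"
  proof -
    have "det (mat l l (\<lambda>x. g x \<omega>)) = (\<Sum>p\<in>{p. p permutes {0..<l}}. signof p * (\<Prod>i = 0..<l. g (i, p i) \<omega>))" for \<omega>
    proof -
      have "det (mat l l (\<lambda>x. g x \<omega>)) = (\<Sum>p\<in>{p. p permutes {0..<l}}. signof p * (\<Prod>i = 0..<l. mat l l (\<lambda>x. g x \<omega>) $$ (i, p i)))"
        by (rule det_def') simp
      also have "\<dots> = (\<Sum>p\<in>{p. p permutes {0..<l}}. signof p * (\<Prod>i = 0..<l. g (i, p i) \<omega>))"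
        by (intro sum.cong refl arg_cong2[where f = "(*)"] prod.cong) (auto simp: permutes_in_image dest: permutes_in_image)
      finally show ?thesis .
    qed
    moreover have "(\<lambda>\<omega>. \<Sum>p\<in>{p. p permutes {0..<l}}. signof p * (\<Prod>i = 0..<l. g (i, p i) \<omega>)) \<in> borel_measurable (gaussian ?I)"
    proof (intro borel_measurable_sum borel_measurable_times borel_measurable_const borel_measurable_prod)
      fix p i assume "p \<in> {p. p permutes {0..<l}}" "i \<in> {0..<l}"
      then show "g (i, p i) \<in> borel_measurable (gaussian ?I)"
        using permutes_in_image[of p "{0..<l}" i] by (intro that) auto
    qed
    ultimately show ?thesis by simp
  qed
  have ent: "(\<lambda>\<omega>. c x + \<sigma> * \<omega> x) \<in> borel_measurable (gaussian ?I)" if "x \<in> ?I" for x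
    by (intro borel_measurable_add borel_measurable_times borel_measurable_const measurable_gaussian_component that)
  have detB: "(\<lambda>\<omega>. det (B \<omega>)) \<in> borel_measurable (gaussian ?I)"
    unfolding B_def by (rule det_meas[where g = "\<lambda>x \<omega>. c x + \<sigma> * \<omega> x"]) (use Suc.prems in \<open>auto intro: ent\<close>)
  have del: "mat_delete (A \<omega>) k j = mat k k (\<lambda>(i, l). c (i, if l < j then l else Suc l) + \<sigma> * \<omega> (i, if l < j then l else Suc l))"
    if "j < k" for j \<omega>
    by (intro eq_matI) (auto simp: mat_delete_def A_def)
  have cof: "(\<lambda>\<omega>. cofactor (A \<omega>) k j) \<in> borel_measurable (gaussian ?I)" if j: "j < k" for j
  proof -
    have e: "(\<lambda>(i, l). c (i, if l < j then l else Suc l) + \<sigma> * \<omega> (i, if l < j then l else Suc l))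
      = (\<lambda>x. c (fst x, if snd x < j then snd x else Suc (snd x)) + \<sigma> * \<omega> (fst x, if snd x < j then snd x else Suc (snd x)))" for \<omega>
      by auto
    show ?thesis unfolding cofactor_def del[OF j] e
      by (intro borel_measurable_times borel_measurable_const
        det_meas[where g = "\<lambda>x \<omega>. c (fst x, if snd x < j then snd x else Suc (snd x)) + \<sigma> * \<omega> (fst x, if snd x < j then snd x else Suc (snd x))"] ent)
       (use Suc.prems in auto)
  qed
  have bm: "b \<in> borel_measurable (gaussian ?I)" unfolding b_def
    by (intro borel_measurable_times borel_measurable_const detB)
  have am: "a \<in> borel_measurable (gaussian ?I)" unfolding a_def
    by (intro borel_measurable_add borel_measurable_times borel_measurable_const detB borel_measurable_sum cof ent)
      (use Suc.prems in auto)
  have Bu: "B (fun_upd \<omega> (k, k) y) = B \<omega>" for \<omega> y unfolding B_def by (intro eq_matI) auto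
  \<comment> \<open>Deleting row \<open>k\<close> removes the corner entry, so these cofactors do
    not see its noise.\<close>
  have cu: "cofactor (A (fun_upd \<omega> (k, k) y)) k j = cofactor (A \<omega>) k j" if "j < k" for \<omega> y j
    unfolding cofactor_def del[OF that] by (intro arg_cong2[where f = "(*)"] refl arg_cong[where f = det] eq_matI) auto
  have "AE \<omega> in gaussian ?I. b \<omega> \<noteq> 0 \<longrightarrow> a \<omega> + b \<omega> * \<omega> (k, k) \<noteq> 0"
  proof (rule AE_gaussian_affine_nonzero[OF _ _ am bm])
    show "a (fun_upd \<omega> (k, k) y) = a \<omega>" for \<omega> y unfolding a_def Bu using cu by (intro arg_cong2[where f = "(+)"] refl sum.cong) auto
    show "b (fun_upd \<omega> (k, k) y) = b \<omega>" for \<omega> y unfolding b_def Bu ..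
  qed (use Suc.prems in auto)
  moreover have "AE \<omega> in gaussian ?I. det (B \<omega>) \<noteq> 0" unfolding B_def by (rule Suc.IH) (use Suc.prems in auto)
  ultimately have "AE \<omega> in gaussian ?I. det (A \<omega>) \<noteq> 0"
    by eventually_elim (use \<open>\<sigma> \<noteq> 0\<close> exp in \<open>auto simp: b_def\<close>)
  then show ?case unfolding A_def .
qed

text \<open>Either the columns of \<open>X\<close> do not span the space, and a fixed nonzero linear form of the noise
  would have to vanish, or the observation would have rank at most \<open>r\<close>, although its leading minor
  of order \<open>r + 1\<close> is nonzero.\<close>

lemma AE_observation_not_low_rank:
  assumes X: "X \<in> carrier_mat m p" and A: "A \<in> carrier_mat p n" and \<sigma>: "\<sigma> > 0" and n: "n \<ge> 1"
    and r: "mat_rank X < m \<or> (r < m \<and> r < n)"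
  shows "AE \<omega> in gauss_space m n. \<forall>B\<in>carrier_mat p n. mat_rank B \<le> r \<longrightarrow> observation X A \<sigma> (mat m n \<omega>) \<noteq> X * B"
proof -
  let ?I = "{..<m} \<times> {..<n}"
  have geq: "gauss_space m n = gaussian ?I" unfolding gauss_space_def gaussian_def ..
  have XA: "X * A \<in> carrier_mat m n" using X A by simp
  have obs: "observation X A \<sigma> (mat m n \<omega>) $$ (i, j) = (X * A) $$ (i, j) + \<sigma> * \<omega> (i, j)" if "i < m" "j < n" for \<omega> i j
    unfolding observation_def using that XA by (simp del: index_mult_mat(1))
  from r show ?thesis
  proof
    assume q: "mat_rank X < m"
    define q where "q = mat_rank X"
    obtain P Q where P: "P \<in> carrier_mat m q" and Q: "Q \<in> carrier_mat q p" and PQ: "X = P * Q"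
      unfolding q_def by (rule rank_factorization[OF X])
    \<comment> \<open>A nonzero vector orthogonal to the columns of \<open>P\<close>, hence to every
      column of every \<open>X * B\<close>.\<close>
    obtain w where w: "w \<in> carrier_vec m" "w \<noteq> 0\<^sub>v m" "transpose_mat P *\<^sub>v w = 0\<^sub>v q"
      using wide_mat_kernel[of "transpose_mat P" q m] P q q_def by auto
    obtain i0 where i0: "i0 < m" "w $ i0 \<noteq> 0" using w by (metis carrier_vecD eq_vecI index_zero_vec)
    have Pw: "(\<Sum>i<m. w $ i * P $$ (i, l)) = 0" if l: "l < q" for l
    proof -
      have "(transpose_mat P *\<^sub>v w) $ l = (\<Sum>i<m. w $ i * P $$ (i, l))"
        using P w(1) l by (auto simp: scalar_prod_def lessThan_atLeast0 mult.commute intro!: sum.cong)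
      then show ?thesis using w(3) l by simp
    qed
    have wX: "(\<Sum>i<m. w $ i * (X * B) $$ (i, 0)) = 0" if B: "B \<in> carrier_mat p n" for B
    proof -
      have XB: "X * B = P * (Q * B)" unfolding PQ by (rule assoc_mult_mat[OF P Q B])
      have QB: "Q * B \<in> carrier_mat q n" using Q B by simp
      have "(\<Sum>i<m. w $ i * (X * B) $$ (i, 0)) = (\<Sum>i<m. \<Sum>l<q. w $ i * P $$ (i, l) * (Q * B) $$ (l, 0))"
        unfolding XB using n by (intro sum.cong refl) (simp add: mat_mult_entry[OF P QB] sum_distrib_left mult.assoc del: index_mult_mat(1))
      also have "\<dots> = (\<Sum>l<q. (\<Sum>i<m. w $ i * P $$ (i, l)) * (Q * B) $$ (l, 0))"
        by (subst sum.swap) (simp add: sum_distrib_right)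
      also have "\<dots> = 0" by (intro sum.neutral ballI) (simp only: Pw lessThan_iff mult_zero_left)
      finally show ?thesis .
    qed
    \<comment> \<open>Column 0 is enough. The coordinate \<open>i0\<close> with nonzero weight is
      singled out so that the form is affine in its noise.\<close>
    define a where "a \<omega> = (\<Sum>i\<in>{..<m} - {i0}. w $ i * \<omega> (i, 0))" for \<omega> :: "nat \<times> nat \<Rightarrow> real"
    have "AE \<omega> in gaussian ?I. w $ i0 \<noteq> 0 \<longrightarrow> a \<omega> + w $ i0 * \<omega> (i0, 0) \<noteq> 0"
    proof (rule AE_gaussian_affine_nonzero)
      show "a \<in> borel_measurable (gaussian ?I)" unfolding a_def
        by (intro borel_measurable_sum borel_measurable_times borel_measurable_const measurable_gaussian_component) (use n in auto)
      show "a (fun_upd \<omega> (i0, 0) y) = a \<omega>" for \<omega> y unfolding a_def by (intro sum.cong) auto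
    qed (use i0 n in auto)
    then show ?thesis unfolding geq
    proof eventually_elim
      case (elim \<omega>)
      have s: "(\<Sum>i<m. w $ i * \<omega> (i, 0)) = a \<omega> + w $ i0 * \<omega> (i0, 0)"
        unfolding a_def using i0 by (subst sum.remove[of "{..<m}" i0]) auto
      show ?case
      proof (intro ballI impI notI)
        fix B assume B: "B \<in> carrier_mat p n" and eq: "observation X A \<sigma> (mat m n \<omega>) = X * B"
        have "(\<Sum>i<m. w $ i * (X * B) $$ (i, 0)) = (\<Sum>i<m. w $ i * (X * A) $$ (i, 0)) + \<sigma> * (\<Sum>i<m. w $ i * \<omega> (i, 0))"
          unfolding eq[symmetric] sum_distrib_left sum.distrib[symmetric] using n
          by (intro sum.cong refl) (simp add: obs algebra_simps del: index_mult_mat(1))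
        then show False using wX[OF B] wX[OF A] s elim i0 \<sigma> by simp
      qed
    qed
  next
    assume r: "r < m \<and> r < n"
    let ?k = "Suc r"
    have "AE \<omega> in gaussian ?I. det (mat ?k ?k (\<lambda>x. (X * A) $$ x + \<sigma> * \<omega> x)) \<noteq> 0"
      by (rule AE_gaussian_minor_nonzero) (use \<sigma> r in auto)
    then show ?thesis unfolding geq
    proof eventually_elim
      case (elim \<omega>)
      show ?case
      proof (intro ballI impI notI)
        fix B assume B: "B \<in> carrier_mat p n" "mat_rank B \<le> r" and eq: "observation X A \<sigma> (mat m n \<omega>) = X * B"
        obtain P Q where P: "P \<in> carrier_mat p (mat_rank B)" and Q: "Q \<in> carrier_mat (mat_rank B) n" and PQ: "B = P * Q"
          by (rule rank_factorization[OF B(1)])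
        define s where "s = mat_rank B"
        have XP: "X * P \<in> carrier_mat m s" using X P by (simp add: s_def)
        have Qs: "Q \<in> carrier_mat s n" using Q by (simp add: s_def)
        have XB: "X * B = X * P * Q" by (subst PQ) (rule assoc_mult_mat[OF X P Q, symmetric])
        \<comment> \<open>The corner of order \<open>r + 1\<close> would factor through at most
          \<open>r\<close> dimensions.\<close>
        define P' where "P' = mat ?k s (\<lambda>(i, j). (X * P) $$ (i, j))"
        define Q' where "Q' = mat s ?k (\<lambda>(i, j). Q $$ (i, j))"
        have P': "P' \<in> carrier_mat ?k s" and Q': "Q' \<in> carrier_mat s ?k" by (auto simp: P'_def Q'_def)
        let ?M = "mat ?k ?k (\<lambda>x. (X * A) $$ x + \<sigma> * \<omega> x)"
        have "?M = P' * Q'"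
        proof (rule eq_matI)
          fix i j assume "i < dim_row (P' * Q')" "j < dim_col (P' * Q')"
          then have ij: "i < ?k" "j < ?k" "i < m" "j < n" using P' Q' r by auto
          have "?M $$ (i, j) = (X * B) $$ (i, j)" unfolding eq[symmetric] obs[OF ij(3,4)] using ij by (simp del: index_mult_mat(1))
          also have "\<dots> = (\<Sum>l<s. (X * P) $$ (i, l) * Q $$ (l, j))" unfolding XB by (rule mat_mult_entry[OF XP Qs ij(3,4)])
          also have "\<dots> = (\<Sum>l<s. P' $$ (i, l) * Q' $$ (l, j))"
            using ij by (intro sum.cong refl) (simp add: P'_def Q'_def)
          also have "\<dots> = (P' * Q') $$ (i, j)" by (rule mat_mult_entry[OF P' Q' ij(1,2), symmetric])
          finally show "?M $$ (i, j) = (P' * Q') $$ (i, j)" .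
        qed (use P' Q' in auto)
        then have "mat_rank ?M \<le> s" using mat_rank_mult_inner[OF P' Q'] by simp
        moreover have "mat_rank ?M = ?k"
          using vec_space.low_rank_det_zero[of ?M ?k] elim by (simp add: mat_rank_def)
        ultimately show False using B(2) by (simp add: s_def)
      qed
    qed
  qed
qed

text \<open>The selection inequality bounds the loss at the selected rank. The residual at the comparison
  rank is at least \<open>\<sigma>\<^sup>2 * e\<close> up to cross terms, which makes the penalty at the selected rank absorb
  the noise level \<open>kh\<close> up to its fluctuation \<open>xi\<close> and the deficit \<open>z\<close> of \<open>e\<close>.\<close>

lemma selected_loss_bound:
  fixes t K \<alpha> \<sigma> N :: real
  assumes t: "t > 1" "t ^ 4 = K" and \<alpha>: "\<alpha> < 1" and N: "N > 0"
    and Dh: "Dh \<ge> 0" and Dr: "Dr \<ge> 0" and e: "e \<ge> 0"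
    and Rh: "Rh = Dh\<^sup>2 - 2 * \<sigma> * Ih + \<sigma>\<^sup>2 * e" and Rr: "Rr = Dr\<^sup>2 - 2 * \<sigma> * Ir + \<sigma>\<^sup>2 * e" and Rr0: "Rr \<ge> 0"
    and xr: "0 \<le> xr" "xr \<le> \<alpha>" and xh: "xh = K * sh / N" "0 \<le> xh" "xh \<le> \<alpha>"
    and sel: "Rh * (1 - xr) \<le> Rr * (1 - xh)"
    and cross: "2 * \<sigma> * (Ih - Ir) \<le> 2 * \<sigma> * (\<Delta> * sqrt (kh\<^sup>2 + kr\<^sup>2))"
    and \<Delta>: "0 \<le> \<Delta>" "\<Delta> \<le> Dh + Dr"
    and Ir1: "2 * \<sigma> * Ir \<le> 2 * Dr\<^sup>2 + \<sigma>\<^sup>2 * (h + 8 * kr\<^sup>2)"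
    and Ir2: "- 2 * \<sigma> * Ir \<le> Dr\<^sup>2 + \<sigma>\<^sup>2 * e" and h: "h \<ge> 0"
    and kh: "kh = \<mu> + xi" "\<mu>\<^sup>2 \<le> sh" and z: "z \<ge> 0" "N / t - e \<le> z"
  shows "Dh\<^sup>2 \<le> t / (t - 1) * (Dr\<^sup>2 * (3 + 1 / (t * (t - 1)) + 2 / (1 - \<alpha>))
    + \<sigma>\<^sup>2 * ((t\<^sup>2 + 8) * kr\<^sup>2 + t ^ 3 / (t - 1) * xi\<^sup>2 + h + z + 2 / (1 - \<alpha>) * (xr * e)))"
proof -
  have t0: "t > 0" "t - 1 > 0" using t by auto
  \<comment> \<open>The first summand is charged with \<open>t\<close>, the factor that must stay
    small; the price \<open>t / (t - 1)\<close> falls on the second.\<close>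
  have young: "(a + b)\<^sup>2 \<le> t * a\<^sup>2 + t / (t - 1) * b\<^sup>2" for a b
  proof -
    have "0 \<le> ((t - 1) * a - b)\<^sup>2" by simp
    then have "(t - 1) * (a + b)\<^sup>2 \<le> (t - 1) * (t * a\<^sup>2) + t * b\<^sup>2"
      by (simp add: power2_eq_square algebra_simps)
    then have "(a + b)\<^sup>2 \<le> ((t - 1) * (t * a\<^sup>2) + t * b\<^sup>2) / (t - 1)"
      using t0 by (simp add: pos_le_divide_eq mult.commute)
    then show ?thesis using t0 by (simp add: add_divide_distrib)
  qed
  have x1: "1 - xr > 0" "1 - xr \<ge> 1 - \<alpha>" using xr \<alpha> by auto
  \<comment> \<open>The comparison residual inflated by its own penalty; the selection inequality
    then reads \<open>Rh \<le> \<rho> * (1 - xh)\<close>.\<close>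
  define \<rho> where "\<rho> = Rr / (1 - xr)"
  have \<rho>R: "\<rho> \<ge> Rr" using Rr0 xr x1 by (simp add: \<rho>_def le_divide_eq mult_left_le)
  have "Rh \<le> Rr * (1 - xh) / (1 - xr)" using sel x1 by (simp add: le_divide_eq)
  also have "\<dots> = \<rho> * (1 - xr) + xr * \<rho> - xh * \<rho>" by (simp add: \<rho>_def algebra_simps diff_divide_distrib)
  also have "\<rho> * (1 - xr) = Rr" using x1 by (simp add: \<rho>_def)
  \<comment> \<open>The common noise energy, \<open>e\<close> times the square of
    \<open>\<sigma>\<close>, cancels between the two residuals.\<close>
  finally have A: "Dh\<^sup>2 \<le> Dr\<^sup>2 + 2 * \<sigma> * (Ih - Ir) + xr * \<rho> - xh * \<rho>"
    unfolding Rh Rr by (simp add: algebra_simps)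
  \<comment> \<open>The weights leave the selected loss with coefficient \<open>1 / t\<close>, to be
    absorbed at the end, and charge the noise two factors \<open>t\<close>.\<close>
  have B: "2 * \<sigma> * (Ih - Ir) \<le> Dh\<^sup>2 / t + Dr\<^sup>2 / (t * (t - 1)) + t\<^sup>2 * \<sigma>\<^sup>2 * (kh\<^sup>2 + kr\<^sup>2)"
  proof -
    let ?S = "sqrt (kh\<^sup>2 + kr\<^sup>2)"
    have "0 \<le> (\<Delta> / t - t * \<sigma> * ?S)\<^sup>2" by simp
    then have "2 * \<sigma> * (\<Delta> * ?S) \<le> \<Delta>\<^sup>2 / t\<^sup>2 + t\<^sup>2 * \<sigma>\<^sup>2 * (kh\<^sup>2 + kr\<^sup>2)"
      using t0 by (simp add: power2_diff power_mult_distrib power_divide algebra_simps)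
    moreover have "\<Delta>\<^sup>2 \<le> t * Dh\<^sup>2 + t / (t - 1) * Dr\<^sup>2"
      using power_mono[OF \<Delta>(2,1), of 2] young[of Dh Dr] by linarith
    then have "\<Delta>\<^sup>2 / t\<^sup>2 \<le> (t * Dh\<^sup>2 + t / (t - 1) * Dr\<^sup>2) / t\<^sup>2" by (rule divide_right_mono) simp
    moreover have "(t * Dh\<^sup>2 + t / (t - 1) * Dr\<^sup>2) / t\<^sup>2 = Dh\<^sup>2 / t + Dr\<^sup>2 / (t * (t - 1))"
      using t0 by (simp add: add_divide_distrib power2_eq_square)
    ultimately show ?thesis using cross by linarith
  qed
  \<comment> \<open>The penalty paid at the comparison rank; \<open>xr \<le> \<alpha> < 1\<close>
    keeps the inflation of the residual bounded.\<close>
  have C: "xr * \<rho> \<le> 2 / (1 - \<alpha>) * Dr\<^sup>2 + \<sigma>\<^sup>2 * (2 / (1 - \<alpha>) * (xr * e))"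
  proof -
    have "Rr \<le> 2 * (Dr\<^sup>2 + \<sigma>\<^sup>2 * e)" using Ir2 unfolding Rr by (simp add: algebra_simps)
    then have "xr * \<rho> \<le> xr * (2 * (Dr\<^sup>2 + \<sigma>\<^sup>2 * e) / (1 - \<alpha>))"
      unfolding \<rho>_def using xr x1 \<alpha> e by (intro mult_left_mono frac_le) auto
    also have "\<dots> = xr * (2 / (1 - \<alpha>) * Dr\<^sup>2) + \<sigma>\<^sup>2 * (2 / (1 - \<alpha>) * (xr * e))"
      by (simp add: algebra_simps add_divide_distrib)
    also have "xr * (2 / (1 - \<alpha>) * Dr\<^sup>2) \<le> 1 * (2 / (1 - \<alpha>) * Dr\<^sup>2)"
      using xr \<alpha> by (intro mult_right_mono) auto
    finally show ?thesis by simp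
  qed
  \<comment> \<open>The penalty at the selected rank pays \<open>t ^ 3 * sh\<close>: of
    \<open>K = t ^ 4\<close>, one factor is given up to replace the energy \<open>e\<close> by
    \<open>N / t\<close>, with shortfall at most \<open>z\<close>.\<close>
  have D: "xh * \<rho> \<ge> \<sigma>\<^sup>2 * (t ^ 3 * sh) - \<sigma>\<^sup>2 * z - (2 * Dr\<^sup>2 + \<sigma>\<^sup>2 * (h + 8 * kr\<^sup>2))"
  proof -
    have xh1: "xh \<le> 1" using xh \<alpha> by simp
    have w0: "0 \<le> 2 * Dr\<^sup>2 + \<sigma>\<^sup>2 * (h + 8 * kr\<^sup>2)" using h by simp
    have "Rr \<ge> \<sigma>\<^sup>2 * e - (2 * Dr\<^sup>2 + \<sigma>\<^sup>2 * (h + 8 * kr\<^sup>2))" using Ir1 unfolding Rr by (smt (verit) zero_le_power2)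
    then have "xh * \<rho> \<ge> xh * (\<sigma>\<^sup>2 * e - (2 * Dr\<^sup>2 + \<sigma>\<^sup>2 * (h + 8 * kr\<^sup>2)))"
      using \<rho>R xh by (intro mult_left_mono) auto
    moreover have "xh * (2 * Dr\<^sup>2 + \<sigma>\<^sup>2 * (h + 8 * kr\<^sup>2)) \<le> 1 * (2 * Dr\<^sup>2 + \<sigma>\<^sup>2 * (h + 8 * kr\<^sup>2))"
      by (rule mult_right_mono[OF xh1 w0])
    moreover have "xh * (\<sigma>\<^sup>2 * e) \<ge> \<sigma>\<^sup>2 * (t ^ 3 * sh) - \<sigma>\<^sup>2 * z"
    proof -
      have "xh * (N / t - z) \<le> xh * e" using z xh by (intro mult_left_mono) auto
      moreover have "xh * (N / t) = t ^ 3 * sh"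
        unfolding xh t(2)[symmetric] using N t0 by (simp add: power4_eq_xxxx power3_eq_cube)
      moreover have "xh * z \<le> 1 * z" using xh1 z by (intro mult_right_mono) auto
      ultimately have "t ^ 3 * sh - z \<le> xh * e" by (simp add: right_diff_distrib)
      from mult_left_mono[OF this, of "\<sigma>\<^sup>2"] show ?thesis by (simp add: algebra_simps)
    qed
    ultimately show ?thesis by (simp add: right_diff_distrib)
  qed
  \<comment> \<open>Separating the mean from the fluctuation costs a third factor \<open>t\<close>
    on top of the two of the cross term, so the mean part is exactly what \<open>D\<close> pays
    for.\<close>
  have E: "t\<^sup>2 * \<sigma>\<^sup>2 * kh\<^sup>2 \<le> \<sigma>\<^sup>2 * (t ^ 3 * sh) + \<sigma>\<^sup>2 * (t ^ 3 / (t - 1) * xi\<^sup>2)"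
  proof -
    have "kh\<^sup>2 \<le> t * sh + t / (t - 1) * xi\<^sup>2"
      using young[of \<mu> xi] mult_left_mono[OF kh(2), of t] t0 unfolding kh(1) by linarith
    then have "t\<^sup>2 * \<sigma>\<^sup>2 * kh\<^sup>2 \<le> t\<^sup>2 * \<sigma>\<^sup>2 * (t * sh + t / (t - 1) * xi\<^sup>2)" by (rule mult_left_mono) simp
    then show ?thesis by (simp add: power2_eq_square power3_eq_cube algebra_simps)
  qed
  let ?G = "Dr\<^sup>2 * (3 + 1 / (t * (t - 1)) + 2 / (1 - \<alpha>))
    + \<sigma>\<^sup>2 * ((t\<^sup>2 + 8) * kr\<^sup>2 + t ^ 3 / (t - 1) * xi\<^sup>2 + h + z + 2 / (1 - \<alpha>) * (xr * e))"
  have G: "?G = 3 * Dr\<^sup>2 + Dr\<^sup>2 / (t * (t - 1)) + 2 / (1 - \<alpha>) * Dr\<^sup>2 + t\<^sup>2 * \<sigma>\<^sup>2 * kr\<^sup>2 + \<sigma>\<^sup>2 * (8 * kr\<^sup>2)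
    + \<sigma>\<^sup>2 * (t ^ 3 / (t - 1) * xi\<^sup>2) + \<sigma>\<^sup>2 * h + \<sigma>\<^sup>2 * z + \<sigma>\<^sup>2 * (2 / (1 - \<alpha>) * (xr * e))"
    by (simp add: distrib_left distrib_right mult_ac)
  have "Dh\<^sup>2 \<le> Dh\<^sup>2 / t + ?G"
    unfolding G using A B C D E by (simp add: distrib_left)
  \<comment> \<open>The fraction \<open>1 / t\<close> of the loss moves to the left, which is the
    origin of the prefactor \<open>t / (t - 1)\<close>.\<close>
  then have "Dh\<^sup>2 * ((t - 1) / t) \<le> ?G" using t0 by (simp add: field_simps)
  then have "Dh\<^sup>2 \<le> ?G / ((t - 1) / t)" using t0 by (subst pos_le_divide_eq) auto
  also have "\<dots> = t / (t - 1) * ?G" by simp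
  finally show ?thesis .
qed

lemma frob_norm_mat: "(frob_norm (mat m n \<omega>))\<^sup>2 = (\<Sum>x\<in>{..<m} \<times> {..<n}. (\<omega> x)\<^sup>2)"
proof -
  have "mat_inner (mat m n \<omega>) (mat m n \<omega>) = (\<Sum>x\<in>{..<m} \<times> {..<n}. mat m n \<omega> $$ x * \<omega> x)"
    by (rule mat_inner_mat) simp
  also have "\<dots> = (\<Sum>x\<in>{..<m} \<times> {..<n}. (\<omega> x)\<^sup>2)" by (intro sum.cong) (auto simp: power2_eq_square)
  finally show ?thesis by (simp add: frob_norm_power2)
qed

lemma gaussian_sum_squares:
  "integrable (gaussian I) (\<lambda>\<omega>. \<Sum>x\<in>I. (\<omega> x)\<^sup>2)" "(\<integral>\<omega>. (\<Sum>x\<in>I. (\<omega> x)\<^sup>2) \<partial>gaussian I) = real (card I)"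
proof -
  show "integrable (gaussian I) (\<lambda>\<omega>. \<Sum>x\<in>I. (\<omega> x)\<^sup>2)"
    by (intro Bochner_Integration.integrable_sum gaussian_square_integrable)
  have "(\<integral>\<omega>. (\<Sum>x\<in>I. (\<omega> x)\<^sup>2) \<partial>gaussian I) = (\<Sum>x\<in>I. \<integral>\<omega>. (\<omega> x)\<^sup>2 \<partial>gaussian I)"
    by (rule Bochner_Integration.integral_sum) (rule gaussian_square_integrable)
  also have "\<dots> = (\<Sum>x\<in>I. 1)" by (intro sum.cong refl gaussian_square_integral)
  finally show "(\<integral>\<omega>. (\<Sum>x\<in>I. (\<omega> x)\<^sup>2) \<partial>gaussian I) = real (card I)" by simp
qed

lemma gaussian_second_moment_le:
  fixes f :: "('i \<Rightarrow> real) \<Rightarrow> real"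
  assumes "integrable (gaussian I) f" "integrable (gaussian I) (\<lambda>\<omega>. (f \<omega>)\<^sup>2)"
    and "(\<integral>\<omega>. (f \<omega> - (\<integral>\<omega>. f \<omega> \<partial>gaussian I))\<^sup>2 \<partial>gaussian I) \<le> V"
  shows "(\<integral>\<omega>. (f \<omega>)\<^sup>2 \<partial>gaussian I) \<le> (\<integral>\<omega>. f \<omega> \<partial>gaussian I)\<^sup>2 + V"
proof -
  interpret prob_space "gaussian I" by (rule prob_space_gaussian)
  have "(\<integral>\<omega>. (f \<omega> - c)\<^sup>2 \<partial>gaussian I) = (\<integral>\<omega>. (f \<omega>)\<^sup>2 \<partial>gaussian I) - 2 * c * (\<integral>\<omega>. f \<omega> \<partial>gaussian I) + c\<^sup>2" for c
    using assms(1,2) by (simp add: power2_diff prob_space)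
  then show ?thesis using assms(3) by (simp add: power2_eq_square)
qed

text \<open>The Euclidean norm is itself a supremum of linear forms, so its variance is bounded and its
  mean is close to the root of the dimension.\<close>

lemma gaussian_sum_squares_deficit:
  assumes I: "finite I" "I \<noteq> {}" and t: "t > 1" and N: "N = real (card I) - 1"
  shows "integrable (gaussian I) (\<lambda>\<omega>. max 0 (N / t - (\<Sum>x\<in>I. (\<omega> x)\<^sup>2)))"
    and "(\<integral>\<omega>. max 0 (N / t - (\<Sum>x\<in>I. (\<omega> x)\<^sup>2)) \<partial>gaussian I) \<le> 5 + 6 / (t - 1)"
proof -
  interpret prob_space "gaussian I" by (rule prob_space_gaussian)
  define T where "T = {v :: 'a \<Rightarrow> real. (\<Sum>x\<in>I. (v x)\<^sup>2) \<le> 1}"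
  define F where "F = lin_sup I (\<lambda>v. v) T"
  define \<mu> where "\<mu> = (\<integral>\<omega>. F \<omega> \<partial>gaussian I)"
  have T0: "T \<noteq> {}" unfolding T_def by (auto intro!: exI[of _ "\<lambda>_. 0"])
  have bd: "\<forall>v\<in>T. \<forall>x\<in>I. \<bar>v x\<bar> \<le> 1"
  proof (intro ballI)
    fix v x assume "v \<in> T" "x \<in> I"
    then have "(v x)\<^sup>2 \<le> 1"
      using member_le_sum[of x I "\<lambda>x. (v x)\<^sup>2"] I unfolding T_def by auto
    then show "\<bar>v x\<bar> \<le> 1" by (simp add: abs_square_le_1)
  qed
  have F2: "(F \<omega>)\<^sup>2 = (\<Sum>x\<in>I. (\<omega> x)\<^sup>2)" for \<omega>
  proof -
    let ?S = "\<Sum>x\<in>I. (\<omega> x)\<^sup>2"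
    have S0: "?S \<ge> 0" by (intro sum_nonneg) auto
    have "F \<omega> \<le> sqrt ?S" unfolding F_def
    proof (rule lin_sup_least[OF T0])
      fix v assume "v \<in> T"
      then have "(\<Sum>x\<in>I. (v x)\<^sup>2) * ?S \<le> 1 * ?S" unfolding T_def by (intro mult_right_mono S0) auto
      then show "(\<Sum>x\<in>I. v x * \<omega> x) \<le> sqrt ?S"
        using Cauchy_Schwarz_ineq_sum[of v \<omega> I] by (intro real_le_rsqrt) simp
    qed
    moreover have "sqrt ?S \<le> F \<omega>"
    proof -
      define v where "v x = \<omega> x / sqrt ?S" for x
      have "(\<Sum>x\<in>I. (v x)\<^sup>2) = ?S / ?S"
        unfolding v_def using S0 by (simp add: power_divide sum_divide_distrib[symmetric])
      then have vT: "v \<in> T" unfolding T_def by simp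
      have "(\<Sum>x\<in>I. v x * \<omega> x) = ?S / sqrt ?S"
        unfolding v_def by (simp add: sum_divide_distrib power2_eq_square)
      then show ?thesis using lin_sup_upper[OF I(1) bd _ vT, of \<omega>] S0 by (simp add: F_def real_div_sqrt)
    qed
    ultimately have "F \<omega> = sqrt ?S" by simp
    then show ?thesis using S0 by simp
  qed
  have iF: "integrable (gaussian I) F" unfolding F_def by (rule lin_sup_integrable[OF I(1) bd _ T0]) simp
  have iF2: "integrable (gaussian I) (\<lambda>\<omega>. (F \<omega>)\<^sup>2)" unfolding F2 by (rule gaussian_sum_squares)
  have var: "(\<integral>\<omega>. (F \<omega> - \<mu>)\<^sup>2 \<partial>gaussian I) \<le> 6"
    unfolding \<mu>_def F_def by (rule lin_sup_variance[OF I(1) T0]) (simp add: T_def)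
  \<comment> \<open>The mean square is the dimension, so the variance bound becomes a lower bound on
    the squared mean.\<close>
  have m: "real (card I) \<le> \<mu>\<^sup>2 + 6"
    using gaussian_second_moment_le[OF iF iF2 var[unfolded \<mu>_def]] unfolding F2 gaussian_sum_squares(2) \<mu>_def .
  have bound: "max 0 (N / t - (\<Sum>x\<in>I. (\<omega> x)\<^sup>2)) \<le> 5 + (F \<omega> - \<mu>)\<^sup>2 / (t - 1)" for \<omega>
  proof -
    \<comment> \<open>Expanding this square bounds the squared mean by \<open>t\<close> times the
      squared norm plus \<open>t / (t - 1)\<close> times the squared deviation.\<close>
    have "0 \<le> ((t - 1) * F \<omega> + (F \<omega> - \<mu>))\<^sup>2" by simp
    then have "(t - 1) * \<mu>\<^sup>2 \<le> (t - 1) * (t * (F \<omega>)\<^sup>2) + t * (F \<omega> - \<mu>)\<^sup>2"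
      by (simp add: power2_eq_square algebra_simps)
    then have "\<mu>\<^sup>2 \<le> ((t - 1) * (t * (F \<omega>)\<^sup>2) + t * (F \<omega> - \<mu>)\<^sup>2) / (t - 1)"
      using t by (simp add: pos_le_divide_eq mult.commute)
    also have "\<dots> = t * ((F \<omega>)\<^sup>2 + (F \<omega> - \<mu>)\<^sup>2 / (t - 1))" using t by (simp add: add_divide_distrib distrib_left)
    finally have "\<mu>\<^sup>2 / t \<le> (F \<omega>)\<^sup>2 + (F \<omega> - \<mu>)\<^sup>2 / (t - 1)" using t by (simp add: pos_divide_le_eq mult.commute)
    \<comment> \<open>The 5 is the variance bound 6 less the 1 subtracted in
      \<open>N\<close>.\<close>
    moreover have "N / t \<le> \<mu>\<^sup>2 / t + 5"
    proof -
      have "N / t \<le> (\<mu>\<^sup>2 + 5) / t" using m N t by (intro divide_right_mono) auto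
      moreover have "5 / t \<le> 5" using t by (simp add: divide_le_eq)
      ultimately show ?thesis by (simp add: add_divide_distrib)
    qed
    ultimately have "N / t - (\<Sum>x\<in>I. (\<omega> x)\<^sup>2) \<le> 5 + (F \<omega> - \<mu>)\<^sup>2 / (t - 1)" unfolding F2[symmetric] by linarith
    moreover have "0 \<le> 5 + (F \<omega> - \<mu>)\<^sup>2 / (t - 1)" using t by (intro add_nonneg_nonneg) auto
    ultimately show ?thesis by simp
  qed
  have iv: "integrable (gaussian I) (\<lambda>\<omega>. (F \<omega> - \<mu>)\<^sup>2)" using iF iF2 by (simp add: power2_diff)
  have ib: "integrable (gaussian I) (\<lambda>\<omega>. 5 + (F \<omega> - \<mu>)\<^sup>2 / (t - 1))"
    by (intro Bochner_Integration.integrable_add integrable_divide iv) auto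
  show i: "integrable (gaussian I) (\<lambda>\<omega>. max 0 (N / t - (\<Sum>x\<in>I. (\<omega> x)\<^sup>2)))"
    by (intro integrable_max Bochner_Integration.integrable_diff gaussian_sum_squares(1)) auto
  have "(\<integral>\<omega>. max 0 (N / t - (\<Sum>x\<in>I. (\<omega> x)\<^sup>2)) \<partial>gaussian I) \<le> (\<integral>\<omega>. 5 + (F \<omega> - \<mu>)\<^sup>2 / (t - 1) \<partial>gaussian I)"
    by (intro integral_mono i ib bound)
  also have "\<dots> = 5 + (\<integral>\<omega>. (F \<omega> - \<mu>)\<^sup>2 \<partial>gaussian I) / (t - 1)" using iv by (simp add: prob_space)
  also have "\<dots> \<le> 5 + 6 / (t - 1)" using var t by (simp add: divide_right_mono)
  finally show "(\<integral>\<omega>. max 0 (N / t - (\<Sum>x\<in>I. (\<omega> x)\<^sup>2)) \<partial>gaussian I) \<le> 5 + 6 / (t - 1)" .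
qed

text \<open>A linear form is a supremum over a one-point family, so after normalisation the variance
  bound applies; its mean is 0. Any absolute constant serves.\<close>

lemma gaussian_linear_form_second_moment:
  fixes v :: "'i \<Rightarrow> real"
  assumes I: "finite I" "I \<noteq> {}"
  shows "integrable (gaussian I) (\<lambda>\<omega>. (\<Sum>x\<in>I. v x * \<omega> x)\<^sup>2)"
    and "(\<integral>\<omega>. (\<Sum>x\<in>I. v x * \<omega> x)\<^sup>2 \<partial>gaussian I) \<le> 7 * (\<Sum>x\<in>I. (v x)\<^sup>2)"
proof -
  interpret prob_space "gaussian I" by (rule prob_space_gaussian)
  have mean: "(\<integral>\<omega>. \<omega> x \<partial>gaussian I) = 0" if "x \<in> I" for x
    using gaussian_component_integral[OF that, of "\<lambda>x. x"] integral_std_normal_distribution_moment_odd[of 1] by simp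
  have ix: "integrable (gaussian I) (\<lambda>\<omega>. \<omega> x)" if "x \<in> I" for x
    using gaussian_component_integrable[OF that, of "\<lambda>x. x"] integrable_std_normal_distribution_moment[of 1] by simp
  define S where "S = (\<Sum>x\<in>I. (v x)\<^sup>2)"
  have S0: "S \<ge> 0" unfolding S_def by (intro sum_nonneg) auto
  define w where "w x = v x / sqrt S" for x
  have il: "integrable (gaussian I) (\<lambda>\<omega>. \<Sum>x\<in>I. u x * \<omega> x)" for u :: "'i \<Rightarrow> real"
    by (intro Bochner_Integration.integrable_sum integrable_mult_right ix)
  show i2: "integrable (gaussian I) (\<lambda>\<omega>. (\<Sum>x\<in>I. u x * \<omega> x)\<^sup>2)" for u :: "'i \<Rightarrow> real"
  proof (rule Bochner_Integration.integrable_bound)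
    show "integrable (gaussian I) (\<lambda>\<omega>. (\<Sum>x\<in>I. (u x)\<^sup>2) * (\<Sum>x\<in>I. (\<omega> x)\<^sup>2))"
      by (intro integrable_mult_right gaussian_sum_squares)
    show "(\<lambda>\<omega>. (\<Sum>x\<in>I. u x * \<omega> x)\<^sup>2) \<in> borel_measurable (gaussian I)"
      using borel_measurable_integrable[OF il] by measurable
    show "AE \<omega> in gaussian I. norm ((\<Sum>x\<in>I. u x * \<omega> x)\<^sup>2) \<le> norm ((\<Sum>x\<in>I. (u x)\<^sup>2) * (\<Sum>x\<in>I. (\<omega> x)\<^sup>2))"
      by (intro AE_I2) (simp add: Cauchy_Schwarz_ineq_sum order_trans[OF Cauchy_Schwarz_ineq_sum abs_ge_self])
  qed
  show "(\<integral>\<omega>. (\<Sum>x\<in>I. v x * \<omega> x)\<^sup>2 \<partial>gaussian I) \<le> 7 * (\<Sum>x\<in>I. (v x)\<^sup>2)"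
  proof (cases "S = 0")
    case True
    then have "v x = 0" if "x \<in> I" for x using that I unfolding S_def by (simp add: sum_nonneg_eq_0_iff)
    then show ?thesis by simp
  next
    case False
    have wn: "(\<Sum>x\<in>I. (w x)\<^sup>2) = 1"
      unfolding w_def using False S0 by (simp add: power_divide sum_divide_distrib[symmetric]) (simp add: S_def[symmetric])
    have ls: "lin_sup I (\<lambda>_. w) {()} \<omega> = (\<Sum>x\<in>I. w x * \<omega> x)" for \<omega> unfolding lin_sup_def by simp
    have "(\<integral>\<omega>. (lin_sup I (\<lambda>_. w) {()} \<omega> - (\<integral>\<omega>. lin_sup I (\<lambda>_. w) {()} \<omega> \<partial>gaussian I))\<^sup>2 \<partial>gaussian I) \<le> 6"
      by (rule lin_sup_variance[OF I(1)]) (use wn in auto)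
    then have var: "(\<integral>\<omega>. ((\<Sum>x\<in>I. w x * \<omega> x) - (\<integral>\<omega>. (\<Sum>x\<in>I. w x * \<omega> x) \<partial>gaussian I))\<^sup>2 \<partial>gaussian I) \<le> 6"
      unfolding ls .
    have mw: "(\<integral>\<omega>. (\<Sum>x\<in>I. w x * \<omega> x) \<partial>gaussian I) = 0"
    proof -
      have "(\<integral>\<omega>. (\<Sum>x\<in>I. w x * \<omega> x) \<partial>gaussian I) = (\<Sum>x\<in>I. \<integral>\<omega>. w x * \<omega> x \<partial>gaussian I)"
        by (rule Bochner_Integration.integral_sum) (intro integrable_mult_right ix)
      also have "\<dots> = 0" using mean by simp
      finally show ?thesis .
    qed
    have "(\<integral>\<omega>. (\<Sum>x\<in>I. w x * \<omega> x)\<^sup>2 \<partial>gaussian I) \<le> 6"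
      using gaussian_second_moment_le[OF il i2 var] unfolding mw by simp
    moreover have "(\<Sum>x\<in>I. v x * \<omega> x)\<^sup>2 = S * (\<Sum>x\<in>I. w x * \<omega> x)\<^sup>2" for \<omega>
    proof -
      have "(\<Sum>x\<in>I. v x * \<omega> x) = sqrt S * (\<Sum>x\<in>I. w x * \<omega> x)"
        unfolding sum_distrib_left w_def using False S0 by (intro sum.cong) auto
      then show ?thesis using S0 by (simp add: power_mult_distrib)
    qed
    ultimately have "(\<integral>\<omega>. (\<Sum>x\<in>I. v x * \<omega> x)\<^sup>2 \<partial>gaussian I) \<le> S * 6"
      using S0 by (simp add: mult_left_mono)
    then show ?thesis using S0 by (simp add: S_def)
  qed
qed

section \<open>The oracle inequality\<close>

lemma frob_norm_eq_0:
  assumes M: "M \<in> carrier_mat m n" and z: "frob_norm M = 0"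
  shows "M = 0\<^sub>m m n"
proof (rule eq_matI)
  fix i j assume "i < dim_row (0\<^sub>m m n :: real mat)" "j < dim_col (0\<^sub>m m n :: real mat)"
  then show "M $$ (i, j) = 0\<^sub>m m n $$ (i, j)" using mat_entry_le_frob_norm[OF M, of "(i, j)"] z by simp
qed (use M in auto)

lemma frob_norm_diff_power2:
  assumes A: "A \<in> carrier_mat m n" and B: "B \<in> carrier_mat m n"
  shows "(frob_norm (A - B))\<^sup>2 = (frob_norm A)\<^sup>2 - 2 * mat_inner A B + (frob_norm B)\<^sup>2"
proof -
  have c: "A - B \<in> carrier_mat m n" by (rule minus_carrier_mat[OF B])
  show ?thesis
    unfolding frob_norm_power2 mat_inner_diff_left[OF A B] mat_inner_diff_right[OF A A B] mat_inner_diff_right[OF B A B]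
    using mat_inner_commute[OF A B] by simp
qed

lemma frob_norm_diff_le:
  assumes A: "A \<in> carrier_mat m n" and B: "B \<in> carrier_mat m n"
  shows "frob_norm (A - B) \<le> frob_norm A + frob_norm B"
proof (rule power2_le_imp_le)
  show "(frob_norm (A - B))\<^sup>2 \<le> (frob_norm A + frob_norm B)\<^sup>2"
    unfolding frob_norm_diff_power2[OF A B] power2_sum using mat_inner_abs_le[OF A B] by simp
qed simp

lemma frob_norm_diff_commute:
  assumes A: "A \<in> carrier_mat m n" and B: "B \<in> carrier_mat m n"
  shows "frob_norm (A - B) = frob_norm (B - A)"
  by (rule power2_eq_imp_eq)
    (simp_all add: frob_norm_diff_power2[OF A B] frob_norm_diff_power2[OF B A] mat_inner_commute[OF A B])

lemma mat_add_diff: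
  fixes P Q R :: "real mat"
  assumes "P \<in> carrier_mat m n" "Q \<in> carrier_mat m n" "R \<in> carrier_mat m n"
  shows "P + R - Q = R - (Q - P)"
  using assms by (intro eq_matI) auto

lemma mat_diff_diff:
  fixes P Q R :: "real mat"
  assumes "P \<in> carrier_mat m n" "Q \<in> carrier_mat m n" "R \<in> carrier_mat m n"
  shows "P - R - (Q - R) = P - Q"
  using assms by (intro eq_matI) auto

text \<open>The expansion isolates the noise energy, which is the same for every \<open>B\<close>
  and so cancels when two residuals are compared.\<close>

lemma residual_power2:
  assumes X: "X \<in> carrier_mat m p" and A: "A \<in> carrier_mat p n" and B: "B \<in> carrier_mat p n" and E: "E \<in> carrier_mat m n"
  shows "(frob_norm (observation X A \<sigma> E - X * B))\<^sup>2
    = loss X A B - 2 * \<sigma> * mat_inner (X * B - X * A) E + \<sigma>\<^sup>2 * (frob_norm E)\<^sup>2"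
proof -
  have XA: "X * A \<in> carrier_mat m n" and XB: "X * B \<in> carrier_mat m n" using X A B by auto
  have D: "X * B - X * A \<in> carrier_mat m n" by (rule minus_carrier_mat[OF XA])
  have sE: "\<sigma> \<cdot>\<^sub>m E \<in> carrier_mat m n" using E by simp
  have "observation X A \<sigma> E - X * B = \<sigma> \<cdot>\<^sub>m E - (X * B - X * A)"
    unfolding observation_def by (rule mat_add_diff[OF XA XB sE])
  then have "(frob_norm (observation X A \<sigma> E - X * B))\<^sup>2
      = (frob_norm (\<sigma> \<cdot>\<^sub>m E))\<^sup>2 - 2 * mat_inner (\<sigma> \<cdot>\<^sub>m E) (X * B - X * A) + loss X A B"
    using frob_norm_diff_power2[OF sE D] by (simp add: loss_def)
  also have "mat_inner (\<sigma> \<cdot>\<^sub>m E) (X * B - X * A) = \<sigma> * mat_inner (X * B - X * A) E"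
    unfolding mat_inner_smult_left[OF E] using mat_inner_commute[OF E D] by simp
  finally show ?thesis by (simp add: frob_norm_smult[OF E] power_mult_distrib)
qed

text \<open>The error \<open>Mr\<close> at rank \<open>r\<close> is not a low-rank image, because of
  the bias in \<open>X * A\<close>. A reference \<open>A0\<close> of rank at most \<open>r\<close>,
  no farther from the signal than \<open>Br\<close>, is therefore inserted: \<open>Mr - M0\<close>
  is a difference of two low-rank images and controlled by the suprema, and if \<open>A0\<close>
  does not depend on the noise, the product of \<open>M0\<close> with the noise is a single Gaussian
  variable.\<close>

lemma selected_loss_pointwise:
  fixes t K \<alpha> \<sigma> N :: real and \<omega> :: "nat \<times> nat \<Rightarrow> real"
  assumes t: "t > 1" "t ^ 4 = K" and \<alpha>: "\<alpha> < 1" and N: "N > 0" and \<sigma>: "\<sigma> > 0"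
    and X: "X \<in> carrier_mat m p" and A: "A \<in> carrier_mat p n"
    and Bh: "Bh \<in> carrier_mat p n" "mat_rank Bh \<le> rh" and Br: "Br \<in> carrier_mat p n" "mat_rank Br \<le> r"
    and A0: "A0 \<in> carrier_mat p n" "mat_rank A0 \<le> r" "frob_norm (X * A - X * A0) \<le> frob_norm (X * A - X * Br)"
    and xr: "0 \<le> xr" "xr \<le> \<alpha>" and xh: "xh = K * sh / N" "0 \<le> xh" "xh \<le> \<alpha>"
    and sel: "(frob_norm (observation X A \<sigma> (mat m n \<omega>) - X * Bh))\<^sup>2 * (1 - xr)
      \<le> (frob_norm (observation X A \<sigma> (mat m n \<omega>) - X * Br))\<^sup>2 * (1 - xh)"
    and \<mu>: "\<mu>\<^sup>2 \<le> sh"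
  shows "loss X A Bh \<le> t / (t - 1) * (loss X A Br * (3 + 1 / (t * (t - 1)) + 2 / (1 - \<alpha>))
    + \<sigma>\<^sup>2 * ((t\<^sup>2 + 8) * (image_sup X n r \<omega>)\<^sup>2 + t ^ 3 / (t - 1) * (image_sup X n rh \<omega> - \<mu>)\<^sup>2
      + (mat_inner (X * A0 - X * A) (mat m n \<omega>))\<^sup>2 / (frob_norm (X * A0 - X * A))\<^sup>2
      + max 0 (N / t - (frob_norm (mat m n \<omega>))\<^sup>2) + 2 / (1 - \<alpha>) * (xr * (frob_norm (mat m n \<omega>))\<^sup>2)))"
proof -
  define E where "E = mat m n \<omega>"
  have E: "E \<in> carrier_mat m n" by (simp add: E_def)
  have XA: "X * A \<in> carrier_mat m n" and XBh: "X * Bh \<in> carrier_mat m n" and XBr: "X * Br \<in> carrier_mat m n"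
    and XA0: "X * A0 \<in> carrier_mat m n" using X A Bh Br A0 by auto
  define Mh where "Mh = X * Bh - X * A"
  define Mr where "Mr = X * Br - X * A"
  define M0 where "M0 = X * A0 - X * A"
  have Mh: "Mh \<in> carrier_mat m n" and Mr: "Mr \<in> carrier_mat m n" and M0: "M0 \<in> carrier_mat m n"
    unfolding Mh_def Mr_def M0_def using XA by (auto simp: minus_carrier_mat)
  let ?kr = "image_sup X n r \<omega>" and ?kh = "image_sup X n rh \<omega>"
  define h where "h = (mat_inner M0 E)\<^sup>2 / (frob_norm M0)\<^sup>2"
  have M0r: "frob_norm M0 \<le> frob_norm Mr"
    using A0(3) frob_norm_diff_commute[OF XA XA0] frob_norm_diff_commute[OF XA XBr] by (simp add: M0_def Mr_def)
  have hr: "Mh - Mr = X * Bh - X * Br"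
    unfolding Mh_def Mr_def by (rule mat_diff_diff[OF XBh XBr XA])
  have r0: "Mr - M0 = X * Br - X * A0"
    unfolding Mr_def M0_def by (rule mat_diff_diff[OF XBr XA0 XA])
  have cross0: "mat_inner Mh E - mat_inner Mr E \<le> frob_norm (Mh - Mr) * sqrt (?kh\<^sup>2 + ?kr\<^sup>2)"
    unfolding mat_inner_diff_left[OF Mh Mr, symmetric] hr E_def
    by (rule mat_inner_diff_le_image_sup[OF X Bh Br])
  have rad: "(frob_norm (observation X A \<sigma> E - X * Br))\<^sup>2 \<ge> 0" by simp
  have AMGM: "2 * \<sigma> * (x * y) \<le> x\<^sup>2 + \<sigma>\<^sup>2 * y\<^sup>2" for x y
    using sum_squares_bound[of x "\<sigma> * y"] by (simp add: power_mult_distrib algebra_simps)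
  have Ir1: "2 * \<sigma> * mat_inner Mr E \<le> 2 * (frob_norm Mr)\<^sup>2 + \<sigma>\<^sup>2 * (h + 8 * ?kr\<^sup>2)"
  proof -
    have "mat_inner (Mr - M0) E \<le> frob_norm (Mr - M0) * sqrt (?kr\<^sup>2 + ?kr\<^sup>2)"
      unfolding r0 E_def by (rule mat_inner_diff_le_image_sup[OF X Br A0(1,2)])
    \<comment> \<open>The 2 appears because \<open>M0\<close> is no longer than \<open>Mr\<close>,
      the \<open>sqrt 2\<close> because both ranks are \<open>r\<close>; squared together they
      become the 8.\<close>
    also have "\<dots> \<le> (2 * frob_norm Mr) * (sqrt 2 * ?kr)"
    proof (rule mult_mono)
      show "frob_norm (Mr - M0) \<le> 2 * frob_norm Mr" using frob_norm_diff_le[OF Mr M0] M0r by simp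
      show "sqrt (?kr\<^sup>2 + ?kr\<^sup>2) \<le> sqrt 2 * ?kr"
        using image_sup_nonneg[of X n r \<omega>] by (simp add: mult_2[symmetric] real_sqrt_mult)
    qed auto
    finally have "2 * \<sigma> * mat_inner (Mr - M0) E \<le> 2 * \<sigma> * ((2 * frob_norm Mr) * (sqrt 2 * ?kr))"
      using \<sigma> by (intro mult_left_mono) auto
    also have "\<dots> = 2 * \<sigma> * (frob_norm Mr * (2 * sqrt 2 * ?kr))" by simp
    also have "\<dots> \<le> (frob_norm Mr)\<^sup>2 + \<sigma>\<^sup>2 * (2 * sqrt 2 * ?kr)\<^sup>2" by (rule AMGM)
    also have "(2 * sqrt 2 * ?kr)\<^sup>2 = 8 * ?kr\<^sup>2" by (simp add: power_mult_distrib)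
    finally have 1: "2 * \<sigma> * mat_inner (Mr - M0) E \<le> (frob_norm Mr)\<^sup>2 + \<sigma>\<^sup>2 * (8 * ?kr\<^sup>2)" .
    have 2: "2 * \<sigma> * mat_inner M0 E \<le> (frob_norm Mr)\<^sup>2 + \<sigma>\<^sup>2 * h"
    proof (cases "frob_norm M0 = 0")
      \<comment> \<open>Here \<open>h\<close> is a division by zero, hence 0, in accordance with the
        vanishing inner product.\<close>
      case True
      then have "mat_inner M0 E = 0" using mat_inner_abs_le[OF M0 E] by simp
      then show ?thesis by (simp add: h_def)
    next
      case False
      then have "2 * \<sigma> * mat_inner M0 E = 2 * \<sigma> * (frob_norm M0 * (mat_inner M0 E / frob_norm M0))" by simp
      also have "\<dots> \<le> (frob_norm M0)\<^sup>2 + \<sigma>\<^sup>2 * (mat_inner M0 E / frob_norm M0)\<^sup>2" by (rule AMGM)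
      also have "(frob_norm M0)\<^sup>2 \<le> (frob_norm Mr)\<^sup>2" using M0r by (intro power_mono) auto
      finally show ?thesis by (simp add: h_def power_divide)
    qed
    have "2 * \<sigma> * mat_inner Mr E = 2 * \<sigma> * mat_inner (Mr - M0) E + 2 * \<sigma> * mat_inner M0 E"
      unfolding mat_inner_diff_left[OF Mr M0] by (simp add: algebra_simps)
    then show ?thesis using 1 2 by (simp add: distrib_left)
  qed
  have Ir2: "- 2 * \<sigma> * mat_inner Mr E \<le> (frob_norm Mr)\<^sup>2 + \<sigma>\<^sup>2 * (frob_norm E)\<^sup>2"
  proof -
    have "- mat_inner Mr E \<le> frob_norm Mr * frob_norm E" using mat_inner_abs_le[OF Mr E] by linarith
    then have "2 * \<sigma> * (- mat_inner Mr E) \<le> 2 * \<sigma> * (frob_norm Mr * frob_norm E)"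
      using \<sigma> by (intro mult_left_mono) auto
    also have "\<dots> \<le> (frob_norm Mr)\<^sup>2 + \<sigma>\<^sup>2 * (frob_norm E)\<^sup>2" by (rule AMGM)
    finally show ?thesis by simp
  qed
  have lh: "loss X A Bh = (frob_norm Mh)\<^sup>2" and lr: "loss X A Br = (frob_norm Mr)\<^sup>2"
    by (simp_all add: loss_def Mh_def Mr_def)
  have "(frob_norm Mh)\<^sup>2 \<le> t / (t - 1) * ((frob_norm Mr)\<^sup>2 * (3 + 1 / (t * (t - 1)) + 2 / (1 - \<alpha>))
    + \<sigma>\<^sup>2 * ((t\<^sup>2 + 8) * ?kr\<^sup>2 + t ^ 3 / (t - 1) * (?kh - \<mu>)\<^sup>2
      + h + max 0 (N / t - (frob_norm E)\<^sup>2) + 2 / (1 - \<alpha>) * (xr * (frob_norm E)\<^sup>2)))"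
  proof (rule selected_loss_bound[OF t \<alpha> N, where Ih = "mat_inner Mh E" and Ir = "mat_inner Mr E"
        and Rh = "(frob_norm (observation X A \<sigma> E - X * Bh))\<^sup>2" and Rr = "(frob_norm (observation X A \<sigma> E - X * Br))\<^sup>2"
        and xr = xr and xh = xh and sh = sh and \<Delta> = "frob_norm (Mh - Mr)" and kh = ?kh and \<mu> = \<mu>])
    show "(frob_norm (observation X A \<sigma> E - X * Bh))\<^sup>2 = (frob_norm Mh)\<^sup>2 - 2 * \<sigma> * mat_inner Mh E + \<sigma>\<^sup>2 * (frob_norm E)\<^sup>2"
      using residual_power2[OF X A Bh(1) E] by (simp add: lh Mh_def)
    show "(frob_norm (observation X A \<sigma> E - X * Br))\<^sup>2 = (frob_norm Mr)\<^sup>2 - 2 * \<sigma> * mat_inner Mr E + \<sigma>\<^sup>2 * (frob_norm E)\<^sup>2"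
      using residual_power2[OF X A Br(1) E] by (simp add: lr Mr_def)
    show "2 * \<sigma> * (mat_inner Mh E - mat_inner Mr E) \<le> 2 * \<sigma> * (frob_norm (Mh - Mr) * sqrt (?kh\<^sup>2 + ?kr\<^sup>2))"
      using cross0 \<sigma> by (intro mult_left_mono) auto
    show "frob_norm (Mh - Mr) \<le> frob_norm Mh + frob_norm Mr" by (rule frob_norm_diff_le[OF Mh Mr])
    show "h \<ge> 0" unfolding h_def by simp
  qed (use xr xh sel Ir1 Ir2 \<mu> in \<open>auto simp: E_def\<close>)
  then show ?thesis unfolding lh lr h_def M0_def E_def .
qed

lemma rank_restricted_ls_D:
  assumes X: "X \<in> carrier_mat m p" and y: "y \<in> carrier_mat m n" and ls: "rank_restricted_ls X y r B"
  shows "B \<in> carrier_mat p n" "mat_rank B \<le> r"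
    "B' \<in> carrier_mat p n \<Longrightarrow> mat_rank B' \<le> r \<Longrightarrow> frob_norm (y - X * B) \<le> frob_norm (y - X * B')"
  using ls X y unfolding rank_restricted_ls_def is_arg_min_def by (auto simp: not_less)

text \<open>Exponentiating the criterion gives a product inequality between residuals. Nonzero
  residuals are demanded because of the convention \<open>ln 0 = 0\<close>, and
  \<open>x s < 1\<close> makes the argument of the logarithm in the penalty positive.\<close>

lemma selection_inequality:
  assumes min: "is_arg_min (crit K X y B) (\<lambda>r. r \<in> {1..rmax}) rh" and r: "r \<in> {1..rmax}"
    and pos: "\<And>s. s \<in> {1..rmax} \<Longrightarrow> frob_norm (y - X * B s) \<noteq> 0"
    and y: "y \<in> carrier_mat m n"
    and x: "\<And>s. x s = K * (gauss_ky_fan n' n s)\<^sup>2 / (real n * real m - 1)" and n': "n' = mat_rank X"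
    and x1: "\<And>s. s \<in> {1..rmax} \<Longrightarrow> x s < 1"
  shows "rh \<in> {1..rmax}" "(frob_norm (y - X * B rh))\<^sup>2 * (1 - x r) \<le> (frob_norm (y - X * B r))\<^sup>2 * (1 - x rh)"
proof -
  show rh: "rh \<in> {1..rmax}" using min unfolding is_arg_min_def by blast
  have "crit K X y B rh \<le> crit K X y B r" using min r unfolding is_arg_min_def by (auto simp: not_less)
  then have "ln ((frob_norm (y - X * B rh))\<^sup>2) - ln (1 - x rh) \<le> ln ((frob_norm (y - X * B r))\<^sup>2) - ln (1 - x r)"
    unfolding crit_def pen_def x n' using y by simp
  then have "ln ((frob_norm (y - X * B rh))\<^sup>2) + ln (1 - x r) \<le> ln ((frob_norm (y - X * B r))\<^sup>2) + ln (1 - x rh)" by simp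
  moreover have "(frob_norm (y - X * B rh))\<^sup>2 > 0" "(frob_norm (y - X * B r))\<^sup>2 > 0" "1 - x r > 0" "1 - x rh > 0"
    using pos[OF rh] pos[OF r] x1[OF r] x1[OF rh] by auto
  ultimately have "ln ((frob_norm (y - X * B rh))\<^sup>2 * (1 - x r)) \<le> ln ((frob_norm (y - X * B r))\<^sup>2 * (1 - x rh))"
    by (simp add: ln_mult)
  then show "(frob_norm (y - X * B rh))\<^sup>2 * (1 - x r) \<le> (frob_norm (y - X * B r))\<^sup>2 * (1 - x rh)"
    using \<open>(frob_norm (y - X * B rh))\<^sup>2 > 0\<close> \<open>(frob_norm (y - X * B r))\<^sup>2 > 0\<close> \<open>1 - x r > 0\<close> \<open>1 - x rh > 0\<close>
    by (subst (asm) ln_le_cancel_iff) auto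
qed

lemma mat_sub_sub:
  fixes P R :: "real mat"
  assumes "P \<in> carrier_mat m n" "R \<in> carrier_mat m n"
  shows "R - (R - P) = P"
  using assms by (intro eq_matI) auto

lemma mat_sub_zero:
  fixes P :: "real mat"
  assumes "P \<in> carrier_mat m n"
  shows "P - 0\<^sub>m m n = P"
  using assms by (intro eq_matI) auto

text \<open>A crude a priori bound, from comparison with the zero matrix. Its purpose is the
  integrability of the loss at a fixed rank.\<close>

lemma rank_restricted_ls_loss_le:
  assumes X: "X \<in> carrier_mat m p" and A: "A \<in> carrier_mat p n" and E: "E \<in> carrier_mat m n" and \<sigma>: "\<sigma> > 0"
    and ls: "rank_restricted_ls X (observation X A \<sigma> E) r B"
  shows "loss X A B \<le> 2 * (frob_norm (X * A))\<^sup>2 + \<sigma>\<^sup>2 * (8 * (frob_norm E)\<^sup>2)"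
proof -
  let ?Y = "observation X A \<sigma> E"
  have XA: "X * A \<in> carrier_mat m n" using X A by simp
  have sE: "\<sigma> \<cdot>\<^sub>m E \<in> carrier_mat m n" using E by simp
  have Y: "?Y \<in> carrier_mat m n" unfolding observation_def using XA sE by simp
  note B = rank_restricted_ls_D[OF X Y ls]
  have XB: "X * B \<in> carrier_mat m n" using X B(1) by simp
  have R: "?Y - X * B \<in> carrier_mat m n" by (rule minus_carrier_mat[OF XB])
  have z: "mat_rank (0\<^sub>m p n) \<le> r"
    using vec_space.rank_0I[of p n, where ?'a = real] by (simp add: mat_rank_def)
  have "frob_norm (?Y - X * B) \<le> frob_norm (?Y - X * 0\<^sub>m p n)" by (rule B(3)) (use z in auto)
  also have "?Y - X * 0\<^sub>m p n = \<sigma> \<cdot>\<^sub>m E - (0\<^sub>m m n - X * A)"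
    unfolding observation_def right_mult_zero_mat[OF X] by (rule mat_add_diff[OF XA zero_carrier_mat sE])
  also have "frob_norm (\<sigma> \<cdot>\<^sub>m E - (0\<^sub>m m n - X * A)) \<le> frob_norm (\<sigma> \<cdot>\<^sub>m E) + frob_norm (0\<^sub>m m n - X * A)"
    by (rule frob_norm_diff_le[OF sE minus_carrier_mat[OF XA]])
  also have "frob_norm (0\<^sub>m m n - X * A) = frob_norm (X * A)"
    unfolding frob_norm_diff_commute[OF zero_carrier_mat XA] mat_sub_zero[OF XA] ..
  also have fE: "frob_norm (\<sigma> \<cdot>\<^sub>m E) = \<sigma> * frob_norm E" using frob_norm_smult[OF E, of \<sigma>] \<sigma> by simp
  finally have res: "frob_norm (?Y - X * B) \<le> \<sigma> * frob_norm E + frob_norm (X * A)" .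
  have D: "X * B - X * A \<in> carrier_mat m n" by (rule minus_carrier_mat[OF XA])
  have "\<sigma> \<cdot>\<^sub>m E - (?Y - X * B) = X * B - X * A"
    unfolding observation_def mat_add_diff[OF XA XB sE] by (rule mat_sub_sub[OF D sE])
  then have "frob_norm (X * B - X * A) \<le> frob_norm (\<sigma> \<cdot>\<^sub>m E) + frob_norm (?Y - X * B)"
    using frob_norm_diff_le[OF sE R] by (simp only:)
  with res fE have "frob_norm (X * B - X * A) \<le> 2 * \<sigma> * frob_norm E + frob_norm (X * A)" by linarith
  then have "loss X A B \<le> (2 * \<sigma> * frob_norm E + frob_norm (X * A))\<^sup>2"
    unfolding loss_def by (rule power_mono) simp
  also have "\<dots> \<le> 2 * (frob_norm (X * A))\<^sup>2 + \<sigma>\<^sup>2 * (8 * (frob_norm E)\<^sup>2)"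
    using sum_squares_bound[of "2 * \<sigma> * frob_norm E" "frob_norm (X * A)"]
    by (simp add: power2_sum power_mult_distrib)
  finally show ?thesis .
qed

text \<open>For a zero matrix \<open>M\<close> the quotient is 0 by the convention on division, so
  the bound holds for every \<open>M\<close>.\<close>

lemma gaussian_normalized_mat_inner:
  assumes M: "M \<in> carrier_mat m n" and mn: "m \<ge> 1" "n \<ge> 1"
  shows "integrable (gauss_space m n) (\<lambda>\<omega>. (mat_inner M (mat m n \<omega>))\<^sup>2 / (frob_norm M)\<^sup>2)"
    and "(\<integral>\<omega>. (mat_inner M (mat m n \<omega>))\<^sup>2 / (frob_norm M)\<^sup>2 \<partial>gauss_space m n) \<le> 7"
proof -
  let ?I = "{..<m} \<times> {..<n}"
  have I: "finite ?I" "?I \<noteq> {}" using mn by (auto simp: lessThan_empty_iff)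
  note L = gaussian_linear_form_second_moment[OF I, of "\<lambda>x. M $$ x"]
  have S: "(frob_norm M)\<^sup>2 = (\<Sum>x\<in>?I. (M $$ x)\<^sup>2)"
    unfolding frob_norm_power2 mat_inner_eq[OF M] by (simp add: power2_eq_square)
  show "integrable (gauss_space m n) (\<lambda>\<omega>. (mat_inner M (mat m n \<omega>))\<^sup>2 / (frob_norm M)\<^sup>2)"
    unfolding gauss_space_eq mat_inner_mat[OF M] by (rule integrable_divide) (use L(1) in simp)
  show "(\<integral>\<omega>. (mat_inner M (mat m n \<omega>))\<^sup>2 / (frob_norm M)\<^sup>2 \<partial>gauss_space m n) \<le> 7"
    using L(2) unfolding gauss_space_eq mat_inner_mat[OF M] S[symmetric]
    by (cases "frob_norm M = 0") (auto simp: divide_le_eq)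
qed

text \<open>Provides the dichotomy under which an exact fit has probability 0. If
  \<open>rmax < n\<close>, cancelling \<open>n\<close> gives \<open>rmax < m\<close>; if
  \<open>rmax = n\<close>, cancelling it gives \<open>q + n < m\<close>.\<close>

lemma rank_range_generic:
  fixes m n q rmax :: nat
  assumes le: "real rmax * (real q + real n) < real n * real m" and r: "rmax \<in> {1..min n q}"
  shows "q < m \<or> (rmax < m \<and> rmax < n)"
proof (cases "rmax < n")
  case True
  have "real rmax * real n \<le> real rmax * (real q + real n)" by (intro mult_left_mono) auto
  also have "\<dots> < real m * real n" using le by (simp only: mult.commute)
  finally have "real rmax < real m" by (rule mult_right_less_imp_less) simp
  then show ?thesis using True by simp
next
  case False
  then have n: "rmax = n" "n \<ge> 1" using r by auto
  have "real n * (real q + real n) < real n * real m" using le unfolding n(1) .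
  then have "real q + real n < real m" by (rule mult_left_less_imp_less) simp
  then show ?thesis by linarith
qed

lemma oracle_constant_combine:
  fixes l c1 c2 R s :: real
  assumes "0 \<le> l" "0 \<le> c1" "0 \<le> c2" "0 \<le> R" "0 \<le> s"
  shows "l * c1 + s * (c2 * R) \<le> (c1 + c2) * (l + R * s + s)"
proof -
  have "0 \<le> c2 * l + c1 * (R * s) + (c1 + c2) * s"
    using assms by (intro add_nonneg_nonneg mult_nonneg_nonneg)
  moreover have "(c1 + c2) * (l + R * s + s) = l * c1 + s * (c2 * R) + (c2 * l + c1 * (R * s) + (c1 + c2) * s)"
    by (simp add: algebra_simps)
  ultimately show ?thesis by linarith
qed

text \<open>Integrates the pointwise bound at one fixed comparison rank. As
  \<open>w \<ge> 1\<close>, terms that are merely constant can be charged to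
  \<open>real r * w\<close> too, and the whole noise part collapses to a single constant times that
  quantity.\<close>

lemma risk_bound:
  fixes t K \<alpha> \<sigma> :: real
  assumes t: "t > 1" "t ^ 4 = K" and \<alpha>: "0 < \<alpha>" "\<alpha> < 1" and \<sigma>: "\<sigma> > 0"
    and mn: "m \<ge> 1" "n \<ge> 1"
    and X: "X \<in> carrier_mat m p" and A: "A \<in> carrier_mat p n" and q: "q = mat_rank X"
    and rmax: "rmax \<in> {1..min n q}"
    and rmax_le: "real rmax \<le> \<alpha> * ((real n * real m - 1) / (K * (sqrt (real q) + sqrt (real n))\<^sup>2))"
    and Y: "Y = (\<lambda>\<omega>. observation X A \<sigma> (mat m n \<omega>))"
    and ls: "\<forall>r\<in>{1..rmax}. \<forall>y\<in>carrier_mat m n. rank_restricted_ls X y r (Ahat r y)"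
    and sel: "AE \<omega> in gauss_space m n.
         is_arg_min (crit K X (Y \<omega>) (\<lambda>r. Ahat r (Y \<omega>))) (\<lambda>r. r \<in> {1..rmax}) (rhat (Y \<omega>))"
    and meas: "\<forall>r\<in>{1..rmax}. (\<lambda>\<omega>. loss X A (Ahat r (Y \<omega>))) \<in> borel_measurable (gauss_space m n)"
    and r: "r \<in> {1..rmax}"
  shows "(\<integral>\<omega>. loss X A (Ahat (rhat (Y \<omega>)) (Y \<omega>)) \<partial>gauss_space m n)
    \<le> t / (t - 1) * ((3 + 1 / (t * (t - 1)) + 2 / (1 - \<alpha>))
        + (7 * (t\<^sup>2 + 8) + 6 * (t ^ 3 / (t - 1)) + 7 + (5 + 6 / (t - 1)) + 4 * K / (1 - \<alpha>)))
      * ((\<integral>\<omega>. loss X A (Ahat r (Y \<omega>)) \<partial>gauss_space m n)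
          + real r * (sqrt (real n) + sqrt (real q))\<^sup>2 * \<sigma>\<^sup>2 + \<sigma>\<^sup>2)"
proof -
  let ?M = "gauss_space m n" and ?I = "{..<m} \<times> {..<n}"
  interpret prob_space ?M unfolding gauss_space_eq by (rule prob_space_gaussian)
  define w where "w = (sqrt (real n) + sqrt (real q))\<^sup>2"
  define N where "N = real n * real m - 1"
  define S where "S s = gauss_ky_fan q n s" for s
  define x where "x s = K * (S s)\<^sup>2 / N" for s
  define \<mu> where "\<mu> s = (\<integral>\<omega>. image_sup X n s \<omega> \<partial>?M)" for s
  define e where "e \<omega> = (frob_norm (mat m n \<omega>))\<^sup>2" for \<omega> :: "nat \<times> nat \<Rightarrow> real"
  \<comment> \<open>The least-squares map applied to the noiseless signal: a deterministic best
    approximation of rank at most \<open>r\<close>.\<close>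
  define A0 where "A0 = Ahat r (X * A)"
  define h where "h \<omega> = (mat_inner (X * A0 - X * A) (mat m n \<omega>))\<^sup>2 / (frob_norm (X * A0 - X * A))\<^sup>2"
    for \<omega> :: "nat \<times> nat \<Rightarrow> real"
  define L where "L \<omega> = loss X A (Ahat r (Y \<omega>))" for \<omega>
  have dX: "dim_row X = m" using X by simp
  have I: "finite ?I" "?I \<noteq> {}" using mn by (auto simp: lessThan_empty_iff)
  have K: "K > 1" using one_less_power[OF t(1), of 4] t(2) by simp
  have q1: "q \<ge> 1" using rmax by auto
  have wqn: "w \<ge> real q + real n" unfolding w_def power2_sum by simp
  have w1: "w \<ge> 1" using wqn q1 by linarith
  have w_rmax: "real rmax \<le> w" using wqn rmax by auto
  have rw: "w \<le> real r * w" using r w1 by (simp add: mult_le_cancel_right1)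
  \<comment> \<open>The restriction on \<open>rmax\<close> without a quotient. It forces
    \<open>N > 0\<close> and keeps every \<open>x s\<close> below \<open>\<alpha>\<close>.\<close>
  have rwK: "real rmax * (K * w) \<le> \<alpha> * N"
  proof -
    have "K * w > 0" using K w1 by simp
    moreover have "real rmax \<le> \<alpha> * N / (K * w)"
      using rmax_le by (simp add: w_def N_def add.commute[of "sqrt (real q)"])
    ultimately show ?thesis by (simp only: pos_le_divide_eq)
  qed
  have N0: "N > 0"
  proof -
    have "0 < real rmax * (K * w)" using rmax K w1 by auto
    then have "0 < \<alpha> * N" using rwK by linarith
    then show ?thesis using \<alpha> by (simp add: zero_less_mult_iff)
  qed
  have S2: "(S s)\<^sup>2 \<le> real s * w" for s
  proof -
    have "(S s)\<^sup>2 \<le> (sqrt (real s) * (sqrt (real q) + sqrt (real n)))\<^sup>2"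
      unfolding S_def by (intro power_mono gauss_ky_fan_le[OF q1 mn(2)] gauss_ky_fan_nonneg)
    then show ?thesis by (simp add: power_mult_distrib w_def add.commute)
  qed
  have x0: "0 \<le> x s" for s unfolding x_def using K N0 by auto
  have xle: "x s \<le> K * (real s * w) / N" for s
    unfolding x_def using S2[of s] K N0 by (intro divide_right_mono mult_left_mono) auto
  have x\<alpha>: "x s \<le> \<alpha>" if "s \<in> {1..rmax}" for s
  proof -
    have "K * (real s * w) \<le> K * (real rmax * w)" using that K w1 by (intro mult_left_mono mult_right_mono) auto
    also have "\<dots> \<le> \<alpha> * N" using rwK by (simp add: ac_simps)
    finally have "K * (real s * w) / N \<le> \<alpha>" using N0 by (simp add: divide_le_eq)
    then show ?thesis using xle[of s] by linarith
  qed
  have gen: "q < m \<or> (rmax < m \<and> rmax < n)"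
  proof (rule rank_range_generic[OF _ rmax])
    have "real rmax * (real q + real n) \<le> real rmax * w" by (rule mult_left_mono[OF wqn]) simp
    also have "\<dots> \<le> real rmax * (K * w)" using K w1 by (intro mult_left_mono) auto
    also have "\<dots> \<le> 1 * N" using rwK mult_right_mono[of \<alpha> 1 N] \<alpha> N0 by linarith
    finally show "real rmax * (real q + real n) < real n * real m" by (simp add: N_def)
  qed
  have Yc: "Y \<omega> \<in> carrier_mat m n" for \<omega> unfolding Y observation_def using X A by simp
  have XA: "X * A \<in> carrier_mat m n" using X A by simp
  have B: "Ahat s y \<in> carrier_mat p n" "mat_rank (Ahat s y) \<le> s"
    if "s \<in> {1..rmax}" "y \<in> carrier_mat m n" for s y
    using rank_restricted_ls_D(1,2)[OF X that(2)] ls that by blast+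
  have A0: "A0 \<in> carrier_mat p n" "mat_rank A0 \<le> r" unfolding A0_def by (rule B[OF r XA])+
  have nz: "AE \<omega> in ?M. \<forall>s\<in>{1..rmax}. frob_norm (Y \<omega> - X * Ahat s (Y \<omega>)) \<noteq> 0"
    using AE_observation_not_low_rank[OF X A \<sigma> mn(2) gen[unfolded q]]
  proof eventually_elim
    case (elim \<omega>)
    show ?case
    proof
      fix s assume s: "s \<in> {1..rmax}"
      have Bs: "Ahat s (Y \<omega>) \<in> carrier_mat p n" "mat_rank (Ahat s (Y \<omega>)) \<le> rmax"
        using B[OF s Yc[of \<omega>]] s by auto
      have XB: "X * Ahat s (Y \<omega>) \<in> carrier_mat m n" using X Bs by simp
      show "frob_norm (Y \<omega> - X * Ahat s (Y \<omega>)) \<noteq> 0"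
      proof
        assume "frob_norm (Y \<omega> - X * Ahat s (Y \<omega>)) = 0"
        then have z: "Y \<omega> - X * Ahat s (Y \<omega>) = 0\<^sub>m m n" by (rule frob_norm_eq_0[OF minus_carrier_mat[OF XB]])
        have "Y \<omega> = (Y \<omega> - X * Ahat s (Y \<omega>)) + X * Ahat s (Y \<omega>)"
          using Yc[of \<omega>] XB by (intro eq_matI) (auto simp del: index_mult_mat(1))
        also have "\<dots> = X * Ahat s (Y \<omega>)" unfolding z using XB by simp
        finally show False using elim Bs unfolding Y by blast
      qed
    qed
  qed
  have geq: "?M = gaussian ({..<dim_row X} \<times> {..<n})" unfolding gauss_space_eq dX ..
  have \<mu>2: "(\<mu> s)\<^sup>2 \<le> (S s)\<^sup>2" for s
  proof (rule power_mono)
    show "\<mu> s \<le> S s" unfolding \<mu>_def S_def q gauss_space_eq by (rule expectation_image_sup_le[OF X])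
    show "0 \<le> \<mu> s" unfolding \<mu>_def by (intro Bochner_Integration.integral_nonneg image_sup_nonneg)
  qed
  define F where "F \<omega> = t / (t - 1) * (L \<omega> * (3 + 1 / (t * (t - 1)) + 2 / (1 - \<alpha>))
    + \<sigma>\<^sup>2 * ((t\<^sup>2 + 8) * (image_sup X n r \<omega>)\<^sup>2 + t ^ 3 / (t - 1) * (\<Sum>s\<in>{1..rmax}. (image_sup X n s \<omega> - \<mu> s)\<^sup>2)
      + h \<omega> + max 0 (N / t - e \<omega>) + 2 / (1 - \<alpha>) * (x r * e \<omega>)))" for \<omega>
  have bound: "AE \<omega> in ?M. loss X A (Ahat (rhat (Y \<omega>)) (Y \<omega>)) \<le> F \<omega>"
    using nz sel
  proof eventually_elim
    case (elim \<omega>)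
    let ?rh = "rhat (Y \<omega>)"
    have x1: "x s < 1" if "s \<in> {1..rmax}" for s using x\<alpha>[OF that] \<alpha> by linarith
    note sl = selection_inequality[where x = x and n' = q, OF elim(2) r bspec[OF elim(1)] Yc x_def[unfolded S_def N_def] q x1]
    have "loss X A (Ahat ?rh (Y \<omega>)) \<le> t / (t - 1) * (L \<omega> * (3 + 1 / (t * (t - 1)) + 2 / (1 - \<alpha>))
    + \<sigma>\<^sup>2 * ((t\<^sup>2 + 8) * (image_sup X n r \<omega>)\<^sup>2 + t ^ 3 / (t - 1) * (image_sup X n ?rh \<omega> - \<mu> ?rh)\<^sup>2
      + h \<omega> + max 0 (N / t - e \<omega>) + 2 / (1 - \<alpha>) * (x r * e \<omega>)))"
      unfolding L_def h_def e_def
    proof (rule selected_loss_pointwise[OF t \<alpha>(2) N0 \<sigma> X A B[OF sl(1) Yc] B[OF r Yc] A0 _ x0 x\<alpha>[OF r] x_def x0 x\<alpha>[OF sl(1)] _ \<mu>2])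
      show "frob_norm (X * A - X * A0) \<le> frob_norm (X * A - X * Ahat r (Y \<omega>))"
        unfolding A0_def by (rule rank_restricted_ls_D(3)[OF X XA]) (use ls r XA B[OF r Yc[of \<omega>]] in auto)
      show "(frob_norm (observation X A \<sigma> (mat m n \<omega>) - X * Ahat ?rh (Y \<omega>)))\<^sup>2 * (1 - x r)
        \<le> (frob_norm (observation X A \<sigma> (mat m n \<omega>) - X * Ahat r (Y \<omega>)))\<^sup>2 * (1 - x ?rh)"
        using sl(2) unfolding Y .
    qed
    also have "\<dots> \<le> F \<omega>"
      unfolding F_def using t sl(1)
      by (intro mult_left_mono add_mono order_refl member_le_sum[where f = "\<lambda>s. (image_sup X n s \<omega> - \<mu> s)\<^sup>2"]) auto
    finally show ?case .
  qed
  have ie: "integrable ?M e" "(\<integral>\<omega>. e \<omega> \<partial>?M) = real m * real n"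
    using gaussian_sum_squares[of ?I] unfolding gauss_space_eq e_def frob_norm_mat by auto
  have iL: "integrable ?M L"
  proof (rule Bochner_Integration.integrable_bound)
    show "integrable ?M (\<lambda>\<omega>. 2 * (frob_norm (X * A))\<^sup>2 + \<sigma>\<^sup>2 * (8 * e \<omega>))" using ie(1) by simp
    show "L \<in> borel_measurable ?M" using meas r unfolding L_def by blast
    show "AE \<omega> in ?M. norm (L \<omega>) \<le> norm (2 * (frob_norm (X * A))\<^sup>2 + \<sigma>\<^sup>2 * (8 * e \<omega>))"
    proof (rule AE_I2)
      fix \<omega>
      have "L \<omega> \<le> 2 * (frob_norm (X * A))\<^sup>2 + \<sigma>\<^sup>2 * (8 * e \<omega>)"
        unfolding L_def e_def Y
        by (rule rank_restricted_ls_loss_le[OF X A _ \<sigma>, where r = r]) (use ls r Yc[of \<omega>] in \<open>auto simp: Y\<close>)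
      moreover have "0 \<le> L \<omega>" by (simp add: L_def loss_def)
      ultimately show "norm (L \<omega>) \<le> norm (2 * (frob_norm (X * A))\<^sup>2 + \<sigma>\<^sup>2 * (8 * e \<omega>))" by simp
    qed
  qed
  have ik: "integrable ?M (image_sup X n s)" "integrable ?M (\<lambda>\<omega>. (image_sup X n s \<omega>)\<^sup>2)" for s
    unfolding geq by (rule image_sup_integrable image_sup_square_integrable)+
  have iv: "integrable ?M (\<lambda>\<omega>. (image_sup X n s \<omega> - \<mu> s)\<^sup>2)" for s
    unfolding power2_diff using ik[of s] by simp
  have v: "(\<integral>\<omega>. (image_sup X n s \<omega> - \<mu> s)\<^sup>2 \<partial>?M) \<le> 6" for s
    unfolding \<mu>_def geq by (rule image_sup_variance)
  have k2: "(\<integral>\<omega>. (image_sup X n r \<omega>)\<^sup>2 \<partial>?M) \<le> 7 * (real r * w)"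
  proof -
    have "(\<integral>\<omega>. (image_sup X n r \<omega>)\<^sup>2 \<partial>?M) \<le> (\<mu> r)\<^sup>2 + 6"
      unfolding \<mu>_def geq
      by (rule gaussian_second_moment_le[OF image_sup_integrable image_sup_square_integrable image_sup_variance])
    also have "\<dots> \<le> 7 * (real r * w)" using \<mu>2[of r] S2[of r] rw w1 by linarith
    finally show ?thesis .
  qed
  have sv: "(\<integral>\<omega>. (\<Sum>s\<in>{1..rmax}. (image_sup X n s \<omega> - \<mu> s)\<^sup>2) \<partial>?M) \<le> 6 * (real r * w)"
  proof -
    have "(\<integral>\<omega>. (\<Sum>s\<in>{1..rmax}. (image_sup X n s \<omega> - \<mu> s)\<^sup>2) \<partial>?M)
        = (\<Sum>s\<in>{1..rmax}. \<integral>\<omega>. (image_sup X n s \<omega> - \<mu> s)\<^sup>2 \<partial>?M)"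
      by (rule Bochner_Integration.integral_sum) (rule iv)
    also have "\<dots> \<le> (\<Sum>s\<in>{1..rmax}. 6)" by (rule sum_mono) (rule v)
    also have "\<dots> \<le> 6 * (real r * w)" using w_rmax rw by simp
    finally show ?thesis .
  qed
  have ih: "integrable ?M h" "(\<integral>\<omega>. h \<omega> \<partial>?M) \<le> 7"
    unfolding h_def by (rule gaussian_normalized_mat_inner[OF minus_carrier_mat[OF XA] mn])+
  have iz: "integrable ?M (\<lambda>\<omega>. max 0 (N / t - e \<omega>))" "(\<integral>\<omega>. max 0 (N / t - e \<omega>) \<partial>?M) \<le> 5 + 6 / (t - 1)"
    unfolding e_def frob_norm_mat gauss_space_eq
    by (rule gaussian_sum_squares_deficit[OF I t(1)], simp add: N_def mult.commute)+
  \<comment> \<open>As \<open>m * n\<close> is at least 2, it is at most \<open>2 * N\<close>; so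
    penalty times mean noise energy is a multiple of \<open>r * w\<close>.\<close>
  have xe: "x r * (real m * real n) \<le> 2 * K * (real r * w)"
  proof -
    have "1 < real (n * m)" using N0 by (simp add: N_def)
    then have "2 \<le> n * m" by linarith
    then have "2 \<le> real (n * m)" by linarith
    then have "2 \<le> real n * real m" by (simp only: of_nat_mult)
    then have nm: "real m * real n \<le> 2 * N" by (simp add: N_def mult.commute)
    have "x r * (real m * real n) \<le> (K * (real r * w) / N) * (2 * N)"
      by (rule mult_mono[OF xle nm]) (use N0 K w1 in auto)
    then show ?thesis using N0 by (simp add: mult.assoc)
  qed
  have F0: "0 \<le> F \<omega>" for \<omega>
    unfolding F_def using t \<alpha> x0[of r]
    by (intro mult_nonneg_nonneg add_nonneg_nonneg divide_nonneg_nonneg sum_nonneg)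
      (auto simp: L_def loss_def h_def e_def)
  \<comment> \<open>One derivation yields both the integrability of \<open>F\<close> and the value
    of its mean.\<close>
  have HF: "has_bochner_integral ?M F (t / (t - 1) * ((\<integral>\<omega>. L \<omega> \<partial>?M) * (3 + 1 / (t * (t - 1)) + 2 / (1 - \<alpha>))
    + \<sigma>\<^sup>2 * ((t\<^sup>2 + 8) * (\<integral>\<omega>. (image_sup X n r \<omega>)\<^sup>2 \<partial>?M)
      + t ^ 3 / (t - 1) * (\<integral>\<omega>. (\<Sum>s\<in>{1..rmax}. (image_sup X n s \<omega> - \<mu> s)\<^sup>2) \<partial>?M)
      + (\<integral>\<omega>. h \<omega> \<partial>?M) + (\<integral>\<omega>. max 0 (N / t - e \<omega>) \<partial>?M) + 2 / (1 - \<alpha>) * (x r * (\<integral>\<omega>. e \<omega> \<partial>?M)))))"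
    unfolding F_def[abs_def]
    by (intro has_bochner_integral_mult_right has_bochner_integral_add has_bochner_integral_mult_left
      has_bochner_integral_integrable Bochner_Integration.integrable_sum iL ik ih iz iv ie)
  have iF: "integrable ?M F" by (rule integrable.intros[OF HF])
  note EF = has_bochner_integral_integral_eq[OF HF, unfolded ie(2)]
  define c1 where "c1 = 3 + 1 / (t * (t - 1)) + 2 / (1 - \<alpha>)"
  define c2 where "c2 = 7 * (t\<^sup>2 + 8) + 6 * (t ^ 3 / (t - 1)) + 7 + (5 + 6 / (t - 1)) + 4 * K / (1 - \<alpha>)"
  have c0: "c1 \<ge> 0" "c2 \<ge> 0" unfolding c1_def c2_def using t(1) \<alpha> K
    by (intro add_nonneg_nonneg mult_nonneg_nonneg divide_nonneg_nonneg; simp)+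
  have "(t\<^sup>2 + 8) * (\<integral>\<omega>. (image_sup X n r \<omega>)\<^sup>2 \<partial>?M)
      + t ^ 3 / (t - 1) * (\<integral>\<omega>. (\<Sum>s\<in>{1..rmax}. (image_sup X n s \<omega> - \<mu> s)\<^sup>2) \<partial>?M)
      + (\<integral>\<omega>. h \<omega> \<partial>?M) + (\<integral>\<omega>. max 0 (N / t - e \<omega>) \<partial>?M) + 2 / (1 - \<alpha>) * (x r * (real m * real n))
    \<le> (t\<^sup>2 + 8) * (7 * (real r * w)) + t ^ 3 / (t - 1) * (6 * (real r * w))
      + 7 * (real r * w) + (5 + 6 / (t - 1)) * (real r * w) + 2 / (1 - \<alpha>) * (2 * K * (real r * w))"
  proof (intro add_mono mult_left_mono k2 sv xe)
    show "(\<integral>\<omega>. h \<omega> \<partial>?M) \<le> 7 * (real r * w)" using ih(2) rw w1 by linarith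
    have "1 \<le> real r * w" using rw w1 by linarith
    moreover have "0 \<le> 5 + 6 / (t - 1)" using t(1) by simp
    ultimately have "(5 + 6 / (t - 1)) * 1 \<le> (5 + 6 / (t - 1)) * (real r * w)" by (rule mult_left_mono)
    then show "(\<integral>\<omega>. max 0 (N / t - e \<omega>) \<partial>?M) \<le> (5 + 6 / (t - 1)) * (real r * w)" using iz(2) by (simp only: mult_1_right)
  qed (use t(1) \<alpha> in \<open>simp_all add: divide_nonneg_nonneg\<close>)
  also have "\<dots> = c2 * (real r * w)"
  proof -
    have "a * (7 * R) + b * (6 * R) + 7 * R + d * R + f * R = (7 * a + 6 * b + 7 + d + f) * R" for a b d f R :: real
      by (simp add: algebra_simps)
    moreover have "2 / (1 - \<alpha>) * (2 * K * (real r * w)) = 4 * K / (1 - \<alpha>) * (real r * w)" by simp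
    ultimately show ?thesis unfolding c2_def by (simp only:)
  qed
  finally have noise: "(t\<^sup>2 + 8) * (\<integral>\<omega>. (image_sup X n r \<omega>)\<^sup>2 \<partial>?M)
      + t ^ 3 / (t - 1) * (\<integral>\<omega>. (\<Sum>s\<in>{1..rmax}. (image_sup X n s \<omega> - \<mu> s)\<^sup>2) \<partial>?M)
      + (\<integral>\<omega>. h \<omega> \<partial>?M) + (\<integral>\<omega>. max 0 (N / t - e \<omega>) \<partial>?M) + 2 / (1 - \<alpha>) * (x r * (real m * real n))
    \<le> c2 * (real r * w)" .
  define l where "l = (\<integral>\<omega>. L \<omega> \<partial>?M)"
  define R where "R = real r * w"
  have l0: "0 \<le> l" unfolding l_def by (intro Bochner_Integration.integral_nonneg) (simp add: L_def loss_def)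
  have R0: "0 \<le> R" unfolding R_def using rw w1 by linarith
  have t0: "0 \<le> t / (t - 1)" using t(1) by simp
  \<comment> \<open>Domination by an integrable nonnegative \<open>F\<close> suffices for this rule;
    a non-integrable left side would have integral 0.\<close>
  have "(\<integral>\<omega>. loss X A (Ahat (rhat (Y \<omega>)) (Y \<omega>)) \<partial>?M) \<le> (\<integral>\<omega>. F \<omega> \<partial>?M)"
    by (rule integral_mono_AE'[OF iF bound]) (simp add: F0)
  also have "\<dots> \<le> t / (t - 1) * (l * c1 + \<sigma>\<^sup>2 * (c2 * R))"
    unfolding EF c1_def[symmetric] l_def[symmetric] R_def
    by (rule mult_left_mono[OF add_left_mono[OF mult_left_mono[OF noise zero_le_power2]] t0])
  also have "\<dots> \<le> t / (t - 1) * ((c1 + c2) * (l + R * \<sigma>\<^sup>2 + \<sigma>\<^sup>2))"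
    by (rule mult_left_mono[OF oracle_constant_combine[OF l0 c0 R0 zero_le_power2] t0])
  finally have fin: "(\<integral>\<omega>. loss X A (Ahat (rhat (Y \<omega>)) (Y \<omega>)) \<partial>?M)
    \<le> t / (t - 1) * ((c1 + c2) * (l + R * \<sigma>\<^sup>2 + \<sigma>\<^sup>2))" .
  show ?thesis
    by (rule ord_le_eq_trans[OF fin]) (simp only: c1_def c2_def l_def L_def R_def w_def mult.assoc)
qed

text \<open>The estimators and the selected rank are arbitrary functions of the observation, so
  every way of breaking ties among minimisers is covered.\<close>

theorem corollary1:
  fixes K \<alpha> :: real
  assumes "K > 1" and "0 < \<alpha>" and "\<alpha> < 1"
  shows "\<exists>c::real. c > 0 \<and>
    (\<forall>(m::nat) (n::nat) (p::nat) (q::nat) (rmax::nat) (X::real mat) (A::real mat) (\<sigma>::real)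
       (Ahat :: nat \<Rightarrow> real mat \<Rightarrow> real mat) (rhat :: real mat \<Rightarrow> nat)
       (Y :: (nat \<times> nat \<Rightarrow> real) \<Rightarrow> real mat).
      m \<ge> 1 \<longrightarrow> n \<ge> 1 \<longrightarrow> p \<ge> 1 \<longrightarrow>
      X \<in> carrier_mat m p \<longrightarrow> X \<noteq> 0\<^sub>m m p \<longrightarrow> q = mat_rank X \<longrightarrow>
      A \<in> carrier_mat p n \<longrightarrow> \<sigma> > 0 \<longrightarrow>
      rmax \<in> {1..min n q} \<longrightarrow>
      real rmax \<le> \<alpha> * ((real n * real m - 1) / (K * (sqrt (real q) + sqrt (real n))\<^sup>2)) \<longrightarrow>
      Y = (\<lambda>\<omega>. observation X A \<sigma> (mat m n \<omega>)) \<longrightarrow>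
      (\<forall>r\<in>{1..rmax}. \<forall>y\<in>carrier_mat m n. rank_restricted_ls X y r (Ahat r y)) \<longrightarrow>
      (AE \<omega> in gauss_space m n.
         is_arg_min (crit K X (Y \<omega>) (\<lambda>r. Ahat r (Y \<omega>))) (\<lambda>r. r \<in> {1..rmax}) (rhat (Y \<omega>))) \<longrightarrow>
      (\<forall>r\<in>{1..rmax}. (\<lambda>\<omega>. loss X A (Ahat r (Y \<omega>))) \<in> borel_measurable (gauss_space m n)) \<longrightarrow>
      (\<lambda>\<omega>. loss X A (Ahat (rhat (Y \<omega>)) (Y \<omega>))) \<in> borel_measurable (gauss_space m n) \<longrightarrow>
      (\<integral>\<omega>. loss X A (Ahat (rhat (Y \<omega>)) (Y \<omega>)) \<partial>gauss_space m n)
        \<le> c * Min ((\<lambda>r. (\<integral>\<omega>. loss X A (Ahat r (Y \<omega>)) \<partial>gauss_space m n)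
                          + real r * (sqrt (real n) + sqrt (real q))\<^sup>2 * \<sigma>\<^sup>2 + \<sigma>\<^sup>2) ` {1..rmax}))"
proof -
  \<comment> \<open>Four factors \<open>t\<close> are spent: two on the cross term, one on
    separating mean and fluctuation, one on the noise energy.\<close>
  define t where "t = root 4 K"
  have t: "t > 1" "t ^ 4 = K" using assms(1) by (simp_all add: t_def)
  define c where "c = t / (t - 1) * ((3 + 1 / (t * (t - 1)) + 2 / (1 - \<alpha>))
        + (7 * (t\<^sup>2 + 8) + 6 * (t ^ 3 / (t - 1)) + 7 + (5 + 6 / (t - 1)) + 4 * K / (1 - \<alpha>)))"
  have "c > 0"
    unfolding c_def using t(1) assms by (intro mult_pos_pos add_pos_pos divide_pos_pos zero_less_power; simp)
  then show ?thesis
  proof (intro exI[of _ c] conjI allI impI)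
    fix m n p q rmax :: nat and X A :: "real mat" and \<sigma> :: real
      and Ahat :: "nat \<Rightarrow> real mat \<Rightarrow> real mat" and rhat :: "real mat \<Rightarrow> nat"
      and Y :: "(nat \<times> nat \<Rightarrow> real) \<Rightarrow> real mat"
    assume mn: "m \<ge> 1" "n \<ge> 1" and X: "X \<in> carrier_mat m p" and q: "q = mat_rank X"
      and A: "A \<in> carrier_mat p n" and \<sigma>: "\<sigma> > 0" and rmax: "rmax \<in> {1..min n q}"
      and hyps: "real rmax \<le> \<alpha> * ((real n * real m - 1) / (K * (sqrt (real q) + sqrt (real n))\<^sup>2))"
        "Y = (\<lambda>\<omega>. observation X A \<sigma> (mat m n \<omega>))"
        "\<forall>r\<in>{1..rmax}. \<forall>y\<in>carrier_mat m n. rank_restricted_ls X y r (Ahat r y)"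
        "AE \<omega> in gauss_space m n.
         is_arg_min (crit K X (Y \<omega>) (\<lambda>r. Ahat r (Y \<omega>))) (\<lambda>r. r \<in> {1..rmax}) (rhat (Y \<omega>))"
        "\<forall>r\<in>{1..rmax}. (\<lambda>\<omega>. loss X A (Ahat r (Y \<omega>))) \<in> borel_measurable (gauss_space m n)"
    let ?b = "\<lambda>r. (\<integral>\<omega>. loss X A (Ahat r (Y \<omega>)) \<partial>gauss_space m n)
      + real r * (sqrt (real n) + sqrt (real q))\<^sup>2 * \<sigma>\<^sup>2 + \<sigma>\<^sup>2"
    have "Min (?b ` {1..rmax}) \<in> ?b ` {1..rmax}" using rmax by (intro Min_in) auto
    then obtain r where r: "r \<in> {1..rmax}" "Min (?b ` {1..rmax}) = ?b r" by (rule imageE)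
    show "(\<integral>\<omega>. loss X A (Ahat (rhat (Y \<omega>)) (Y \<omega>)) \<partial>gauss_space m n) \<le> c * Min (?b ` {1..rmax})"
      unfolding r(2) c_def by (rule risk_bound[OF t assms(2,3) \<sigma> mn X A q rmax hyps r(1)])
  qed
qed

end
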